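(* Let $\mathcal O$ be a discrete valuation ring with field of fractions $K$ and residue field $k$, and let $\mathcal S$ be a cellular $\mathcal O$-algebra with cell datum $(\Lambda,T,C)$ such that $\mathcal S_K=\mathcal S\otimes_{\mathcal O}K$ is semisimple and $\mathcal S_k=\mathcal S\otimes_{\mathcal O}k$ is quasi-hereditary. Let $\lambda,\mu\in\Lambda$. Then $\Delta_k^\lambda$ and $\Delta_k^\mu$ belong to the same block as $\mathcal S_k$-modules if and only if $\lambda\sim_J\mu$.
   Context: Cell datum: $\Lambda=(\Lambda,>)$ is a finite poset, $T(\lambda)$ is a finite set for each $\lambda\in\Lambda$, and $(s,t)\mapsto C^\lambda_{st}$ ($s,t\in T(\lambda)$) is an injective map into $\mathcal S$ such that (i) $\{C^\lambda_{st}:\lambda\in\Lambda,\ s,t\in T(\lambda)\}$ is an $\mathcal O$-basis of $\mathcal S$; (ii) for $x\in\mathcal S$ and $t\in T(\lambda)$ there are scalars $r_{tv}(x)\in\mathcal O$ such that for all $s\in T(\lambda)$, $C^\lambda_{st}x\equiv\sum_{v\in T(\lambda)}r_{tv}(x)C^\lambda_{sv}\pmod{\mathcal S^\lambda}$, where $\mathcal S^\lambda$ is the $\mathcal O$-span of $\{C^\mu_{yz}:\mu>\lambda,\ y,z\in T(\mu)\}$; (iii) the $\mathcal O$-linear map $*$ with $(C^\lambda_{st})^*=C^\lambda_{ts}$ is an anti-isomorphism of $\mathcal S$. The standard (cell) module $\Delta^\lambda_{\mathcal O}$ is the free $\mathcal O$-module with basis $\{C^\lambda_t:t\in T(\lambda)\}$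 and right action $C^\lambda_tx=\sum_v r_{tv}(x)C^\lambda_v$. It carries the symmetric bilinear form determined by $\langle C^\lambda_t,C^\lambda_u\rangle_\lambda C^\lambda_{sv}\equiv C^\lambda_{st}C^\lambda_{uv}\pmod{\mathcal S^\lambda}$. Put $\Delta^\lambda_k=\Delta^\lambda_{\mathcal O}\otimes_{\mathcal O}k$. Let $\mathfrak p$ be the maximal ideal of $\mathcal O$. For $i\ge0$ let $J_i(\Delta^\lambda_{\mathcal O})=\{x\in\Delta^\lambda_{\mathcal O}:\langle x,y\rangle_\lambda\in\mathfrak p^i\text{ for all }y\in\Delta^\lambda_{\mathcal O}\}$ and let $J_i(\Delta^\lambda_k)=(J_i(\Delta^\lambda_{\mathcal O})+\mathfrak p\Delta^\lambda_{\mathcal O})/\mathfrak p\Delta^\lambda_{\mathcal O}$ (the Jantzen filtration of $\Delta_k^\lambda$). Set $L^\lambda_k=\Delta^\lambda_k/J_1(\Delta^\lambda_k)$. Here $\mathcal S_k$ is quasi-hereditary if and only if $L^\lambda_k\neq0$ for all $\lambda\in\Lambda$; then the $L^\lambda_k$ are a complete set of pairwise non-isomorphic simple $\mathcal S_k$-modules and the classes $[\Delta^\lambda_k]$ form a $\mathbb Z$-basis of the Grothendieck group $K_0(\mathcal S_k)$ of finite-dimensional right modules. The Jantzen coefficients $J_{\lambda\mu}\in\mathbb Z$ ($\lambda,\mu\in\Lambda$) are determined by $\sum_{i>0}[J_i(\Delta^\lambda_k)]=\sum_{\mu\in\Lambda,\ \lambda>\mu}J_{\lambda\mu}[\Delta^\mu_k]$,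 with $J_{\lambda\mu}=0$ unless $\lambda>\mu$. Write $\lambda\sim_J\mu$ (Jantzen equivalent) if there exist $\lambda_1=\lambda,\lambda_2,\dots,\lambda_l=\mu$ in $\Lambda$ such that $J_{\lambda_i\lambda_{i+1}}\ne0$ or $J_{\lambda_{i+1}\lambda_i}\neq0$ for each $1\le i<l$. A module $M$ belongs to a block $B$ (an indecomposable two-sided ideal direct summand of $\mathcal S_k$) if $MB=M$. *)

theory Defs
  imports
    "HOL-Computational_Algebra.Computational_Algebra"
    "HOL-Library.Function_Algebras"
    "HOL-Library.Poly_Mapping"
begin

section \<open>Ideals\<close>

definition right_ideal :: "'a::ring_1 set \<Rightarrow> bool" where
  "right_ideal I \<longleftrightarrow> 0 \<in> I \<and> (\<forall>x\<in>I. \<forall>y\<in>I. x + y \<in> I) \<and> (\<forall>x\<in>I. \<forall>a. x * a \<in> I)"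

definition two_sided_ideal :: "'a::ring_1 set \<Rightarrow> bool" where
  "two_sided_ideal I \<longleftrightarrow> right_ideal I \<and> (\<forall>x\<in>I. \<forall>a. a * x \<in> I)"

definition ideal_mult :: "'a::ring_1 set \<Rightarrow> 'a set \<Rightarrow> 'a set" where
  "ideal_mult I J =
     {(\<Sum>i<n. x i * y i) | (n::nat) x y. \<forall>i<n. x i \<in> I \<and> y i \<in> J}"

primrec ideal_power :: "'a::ring_1 set \<Rightarrow> nat \<Rightarrow> 'a set" where
  "ideal_power I 0 = UNIV"
| "ideal_power I (Suc n) = ideal_mult I (ideal_power I n)"

definition internal_direct_sum :: "'a::ab_group_add set \<Rightarrow> 'a set \<Rightarrow> 'a set \<Rightarrow> bool" where
  "internal_direct_sum V I J \<longleftrightarrow> V = {x + y | x y. x \<in> I \<and> y \<in> J} \<and> I \<inter> J = {0}"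

text \<open>The ring is semisimple as a right module over itself: every submodule of the
  regular module is a direct summand.\<close>

definition semisimple_ring :: "'a::ring_1 itself \<Rightarrow> bool" where
  "semisimple_ring _ \<longleftrightarrow>
     (\<forall>I::'a set. right_ideal I \<longrightarrow> (\<exists>J. right_ideal J \<and> internal_direct_sum UNIV I J))"

definition is_block :: "'a::ring_1 set \<Rightarrow> bool" where
  "is_block B \<longleftrightarrow>
     two_sided_ideal B \<and> B \<noteq> {0} \<and>
     (\<exists>B'. two_sided_ideal B' \<and> internal_direct_sum UNIV B B') \<and>
     (\<forall>I J. two_sided_ideal I \<and> two_sided_ideal J \<and> internal_direct_sum B I J \<longrightarrow>
        I = {0} \<or> J = {0})"


section \<open>Discrete valuation rings\<close>

text \<open>In a local ring the maximal ideal is the set of non-units.\<close>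

definition nonunits :: "'o::idom set" where
  "nonunits = {a. \<not> a dvd 1}"

text \<open>A discrete valuation ring is a local principal ideal domain that is not a field.\<close>

definition discrete_valuation_ring :: "'o::idom itself \<Rightarrow> bool" where
  "discrete_valuation_ring _ \<longleftrightarrow>
     two_sided_ideal (nonunits :: 'o set) \<and>
     (\<forall>I::'o set. two_sided_ideal I \<longrightarrow> (\<exists>a. I = {a * x | x. True})) \<and>
     (nonunits :: 'o set) \<noteq> {0}"

text \<open>The residue field is given by any field \<open>'k\<close> together with a surjective ring
  homomorphism whose kernel is the maximal ideal.\<close>

definition residue_map :: "('o::idom \<Rightarrow> 'k::field) \<Rightarrow> bool" where
  "residue_map \<phi> \<longleftrightarrow>
     \<phi> 1 = 1 \<and> (\<forall>a b. \<phi> (a + b) = \<phi> a + \<phi> b) \<and> (\<forall>a b. \<phi> (a * b) = \<phi> a * \<phi> b) \<and>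
     surj \<phi> \<and> {a. \<phi> a = 0} = nonunits"


section \<open>Algebras and base change\<close>

locale assoc_algebra = module scale
  for scale :: "'r::comm_ring_1 \<Rightarrow> 'a::ring_1 \<Rightarrow> 'a" (infixr \<open>*s\<close> 75) +
  assumes scale_mult_left: "(r *s x) * y = r *s (x * y)"
    and scale_mult_right: "x * (r *s y) = r *s (x * y)"

definition module_basis :: "('r::comm_ring_1 \<Rightarrow> 'a::ab_group_add \<Rightarrow> 'a) \<Rightarrow> 'a set \<Rightarrow> bool" where
  "module_basis scale B \<longleftrightarrow>
     \<not> module.dependent scale B \<and> module.span scale B = UNIV"

text \<open>For an algebra \<open>'s\<close> that is free over \<open>'o\<close> and a ring homomorphism \<open>\<phi>\<close> from \<open>'o\<close> to
  \<open>'r\<close>, the predicate says that \<open>'sr\<close> is the tensor product of \<open>'s\<close> and \<open>'r\<close> over \<open>'o\<close>,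
  with \<open>\<iota>\<close> the canonical map sending \<open>x\<close> to \<open>x \<otimes> 1\<close>: the images of the elements
  of a basis of \<open>'s\<close> are distinct and form a basis of \<open>'sr\<close> over \<open>'r\<close>. If this holds for one
  basis of \<open>'s\<close>, it holds for every basis.\<close>

definition base_change ::
  "('o::comm_ring_1 \<Rightarrow> 'r::comm_ring_1) \<Rightarrow> ('o \<Rightarrow> 's::ring_1 \<Rightarrow> 's) \<Rightarrow>
   ('r \<Rightarrow> 'sr::ring_1 \<Rightarrow> 'sr) \<Rightarrow> ('s \<Rightarrow> 'sr) \<Rightarrow> bool" where
  "base_change \<phi> scale scale' \<iota> \<longleftrightarrow>
     assoc_algebra scale' \<and>
     \<iota> 1 = 1 \<and> (\<forall>x y. \<iota> (x + y) = \<iota> x + \<iota> y) \<and> (\<forall>x y. \<iota> (x * y) = \<iota> x * \<iota> y) \<and>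
     (\<forall>r x. \<iota> (scale r x) = scale' (\<phi> r) (\<iota> x)) \<and>
     (\<exists>B. module_basis scale B \<and> inj_on \<iota> B \<and> module_basis scale' (\<iota> ` B))"


section \<open>Right modules\<close>

text \<open>A right module over the ring \<open>'a\<close> is a subgroup \<open>mcarrier\<close> of the ambient group \<open>'m\<close>
  with an action of \<open>'a\<close> on it; the values of \<open>mact\<close> off the carrier are irrelevant.\<close>

record ('a, 'm) rmodule =
  mcarrier :: "'m set"
  mact :: "'m \<Rightarrow> 'a \<Rightarrow> 'm"

definition right_module :: "('a::ring_1, 'm::ab_group_add) rmodule \<Rightarrow> bool" where
  "right_module M \<longleftrightarrow>
     0 \<in> mcarrier M \<and>
     (\<forall>x\<in>mcarrier M. - x \<in> mcarrier M) \<and>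
     (\<forall>x\<in>mcarrier M. \<forall>y\<in>mcarrier M. x + y \<in> mcarrier M) \<and>
     (\<forall>x\<in>mcarrier M. \<forall>a. mact M x a \<in> mcarrier M) \<and>
     (\<forall>x\<in>mcarrier M. \<forall>y\<in>mcarrier M. \<forall>a. mact M (x + y) a = mact M x a + mact M y a) \<and>
     (\<forall>x\<in>mcarrier M. \<forall>a b. mact M x (a + b) = mact M x a + mact M x b) \<and>
     (\<forall>x\<in>mcarrier M. \<forall>a b. mact M x (a * b) = mact M (mact M x a) b) \<and>
     (\<forall>x\<in>mcarrier M. mact M x 1 = x)"

text \<open>A module over a \<open>'k\<close>-algebra is a \<open>'k\<close>-space via the scalars \<open>scale c 1\<close>.\<close>

definition fd_module ::
  "('k::field \<Rightarrow> 'a::ring_1 \<Rightarrow> 'a) \<Rightarrow> ('a, 'm::ab_group_add) rmodule \<Rightarrow> bool" where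
  "fd_module scale M \<longleftrightarrow>
     right_module M \<and>
     (\<exists>B. finite B \<and> B \<subseteq> mcarrier M \<and>
        (\<forall>x\<in>mcarrier M. \<exists>c. x = (\<Sum>b\<in>B. mact M b (scale (c b) 1))))"

definition rmodule_hom ::
  "('a::ring_1, 'm::ab_group_add) rmodule \<Rightarrow> ('a, 'n::ab_group_add) rmodule \<Rightarrow> ('m \<Rightarrow> 'n) \<Rightarrow> bool"
  where
  "rmodule_hom M N f \<longleftrightarrow>
     (\<forall>x\<in>mcarrier M. f x \<in> mcarrier N) \<and>
     (\<forall>x\<in>mcarrier M. \<forall>y\<in>mcarrier M. f (x + y) = f x + f y) \<and>
     (\<forall>x\<in>mcarrier M. \<forall>a. f (mact M x a) = mact N (f x) a)"

definition rmodule_iso ::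
  "('a::ring_1, 'm::ab_group_add) rmodule \<Rightarrow> ('a, 'n::ab_group_add) rmodule \<Rightarrow> bool" where
  "rmodule_iso M N \<longleftrightarrow> (\<exists>f. rmodule_hom M N f \<and> bij_betw f (mcarrier M) (mcarrier N))"

definition mod_ideal_mult :: "('a::ring_1, 'm::ab_group_add) rmodule \<Rightarrow> 'a set \<Rightarrow> 'm set" where
  "mod_ideal_mult M I =
     {(\<Sum>i<n. mact M (x i) (a i)) | (n::nat) x a. \<forall>i<n. x i \<in> mcarrier M \<and> a i \<in> I}"

definition belongs_to_block :: "('a::ring_1, 'm::ab_group_add) rmodule \<Rightarrow> 'a set \<Rightarrow> bool" where
  "belongs_to_block M B \<longleftrightarrow> is_block B \<and> mod_ideal_mult M B = mcarrier M"


section \<open>The Grothendieck group\<close>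

definition short_exact ::
  "('a::ring_1, 'm::ab_group_add) rmodule \<Rightarrow> ('a, 'm) rmodule \<Rightarrow> ('a, 'm) rmodule \<Rightarrow> bool" where
  "short_exact M' M M'' \<longleftrightarrow>
     (\<exists>f g. rmodule_hom M' M f \<and> inj_on f (mcarrier M') \<and>
            rmodule_hom M M'' g \<and> g ` mcarrier M = mcarrier M'' \<and>
            f ` mcarrier M' = {x \<in> mcarrier M. g x = 0})"

text \<open>Every finite-dimensional module over a \<open>'k\<close>-algebra is isomorphic to one whose elements
  lie in \<open>nat \<Rightarrow> 'k\<close> (with pointwise addition). So \<open>K\<^sub>0\<close> is the free abelian group on the
  finite-dimensional modules with elements in \<open>nat \<Rightarrow> 'k\<close>, modulo the subgroup \<open>K0_relations\<close>
  generated by the elements \<open>[M] - [M'] - [M'']\<close> for the short exact sequences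
  \<open>0 \<rightarrow> M' \<rightarrow> M \<rightarrow> M'' \<rightarrow> 0\<close>.\<close>

inductive_set K0_relations ::
  "('k::field \<Rightarrow> 'a::ring_1 \<Rightarrow> 'a) \<Rightarrow> (('a, nat \<Rightarrow> 'k) rmodule \<Rightarrow>\<^sub>0 int) set"
  for scale :: "'k::field \<Rightarrow> 'a::ring_1 \<Rightarrow> 'a" where
  gen: "\<lbrakk>fd_module scale M'; fd_module scale M; fd_module scale M''; short_exact M' M M''\<rbrakk> \<Longrightarrow>
     Poly_Mapping.single M 1 - Poly_Mapping.single M' 1 - Poly_Mapping.single M'' 1
       \<in> K0_relations scale"
| zero: "0 \<in> K0_relations scale"
| diff: "\<lbrakk>x \<in> K0_relations scale; y \<in> K0_relations scale\<rbrakk> \<Longrightarrow> x - y \<in> K0_relations scale"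

definition K0_eq ::
  "('k::field \<Rightarrow> 'a::ring_1 \<Rightarrow> 'a) \<Rightarrow> (('a, nat \<Rightarrow> 'k) rmodule \<Rightarrow>\<^sub>0 int) \<Rightarrow>
   (('a, nat \<Rightarrow> 'k) rmodule \<Rightarrow>\<^sub>0 int) \<Rightarrow> bool" where
  "K0_eq scale x y \<longleftrightarrow> x - y \<in> K0_relations scale"

text \<open>The multiple \<open>n [M]\<close> for a finite-dimensional module \<open>M\<close> with elements in any type; the
  choice of an isomorphic copy does not matter modulo \<open>K0_relations\<close>.\<close>

definition K0_multiple ::
  "('k::field \<Rightarrow> 'a::ring_1 \<Rightarrow> 'a) \<Rightarrow> int \<Rightarrow> ('a, 'm::ab_group_add) rmodule \<Rightarrow>
   (('a, nat \<Rightarrow> 'k) rmodule \<Rightarrow>\<^sub>0 int)" where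
  "K0_multiple scale n M =
     Poly_Mapping.single (SOME N. fd_module scale N \<and> rmodule_iso M N) n"


section \<open>Quasi-hereditary algebras\<close>

text \<open>Quotients \<open>A/I\<close> are treated through their preimages in \<open>A\<close>: ideals of \<open>A/I\<close> are ideals
  of \<open>A\<close> containing \<open>I\<close>, and \<open>A/I\<close>-modules are \<open>A\<close>-modules annihilated by \<open>I\<close>.\<close>

definition maximal_right_ideal :: "'a::ring_1 set \<Rightarrow> bool" where
  "maximal_right_ideal I \<longleftrightarrow>
     right_ideal I \<and> I \<noteq> UNIV \<and> (\<forall>J. right_ideal J \<and> I \<subseteq> J \<longrightarrow> J = I \<or> J = UNIV)"

text \<open>The preimage of the Jacobson radical of \<open>A/I\<close>.\<close>

definition radical_over :: "'a::ring_1 set \<Rightarrow> 'a set" where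
  "radical_over I = \<Inter> {M. maximal_right_ideal M \<and> I \<subseteq> M}"

text \<open>\<open>J/I\<close> is a projective right \<open>A/I\<close>-module, by the lifting property with respect to
  surjections of finite-dimensional modules.\<close>

definition projective_over :: "('k::field \<Rightarrow> 'a::ring_1 \<Rightarrow> 'a) \<Rightarrow> 'a set \<Rightarrow> 'a set \<Rightarrow> bool" where
  "projective_over scale I J \<longleftrightarrow>
     (\<forall>(M :: ('a, nat \<Rightarrow> 'k) rmodule) (N :: ('a, nat \<Rightarrow> 'k) rmodule) g f.
        fd_module scale M \<and> fd_module scale N \<and>
        (\<forall>x\<in>mcarrier M. \<forall>a\<in>I. mact M x a = 0) \<and> (\<forall>x\<in>mcarrier N. \<forall>a\<in>I. mact N x a = 0) \<and>
        rmodule_hom M N g \<and> g ` mcarrier M = mcarrier N \<and>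
        rmodule_hom \<lparr>mcarrier = J, mact = (*)\<rparr> N f \<and> (\<forall>a\<in>I. f a = 0) \<longrightarrow>
        (\<exists>h. rmodule_hom \<lparr>mcarrier = J, mact = (*)\<rparr> M h \<and> (\<forall>a\<in>I. h a = 0) \<and>
             (\<forall>x\<in>J. g (h x) = f x)))"

text \<open>\<open>J/I\<close> is a heredity ideal of \<open>A/I\<close> (Cline, Parshall and Scott): it is idempotent, it is
  projective as a right module, and \<open>(J/I) rad(A/I) (J/I) = 0\<close>.\<close>

definition heredity_ideal_over ::
  "('k::field \<Rightarrow> 'a::ring_1 \<Rightarrow> 'a) \<Rightarrow> 'a set \<Rightarrow> 'a set \<Rightarrow> bool" where
  "heredity_ideal_over scale I J \<longleftrightarrow>
     two_sided_ideal I \<and> two_sided_ideal J \<and> I \<subseteq> J \<and>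
     J = {x + y | x y. x \<in> ideal_mult J J \<and> y \<in> I} \<and>
     ideal_mult (ideal_mult J (radical_over I)) J \<subseteq> I \<and>
     projective_over scale I J"

definition quasi_hereditary :: "('k::field \<Rightarrow> 'a::ring_1 \<Rightarrow> 'a) \<Rightarrow> bool" where
  "quasi_hereditary scale \<longleftrightarrow>
     (\<exists>(n::nat) J. J 0 = {0} \<and> J n = UNIV \<and>
        (\<forall>i<n. heredity_ideal_over scale (J i) (J (Suc i))))"


section \<open>Cellular algebras\<close>

text \<open>The sets \<open>T l\<close> are taken to be nonempty. The usual criterion presupposes this: the
  algebra over \<open>'k\<close> is quasi-hereditary iff the bilinear form on every cell module over
  \<open>'k\<close> is nonzero. Below, \<open>l\<close> stands for the \<open>\<lambda>\<close> of the literature.\<close>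

locale cell_datum = assoc_algebra scale
  for scale :: "'o::idom \<Rightarrow> 's::ring_1 \<Rightarrow> 's" (infixr \<open>*s\<close> 75) +
  fixes \<Lambda> :: "'l::order set"
    and T :: "'l \<Rightarrow> 't set"
    and C :: "'l \<Rightarrow> 't \<Rightarrow> 't \<Rightarrow> 's"
  assumes finite_Lambda: "finite \<Lambda>"
    and finite_T: "l \<in> \<Lambda> \<Longrightarrow> finite (T l)"
    and T_nonempty: "l \<in> \<Lambda> \<Longrightarrow> T l \<noteq> {}"
    and C_inj: "inj_on (\<lambda>(l, s, t). C l s t) (SIGMA l:\<Lambda>. T l \<times> T l)"
    and C_basis: "module_basis scale {C l s t | l s t. l \<in> \<Lambda> \<and> s \<in> T l \<and> t \<in> T l}"
    and C_mult: "\<lbrakk>l \<in> \<Lambda>; t \<in> T l\<rbrakk> \<Longrightarrow>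
      \<exists>r. \<forall>s\<in>T l. C l s t * x - (\<Sum>v\<in>T l. r v *s C l s v)
        \<in> span {C \<mu> y z | \<mu> y z. \<mu> \<in> \<Lambda> \<and> l < \<mu> \<and> y \<in> T \<mu> \<and> z \<in> T \<mu>}"
    and C_star: "\<exists>star. module_hom scale scale star \<and> bij star \<and>
      (\<forall>x y. star (x * y) = star y * star x) \<and>
      (\<forall>l\<in>\<Lambda>. \<forall>s\<in>T l. \<forall>t\<in>T l. star (C l s t) = C l t s)"
begin

definition higher :: "'l \<Rightarrow> 's set" where
  "higher l = span {C \<mu> y z | \<mu> y z. \<mu> \<in> \<Lambda> \<and> l < \<mu> \<and> y \<in> T \<mu> \<and> z \<in> T \<mu>}"

text \<open>\<open>cell_coeff l t x v\<close> is the scalar \<open>r\<^sub>t\<^sub>v(x)\<close>.\<close>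

definition cell_coeff :: "'l \<Rightarrow> 't \<Rightarrow> 's \<Rightarrow> 't \<Rightarrow> 'o" where
  "cell_coeff l t x =
     (THE r. (\<forall>v. v \<notin> T l \<longrightarrow> r v = 0) \<and>
             (\<forall>s\<in>T l. C l s t * x - (\<Sum>v\<in>T l. r v *s C l s v) \<in> higher l))"

definition gram :: "'l \<Rightarrow> 't \<Rightarrow> 't \<Rightarrow> 'o" where
  "gram l t u =
     (THE c. \<forall>s\<in>T l. \<forall>v\<in>T l. C l s t * C l u v - c *s C l s v \<in> higher l)"

text \<open>Elements of the cell module are coordinate vectors with respect to the basis of the
  \<open>C\<^sup>l\<^sub>t\<close>.\<close>

definition cell_module :: "'l \<Rightarrow> ('s, 't \<Rightarrow> 'o) rmodule" where
  "cell_module l =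
     \<lparr>mcarrier = {x. \<forall>t. t \<notin> T l \<longrightarrow> x t = 0},
      mact = (\<lambda>x a v. \<Sum>t\<in>T l. x t * cell_coeff l t a v)\<rparr>"

definition cell_form :: "'l \<Rightarrow> ('t \<Rightarrow> 'o) \<Rightarrow> ('t \<Rightarrow> 'o) \<Rightarrow> 'o" where
  "cell_form l x y = (\<Sum>t\<in>T l. \<Sum>u\<in>T l. x t * y u * gram l t u)"

definition jantzen_submodule :: "'l \<Rightarrow> nat \<Rightarrow> ('t \<Rightarrow> 'o) set" where
  "jantzen_submodule l i =
     {x \<in> mcarrier (cell_module l). \<forall>y \<in> mcarrier (cell_module l).
        cell_form l x y \<in> ideal_power nonunits i}"

text \<open>From here on \<open>\<phi>\<close> is the residue map and \<open>\<iota>\<close> the map from \<open>'s\<close> to its base change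
  along \<open>\<phi>\<close>. Elements of the base change of the cell module are again coordinate vectors, the
  reduction map being \<open>x \<mapsto> \<phi> \<circ> x\<close>; the action of \<open>\<iota> x\<close> is the reduction of the action of \<open>x\<close>.
  Here \<open>\<iota>\<close> is surjective, and the choice of a preimage does not matter.\<close>

definition cell_module_red ::
  "('o \<Rightarrow> 'k::field) \<Rightarrow> ('s \<Rightarrow> 'a::ring_1) \<Rightarrow> 'l \<Rightarrow> ('a, 't \<Rightarrow> 'k) rmodule" where
  "cell_module_red \<phi> \<iota> l =
     \<lparr>mcarrier = {x. \<forall>t. t \<notin> T l \<longrightarrow> x t = 0},
      mact = (\<lambda>x a v. \<Sum>t\<in>T l. x t * \<phi> (cell_coeff l t (inv \<iota> a) v))\<rparr>"

text \<open>The kernel of the reduction map is \<open>\<pp>\<Delta>\<close>, so the image of \<open>J\<^sub>i\<close> is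
  \<open>(J\<^sub>i + \<pp>\<Delta>)/\<pp>\<Delta>\<close>.\<close>

definition jantzen_filtration ::
  "('o \<Rightarrow> 'k::field) \<Rightarrow> ('s \<Rightarrow> 'a::ring_1) \<Rightarrow> 'l \<Rightarrow> nat \<Rightarrow> ('a, 't \<Rightarrow> 'k) rmodule" where
  "jantzen_filtration \<phi> \<iota> l i =
     (cell_module_red \<phi> \<iota> l)\<lparr>mcarrier := (\<lambda>x. \<phi> \<circ> x) ` jantzen_submodule l i\<rparr>"

text \<open>If the algebra over the fraction field is semisimple, the forms are nondegenerate and
  only finitely many terms of the filtration are nonzero, so the sum over \<open>i\<close> is finite.\<close>

definition jantzen_coeff ::
  "('o \<Rightarrow> 'k::field) \<Rightarrow> ('k \<Rightarrow> 'a::ring_1 \<Rightarrow> 'a) \<Rightarrow> ('s \<Rightarrow> 'a) \<Rightarrow> 'l \<Rightarrow> 'l \<Rightarrow> int" where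
  "jantzen_coeff \<phi> scale' \<iota> =
     (THE J. (\<forall>l \<mu>. \<not> (l \<in> \<Lambda> \<and> \<mu> \<in> \<Lambda> \<and> \<mu> < l) \<longrightarrow> J l \<mu> = 0) \<and>
        (\<forall>l\<in>\<Lambda>. K0_eq scale'
           (\<Sum>i | 0 < i \<and> mcarrier (jantzen_filtration \<phi> \<iota> l i) \<noteq> {0}.
              K0_multiple scale' 1 (jantzen_filtration \<phi> \<iota> l i))
           (\<Sum>\<mu> | \<mu> \<in> \<Lambda> \<and> \<mu> < l.
              K0_multiple scale' (J l \<mu>) (cell_module_red \<phi> \<iota> \<mu>))))"

definition jantzen_equivalent ::
  "('o \<Rightarrow> 'k::field) \<Rightarrow> ('k \<Rightarrow> 'a::ring_1 \<Rightarrow> 'a) \<Rightarrow> ('s \<Rightarrow> 'a) \<Rightarrow> 'l \<Rightarrow> 'l \<Rightarrow> bool" where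
  "jantzen_equivalent \<phi> scale' \<iota> =
     (\<lambda>l \<mu>. l \<in> \<Lambda> \<and> \<mu> \<in> \<Lambda> \<and>
        (jantzen_coeff \<phi> scale' \<iota> l \<mu> \<noteq> 0 \<or> jantzen_coeff \<phi> scale' \<iota> \<mu> l \<noteq> 0))\<^sup>*\<^sup>*"

end

end

(* Over the residue field, the cells filter the algebra by ideals. The ideal of elements acting as zero
   on all heads Delta / rad is nilpotent, so a primitive idempotent e_l can be lifted for every cell l
   with nonzero form, and dim (M e_l) is additive in M. Quasi-heredity makes all forms nonzero. The matrix
   of the numbers dim (Delta^m e_l) is then triangular with nonzero diagonal entries, so the classes of
   the cell modules are independent. They span because a composition factor can be traded for a cell
   module and factors from smaller cells. Hence the Jantzen coefficients exist and are unique.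

   If l and m are linked by a Jantzen coefficient, apply M |-> dim (M (1 - c) e_n), with c a central
   idempotent acting as 1 on Delta^l, to the defining relation: since J_1 <= Delta^l is killed by 1 - c,
   triangularity forces 1 - c to kill every Delta^n with nonzero coefficient, and so blocks contain
   linkage classes. Conversely J_1(Delta^l) = rad, so every composition factor of Delta^l other than its
   head occurs in a Delta^m with J_{lm} nonzero, and induction on l links it to l. An idempotent f that
   acts as 1 on the heads of one linkage class and as 0 on the others then acts in the same way on the
   cell modules, and so does f*; the cell filtration forces f to be central, and blocks are contained in
   linkage classes. Semisimplicity over the fraction field makes the Gram matrices invertible there, so
   that the Jantzen filtrations are finite. *)

theory Submission
  imports Defs
begin

section \<open>Cellular algebras\<close>

text \<open>Jantzen coefficients can be negative, so a nonzero one need not exhibit a common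
  composition factor. That linkage stays inside a block is therefore deduced from the independence
  of the classes of cell modules, not from multiplicities. In the converse direction signs are
  harmless: the left side of the defining relation becomes a sum of dimensions, and if it is
  positive, some summand on the right has both its coefficient and its multiplicity nonzero.

  Simple modules are not constructed. A head is represented by its annihilator
  \<open>head_ann l\<close>, and dim (M e) with e = \<open>prim_idem m\<close> plays the role of the
  multiplicity of the head of m in M; this count is right over any field because the C_st act on the
  heads as operators of rank one.

  A chain of heredity ideals does not mention forms. The bridge is the formula dim (f A g) = sum
  over l of dim (\<Delta> l \<open>cstar f\<close>) dim (\<Delta> l g) for idempotents f and g,
  which the cell filtration gives whatever the forms are; it is compared with bounds for f (J i) g
  along the chain.\<close>

lemma (in assoc_algebra) subspace_algebra_map:
  assumes "subspace V"
  shows "subspace {x. a * x \<in> V}" "subspace {x. x * a \<in> V}"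
  using assms unfolding subspace_def
  by (auto simp: algebra_simps scale_mult_left scale_mult_right)

lemma (in assoc_algebra) scale_as_mult: "r *s x = x * (r *s 1)" "r *s x = (r *s 1) * x"
  by (simp_all add: scale_mult_right scale_mult_left)

lemma (in assoc_algebra) two_sided_ideal_subspace: "two_sided_ideal I \<Longrightarrow> subspace I"
  unfolding two_sided_ideal_def right_ideal_def subspace_def using scale_as_mult by metis

lemma two_sided_idealD:
  assumes "two_sided_ideal I"
  shows "0 \<in> I" "\<And>x y. x \<in> I \<Longrightarrow> y \<in> I \<Longrightarrow> x + y \<in> I" "\<And>x a. x \<in> I \<Longrightarrow> x * a \<in> I"
    "\<And>x a. x \<in> I \<Longrightarrow> a * x \<in> I" "\<And>x. x \<in> I \<Longrightarrow> - x \<in> I" "\<And>x y. x \<in> I \<Longrightarrow> y \<in> I \<Longrightarrow> x - y \<in> I"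
proof -
  show "0 \<in> I" and a: "\<And>x y. x \<in> I \<Longrightarrow> y \<in> I \<Longrightarrow> x + y \<in> I" and m: "\<And>x a. x \<in> I \<Longrightarrow> x * a \<in> I"
    and "\<And>x a. x \<in> I \<Longrightarrow> a * x \<in> I"
    using assms unfolding two_sided_ideal_def right_ideal_def by auto
  show n: "- x \<in> I" if "x \<in> I" for x using m[OF that, of "-1"] by simp
  show "x - y \<in> I" if "x \<in> I" "y \<in> I" for x y using a[OF that(1) n[OF that(2)]] by simp
qed

lemma two_sided_idealI:
  assumes "0 \<in> I" "\<And>x y. x \<in> I \<Longrightarrow> y \<in> I \<Longrightarrow> x + y \<in> I" "\<And>x a. x \<in> I \<Longrightarrow> x * a \<in> I"
    "\<And>x a. x \<in> I \<Longrightarrow> a * x \<in> I"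
  shows "two_sided_ideal I"
  using assms unfolding two_sided_ideal_def right_ideal_def by auto

lemma two_sided_ideal_sum:
  "two_sided_ideal I \<Longrightarrow> (\<And>i. i \<in> A \<Longrightarrow> f i \<in> I) \<Longrightarrow> sum f A \<in> I"
  by (induction A rule: infinite_finite_induct) (auto simp: two_sided_idealD)

lemma sum_fun_apply: "(\<Sum>i\<in>A. F i) v = (\<Sum>i\<in>A. F i v)"
  by (induction A rule: infinite_finite_induct) auto

context cell_datum
begin

section \<open>Coordinates in the cellular basis and the ideals spanned by cells\<close>

definition "cbasis = {C l s t | l s t. l \<in> \<Lambda> \<and> s \<in> T l \<and> t \<in> T l}"

definition "cf l s t x = representation cbasis x (C l s t)"

definition "cspan U = span {C l s t | l s t. l \<in> \<Lambda> \<and> l \<in> U \<and> s \<in> T l \<and> t \<in> T l}"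

definition "upset U \<longleftrightarrow> U \<subseteq> \<Lambda> \<and> (\<forall>l\<in>U. \<forall>m\<in>\<Lambda>. l < m \<longrightarrow> m \<in> U)"

lemma cbasis_indep: "independent cbasis" and cbasis_span: "span cbasis = UNIV"
  using C_basis unfolding module_basis_def cbasis_def by auto

lemma C_in_cbasis: "l \<in> \<Lambda> \<Longrightarrow> s \<in> T l \<Longrightarrow> t \<in> T l \<Longrightarrow> C l s t \<in> cbasis"
  unfolding cbasis_def by auto

lemma C_eq_iff:
  assumes "l \<in> \<Lambda>" "s \<in> T l" "t \<in> T l" "l' \<in> \<Lambda>" "s' \<in> T l'" "t' \<in> T l'"
  shows "C l s t = C l' s' t' \<longleftrightarrow> l = l' \<and> s = s' \<and> t = t'"
  using inj_onD[OF C_inj, of "(l,s,t)" "(l',s',t')"] assms by auto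

lemma cf_add: "cf l s t (x + y) = cf l s t x + cf l s t y"
  unfolding cf_def by (simp add: representation_add[OF cbasis_indep] cbasis_span)

lemma cf_scale: "cf l s t (r *s x) = r * cf l s t x"
  unfolding cf_def by (simp add: representation_scale[OF cbasis_indep] cbasis_span)

lemma cf_zero [simp]: "cf l s t 0 = 0"
  unfolding cf_def by (simp add: representation_zero)

lemma cf_diff: "cf l s t (x - y) = cf l s t x - cf l s t y"
  unfolding cf_def by (simp add: representation_diff[OF cbasis_indep] cbasis_span)

lemma cf_sum: "cf l s t (sum f A) = (\<Sum>i\<in>A. cf l s t (f i))"
  by (induction A rule: infinite_finite_induct) (auto simp: cf_add)

lemma cf_C:
  assumes "l \<in> \<Lambda>" "s \<in> T l" "t \<in> T l" "l' \<in> \<Lambda>" "s' \<in> T l'" "t' \<in> T l'"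
  shows "cf l s t (C l' s' t') = (if l = l' \<and> s = s' \<and> t = t' then 1 else 0)"
  unfolding cf_def
  using representation_basis[OF cbasis_indep C_in_cbasis[OF assms(4-6)]] C_eq_iff[OF assms] by auto

lemma finite_cbasis: "finite cbasis"
proof -
  have "cbasis = (\<lambda>(l,s,t). C l s t) ` (SIGMA l:\<Lambda>. T l \<times> T l)"
    unfolding cbasis_def by (auto simp: image_iff) blast
  then show ?thesis using finite_Lambda finite_T by auto
qed

lemma cf_expand: "x = (\<Sum>l\<in>\<Lambda>. \<Sum>s\<in>T l. \<Sum>t\<in>T l. cf l s t x *s C l s t)"
proof -
  have im: "cbasis = (\<lambda>(l,s,t). C l s t) ` (SIGMA l:\<Lambda>. T l \<times> T l)"
    unfolding cbasis_def by (auto simp: image_iff) blast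
  have "x = (\<Sum>b\<in>cbasis. representation cbasis x b *s b)"
    using sum_representation_eq[OF cbasis_indep, of x cbasis] cbasis_span finite_cbasis by auto
  also have "\<dots> = (\<Sum>(l,s,t)\<in>(SIGMA l:\<Lambda>. T l \<times> T l). cf l s t x *s C l s t)"
    unfolding im by (subst sum.reindex[OF C_inj]) (auto simp: cf_def im intro!: sum.cong)
  also have "\<dots> = (\<Sum>l\<in>\<Lambda>. \<Sum>(s,t)\<in>T l \<times> T l. cf l s t x *s C l s t)"
    by (subst sum.Sigma[symmetric]) (auto simp: finite_Lambda finite_T)
  also have "\<dots> = (\<Sum>l\<in>\<Lambda>. \<Sum>s\<in>T l. \<Sum>t\<in>T l. cf l s t x *s C l s t)"
    by (simp add: sum.cartesian_product)
  finally show ?thesis .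
qed

lemma basis_induct:
  assumes "subspace {x. P x}" "\<And>l s t. l \<in> \<Lambda> \<Longrightarrow> s \<in> T l \<Longrightarrow> t \<in> T l \<Longrightarrow> P (C l s t)"
  shows "P x"
proof -
  have "x \<in> span cbasis" using cbasis_span by auto
  then show ?thesis
    by (rule span_induct) (use assms in \<open>auto simp: cbasis_def\<close>)
qed

lemma eq_iff_cf: "x = y \<longleftrightarrow> (\<forall>l\<in>\<Lambda>. \<forall>s\<in>T l. \<forall>t\<in>T l. cf l s t x = cf l s t y)"
proof
  assume *: "\<forall>l\<in>\<Lambda>. \<forall>s\<in>T l. \<forall>t\<in>T l. cf l s t x = cf l s t y"
  show "x = y"
    by (subst cf_expand[of x], subst cf_expand[of y]) (use * in \<open>auto intro!: sum.cong\<close>)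
qed auto

text \<open>The C_st form a basis, so lying in a span of cells is a condition on coordinates.
  Congruences modulo higher cells are handled through this criterion.\<close>

lemma cspan_iff: "x \<in> cspan U \<longleftrightarrow> (\<forall>l\<in>\<Lambda> - U. \<forall>s\<in>T l. \<forall>t\<in>T l. cf l s t x = 0)"
proof
  assume "x \<in> cspan U"
  then show "\<forall>l\<in>\<Lambda> - U. \<forall>s\<in>T l. \<forall>t\<in>T l. cf l s t x = 0"
    unfolding cspan_def
    by (rule span_induct) (auto simp: subspace_def cf_add cf_scale cf_C)
next
  assume *: "\<forall>l\<in>\<Lambda> - U. \<forall>s\<in>T l. \<forall>t\<in>T l. cf l s t x = 0"
  have "cf l s t x *s C l s t \<in> cspan U" if "l \<in> \<Lambda>" "s \<in> T l" "t \<in> T l" for l s t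
  proof (cases "l \<in> U")
    case True
    then have "C l s t \<in> cspan U" unfolding cspan_def using that by (intro span_base) auto
    then show ?thesis unfolding cspan_def by (rule span_scale)
  qed (use that * in \<open>simp add: cspan_def span_zero\<close>)
  then have "(\<Sum>l\<in>\<Lambda>. \<Sum>s\<in>T l. \<Sum>t\<in>T l. cf l s t x *s C l s t) \<in> cspan U"
    unfolding cspan_def by (intro span_sum) auto
  then show "x \<in> cspan U" using cf_expand[of x] by simp
qed

lemma cspan_subspace: "subspace (cspan U)"
  unfolding cspan_def by (rule subspace_span)

lemma cspan_mono: "U \<subseteq> V \<Longrightarrow> cspan U \<subseteq> cspan V"
  unfolding cspan_def by (rule span_mono) blast

lemma C_in_cspan: "l \<in> \<Lambda> \<Longrightarrow> l \<in> U \<Longrightarrow> s \<in> T l \<Longrightarrow> t \<in> T l \<Longrightarrow> C l s t \<in> cspan U"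
  unfolding cspan_def by (rule span_base) auto

lemma cspan_induct:
  assumes "x \<in> cspan U" "subspace {x. P x}"
    "\<And>l s t. l \<in> \<Lambda> \<Longrightarrow> l \<in> U \<Longrightarrow> s \<in> T l \<Longrightarrow> t \<in> T l \<Longrightarrow> P (C l s t)"
  shows "P x"
  using assms(1) unfolding cspan_def by (rule span_induct) (use assms(2,3) in auto)

lemma cspan_Lambda: "\<Lambda> \<subseteq> U \<Longrightarrow> cspan U = UNIV" by (auto simp: cspan_iff)

lemma cspan_empty: "cspan {} = {0}"
  using eq_iff_cf[of _ 0] by (auto simp: cspan_iff)

lemma higher_eq: "higher l = cspan {m. l < m}"
  unfolding higher_def cspan_def by (rule arg_cong[where f=span]) auto

lemma higher_subset: "upset U \<Longrightarrow> l \<in> U \<Longrightarrow> higher l \<subseteq> cspan (U - {l})"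
  unfolding higher_eq cspan_iff upset_def subset_iff by blast

text \<open>Elements of \<open>higher l\<close> have no coordinates in cell l, so the coefficients
  in the cellular congruence can be read off as coordinates. This makes the function described in
  \<open>cell_coeff\<close> unique, its values outside \<open>T l\<close> being fixed to 0, and any
  row s may be used to compute it.\<close>

lemma cf_mult:
  assumes "l \<in> \<Lambda>" "s \<in> T l" "t \<in> T l" "v \<in> T l"
  shows "cell_coeff l t x v = cf l s v (C l s t * x)"
    and "C l s t * x - (\<Sum>v\<in>T l. cell_coeff l t x v *s C l s v) \<in> higher l"
    and "w \<notin> T l \<Longrightarrow> cell_coeff l t x w = 0"
proof -
  obtain r where r: "\<forall>s\<in>T l. C l s t * x - (\<Sum>v\<in>T l. r v *s C l s v) \<in> higher l"
    using C_mult[OF assms(1,3), of x] unfolding higher_def by blast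
  let ?P = "\<lambda>r. (\<forall>v. v \<notin> T l \<longrightarrow> r v = 0) \<and>
             (\<forall>s\<in>T l. C l s t * x - (\<Sum>v\<in>T l. r v *s C l s v) \<in> higher l)"
  have val: "cf l s v (C l s t * x) = r v"
    if "\<forall>s\<in>T l. C l s t * x - (\<Sum>v\<in>T l. r v *s C l s v) \<in> higher l" "s \<in> T l" "v \<in> T l" for r s v
  proof -
    have "cf l s v (C l s t * x - (\<Sum>v\<in>T l. r v *s C l s v)) = 0"
      using that assms(1) unfolding higher_eq cspan_iff by auto
    then show ?thesis
      using that assms(1)
      by (simp add: cf_diff cf_sum cf_scale cf_C finite_T if_distrib[of "\<lambda>y. _ * y"] cong: if_cong)
  qed
  have "?P (\<lambda>v. if v \<in> T l then r v else 0)" using r by auto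
  moreover have "r' = (\<lambda>v. if v \<in> T l then r v else 0)" if "?P r'" for r'
    using that val[of r'] val[OF r] assms by (auto simp: fun_eq_iff)
  ultimately have "cell_coeff l t x = (\<lambda>v. if v \<in> T l then r v else 0)"
    unfolding cell_coeff_def by (rule the_equality)
  moreover have "?P (cell_coeff l t x)"
    unfolding \<open>cell_coeff l t x = _\<close> using r by auto
  ultimately show "cell_coeff l t x v = cf l s v (C l s t * x)"
    and "C l s t * x - (\<Sum>v\<in>T l. cell_coeff l t x v *s C l s v) \<in> higher l"
    and "w \<notin> T l \<Longrightarrow> cell_coeff l t x w = 0"
    using val[of "cell_coeff l t x" s v] assms by auto
qed

lemma cf_mult_C_eq:
  assumes "l \<in> \<Lambda>" "s \<in> T l" "t \<in> T l" "s' \<in> T l" "v \<in> T l"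
  shows "cf l s' v (C l s t * x) = (if s' = s then cell_coeff l t x v else 0)"
proof -
  have "cf l s' v (C l s t * x - (\<Sum>v\<in>T l. cell_coeff l t x v *s C l s v)) = 0"
    using cf_mult(2)[OF assms(1,2,3,5), of x] assms unfolding higher_eq cspan_iff by auto
  then show ?thesis using assms by (auto simp: cf_diff cf_sum cf_scale cf_C finite_T if_distrib[of "\<lambda>y. _ * y"] cong: if_cong)
qed

lemma C_mult_in:
  assumes "l \<in> \<Lambda>" "s \<in> T l" "t \<in> T l" "upset U" "l \<in> U"
  shows "C l s t * x \<in> cspan U"
proof -
  have "C l s t * x - (\<Sum>v\<in>T l. cell_coeff l t x v *s C l s v) \<in> cspan U"
    using cf_mult(2)[OF assms(1-3), of t] assms higher_subset[of U l] cspan_mono[of "U - {l}" U]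
    by blast
  moreover have "(\<Sum>v\<in>T l. cell_coeff l t x v *s C l s v) \<in> cspan U"
    using assms by (intro subspace_sum subspace_scale cspan_subspace C_in_cspan) auto
  ultimately show ?thesis using subspace_add[OF cspan_subspace] by fastforce
qed

lemma cspan_mult_right: "upset U \<Longrightarrow> x \<in> cspan U \<Longrightarrow> x * a \<in> cspan U"
  by (rule cspan_induct[of x U]) (auto intro: C_mult_in simp: subspace_algebra_map cspan_subspace)

text \<open>The involution is defined by transposing coordinates rather than chosen from
  \<open>C_star\<close>. Linearity, involutivity and the effect on coordinates are then immediate,
  and only multiplicativity has to be carried over from the postulated anti-automorphism, with which
  it agrees on the basis.\<close>

definition "cstar x = (\<Sum>l\<in>\<Lambda>. \<Sum>s\<in>T l. \<Sum>t\<in>T l. cf l s t x *s C l t s)"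

lemma cf_cstar: "l \<in> \<Lambda> \<Longrightarrow> s \<in> T l \<Longrightarrow> t \<in> T l \<Longrightarrow> cf l s t (cstar x) = cf l t s x"
proof -
  assume a: "l \<in> \<Lambda>" "s \<in> T l" "t \<in> T l"
  have "cf l s t (cstar x) = (\<Sum>l'\<in>\<Lambda>. if l' = l then cf l t s x else 0)"
    unfolding cstar_def cf_sum cf_scale
  proof (rule sum.cong[OF refl])
    fix l' assume l': "l' \<in> \<Lambda>"
    have "(\<Sum>s'\<in>T l'. \<Sum>t'\<in>T l'. cf l' s' t' x * cf l s t (C l' t' s'))
       = (\<Sum>s'\<in>T l'. \<Sum>t'\<in>T l'. if t' = s then if s' = t then if l' = l then cf l t s x else 0 else 0 else 0)"
      using a l' by (intro sum.cong refl) (auto simp: cf_C)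
    also have "\<dots> = (if l' = l then cf l t s x else 0)"
    proof (cases "l' = l")
      case False
      have "(\<Sum>s'\<in>T l'. \<Sum>t'\<in>T l'. if t' = s then if s' = t then if l' = l then cf l t s x else 0 else 0 else 0)
        = (\<Sum>s'\<in>T l'. \<Sum>t'\<in>T l'. 0)" using False by (intro sum.cong) auto
      then show ?thesis using False by simp
    qed (use a finite_T[of l] in auto)
    finally show "(\<Sum>s'\<in>T l'. \<Sum>t'\<in>T l'. cf l' s' t' x * cf l s t (C l' t' s')) = (if l' = l then cf l t s x else 0)" .
  qed
  then show ?thesis using a finite_Lambda by simp
qed

lemma cstar_props:
  shows cstar_mult: "cstar (x * y) = cstar y * cstar x"
    and cstar_add: "cstar (x + y) = cstar x + cstar y"
    and cstar_diff: "cstar (x - y) = cstar x - cstar y"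
    and cstar_scale: "cstar (r *s x) = r *s cstar x"
    and cstar_C: "l \<in> \<Lambda> \<Longrightarrow> s \<in> T l \<Longrightarrow> t \<in> T l \<Longrightarrow> cstar (C l s t) = C l t s"
    and cstar_cstar [simp]: "cstar (cstar x) = x"
    and cstar_zero [simp]: "cstar 0 = 0"
    and cstar_one [simp]: "cstar 1 = 1"
proof -
  show add: "cstar (x + y) = cstar x + cstar y" for x y
    by (subst eq_iff_cf) (auto simp: cf_cstar cf_add)
  show "cstar (x - y) = cstar x - cstar y" for x y
    by (subst eq_iff_cf) (auto simp: cf_cstar cf_diff)
  show sc: "cstar (r *s x) = r *s cstar x" for r x
    by (subst eq_iff_cf) (auto simp: cf_cstar cf_scale)
  show cC: "cstar (C l s t) = C l t s" if "l \<in> \<Lambda>" "s \<in> T l" "t \<in> T l" for l s t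
    using that by (subst eq_iff_cf) (auto simp: cf_cstar cf_C)
  show inv: "cstar (cstar x) = x" for x
    by (subst eq_iff_cf) (auto simp: cf_cstar)
  show "cstar 0 = 0" by (subst eq_iff_cf) (auto simp: cf_cstar)
  obtain star where st: "module_hom scale scale star" "\<forall>x y. star (x * y) = star y * star x"
    "\<forall>l\<in>\<Lambda>. \<forall>s\<in>T l. \<forall>t\<in>T l. star (C l s t) = C l t s"
    using C_star by blast
  have eq: "star x = cstar x" for x
  proof (induction x rule: basis_induct)
    case 1
    show ?case
      using add sc st(1) module_hom.add[OF st(1)] module_hom.scale[OF st(1)] module_hom.zero[OF st(1)] \<open>cstar 0 = 0\<close>
      by (auto simp: subspace_def)
  qed (use st(3) cC in auto)
  show m: "cstar (x * y) = cstar y * cstar x" for x y using st(2) eq by metis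
  \<comment> \<open>Multiplicativity at the product of \<open>cstar 1\<close> and 1 reads 1 =
    \<open>cstar 1\<close> once the double involutions are removed.\<close>
  show "cstar 1 = 1" using m[of "cstar 1" 1] inv by simp
qed

lemma cstar_cspan: "x \<in> cspan U \<Longrightarrow> cstar x \<in> cspan U"
  by (auto simp: cspan_iff cf_cstar)

lemma cspan_mult_left: "upset U \<Longrightarrow> x \<in> cspan U \<Longrightarrow> a * x \<in> cspan U"
  using cspan_mult_right[of U "cstar x" "cstar a"] cstar_cspan[of x U]
  by (metis cstar_cspan cstar_cstar cstar_mult)

lemma cspan_ideal: "upset U \<Longrightarrow> two_sided_ideal (cspan U)"
  using cspan_mult_left cspan_mult_right cspan_subspace
  by (auto intro!: two_sided_idealI simp: subspace_def)

lemma upset_above: "upset {m \<in> \<Lambda>. l \<le> m}" "upset {m \<in> \<Lambda>. l < m}"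
  by (auto simp: upset_def)

lemma cell_coeff_outside: "l \<in> \<Lambda> \<Longrightarrow> t \<in> T l \<Longrightarrow> v \<notin> T l \<Longrightarrow> cell_coeff l t x v = 0"
  using cf_mult(3) by metis

text \<open>Computed from the right, C_st C_uv lies in row s modulo higher cells; computed from the
  left through the involution, it lies in column v. So it is a multiple of C_sv, the factor depends
  on neither s nor v, and exchanging the two computations gives the symmetry in t and u.\<close>

lemma gram_props:
  assumes "l \<in> \<Lambda>" "t \<in> T l" "u \<in> T l"
  shows gram_coeff: "v \<in> T l \<Longrightarrow> w \<in> T l \<Longrightarrow> cell_coeff l t (C l u v) w = (if w = v then gram l t u else 0)"
    and gram_sym: "gram l t u = gram l u t"
proof -
  have left: "cf l s' v' (C l s t * C l u v) = (if v' = v then cell_coeff l u (C l t s) s' else 0)"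
    if "s \<in> T l" "v \<in> T l" "s' \<in> T l" "v' \<in> T l" "t \<in> T l" "u \<in> T l" for s v s' v' t u
  proof -
    have "cf l s' v' (C l s t * C l u v) = cf l v' s' (cstar (C l s t * C l u v))"
      using that assms by (simp add: cf_cstar)
    also have "\<dots> = cf l v' s' (C l v u * C l t s)" using that assms by (simp add: cstar_mult cstar_C)
    finally show ?thesis using cf_mult_C_eq[OF assms(1)] that by auto
  qed
  \<comment> \<open>The left side does not mention s, and for w = v the right side does not mention
    v; the common value is therefore independent of both.\<close>
  have diag: "cell_coeff l t (C l u v) w = (if w = v then cell_coeff l u (C l t s) s else 0)"
    if "s \<in> T l" "v \<in> T l" "w \<in> T l" "t \<in> T l" "u \<in> T l" for s v w t u
    using left[of s v s w t u] cf_mult_C_eq[OF assms(1), of s t s w "C l u v"] that by auto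
  obtain s0 where s0: "s0 \<in> T l" using assms by blast
  have gram_eq: "gram l t u = cell_coeff l t (C l u s0) s0" if tu: "t \<in> T l" "u \<in> T l" for t u
    unfolding gram_def
  proof (rule the_equality)
    show "\<forall>s\<in>T l. \<forall>v\<in>T l. C l s t * C l u v - cell_coeff l t (C l u s0) s0 *s C l s v \<in> higher l"
    proof safe
      fix s v assume sv: "s \<in> T l" "v \<in> T l"
      have eq: "cell_coeff l t (C l u v) w = (if w = v then cell_coeff l t (C l u s0) s0 else 0)"
        if "w \<in> T l" for w
        using diag[of s0 v w t u] diag[of s0 s0 s0 t u] sv s0 tu that by simp
      have "(\<Sum>w\<in>T l. cell_coeff l t (C l u v) w *s C l s w)
          = (\<Sum>w\<in>T l. if w = v then cell_coeff l t (C l u s0) s0 *s C l s v else 0)"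
        by (rule sum.cong) (auto simp: eq)
      then have "(\<Sum>w\<in>T l. cell_coeff l t (C l u v) w *s C l s w) = cell_coeff l t (C l u s0) s0 *s C l s v"
        using sv assms finite_T by simp
      then show "C l s t * C l u v - cell_coeff l t (C l u s0) s0 *s C l s v \<in> higher l"
        using cf_mult(2)[OF assms(1) sv(1) tu(1) s0, of "C l u v"] by simp
    qed
  next
    fix c assume "\<forall>s\<in>T l. \<forall>v\<in>T l. C l s t * C l u v - c *s C l s v \<in> higher l"
    then have "cf l s0 s0 (C l s0 t * C l u s0 - c *s C l s0 s0) = 0"
      using s0 assms unfolding higher_eq cspan_iff by auto
    then show "c = cell_coeff l t (C l u s0) s0"
      using cf_mult_C_eq[OF assms(1), of s0 t s0 s0] s0 assms tu by (simp add: cf_diff cf_scale cf_C)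
  qed
  show "cell_coeff l t (C l u v) w = (if w = v then gram l t u else 0)" if "v \<in> T l" "w \<in> T l"
    using gram_eq[of t u] diag[of s0 v w t u] diag[of s0 s0 s0 t u] that assms s0 by auto
  show "gram l t u = gram l u t"
    using gram_eq[of t u] gram_eq[of u t] diag[of s0 s0 s0 t u] assms s0 by auto
qed

section \<open>Cell modules and their bilinear forms\<close>

definition \<Delta> :: "'l \<Rightarrow> ('t \<Rightarrow> 'o) set" where
  "\<Delta> l = {x. \<forall>t. t \<notin> T l \<longrightarrow> x t = 0}"

definition "act l x a = (\<lambda>v. \<Sum>t\<in>T l. x t * cell_coeff l t a v)"

lemma cell_module_eq: "cell_module l = \<lparr>mcarrier = \<Delta> l, mact = act l\<rparr>"
  unfolding cell_module_def \<Delta>_def act_def by simp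

lemma cell_coeff_add: "l \<in> \<Lambda> \<Longrightarrow> t \<in> T l \<Longrightarrow> cell_coeff l t (x + y) v = cell_coeff l t x v + cell_coeff l t y v"
  by (cases "v \<in> T l") (simp_all add: cf_mult(1)[of l t] cf_add distrib_left cell_coeff_outside)

lemma cell_coeff_scale: "l \<in> \<Lambda> \<Longrightarrow> t \<in> T l \<Longrightarrow> cell_coeff l t (r *s x) v = r * cell_coeff l t x v"
  by (cases "v \<in> T l") (simp_all add: cf_mult(1)[of l t] cf_scale scale_mult_right cell_coeff_outside)

lemma cell_coeff_one: "l \<in> \<Lambda> \<Longrightarrow> t \<in> T l \<Longrightarrow> cell_coeff l t 1 v = (if v = t then 1 else 0)"
  by (cases "v \<in> T l") (auto simp: cf_mult(1)[of l t] cf_C cell_coeff_outside)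

text \<open>\<open>higher l\<close> is an ideal, so the congruence that defines the coefficients of
  x may be multiplied by y on the right and read again in row t.\<close>

lemma cell_coeff_mult:
  assumes "l \<in> \<Lambda>" "t \<in> T l"
  shows "cell_coeff l t (x * y) v = (\<Sum>u\<in>T l. cell_coeff l t x u * cell_coeff l u y v)"
proof (cases "v \<in> T l")
  case True
  have ideal: "two_sided_ideal (cspan {m \<in> \<Lambda>. l < m})" by (intro cspan_ideal upset_above)
  have hi: "higher l = cspan {m \<in> \<Lambda>. l < m}" unfolding higher_eq by (auto simp: cspan_iff)
  have "(C l t t * x - (\<Sum>u\<in>T l. cell_coeff l t x u *s C l t u)) * y \<in> higher l"
    using cf_mult(2)[OF assms assms(2) assms(2)] two_sided_idealD(3)[OF ideal] unfolding hi by blast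
  then have "cf l t v ((C l t t * x - (\<Sum>u\<in>T l. cell_coeff l t x u *s C l t u)) * y) = 0"
    using assms True unfolding hi cspan_iff by auto
  then have "cf l t v (C l t t * (x * y)) = cf l t v ((\<Sum>u\<in>T l. cell_coeff l t x u *s C l t u) * y)"
    by (simp add: left_diff_distrib cf_diff mult.assoc)
  also have "\<dots> = (\<Sum>u\<in>T l. cell_coeff l t x u * cell_coeff l u y v)"
    using assms True
    by (auto simp: sum_distrib_right scale_mult_left cf_sum cf_scale cf_mult_C_eq intro!: sum.cong)
  finally show ?thesis using assms True by (simp add: cf_mult(1))
qed (use assms in \<open>auto simp: cell_coeff_outside\<close>)

lemma \<Delta>_closed:
  "0 \<in> \<Delta> l" "x \<in> \<Delta> l \<Longrightarrow> y \<in> \<Delta> l \<Longrightarrow> x + y \<in> \<Delta> l" "x \<in> \<Delta> l \<Longrightarrow> y \<in> \<Delta> l \<Longrightarrow> x - y \<in> \<Delta> l"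
  "x \<in> \<Delta> l \<Longrightarrow> - x \<in> \<Delta> l" "x \<in> \<Delta> l \<Longrightarrow> (\<lambda>t. c * x t) \<in> \<Delta> l"
  by (auto simp: \<Delta>_def)

lemma act_in: "l \<in> \<Lambda> \<Longrightarrow> act l x a \<in> \<Delta> l"
  by (auto simp: \<Delta>_def act_def cell_coeff_outside)

lemma act_linear:
  assumes l: "l \<in> \<Lambda>"
  shows act_add_left: "act l (x + y) a = act l x a + act l y a"
    and act_diff_left: "act l (x - y) a = act l x a - act l y a"
    and act_scale_left: "act l (\<lambda>t. c * x t) a = (\<lambda>t. c * act l x a t)"
    and act_add: "act l x (a + b) = act l x a + act l x b"
    and act_scale: "act l x (c *s a) = (\<lambda>t. c * act l x a t)"
    and act_zero_left [simp]: "act l 0 a = 0"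
  using assms unfolding act_def
  by (auto simp: fun_eq_iff algebra_simps sum.distrib sum_subtractf sum_distrib_left cell_coeff_add
      cell_coeff_scale intro!: sum.cong)

lemma act_zero [simp]: "l \<in> \<Lambda> \<Longrightarrow> act l x 0 = 0"
  using act_scale[of l x 0 0] by (auto simp: fun_eq_iff)

lemma act_uminus: "l \<in> \<Lambda> \<Longrightarrow> act l x (- a) = - act l x a"
  using act_scale[of l x "-1" a] by (auto simp: fun_eq_iff)

lemma act_diff: "l \<in> \<Lambda> \<Longrightarrow> act l x (a - b) = act l x a - act l x b"
  using act_add[of l x a "-b"] act_uminus[of l x b] by simp

lemma act_sum: "l \<in> \<Lambda> \<Longrightarrow> act l x (sum f A) = (\<Sum>i\<in>A. act l x (f i))"
  by (induction A rule: infinite_finite_induct) (auto simp: act_add)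

lemma act_sum_left: "l \<in> \<Lambda> \<Longrightarrow> act l (sum h A) a = (\<Sum>i\<in>A. act l (h i) a)"
  by (induction A rule: infinite_finite_induct) (simp_all add: act_add_left)

lemma act_one [simp]: "l \<in> \<Lambda> \<Longrightarrow> x \<in> \<Delta> l \<Longrightarrow> act l x 1 = x"
proof
  fix v assume l: "l \<in> \<Lambda>" and x: "x \<in> \<Delta> l"
  have "act l x 1 v = (\<Sum>t\<in>T l. if t = v then x t else 0)"
    unfolding act_def using l by (auto simp: cell_coeff_one intro!: sum.cong)
  then show "act l x 1 v = x v" using x l finite_T by (auto simp: \<Delta>_def)
qed

lemma act_mult: "l \<in> \<Lambda> \<Longrightarrow> act l x (a * b) = act l (act l x a) b"
proof
  fix v assume l: "l \<in> \<Lambda>"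
  have "act l x (a * b) v = (\<Sum>t\<in>T l. \<Sum>u\<in>T l. x t * cell_coeff l t a u * cell_coeff l u b v)"
    unfolding act_def using l by (auto simp: cell_coeff_mult sum_distrib_left mult.assoc intro!: sum.cong)
  also have "\<dots> = act l (act l x a) b v"
    unfolding act_def by (subst sum.swap) (auto simp: sum_distrib_right intro!: sum.cong)
  finally show "act l x (a * b) v = act l (act l x a) b v" .
qed

definition unitv :: "'t \<Rightarrow> 't \<Rightarrow> 'o" where
  "unitv t = (\<lambda>u. if u = t then 1 else 0)"

lemma unitv_in: "t \<in> T l \<Longrightarrow> unitv t \<in> \<Delta> l" by (auto simp: unitv_def \<Delta>_def)

lemma act_unitv: "l \<in> \<Lambda> \<Longrightarrow> t \<in> T l \<Longrightarrow> act l (unitv t) a v = cell_coeff l t a v"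
  unfolding act_def unitv_def using finite_T by (simp add: if_distribR sum.delta if_distrib[of "\<lambda>x. x * _"] cong: if_cong)

lemma \<Delta>_expand: "l \<in> \<Lambda> \<Longrightarrow> x \<in> \<Delta> l \<Longrightarrow> x = (\<lambda>v. \<Sum>t\<in>T l. x t * unitv t v)"
proof
  fix v assume a: "l \<in> \<Lambda>" "x \<in> \<Delta> l"
  have "(\<Sum>t\<in>T l. x t * unitv t v) = (\<Sum>t\<in>T l. if t = v then x v else 0)"
    by (intro sum.cong) (auto simp: unitv_def)
  then show "x v = (\<Sum>t\<in>T l. x t * unitv t v)" using a finite_T by (auto simp: \<Delta>_def)
qed

lemma cell_form_linear:
  shows form_add_left: "cell_form l (x + x') y = cell_form l x y + cell_form l x' y"
    and form_add_right: "cell_form l x (y + y') = cell_form l x y + cell_form l x y'"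
    and form_diff_left: "cell_form l (x - x') y = cell_form l x y - cell_form l x' y"
    and form_scale_left: "cell_form l (\<lambda>t. c * x t) y = c * cell_form l x y"
    and form_scale_right: "cell_form l x (\<lambda>t. c * y t) = c * cell_form l x y"
    and form_zero [simp]: "cell_form l 0 y = 0" "cell_form l x 0 = 0"
  unfolding cell_form_def
  by (auto simp: algebra_simps sum.distrib sum_subtractf sum_distrib_left intro!: sum.cong)

lemma form_sym: "l \<in> \<Lambda> \<Longrightarrow> cell_form l x y = cell_form l y x"
  unfolding cell_form_def by (subst sum.swap) (auto simp: gram_sym algebra_simps intro!: sum.cong)

lemma form_unitv_right: "l \<in> \<Lambda> \<Longrightarrow> u \<in> T l \<Longrightarrow> cell_form l x (unitv u) = (\<Sum>t\<in>T l. x t * gram l t u)"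
proof -
  assume a: "l \<in> \<Lambda>" "u \<in> T l"
  have "(\<Sum>u'\<in>T l. x t * unitv u u' * gram l t u') = x t * gram l t u" for t
  proof -
    have "(\<Sum>u'\<in>T l. x t * unitv u u' * gram l t u') = (\<Sum>u'\<in>T l. if u' = u then x t * gram l t u else 0)"
      by (rule sum.cong) (auto simp: unitv_def)
    then show ?thesis using a finite_T by simp
  qed
  then show ?thesis unfolding cell_form_def by simp
qed

lemma form_expand_right: "l \<in> \<Lambda> \<Longrightarrow> cell_form l x y = (\<Sum>u\<in>T l. y u * cell_form l x (unitv u))"
proof -
  assume l: "l \<in> \<Lambda>"
  have "cell_form l x y = (\<Sum>u\<in>T l. \<Sum>t\<in>T l. x t * y u * gram l t u)"
    unfolding cell_form_def by (rule sum.swap)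
  also have "\<dots> = (\<Sum>u\<in>T l. y u * cell_form l x (unitv u))"
    using l by (intro sum.cong refl) (auto simp: form_unitv_right sum_distrib_left algebra_simps)
  finally show ?thesis .
qed

text \<open>On its own cell module C_uv is the operator of rank one x |-> <x, C_u> C_v. Elements
  with a prescribed action on a cell module are built from such operators throughout.\<close>

lemma act_C_same:
  assumes "l \<in> \<Lambda>" "u \<in> T l" "v \<in> T l"
  shows "act l x (C l u v) = (\<lambda>w. cell_form l x (unitv u) * unitv v w)"
proof
  fix w
  show "act l x (C l u v) w = cell_form l x (unitv u) * unitv v w"
  proof (cases "w \<in> T l")
    case True
    have "act l x (C l u v) w = (\<Sum>t\<in>T l. x t * (if w = v then gram l t u else 0))"
      unfolding act_def using assms True by (intro sum.cong) (auto simp: gram_coeff)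
    then show ?thesis using assms by (simp add: form_unitv_right, simp add: unitv_def)
  qed (use assms act_in[of l x] in \<open>auto simp: \<Delta>_def unitv_def\<close>)
qed

text \<open>C_uu times an element of cell m lies in the ideal spanned by m and the cells above it,
  and this ideal has no coordinates in cell l unless m \<le> l.\<close>

lemma act_cspan_zero:
  assumes "l \<in> \<Lambda>" "a \<in> cspan U" "\<forall>m\<in>U. \<not> m \<le> l"
  shows "act l x a = 0"
proof (rule cspan_induct[OF assms(2)])
  show "subspace {a. act l x a = 0}"
    using assms(1) by (auto simp: subspace_def act_add act_scale fun_eq_iff)
next
  fix m s t assume m: "m \<in> \<Lambda>" "m \<in> U" "s \<in> T m" "t \<in> T m"
  have "cell_coeff l u (C m s t) v = 0" if u: "u \<in> T l" for u v
  proof (cases "v \<in> T l")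
    case True
    have "C l u u * C m s t \<in> cspan {k \<in> \<Lambda>. m \<le> k}"
      using m by (intro cspan_mult_left upset_above C_in_cspan) auto
    then have "cf l u v (C l u u * C m s t) = 0"
      using assms m u True by (auto simp: cspan_iff)
    then show ?thesis using assms u True by (simp add: cf_mult(1))
  qed (use u assms in \<open>auto simp: cell_coeff_outside\<close>)
  then show "act l x (C m s t) = 0" unfolding act_def by (auto simp: fun_eq_iff)
qed

text \<open>In the layer of cell l of the filtration by ideals, the elements with fixed first index
  s form a copy of the cell module; \<open>row l s\<close> projects to it.\<close>

definition "row l s p = (\<lambda>t. if t \<in> T l then cf l s t p else 0)"

lemma row_in: "row l s p \<in> \<Delta> l" by (auto simp: row_def \<Delta>_def)

lemma row_linear: "row l s (x + y) = row l s x + row l s y" "row l s (x - y) = row l s x - row l s y"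
  "row l s (c *s x) = (\<lambda>t. c * row l s x t)" "row l s 0 = 0"
  by (auto simp: row_def cf_add cf_diff cf_scale fun_eq_iff)

lemma row_mult:
  assumes "upset U" "upset (insert l U)" "l \<notin> U" "p \<in> cspan (insert l U)" "l \<in> \<Lambda>" "s \<in> T l"
  shows "row l s (p * q) = act l (row l s p) q"
proof (rule cspan_induct[OF assms(4)])
  show "subspace {p. row l s (p * q) = act l (row l s p) q}"
    using assms by (auto simp: subspace_def row_linear act_add_left distrib_right scale_mult_left act_scale_left)
next
  fix m a b assume m: "m \<in> \<Lambda>" "m \<in> insert l U" "a \<in> T m" "b \<in> T m"
  show "row l s (C m a b * q) = act l (row l s (C m a b)) q"
  proof (cases "m = l")
    case True
    have r: "row l s (C l a b) = (if s = a then unitv b else 0)"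
      using m True assms by (auto simp: row_def cf_C unitv_def fun_eq_iff)
    have "act l (row l s (C l a b)) q v = (if s = a then cell_coeff l b q v else 0)" for v
      using m True assms by (simp add: r act_unitv)
    moreover have "row l s (C l a b * q) v = (if s = a then cell_coeff l b q v else 0)" for v
      using m True assms by (auto simp: row_def cf_mult_C_eq cell_coeff_outside)
    ultimately show ?thesis using True by (auto simp: fun_eq_iff)
  next
    case False
    then have mU: "m \<in> U" using m by auto
    have "row l s p = 0" if "p \<in> cspan U" for p
      using that assms by (auto simp: row_def cspan_iff fun_eq_iff)
    then show ?thesis
      using C_in_cspan[OF m(1) mU m(3,4)] cspan_mult_right[OF assms(1)] assms(5) by simp
  qed
qed

text \<open>This is how arguments descend the filtration by one cell: by \<open>row_mult\<close> the
  vanishing of the rows becomes a computation in the cell module.\<close>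

lemma in_cspan_if_rows:
  assumes "p \<in> cspan (insert l U)" "\<And>s. s \<in> T l \<Longrightarrow> row l s p = 0"
  shows "p \<in> cspan U"
  unfolding cspan_iff
proof safe
  fix m s t assume m: "m \<in> \<Lambda>" "m \<notin> U" "s \<in> T m" "t \<in> T m"
  show "cf m s t p = 0"
  proof (cases "m = l")
    case True then show ?thesis using assms(2)[of s] m by (auto simp: row_def fun_eq_iff split: if_splits)
  qed (use assms(1) m in \<open>auto simp: cspan_iff\<close>)
qed

text \<open>Both sides come from the action of a C_us on a basis vector C_t. Letting a act first
  gives the form of C_t a and C_u; expanding a C_us along its left index, with coefficients supplied
  by the involution, gives the form of C_t and C_u \<open>cstar a\<close>.\<close>

lemma form_assoc:
  assumes "l \<in> \<Lambda>" "x \<in> \<Delta> l" "y \<in> \<Delta> l"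
  shows "cell_form l (act l x a) y = cell_form l x (act l y (cstar a))"
proof -
  obtain s where s: "s \<in> T l" using T_nonempty[OF assms(1)] by auto
  define U where "U = {m \<in> \<Lambda>. l < m}"
  have U: "upset U" "upset (insert l U)" "l \<notin> U"
    using assms by (auto simp: U_def upset_def)
  have key: "(\<Sum>w\<in>T l. cell_coeff l t a w * gram l w u) = (\<Sum>w\<in>T l. cell_coeff l u (cstar a) w * gram l t w)"
    if tu: "t \<in> T l" "u \<in> T l" for t u
  proof -
    have ev: "act l z (C l w s) s = cell_form l z (unitv w)" if "w \<in> T l" for z w
      using act_C_same[OF assms(1) that s] by (simp add: unitv_def)
    have g: "cell_form l (unitv t) (unitv w) = gram l t w" if "w \<in> T l" for w
    proof -
      have "(\<Sum>t'\<in>T l. unitv t t' * gram l t' w) = (\<Sum>t'\<in>T l. if t' = t then gram l t w else 0)"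
        by (intro sum.cong) (auto simp: unitv_def)
      then show ?thesis using that tu assms finite_T by (simp add: form_unitv_right)
    qed
    have "act l (act l (unitv t) a) (C l u s) s = (\<Sum>w\<in>T l. cell_coeff l t a w * gram l w u)"
      using assms tu by (simp add: ev form_unitv_right act_unitv)
    moreover have "act l (act l (unitv t) a) (C l u s) s = act l (unitv t) (a * C l u s) s"
      by (simp add: act_mult[OF assms(1)])
    moreover have "act l (unitv t) (a * C l u s) s = (\<Sum>w\<in>T l. cell_coeff l u (cstar a) w * gram l t w)"
    proof -
      \<comment> \<open>z is the error in expanding a C_us in column s. Its image under the
        involution is the error of a row expansion, so it lies in higher cells, and these act as
        zero on the cell module of l.\<close>
      define z where "z = a * C l u s - (\<Sum>w\<in>T l. cell_coeff l u (cstar a) w *s C l w s)"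
      have "cstar z = C l s u * cstar a - (\<Sum>w\<in>T l. cell_coeff l u (cstar a) w *s C l s w)"
      proof -
        have cs: "cstar (sum f A) = (\<Sum>i\<in>A. cstar (f i))" for f :: "'t \<Rightarrow> 's" and A
          by (induction A rule: infinite_finite_induct) (auto simp: cstar_add)
        show ?thesis unfolding z_def cstar_diff cs using assms tu s
          by (auto simp: cstar_mult cstar_C cstar_scale intro!: sum.cong)
      qed
      then have "cstar z \<in> cspan {m. l < m}"
        using cf_mult(2)[OF assms(1) s tu(2) s, of "cstar a"] unfolding higher_eq by simp
      then have "z \<in> cspan {m. l < m}" using cstar_cspan[of "cstar z"] by simp
      then have "act l (unitv t) z = 0" using assms(1) by (intro act_cspan_zero) auto
      then have "act l (unitv t) (a * C l u s) s
          = act l (unitv t) (\<Sum>w\<in>T l. cell_coeff l u (cstar a) w *s C l w s) s"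
        unfolding z_def using assms(1) by (simp add: act_diff)
      also have "\<dots> = (\<Sum>w\<in>T l. cell_coeff l u (cstar a) w * act l (unitv t) (C l w s) s)"
        using assms(1) by (simp add: act_sum act_scale sum_fun_apply)
      also have "\<dots> = (\<Sum>w\<in>T l. cell_coeff l u (cstar a) w * gram l t w)"
        by (intro sum.cong) (auto simp: ev g)
      finally show ?thesis .
    qed
    ultimately show ?thesis by simp
  qed
  have "cell_form l (act l x a) y = (\<Sum>u\<in>T l. \<Sum>t\<in>T l. x t * y u * (\<Sum>w\<in>T l. cell_coeff l t a w * gram l w u))"
  proof -
    have "cell_form l (act l x a) (unitv u) = (\<Sum>t\<in>T l. x t * (\<Sum>w\<in>T l. cell_coeff l t a w * gram l w u))" if "u \<in> T l" for u
      unfolding form_unitv_right[OF assms(1) that] act_def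
      unfolding sum_distrib_left sum_distrib_right
      by (subst sum.swap) (auto simp: mult.assoc)
    then show ?thesis
      by (subst form_expand_right[OF assms(1)])
        (auto simp: sum_distrib_left algebra_simps intro!: sum.cong)
  qed
  also have "\<dots> = (\<Sum>u\<in>T l. \<Sum>t\<in>T l. x t * y u * (\<Sum>w\<in>T l. cell_coeff l u (cstar a) w * gram l t w))"
    by (intro sum.cong refl) (simp add: key)
  also have "\<dots> = (\<Sum>t\<in>T l. \<Sum>u\<in>T l. x t * y u * (\<Sum>w\<in>T l. cell_coeff l u (cstar a) w * gram l t w))"
    by (rule sum.swap)
  also have "\<dots> = cell_form l x (act l y (cstar a))"
    unfolding cell_form_def
  proof (rule sum.cong[OF refl])
    fix t assume t: "t \<in> T l"
    have "(\<Sum>u\<in>T l. x t * y u * (\<Sum>w\<in>T l. cell_coeff l u (cstar a) w * gram l t w))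
      = (\<Sum>w\<in>T l. \<Sum>u\<in>T l. x t * y u * (cell_coeff l u (cstar a) w * gram l t w))"
      unfolding sum_distrib_left by (rule sum.swap)
    also have "\<dots> = (\<Sum>w\<in>T l. x t * act l y (cstar a) w * gram l t w)"
      unfolding act_def by (auto simp: sum_distrib_left sum_distrib_right algebra_simps intro!: sum.cong)
    finally show "(\<Sum>u\<in>T l. x t * y u * (\<Sum>w\<in>T l. cell_coeff l u (cstar a) w * gram l t w))
      = (\<Sum>w\<in>T l. x t * act l y (cstar a) w * gram l t w)" .
  qed
  finally show ?thesis .
qed

text \<open>The elementary tensor x \<otimes> y, when the span of cell l is identified with the
  tensor square of its cell module by C_st = C_s \<otimes> C_t.\<close>

definition "tens l x y = (\<Sum>s\<in>T l. \<Sum>t\<in>T l. (x s * y t) *s C l s t)"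

lemma cf_tens: "l \<in> \<Lambda> \<Longrightarrow> s \<in> T l \<Longrightarrow> t \<in> T l \<Longrightarrow> cf l s t (tens l x y) = x s * y t"
proof -
  assume a: "l \<in> \<Lambda>" "s \<in> T l" "t \<in> T l"
  have "cf l s t (tens l x y) = (\<Sum>s'\<in>T l. \<Sum>t'\<in>T l. if t' = t then if s' = s then x s * y t else 0 else 0)"
    unfolding tens_def cf_sum cf_scale using a by (intro sum.cong refl) (auto simp: cf_C)
  then show ?thesis using a finite_T by simp
qed

lemma tens_in: "l \<in> \<Lambda> \<Longrightarrow> l \<in> U \<Longrightarrow> tens l x y \<in> cspan U"
  unfolding tens_def by (intro subspace_sum subspace_scale cspan_subspace C_in_cspan) auto

lemma row_tens: "l \<in> \<Lambda> \<Longrightarrow> s \<in> T l \<Longrightarrow> y \<in> \<Delta> l \<Longrightarrow> row l s (tens l x y) = (\<lambda>t. x s * y t)"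
  by (auto simp: row_def cf_tens \<Delta>_def fun_eq_iff)

lemma act_tens: "l \<in> \<Lambda> \<Longrightarrow> y \<in> \<Delta> l \<Longrightarrow> act l z (tens l x y) = (\<lambda>t. cell_form l z x * y t)"
proof
  fix v assume a: "l \<in> \<Lambda>" "y \<in> \<Delta> l"
  have "act l z (tens l x y) v = (\<Sum>s\<in>T l. \<Sum>t\<in>T l. x s * y t * (cell_form l z (unitv s) * unitv t v))"
    unfolding tens_def using a by (auto simp: act_sum act_scale sum_fun_apply act_C_same intro!: sum.cong)
  also have "\<dots> = (\<Sum>s\<in>T l. x s * cell_form l z (unitv s) * (\<Sum>t\<in>T l. y t * unitv t v))"
    by (auto simp: sum_distrib_left algebra_simps intro!: sum.cong)
  also have "(\<Sum>t\<in>T l. y t * unitv t v) = y v" using \<Delta>_expand[OF a] by metis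
  also have "(\<Sum>s\<in>T l. x s * cell_form l z (unitv s) * y v) = cell_form l z x * y v"
    by (subst (2) form_expand_right[OF a(1)]) (simp add: sum_distrib_right)
  finally show "act l z (tens l x y) v = cell_form l z x * y v" .
qed

lemma cstar_tens: "l \<in> \<Lambda> \<Longrightarrow> cstar (tens l x y) = tens l y x"
proof (subst eq_iff_cf, safe)
  fix m s t assume l: "l \<in> \<Lambda>" and m: "m \<in> \<Lambda>" "s \<in> T m" "t \<in> T m"
  show "cf m s t (cstar (tens l x y)) = cf m s t (tens l y x)"
  proof (cases "m = l")
    case False
    then show ?thesis using m tens_in[OF l, of "{l}" x y] tens_in[OF l, of "{l}" y x] by (auto simp: cf_cstar cspan_iff)
  qed (use l m in \<open>auto simp: cf_cstar cf_tens\<close>)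
qed

text \<open>The filtration is run through downwards: for l maximal in \<Lambda> - U, the set
  \<open>insert l U\<close> is again an upper set. At U = {} the conclusion is often that an element
  vanishes, because \<open>cspan {}\<close> is 0. The companion rule
  \<open>upset_induct_bottom\<close> works upwards from the empty set, the last cell added being
  minimal.\<close>

lemma upset_induct [consumes 1, case_names top step]:
  assumes "upset U" "P \<Lambda>"
    "\<And>U l. upset U \<Longrightarrow> upset (insert l U) \<Longrightarrow> l \<notin> U \<Longrightarrow> l \<in> \<Lambda> \<Longrightarrow> P (insert l U) \<Longrightarrow> P U"
  shows "P U"
  using assms(1)
proof (induction "card (\<Lambda> - U)" arbitrary: U rule: less_induct)
  case less
  show ?case
  proof (cases "U = \<Lambda>")
    case False
    then have ne: "\<Lambda> - U \<noteq> {}" "finite (\<Lambda> - U)" using less.prems finite_Lambda by (auto simp: upset_def)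
    obtain l where l: "l \<in> \<Lambda> - U" "\<And>m. m \<in> \<Lambda> - U \<Longrightarrow> l \<le> m \<Longrightarrow> l = m"
      using finite_has_maximal[OF ne(2,1)] by blast
    have up: "upset (insert l U)" using less.prems l by (auto simp: upset_def dest: less_imp_le)
    have "card (\<Lambda> - insert l U) < card (\<Lambda> - U)"
      using l ne by (intro psubset_card_mono) auto
    then have "P (insert l U)" using less.hyps up by blast
    then show ?thesis using assms(3) less.prems up l by blast
  qed (use assms(2) in simp)
qed

lemma upset_induct_bottom [consumes 1, case_names empty step]:
  assumes "upset U" "P {}"
    "\<And>U l. upset U \<Longrightarrow> upset (insert l U) \<Longrightarrow> l \<notin> U \<Longrightarrow> l \<in> \<Lambda> \<Longrightarrow> P U \<Longrightarrow> P (insert l U)"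
  shows "P U"
  using assms(1)
proof (induction "card U" arbitrary: U rule: less_induct)
  case less
  show ?case
  proof (cases "U = {}")
    case False
    have fin: "finite U" using less.prems finite_Lambda by (auto simp: upset_def dest: finite_subset)
    obtain l where l: "l \<in> U" "\<And>m. m \<in> U \<Longrightarrow> m \<le> l \<Longrightarrow> l = m"
      using finite_has_minimal[OF fin False] by blast
    have "\<not> k < l" if "k \<in> U" for k using l(2)[OF that] by (auto dest: less_imp_le)
    then have up: "upset (U - {l})" using less.prems unfolding upset_def by blast
    have "card (U - {l}) < card U" using l fin by (intro psubset_card_mono) auto
    then have "P (U - {l})" using less.hyps up by blast
    moreover have U: "insert l (U - {l}) = U" using l by auto
    moreover have "l \<in> \<Lambda>" using less.prems l unfolding upset_def by auto
    ultimately show ?thesis using assms(3)[OF up, of l] less.prems by simp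
  qed (use assms(2) in simp)
qed

end

section \<open>Simple heads and primitive idempotents\<close>

lemma two_sided_ideal_power_diff:
  assumes "two_sided_ideal I" "x - y \<in> I"
  shows "x ^ m - y ^ m \<in> I"
proof (induction m)
  case (Suc m)
  have "x ^ Suc m - y ^ Suc m = (x - y) * x ^ m + y * (x ^ m - y ^ m)" by (simp add: algebra_simps)
  then show ?case using Suc two_sided_idealD[OF assms(1)] assms(2) by metis
qed (use two_sided_idealD(1)[OF assms(1)] in simp)

lemma two_sided_ideal_idem_power:
  assumes "two_sided_ideal I" "x * x - x \<in> I" "m > 0"
  shows "x ^ m - x \<in> I"
  using assms(3)
proof (induction m rule: nat_induct_non_zero)
  case 1
  then show ?case using two_sided_idealD(1)[OF assms(1)] by simp
next
  case (Suc m)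
  have "x ^ Suc m - x = x * (x ^ m - x) + (x * x - x)" by (simp add: algebra_simps)
  then show ?case using Suc two_sided_idealD[OF assms(1)] assms(2) by metis
qed

text \<open>The factor s is the geometric sum 1 + x + ... + x^(n-1); the second conjunct keeps what
  is needed of its being a polynomial in x.\<close>

lemma one_minus_power_factor:
  fixes x :: "'a::ring_1"
  shows "\<exists>s. 1 - x ^ n = (1 - x) * s \<and> (\<forall>y. x * y = y * x \<longrightarrow> s * y = y * s)"
proof (induction n)
  case (Suc n)
  then obtain s where s: "1 - x ^ n = (1 - x) * s" "\<forall>y. x * y = y * x \<longrightarrow> s * y = y * s" by blast
  have "1 - x ^ Suc n = (1 - x ^ n) + (x ^ n - x * x ^ n)" by simp
  also have "\<dots> = (1 - x) * (s + x ^ n)" by (simp add: s(1) algebra_simps power_commutes)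
  finally have "1 - x ^ Suc n = (1 - x) * (s + x ^ n)" .
  moreover have "(s + x ^ n) * y = y * (s + x ^ n)" if "x * y = y * x" for y
    using s(2) that power_commuting_commutes[of x y n] by (simp add: algebra_simps)
  ultimately show ?case by blast
qed (auto intro: exI[of _ 0])

lemma power_mult_commuting:
  fixes x y :: "'a::ring_1"
  assumes "x * y = y * x"
  shows "(x * y) ^ n = x ^ n * y ^ n"
proof (induction n)
  case (Suc n)
  have "(x * y) ^ Suc n = x * (y * x ^ n) * y ^ n" using Suc by (simp add: mult.assoc)
  also have "y * x ^ n = x ^ n * y" using power_commuting_commutes[OF assms, of n] by simp
  finally show ?case by (simp add: mult.assoc)
qed simp

text \<open>The lift is e = 1 - (1 - a^m)^m. It is divisible by a^m, and 1 - e by (1 - a)^m, so e (1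
  - e) contains the factor a^m (1 - a)^m = (a - a^2)^m = 0. Modulo I all positive powers of a agree
  with a, and those of 1 - a with 1 - a, which gives e = a there.\<close>

lemma lift_idempotent:
  fixes a :: "'a::ring_1"
  assumes I: "two_sided_ideal I" "a * a - a \<in> I" and nil: "(a * a - a) ^ m = 0"
  shows "\<exists>e. e * e = e \<and> e - a \<in> I"
proof -
  have m: "m > 0" using nil by (cases m) auto
  define b where "b = 1 - a ^ m"
  obtain s where s: "1 - b ^ m = (1 - b) * s" "\<And>y. b * y = y * b \<Longrightarrow> s * y = y * s"
    using one_minus_power_factor by blast
  obtain s' where s': "1 - a ^ m = (1 - a) * s'" "\<And>y. a * y = y * a \<Longrightarrow> s' * y = y * s'"
    using one_minus_power_factor by blast
  define e where "e = 1 - b ^ m"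
  have am: "a ^ m * a = a * a ^ m" by (simp add: power_commutes)
  have ba: "b * a = a * b" unfolding b_def by (simp add: algebra_simps am)
  have sa: "s * a = a * s" using s(2)[OF ba] .
  have z: "a ^ m * (1 - a) ^ m = 0"
  proof -
    have "a ^ m * (1 - a) ^ m = (a * (1 - a)) ^ m"
      by (subst power_mult_commuting) (auto simp: algebra_simps)
    also have "a * (1 - a) = - (a * a - a)" by (simp add: algebra_simps)
    finally show ?thesis using nil by (subst (asm) power_minus) simp
  qed
  have e1: "e = a ^ m * s" unfolding e_def s(1) by (simp add: b_def)
  have e2: "1 - e = (1 - a) ^ m * s' ^ m"
  proof -
    have "(1 - a) * s' = s' * (1 - a)" using s'(2)[of a] by (simp add: algebra_simps)
    then show ?thesis unfolding e_def using power_mult_commuting[of "1 - a" s' m] by (simp add: b_def s'(1))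
  qed
  have "s * (1 - a) = (1 - a) * s" using sa by (simp add: algebra_simps)
  then have "s * (1 - a) ^ m = (1 - a) ^ m * s" by (metis power_commuting_commutes)
  then have "e * (1 - e) = a ^ m * (1 - a) ^ m * (s * s' ^ m)"
    unfolding e2 by (subst e1) (metis mult.assoc)
  then have "e * (1 - e) = 0" using z by simp
  then have idem: "e * e = e" by (simp add: algebra_simps)
  have "a ^ m - a \<in> I" using two_sided_ideal_idem_power[OF I m] .
  then have "b - (1 - a) \<in> I" using two_sided_idealD(5)[OF I(1)] unfolding b_def by fastforce
  then have "b ^ m - (1 - a) ^ m \<in> I" using two_sided_ideal_power_diff[OF I(1)] by blast
  moreover have "(1 - a) ^ m - (1 - a) \<in> I"
    using I(2) by (intro two_sided_ideal_idem_power[OF I(1) _ m]) (simp add: algebra_simps)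
  ultimately have "b ^ m - (1 - a) ^ m + ((1 - a) ^ m - (1 - a)) \<in> I"
    using two_sided_idealD(2)[OF I(1)] by blast
  moreover have "b ^ m - (1 - a) ^ m + ((1 - a) ^ m - (1 - a)) = b ^ m - (1 - a)" by (simp add: algebra_simps)
  ultimately have "b ^ m - (1 - a) \<in> I" by metis
  then have "- (b ^ m - (1 - a)) \<in> I" by (rule two_sided_idealD(5)[OF I(1)])
  then have "e - a \<in> I" unfolding e_def by (simp add: algebra_simps)
  then show ?thesis using idem by blast
qed

lemma idem_power: "e * e = (e::'a::ring_1) \<Longrightarrow> m > 0 \<Longrightarrow> e ^ m = e"
proof -
  assume e: "e * e = e" and "m > 0"
  show ?thesis using \<open>m > 0\<close> by (induction m rule: nat_induct_non_zero) (auto simp: e)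
qed

lemma pointwise_vector_space: "vector_space (\<lambda>(c::'k::field) (f::'t \<Rightarrow> 'k) t. c * f t)"
  by unfold_locales (auto simp: fun_eq_iff algebra_simps)

section \<open>Annihilators of the heads of cell modules over a field\<close>

locale field_cell_datum = cell_datum scale \<Lambda> T C
  for scale :: "'k::field \<Rightarrow> 'a::ring_1 \<Rightarrow> 'a" (infixr \<open>*s\<close> 75)
    and \<Lambda> :: "'l::order set" and T :: "'l \<Rightarrow> 't set" and C :: "'l \<Rightarrow> 't \<Rightarrow> 't \<Rightarrow> 'a"
begin

definition "rad l = {x \<in> \<Delta> l. \<forall>y\<in>\<Delta> l. cell_form l x y = 0}"

text \<open>This is the annihilator of the head \<Delta> l / rad l. When the form of l is zero, the
  head is zero and the annihilator is the whole algebra, so such a cell imposes no condition in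
  \<open>heads_ann\<close>.\<close>

definition "head_ann l = {a. \<forall>x\<in>\<Delta> l. act l x a \<in> rad l}"

definition "heads_ann = {a. \<forall>l\<in>\<Lambda>. a \<in> head_ann l}"

definition "good_cells = {l \<in> \<Lambda>. rad l \<noteq> \<Delta> l}"

lemma rad_closed:
  "rad l \<subseteq> \<Delta> l" "0 \<in> rad l" "x \<in> rad l \<Longrightarrow> y \<in> rad l \<Longrightarrow> x + y \<in> rad l"
  "x \<in> rad l \<Longrightarrow> y \<in> rad l \<Longrightarrow> x - y \<in> rad l" "x \<in> rad l \<Longrightarrow> (\<lambda>t. c * x t) \<in> rad l"
  by (auto simp: rad_def \<Delta>_closed cell_form_linear)

lemma rad_act: "l \<in> \<Lambda> \<Longrightarrow> x \<in> rad l \<Longrightarrow> act l x a \<in> rad l"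
  by (auto simp: rad_def act_in form_assoc)

lemma head_ann_ideal: "l \<in> \<Lambda> \<Longrightarrow> two_sided_ideal (head_ann l)"
  by (rule two_sided_idealI) (auto simp: head_ann_def act_linear act_mult act_in rad_act rad_closed)

lemma head_ann_scale: "l \<in> \<Lambda> \<Longrightarrow> a \<in> head_ann l \<Longrightarrow> c *s a \<in> head_ann l"
  by (auto simp: head_ann_def act_scale rad_closed)

lemma head_ann_one: "l \<in> \<Lambda> \<Longrightarrow> 1 \<in> head_ann l \<longleftrightarrow> l \<notin> good_cells"
  using rad_closed(1)[of l] by (auto simp: head_ann_def good_cells_def)

lemma head_ann_0I: "l \<in> \<Lambda> \<Longrightarrow> (\<And>x. x \<in> \<Delta> l \<Longrightarrow> act l x a = 0) \<Longrightarrow> a \<in> head_ann l"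
  by (auto simp: head_ann_def rad_closed)

text \<open>The head inherits a nondegenerate form for which the action of \<open>cstar a\<close> is
  adjoint to that of a.\<close>

lemma head_ann_star: "l \<in> \<Lambda> \<Longrightarrow> cstar a \<in> head_ann l \<longleftrightarrow> a \<in> head_ann l"
proof -
  assume l: "l \<in> \<Lambda>"
  have "cstar a \<in> head_ann l" if "a \<in> head_ann l" for a
    unfolding head_ann_def rad_def
  proof safe
    fix x y assume xy: "x \<in> \<Delta> l" "y \<in> \<Delta> l"
    have "cell_form l (act l x (cstar a)) y = cell_form l (act l y a) x"
      using form_assoc[OF l xy, of "cstar a"] form_sym[OF l] by simp
    then show "cell_form l (act l x (cstar a)) y = 0" using that xy by (auto simp: head_ann_def rad_def)
  qed (use l act_in in blast)
  from this[of a] this[of "cstar a"] show ?thesis by auto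
qed

lemma heads_ann_ideal: "two_sided_ideal heads_ann"
  by (rule two_sided_idealI) (auto simp: heads_ann_def dest: two_sided_idealD[OF head_ann_ideal])

text \<open>The elements of cell l act on their cell module through the form, which vanishes on the
  radical; the cells of the upper set U are not below l and act as zero on all of \<Delta>
  l.\<close>

lemma rad_cspan_zero:
  assumes "upset U" "upset (insert l U)" "l \<notin> U" "l \<in> \<Lambda>" "y \<in> rad l" "q \<in> cspan (insert l U)"
  shows "act l y q = 0"
proof (rule cspan_induct[OF assms(6)])
  show "subspace {a. act l y a = 0}"
    using assms(4) by (auto simp: subspace_def act_add act_scale fun_eq_iff)
next
  fix m s t assume m: "m \<in> \<Lambda>" "m \<in> insert l U" "s \<in> T m" "t \<in> T m"
  show "act l y (C m s t) = 0"
  proof (cases "m = l")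
    case True
    then show ?thesis using m assms unitv_in[of s l]
      by (auto simp: act_C_same rad_def fun_eq_iff)
  next
    case False
    then have "\<not> m \<le> l" using assms m by (auto simp: upset_def)
    then show ?thesis using act_cspan_zero[OF assms(4) C_in_cspan[of m "{m}" s t]] m by auto
  qed
qed

text \<open>If products of m factors lie in \<open>cspan (insert l U)\<close>, then products of 2 m
  + 1 factors lie in \<open>cspan U\<close>: the rows in cell l of the first m factors are vectors
  of the cell module, the middle factor moves them into the radical, and the product of the last m
  factors, lying in \<open>cspan (insert l U)\<close>, kills the radical.\<close>

lemma heads_ann_product_in_cspan:
  assumes "upset U"
  shows "\<exists>m. \<forall>ns. set ns \<subseteq> heads_ann \<and> length ns = m \<longrightarrow> prod_list ns \<in> cspan U"
  using assms
proof (induction rule: upset_induct)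
  case top
  then show ?case by (auto simp: cspan_Lambda)
next
  case (step U l)
  then obtain m where m: "\<And>ns. set ns \<subseteq> heads_ann \<Longrightarrow> length ns = m \<Longrightarrow> prod_list ns \<in> cspan (insert l U)" by blast
  have "prod_list ns \<in> cspan U" if ns: "set ns \<subseteq> heads_ann" "length ns = m + Suc m" for ns
  proof -
    define p n q where "p = prod_list (take m ns)" and "n = ns ! m" and "q = prod_list (drop (Suc m) ns)"
    have "ns = take m ns @ ns ! m # drop (Suc m) ns" using ns by (intro id_take_nth_drop) auto
    then have "prod_list ns = prod_list (take m ns @ ns ! m # drop (Suc m) ns)" by simp
    then have eq: "prod_list ns = p * n * q"
      unfolding p_def n_def q_def by (simp del: append_take_drop_id add: mult.assoc)
    have p: "p \<in> cspan (insert l U)" unfolding p_def using ns set_take_subset[of m ns] by (intro m) auto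
    have q: "q \<in> cspan (insert l U)" unfolding q_def using ns set_drop_subset[of "Suc m" ns] by (intro m) auto
    have n: "n \<in> heads_ann" unfolding n_def using ns nth_mem[of m ns] by auto
    have pn: "p * n \<in> cspan (insert l U)" using cspan_mult_right[OF step(2) p] .
    show ?thesis unfolding eq
    proof (rule in_cspan_if_rows)
      show "p * n * q \<in> cspan (insert l U)" using cspan_mult_right[OF step(2) pn] .
      fix s assume s: "s \<in> T l"
      have "row l s (p * n) \<in> rad l"
        using row_mult[OF step(1-3) p step(4) s] n step(4) row_in by (auto simp: heads_ann_def head_ann_def)
      then show "row l s (p * n * q) = 0"
        using row_mult[OF step(1-3) pn step(4) s] rad_cspan_zero[OF step(1-4) _ q] by simp
    qed
  qed
  then show ?case by blast
qed

lemma heads_ann_nilpotent: "\<exists>m. \<forall>ns. set ns \<subseteq> heads_ann \<and> length ns = m \<longrightarrow> prod_list ns = 0"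
  using heads_ann_product_in_cspan[of "{}"] by (auto simp: upset_def cspan_empty)

lemma heads_ann_nil: "n \<in> heads_ann \<Longrightarrow> \<exists>m. n ^ m = 0"
proof -
  assume n: "n \<in> heads_ann"
  obtain m where m: "\<And>ns. set ns \<subseteq> heads_ann \<Longrightarrow> length ns = m \<Longrightarrow> prod_list ns = 0"
    using heads_ann_nilpotent by blast
  have "prod_list (replicate m n) = n ^ m" by (induction m) auto
  then show ?thesis using m[of "replicate m n"] n by (metis set_replicate_conv_if length_replicate empty_subsetI insert_subset)
qed

lemma lift_idempotent_heads_ann: "a * a - a \<in> heads_ann \<Longrightarrow> \<exists>e. e * e = e \<and> e - a \<in> heads_ann"
  using lift_idempotent[OF heads_ann_ideal] heads_ann_nil by blast

text \<open>An idempotent g equals its m-th power, which modulo I is (g - x)^m; for suitable m this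
  is 0.\<close>

lemma idem_in_ideal_mod_heads_ann:
  assumes "two_sided_ideal I" "x \<in> I" "g - x \<in> heads_ann" "g * g = g"
  shows "g \<in> I"
proof -
  obtain m where m: "(g - x) ^ m = 0" using heads_ann_nil assms by blast
  then have "m > 0" by (cases m) auto
  have "g ^ m - (g - x) ^ m \<in> I" by (rule two_sided_ideal_power_diff[OF assms(1)]) (simp add: assms)
  then show ?thesis using idem_power[OF assms(4) \<open>m > 0\<close>] m by simp
qed

text \<open>\<open>Z\<close> is a generalised inverse of the Gram matrix.\<close>

lemma ex_gram_inverse:
  assumes l: "l \<in> \<Lambda>"
  shows "\<exists>Z. \<forall>x\<in>\<Delta> l. (\<lambda>v. \<Sum>u\<in>T l. \<Sum>w\<in>T l. cell_form l x (unitv u) * Z u w * unitv w v) - x \<in> rad l"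
proof -
  interpret fs: vector_space_pair "\<lambda>(c::'k) (f::'t \<Rightarrow> 'k) t. c * f t" "\<lambda>(c::'k) (f::'t \<Rightarrow> 'k) t. c * f t"
    by (intro vector_space_pair.intro pointwise_vector_space)
  define f where "f = (\<lambda>(x::'t \<Rightarrow> 'k) u. if u \<in> T l then \<Sum>t\<in>T l. x t * gram l t u else 0)"
  have lin: "Vector_Spaces.linear (\<lambda>(c::'k) (f::'t \<Rightarrow> 'k) t. c * f t) (\<lambda>(c::'k) (f::'t \<Rightarrow> 'k) t. c * f t) f"
    unfolding Vector_Spaces.linear_iff f_def
    by (auto intro: pointwise_vector_space simp: fun_eq_iff sum.distrib algebra_simps sum_distrib_left)
  \<comment> \<open>f is the Gram map. A linear section g over its image exists even if the form is
    degenerate, and f (g (f x)) = f x is all that is asked of a generalised inverse; Z is the matrix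
    of g.\<close>
  obtain g where g: "Vector_Spaces.linear (\<lambda>(c::'k) (f::'t \<Rightarrow> 'k) t. c * f t) (\<lambda>(c::'k) (f::'t \<Rightarrow> 'k) t. c * f t) g"
      "\<forall>v\<in>f ` UNIV. f (g v) = v"
    using fs.linear_exists_right_inverse_on[OF lin fs.vs1.subspace_UNIV] by blast
  have fe: "f x u = cell_form l x (unitv u)" if "u \<in> T l" for x u
    using that l by (simp add: f_def form_unitv_right)
  have "(\<lambda>v. \<Sum>u\<in>T l. \<Sum>w\<in>T l. cell_form l x (unitv u) * g (unitv u) w * unitv w v) - x \<in> rad l" (is "?w - x \<in> _")
    if x: "x \<in> \<Delta> l" for x
  proof -
    have fx: "f x \<in> \<Delta> l" by (auto simp: f_def \<Delta>_def)
    have eq: "f x = (\<Sum>u\<in>T l. (\<lambda>v. f x u * unitv u v))"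
    proof
      fix v
      show "f x v = (\<Sum>u\<in>T l. (\<lambda>v. f x u * unitv u v)) v"
        unfolding sum_fun_apply using fun_cong[OF \<Delta>_expand[OF l fx], of v] by simp
    qed
    have "g (f x) = (\<Sum>u\<in>T l. (\<lambda>v. f x u * g (unitv u) v))"
      using arg_cong[OF eq, of g] unfolding fs.linear_sum[OF g(1)] fs.linear_scale[OF g(1)] .
    then have gfx: "g (f x) v = (\<Sum>u\<in>T l. cell_form l x (unitv u) * g (unitv u) v)" for v
      by (simp add: sum_fun_apply fe)
    have weq: "?w v = (if v \<in> T l then g (f x) v else 0)" for v
    proof -
      have "?w v = (\<Sum>u\<in>T l. cell_form l x (unitv u) * (\<Sum>w\<in>T l. g (unitv u) w * unitv w v))"
        by (simp add: sum_distrib_left mult.assoc)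
      moreover have "(\<Sum>w\<in>T l. h w * unitv w v) = (if v \<in> T l then h v else 0)" for h :: "'t \<Rightarrow> 'k"
      proof -
        have "(\<Sum>w\<in>T l. h w * unitv w v) = (\<Sum>w\<in>T l. if w = v then h v else 0)"
          by (intro sum.cong) (auto simp: unitv_def)
        then show ?thesis using l finite_T by simp
      qed
      ultimately show ?thesis by (simp add: gfx)
    qed
    have "cell_form l ?w (unitv u) = cell_form l x (unitv u)" if u: "u \<in> T l" for u
    proof -
      have "cell_form l ?w (unitv u) = (\<Sum>t\<in>T l. g (f x) t * gram l t u)"
        unfolding form_unitv_right[OF l u] weq by (intro sum.cong) auto
      also have "\<dots> = f (g (f x)) u" using u by (simp add: f_def)
      also have "\<dots> = f x u" using g(2) by auto
      finally show ?thesis using fe[OF u] by simp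
    qed
    then have "cell_form l (?w - x) y = 0" for y
      by (subst form_expand_right[OF l]) (simp add: form_diff_left)
    moreover have "?w - x \<in> \<Delta> l" using x weq by (auto simp: \<Delta>_def)
    ultimately show ?thesis by (auto simp: rad_def)
  qed
  then show ?thesis by (intro exI[of _ "\<lambda>u. g (unitv u)"]) simp
qed

text \<open>The C_uw act as operators of rank one. Weighted with a generalised inverse Z of the Gram
  matrix, their sum acts on the cell module as the identity modulo the radical.\<close>

lemma ex_cell_one:
  assumes l: "l \<in> \<Lambda>"
  shows "\<exists>z\<in>cspan {l}. z - 1 \<in> head_ann l"
proof -
  obtain Z where Z: "\<And>x. x \<in> \<Delta> l \<Longrightarrow> (\<lambda>v. \<Sum>u\<in>T l. \<Sum>w\<in>T l. cell_form l x (unitv u) * Z u w * unitv w v) - x \<in> rad l"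
    using ex_gram_inverse[OF l] by blast
  define z where "z = (\<Sum>u\<in>T l. \<Sum>w\<in>T l. Z u w *s C l u w)"
  have "act l x z = (\<lambda>v. \<Sum>u\<in>T l. \<Sum>w\<in>T l. cell_form l x (unitv u) * Z u w * unitv w v)" for x
    unfolding z_def using l
    by (auto simp: act_sum act_scale act_C_same sum_fun_apply fun_eq_iff algebra_simps intro!: sum.cong)
  then have "z - 1 \<in> head_ann l" using Z l by (auto simp: head_ann_def act_diff)
  moreover have "z \<in> cspan {l}" unfolding z_def using l
    by (intro subspace_sum subspace_scale cspan_subspace C_in_cspan) auto
  ultimately show ?thesis by blast
qed

lemma cspan_single_head_ann: "l \<in> \<Lambda> \<Longrightarrow> m \<in> \<Lambda> \<Longrightarrow> \<not> m \<le> l \<Longrightarrow> z \<in> cspan {m} \<Longrightarrow> z \<in> head_ann l"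
  using act_cspan_zero[of l z "{m}"] by (intro head_ann_0I) auto

text \<open>An element of cell l acting as 1 on the head of l can act nontrivially only on heads of
  cells above l otherwise. These are removed one at a time: for k > l multiply by 1 - z, where z in
  cell k acts as 1 on the head of k. The head of l is unaffected, because z acts as 0 on it.\<close>

lemma ex_separator:
  assumes l: "l \<in> \<Lambda>"
  shows "\<exists>u. u - 1 \<in> head_ann l \<and> (\<forall>m\<in>\<Lambda>. m \<noteq> l \<longrightarrow> u \<in> head_ann m)"
proof -
  have "\<exists>u. u - 1 \<in> head_ann l \<and> (\<forall>m\<in>\<Lambda>. m \<noteq> l \<and> (\<not> l < m \<or> m \<in> F) \<longrightarrow> u \<in> head_ann m)"
    if "finite F" "F \<subseteq> {m \<in> \<Lambda>. l < m}" for F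
    using that
  proof (induction F rule: finite_induct)
    case empty
    obtain z where "z \<in> cspan {l}" "z - 1 \<in> head_ann l" using ex_cell_one[OF l] by blast
    then show ?case using l by (intro exI[of _ z]) (auto intro: cspan_single_head_ann simp: less_le)
  next
    case (insert k F)
    then obtain u where u: "u - 1 \<in> head_ann l" "\<And>m. m \<in> \<Lambda> \<Longrightarrow> m \<noteq> l \<Longrightarrow> (\<not> l < m \<or> m \<in> F) \<Longrightarrow> u \<in> head_ann m" by blast
    have k: "k \<in> \<Lambda>" "l < k" using insert by auto
    obtain z where z: "z \<in> cspan {k}" "z - 1 \<in> head_ann k" using ex_cell_one[OF k(1)] by blast
    have "z \<in> head_ann l" using cspan_single_head_ann[OF l k(1) _ z(1)] k by auto
    then have "(u - 1) - u * z \<in> head_ann l" using u(1) two_sided_idealD(4,6)[OF head_ann_ideal[OF l]] by blast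
    then have "u * (1 - z) - 1 \<in> head_ann l" by (simp add: algebra_simps)
    moreover have "u * (1 - z) \<in> head_ann m" if m: "m \<in> \<Lambda>" "m \<noteq> l" "\<not> l < m \<or> m \<in> insert k F" for m
    proof (cases "m = k")
      case True
      have "- (z - 1) \<in> head_ann k" using two_sided_idealD(5)[OF head_ann_ideal[OF k(1)] z(2)] .
      then show ?thesis using True two_sided_idealD(4)[OF head_ann_ideal[OF k(1)], of "1 - z" u] by simp
    next
      case False
      then show ?thesis using u(2)[of m] m two_sided_idealD(3)[OF head_ann_ideal[OF m(1)]] by blast
    qed
    ultimately show ?case by blast
  qed
  from this[of "{m \<in> \<Lambda>. l < m}"] show ?thesis using finite_Lambda by auto
qed

definition "separator l = (SOME u. u - 1 \<in> head_ann l \<and> (\<forall>m\<in>\<Lambda>. m \<noteq> l \<longrightarrow> u \<in> head_ann m))"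

lemma separator: "l \<in> \<Lambda> \<Longrightarrow> separator l - 1 \<in> head_ann l" "l \<in> \<Lambda> \<Longrightarrow> m \<in> \<Lambda> \<Longrightarrow> m \<noteq> l \<Longrightarrow> separator l \<in> head_ann m"
  using someI_ex[OF ex_separator, of l] unfolding separator_def by auto

text \<open>The Chinese remainder theorem for the annihilators of the heads, solved with the
  separators.\<close>

lemma density: "\<exists>a. \<forall>l\<in>\<Lambda>. a - b l \<in> head_ann l"
proof -
  define a where "a = (\<Sum>m\<in>\<Lambda>. separator m * b m)"
  have "a - b l \<in> head_ann l" if l: "l \<in> \<Lambda>" for l
  proof -
    note I = two_sided_idealD[OF head_ann_ideal[OF l]]
    have "a = separator l * b l + (\<Sum>m\<in>\<Lambda> - {l}. separator m * b m)"
      unfolding a_def using l finite_Lambda by (simp add: sum.remove)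
    then have "a - b l = (separator l - 1) * b l + (\<Sum>m\<in>\<Lambda> - {l}. separator m * b m)" by (simp add: algebra_simps)
    moreover have "(\<Sum>m\<in>\<Lambda> - {l}. separator m * b m) \<in> head_ann l"
      using l separator(2) I(3) by (intro two_sided_ideal_sum[OF head_ann_ideal[OF l]]) auto
    ultimately show ?thesis using I(2) I(3)[OF separator(1)[OF l]] by simp
  qed
  then show ?thesis by blast
qed

text \<open>Rescale x to x0 with <x0, y> = 1. Then b = y \<otimes> x0 acts on \<Delta> l as the
  projection z |-> <z, y> x0 of rank one. Prescribe b at the head of l and 0 at all other heads, and
  lift the result to an idempotent.\<close>

lemma ex_primitive_idem:
  assumes "l \<in> good_cells"
  shows "\<exists>e x0 y0. x0 \<in> \<Delta> l \<and> y0 \<in> \<Delta> l \<and> cell_form l x0 y0 = 1 \<and> e * e = e \<and>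
     e - tens l y0 x0 \<in> head_ann l \<and> (\<forall>m\<in>\<Lambda>. m \<noteq> l \<longrightarrow> e \<in> head_ann m)"
proof -
  have l: "l \<in> \<Lambda>" using assms by (auto simp: good_cells_def)
  note I = two_sided_idealD[OF head_ann_ideal[OF l]]
  obtain x y where xy: "x \<in> \<Delta> l" "y \<in> \<Delta> l" "cell_form l x y \<noteq> 0"
    using assms rad_closed(1)[of l] by (auto simp: good_cells_def rad_def)
  define x0 where "x0 = (\<lambda>t. inverse (cell_form l x y) * x t)"
  have x0: "x0 \<in> \<Delta> l" "cell_form l x0 y = 1"
    using xy unfolding x0_def by (simp_all add: \<Delta>_closed(5) form_scale_left)
  define b where "b = tens l y x0"
  obtain a where a: "\<And>m. m \<in> \<Lambda> \<Longrightarrow> a - (if m = l then b else 0) \<in> head_ann m"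
    using density[of "\<lambda>m. if m = l then b else 0"] by auto
  have al: "a - b \<in> head_ann l" using a[OF l] by simp
  have am: "a \<in> head_ann m" if "m \<in> \<Lambda>" "m \<noteq> l" for m using a[of m] that by simp
  have bb: "act l z (b * b) = act l z b" for z
    unfolding b_def act_mult[OF l] act_tens[OF l x0(1)] using x0(2) by (simp add: form_scale_left)
  have "a * a - a \<in> head_ann m" if m: "m \<in> \<Lambda>" for m
  proof (cases "m = l")
    case True
    have "b * b - b \<in> head_ann l" using bb l by (intro head_ann_0I) (auto simp: act_diff)
    moreover have "a * a - a = (a - b) * a + b * (a - b) + (b * b - b) - (a - b)" by (simp add: algebra_simps)
    ultimately show ?thesis using True al I by metis
  next
    case False
    then have am': "a \<in> head_ann m" using am[OF m] by simp
    show ?thesis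
      by (intro two_sided_idealD(6)[OF head_ann_ideal[OF m]] two_sided_idealD(3)[OF head_ann_ideal[OF m] am'] am')
  qed
  then have "a * a - a \<in> heads_ann" by (auto simp: heads_ann_def)
  then obtain e where e: "e * e = e" "e - a \<in> heads_ann" using lift_idempotent_heads_ann by blast
  have "(e - a) + (a - b) \<in> head_ann l" using I(2)[OF _ al, of "e - a"] e(2) l unfolding heads_ann_def by blast
  moreover have "(e - a) + a \<in> head_ann m" if "m \<in> \<Lambda>" "m \<noteq> l" for m
    using two_sided_idealD(2)[OF head_ann_ideal[OF that(1)] _ am[OF that], of "e - a"] e(2) that
    unfolding heads_ann_def by blast
  ultimately have "e - b \<in> head_ann l" "\<And>m. m \<in> \<Lambda> \<Longrightarrow> m \<noteq> l \<Longrightarrow> e \<in> head_ann m" by simp_all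
  then show ?thesis using x0 xy(2) e(1) unfolding b_def by blast
qed

section \<open>The primitive idempotent of a cell with nonzero form\<close>

definition "prim_data l = (SOME (e, x0, y0). x0 \<in> \<Delta> l \<and> y0 \<in> \<Delta> l \<and> cell_form l x0 y0 = 1 \<and> e * e = e \<and>
     e - tens l y0 x0 \<in> head_ann l \<and> (\<forall>m\<in>\<Lambda>. m \<noteq> l \<longrightarrow> e \<in> head_ann m))"

definition "prim_idem l = fst (prim_data l)"
definition "prim_vec l = fst (snd (prim_data l))"
definition "prim_covec l = snd (snd (prim_data l))"

lemma prim_idem:
  assumes "l \<in> good_cells"
  shows prim_vec_in: "prim_vec l \<in> \<Delta> l" and prim_covec_in: "prim_covec l \<in> \<Delta> l" and prim_vec_covec: "cell_form l (prim_vec l) (prim_covec l) = 1"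
    and prim_idem_idem: "prim_idem l * prim_idem l = prim_idem l" and prim_idem_head_ann: "prim_idem l - tens l (prim_covec l) (prim_vec l) \<in> head_ann l"
    and prim_idem_other: "\<And>m. m \<in> \<Lambda> \<Longrightarrow> m \<noteq> l \<Longrightarrow> prim_idem l \<in> head_ann m"
proof -
  have "case prim_data l of (e, x0, y0) \<Rightarrow> x0 \<in> \<Delta> l \<and> y0 \<in> \<Delta> l \<and> cell_form l x0 y0 = 1 \<and> e * e = e \<and>
     e - tens l y0 x0 \<in> head_ann l \<and> (\<forall>m\<in>\<Lambda>. m \<noteq> l \<longrightarrow> e \<in> head_ann m)"
    unfolding prim_data_def by (rule someI_ex) (use ex_primitive_idem[OF assms] in auto)
  then show "prim_vec l \<in> \<Delta> l" "prim_covec l \<in> \<Delta> l" "cell_form l (prim_vec l) (prim_covec l) = 1" "prim_idem l * prim_idem l = prim_idem l"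
    "prim_idem l - tens l (prim_covec l) (prim_vec l) \<in> head_ann l" "\<And>m. m \<in> \<Lambda> \<Longrightarrow> m \<noteq> l \<Longrightarrow> prim_idem l \<in> head_ann m"
    by (auto simp: prim_idem_def prim_vec_def prim_covec_def split: prod.splits)
qed

lemma good_cells_Lambda: "l \<in> good_cells \<Longrightarrow> l \<in> \<Lambda>" by (simp add: good_cells_def)

lemma prim_vec_prim_idem: "l \<in> good_cells \<Longrightarrow> act l (prim_vec l) (prim_idem l) - prim_vec l \<in> rad l"
proof -
  assume l: "l \<in> good_cells"
  have "act l (prim_vec l) (tens l (prim_covec l) (prim_vec l)) = prim_vec l"
    using prim_idem[OF l] act_tens[OF good_cells_Lambda[OF l], of "prim_vec l"] by simp
  then show ?thesis
    using prim_idem_head_ann[OF l] prim_vec_in[OF l] good_cells_Lambda[OF l] by (auto simp: head_ann_def act_diff)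
qed

lemma prim_vec_notin_rad: "l \<in> good_cells \<Longrightarrow> prim_vec l \<notin> rad l"
  using prim_vec_covec[of l] prim_covec_in[of l] prim_vec_in[of l] by (force simp: rad_def)

lemma prim_idem_notin_head_ann: "l \<in> good_cells \<Longrightarrow> prim_idem l \<notin> head_ann l"
proof
  assume l: "l \<in> good_cells" and "prim_idem l \<in> head_ann l"
  then have "act l (prim_vec l) (prim_idem l) \<in> rad l" using prim_vec_in by (auto simp: head_ann_def)
  then have "act l (prim_vec l) (prim_idem l) - (act l (prim_vec l) (prim_idem l) - prim_vec l) \<in> rad l"
    using rad_closed(4) prim_vec_prim_idem[OF l] by blast
  then show False using prim_vec_notin_rad[OF l] by simp
qed

lemma form_prim_vec_prim_idem: "l \<in> good_cells \<Longrightarrow> cell_form l (act l (prim_vec l) (prim_idem l)) (prim_covec l) = 1"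
proof -
  assume l: "l \<in> good_cells"
  have "cell_form l (act l (prim_vec l) (prim_idem l) - prim_vec l) (prim_covec l) = 0"
    using prim_vec_prim_idem[OF l] prim_covec_in[OF l] by (auto simp: rad_def)
  then show ?thesis using prim_vec_covec[OF l] by (simp add: form_diff_left)
qed

lemma tens_sandwich:
  assumes "l \<in> \<Lambda>" "x \<in> \<Delta> l" "q \<in> \<Delta> l"
  shows "act l z (tens l p x * a * tens l y q) = (\<lambda>t. cell_form l z p * cell_form l (act l x a) y * q t)"
  unfolding act_mult[OF assms(1)] act_tens[OF assms(1,2)] act_tens[OF assms(1,3)] act_scale_left[OF assms(1)]
  by (simp add: form_scale_left mult.assoc)

text \<open>On the head of l the idempotent e is a projection of rank one, and on the other heads it
  is 0; so the corner e A e reduces to the scalars modulo the nilpotent ideal. The scalar is the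
  matrix coefficient of a at \<open>prim_vec l\<close> and \<open>prim_covec l\<close>.\<close>

lemma prim_idem_local:
  assumes l: "l \<in> good_cells"
  shows "\<exists>c. prim_idem l * a * prim_idem l - c *s prim_idem l \<in> heads_ann"
proof -
  have l': "l \<in> \<Lambda>" using good_cells_Lambda[OF l] .
  note I = two_sided_idealD[OF head_ann_ideal[OF l']]
  define b where "b = tens l (prim_covec l) (prim_vec l)"
  define c where "c = cell_form l (act l (prim_vec l) a) (prim_covec l)"
  have eb: "prim_idem l - b \<in> head_ann l" using prim_idem_head_ann[OF l] by (simp add: b_def)
  have bab: "b * a * b - c *s b \<in> head_ann l"
    using l' unfolding b_def
    by (intro head_ann_0I) (simp_all add: act_diff act_scale tens_sandwich act_tens prim_vec_in[OF l] c_def fun_eq_iff)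
  have "prim_idem l * a * prim_idem l - c *s prim_idem l =
     (prim_idem l - b) * a * prim_idem l + b * a * (prim_idem l - b) + (b * a * b - c *s b) - c *s (prim_idem l - b)"
    by (simp add: algebra_simps)
  then have "prim_idem l * a * prim_idem l - c *s prim_idem l \<in> head_ann l"
    using eb bab I head_ann_scale[OF l'] by metis
  moreover have "prim_idem l * a * prim_idem l - c *s prim_idem l \<in> head_ann m" if "m \<in> \<Lambda>" "m \<noteq> l" for m
    using prim_idem_other[OF l that] two_sided_idealD[OF head_ann_ideal[OF that(1)]] head_ann_scale[OF that(1)] by metis
  ultimately show ?thesis by (auto simp: heads_ann_def)
qed

text \<open>Write e, x0, y0 for the idempotent, vector and covector of l. If j in J is nonzero on
  the head of l, then for suitable x and y a multiple of (y0 \<otimes> x) j (y \<otimes> x0) acts on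
  that head like e. Cut by e on both sides, it becomes congruent to e modulo the nilpotent ideal,
  and an idempotent congruent to an element of J lies in J. Applied to annihilators of modules, this
  replaces a discussion of composition factors.\<close>

lemma ideal_dichotomy:
  assumes l: "l \<in> good_cells" and J: "two_sided_ideal J"
  shows "J \<subseteq> head_ann l \<or> prim_idem l \<in> J"
proof (rule disjCI)
  assume "prim_idem l \<notin> J"
  show "J \<subseteq> head_ann l"
  proof (rule ccontr)
    assume "\<not> J \<subseteq> head_ann l"
    then obtain j x where j: "j \<in> J" "x \<in> \<Delta> l" "act l x j \<notin> rad l" by (auto simp: head_ann_def)
    have l': "l \<in> \<Lambda>" using good_cells_Lambda[OF l] .
    note I = two_sided_idealD[OF head_ann_ideal[OF l']]
    obtain y where y: "y \<in> \<Delta> l" "cell_form l (act l x j) y \<noteq> 0"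
      using j act_in[OF l'] by (auto simp: rad_def)
    define b where "b = inverse (cell_form l (act l x j) y) *s (tens l (prim_covec l) x * j * tens l y (prim_vec l))"
    have "tens l (prim_covec l) x * j * tens l y (prim_vec l) \<in> J" using j(1) two_sided_idealD[OF J] by blast
    then have bJ: "b \<in> J" unfolding b_def using two_sided_ideal_subspace[OF J] by (auto simp: subspace_def)
    have "b - tens l (prim_covec l) (prim_vec l) \<in> head_ann l"
      unfolding b_def using l' y
      by (intro head_ann_0I) (simp_all add: act_diff act_scale tens_sandwich act_tens prim_vec_in[OF l] j(2) fun_eq_iff)
    then have "b - tens l (prim_covec l) (prim_vec l) - (prim_idem l - tens l (prim_covec l) (prim_vec l)) \<in> head_ann l"
      by (rule I(6)[OF _ prim_idem_head_ann[OF l]])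
    then have "prim_idem l * (b - prim_idem l) * prim_idem l \<in> head_ann l" using I by simp
    then have "- (prim_idem l * (b - prim_idem l) * prim_idem l) \<in> head_ann l" using I by blast
    moreover have "- (prim_idem l * (b - prim_idem l) * prim_idem l) \<in> head_ann m" if "m \<in> \<Lambda>" "m \<noteq> l" for m
      using prim_idem_other[OF l that] two_sided_idealD[OF head_ann_ideal[OF that(1)]] by metis
    ultimately have "- (prim_idem l * (b - prim_idem l) * prim_idem l) \<in> heads_ann" by (auto simp: heads_ann_def)
    moreover have "- (prim_idem l * (b - prim_idem l) * prim_idem l) = prim_idem l - prim_idem l * b * prim_idem l"
      using prim_idem_idem[OF l] by (simp add: algebra_simps)
    ultimately have "prim_idem l - prim_idem l * b * prim_idem l \<in> heads_ann" by simp
    moreover have "prim_idem l * b * prim_idem l \<in> J" using bJ two_sided_idealD[OF J] by blast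
    ultimately show False using idem_in_ideal_mod_heads_ann[OF J _ _ prim_idem_idem[OF l]] \<open>prim_idem l \<notin> J\<close> by blast
  qed
qed

text \<open>By \<open>form_prim_vec_prim_idem\<close> the inner factor contributes the scalar 1. So
  an ideal that contains \<open>prim_idem l\<close> contains elements acting on \<Delta> l like any
  given tensor.\<close>

lemma tens_prim_idem_tens:
  assumes "l \<in> good_cells" "q \<in> \<Delta> l"
  shows "act l z (tens l p (prim_vec l) * prim_idem l * tens l (prim_covec l) q) = act l z (tens l p q)"
  using assms good_cells_Lambda[OF assms(1)] by (simp add: tens_sandwich prim_vec_in act_tens form_prim_vec_prim_idem)

lemma unitv_tens: "l \<in> \<Lambda> \<Longrightarrow> s \<in> T l \<Longrightarrow> t \<in> T l \<Longrightarrow> tens l (unitv s) (unitv t) = C l s t"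
proof -
  assume a: "l \<in> \<Lambda>" "s \<in> T l" "t \<in> T l"
  have "tens l (unitv s) (unitv t) = (\<Sum>s'\<in>T l. \<Sum>t'\<in>T l. if t' = t then if s' = s then C l s t else 0 else 0)"
    unfolding tens_def by (intro sum.cong refl) (auto simp: unitv_def)
  then show ?thesis using a finite_T by simp
qed

text \<open>The construction of \<open>ex_cell_one\<close>, with each C_uw replaced by a product
  through \<open>prim_idem l\<close>, which acts in the same way on the cell module and lies in
  J.\<close>

lemma ideal_one:
  assumes l: "l \<in> good_cells" and J: "two_sided_ideal J" "prim_idem l \<in> J"
  shows "\<exists>y\<in>J. y - 1 \<in> head_ann l"
proof -
  have l': "l \<in> \<Lambda>" using good_cells_Lambda[OF l] .
  obtain Z where Z: "\<And>x. x \<in> \<Delta> l \<Longrightarrow> (\<lambda>v. \<Sum>u\<in>T l. \<Sum>w\<in>T l. cell_form l x (unitv u) * Z u w * unitv w v) - x \<in> rad l"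
    using ex_gram_inverse[OF l'] by blast
  define y where "y = (\<Sum>u\<in>T l. \<Sum>w\<in>T l. Z u w *s (tens l (unitv u) (prim_vec l) * prim_idem l * tens l (prim_covec l) (unitv w)))"
  have "act l x y = (\<lambda>v. \<Sum>u\<in>T l. \<Sum>w\<in>T l. cell_form l x (unitv u) * Z u w * unitv w v)" for x
  proof -
    have "act l x (tens l (unitv u) (prim_vec l) * prim_idem l * tens l (prim_covec l) (unitv w))
      = (\<lambda>v. cell_form l x (unitv u) * unitv w v)" if "w \<in> T l" for u w
      using tens_prim_idem_tens[OF l unitv_in[OF that], of x "unitv u"] act_tens[OF l' unitv_in[OF that]] by simp
    then show ?thesis
      unfolding y_def using l'
      by (auto simp: act_sum act_scale sum_fun_apply fun_eq_iff algebra_simps intro!: sum.cong)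
  qed
  then have "y - 1 \<in> head_ann l" using Z l' by (auto simp: head_ann_def act_diff)
  moreover have "y \<in> J"
    unfolding y_def using J two_sided_idealD(3,4)[OF J(1)]
    by (intro subspace_sum subspace_scale two_sided_ideal_subspace[OF J(1)]) auto
  ultimately show ?thesis by blast
qed

text \<open>At each head where j is nonzero, I contains an element y acting as 1, so y j is in I and
  agrees with j there. The separators glue these local solutions.\<close>

lemma in_ideal_mod_heads_ann:
  assumes I: "two_sided_ideal I" and j: "\<And>l. l \<in> \<Lambda> \<Longrightarrow> j \<in> head_ann l \<or> (l \<in> good_cells \<and> prim_idem l \<in> I)"
  shows "\<exists>x\<in>I. j - x \<in> heads_ann"
proof -
  have "\<exists>y\<in>I. l \<in> \<Lambda> \<longrightarrow> j - y \<in> head_ann l" for l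
  proof (cases "l \<in> \<Lambda> \<and> j \<notin> head_ann l")
    case True
    then obtain y where y: "y \<in> I" "y - 1 \<in> head_ann l" using ideal_one[OF _ I] j by blast
    have "- ((y - 1) * j) \<in> head_ann l" using two_sided_idealD[OF head_ann_ideal, of l] y(2) True by blast
    then show ?thesis using y(1) two_sided_idealD(3)[OF I] by (intro bexI[of _ "y * j"]) (auto simp: algebra_simps)
  qed (use two_sided_idealD(1)[OF I] in \<open>auto intro!: bexI[of _ 0]\<close>)
  then obtain y where y: "\<And>l. y l \<in> I" "\<And>l. l \<in> \<Lambda> \<Longrightarrow> j - y l \<in> head_ann l" by metis
  define x where "x = (\<Sum>m\<in>\<Lambda>. separator m * y m)"
  have xI: "x \<in> I" unfolding x_def using y(1) two_sided_idealD(4)[OF I] by (intro two_sided_ideal_sum[OF I]) auto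
  have "j - x \<in> head_ann l" if l: "l \<in> \<Lambda>" for l
  proof -
    note R = two_sided_idealD[OF head_ann_ideal[OF l]]
    have "x = separator l * y l + (\<Sum>m\<in>\<Lambda> - {l}. separator m * y m)"
      unfolding x_def using l finite_Lambda by (simp add: sum.remove)
    then have "j - x = (j - y l) - (separator l - 1) * y l - (\<Sum>m\<in>\<Lambda> - {l}. separator m * y m)" by (simp add: algebra_simps)
    moreover have "(\<Sum>m\<in>\<Lambda> - {l}. separator m * y m) \<in> head_ann l"
      using l separator(2) R(3) by (intro two_sided_ideal_sum[OF head_ann_ideal[OF l]]) auto
    ultimately show ?thesis by (metis R(3) R(6) separator(1)[OF l] y(2)[OF l])
  qed
  then show ?thesis using xI by (auto simp: heads_ann_def)
qed

lemma idem_in_ideal: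
  assumes "two_sided_ideal I" "g * g = g" "\<And>l. l \<in> \<Lambda> \<Longrightarrow> g \<in> head_ann l \<or> (l \<in> good_cells \<and> prim_idem l \<in> I)"
  shows "g \<in> I"
  using in_ideal_mod_heads_ann[OF assms(1,3)] idem_in_ideal_mod_heads_ann[OF assms(1) _ _ assms(2)] by blast

end

section \<open>Quasi-hereditary cellular algebras\<close>

lemma (in module) span_family:
  assumes "finite P" "x \<in> span (w ` P)"
  shows "\<exists>c. x = (\<Sum>p\<in>P. c p *s w p)"
  using assms(2)
proof (rule span_induct)
  show "subspace {x. \<exists>c. x = (\<Sum>p\<in>P. c p *s w p)}"
    unfolding subspace_def
  proof safe
    show "\<exists>c. 0 = (\<Sum>p\<in>P. c p *s w p)" by (intro exI[of _ "\<lambda>_. 0"]) simp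
  next
    fix c d
    show "\<exists>e. (\<Sum>p\<in>P. c p *s w p) + (\<Sum>p\<in>P. d p *s w p) = (\<Sum>p\<in>P. e p *s w p)"
      by (intro exI[of _ "\<lambda>p. c p + d p"]) (simp add: scale_left_distrib sum.distrib)
  next
    fix r c
    show "\<exists>e. r *s (\<Sum>p\<in>P. c p *s w p) = (\<Sum>p\<in>P. e p *s w p)"
      by (intro exI[of _ "\<lambda>p. r * c p"]) (simp add: scale_sum_right)
  qed
next
  fix x assume "x \<in> w ` P"
  then obtain p where p: "p \<in> P" "x = w p" by blast
  have "x = (\<Sum>q\<in>P. if q = p then w p else 0)" using p assms(1) by simp
  also have "\<dots> = (\<Sum>q\<in>P. (if q = p then 1 else 0) *s w q)" by (intro sum.cong) auto
  finally show "\<exists>c. x = (\<Sum>p\<in>P. c p *s w p)" by (intro exI[of _ "\<lambda>q. if q = p then 1 else 0"])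
qed

text \<open>Independence is a property of sets and does not see repeated members of a family; the
  hypothesis on coefficients excludes repetitions as well.\<close>

lemma (in vector_space) independent_family:
  assumes P: "finite P" and ind: "\<And>c p. (\<Sum>p\<in>P. c p *s w p) = 0 \<Longrightarrow> p \<in> P \<Longrightarrow> c p = 0"
  shows "inj_on w P" "independent (w ` P)"
proof -
  show inj: "inj_on w P"
  proof (rule inj_onI, rule ccontr)
    fix p q assume pq: "p \<in> P" "q \<in> P" "w p = w q" "p \<noteq> q"
    define c where "c = (\<lambda>r. if r = p then 1 else if r = q then - 1 else (0::'a))"
    have "(\<Sum>r\<in>P. c r *s w r) = (\<Sum>r\<in>P. (if r = p then w p else 0) - (if r = q then w p else 0))"
      unfolding c_def using pq by (intro sum.cong) auto
    also have "\<dots> = 0" using pq P by (simp add: sum_subtractf)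
    finally show False using ind[of c p] pq by (simp add: c_def)
  qed
  show "independent (w ` P)"
  proof (rule independent_if_scalars_zero)
    fix f x assume "(\<Sum>x\<in>w ` P. f x *s x) = 0" "x \<in> w ` P"
    then show "f x = 0" using ind[of "f \<circ> w"] inj by (auto simp: sum.reindex)
  qed (use P in simp)
qed

context finite_dimensional_vector_space
begin

lemma dim_family:
  assumes "finite P" "\<And>c p. (\<Sum>p\<in>P. c p *s w p) = 0 \<Longrightarrow> p \<in> P \<Longrightarrow> c p = 0"
  shows "dim (span (w ` P)) = card P"
proof -
  have "inj_on w P" "independent (w ` P)" by (rule independent_family; use assms in blast)+
  then show ?thesis by (simp add: dim_eq_card_independent card_image)
qed

lemma dim_span_Un_le: "finite F \<Longrightarrow> dim (span (V \<union> F)) \<le> dim V + card F"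
proof -
  assume F: "finite F"
  obtain B where B: "B \<subseteq> V" "independent B" "V \<subseteq> span B" "card B = dim V" using basis_exists by blast
  have "V \<union> F \<subseteq> span (B \<union> F)"
    using B(3) span_mono[of B "B \<union> F"] span_superset[of "B \<union> F"] by auto
  then have "dim (span (V \<union> F)) \<le> card (B \<union> F)"
    using F finiteI_independent[OF B(2)] by (intro dim_le_card) (auto simp: span_minimal)
  also have "\<dots> \<le> dim V + card F" using card_Un_le[of B F] B(4) by simp
  finally show ?thesis .
qed

lemma complementary_family:
  assumes "V0 \<subseteq> V"
  shows "\<exists>P\<subseteq>V. finite P \<and> card P = dim V - dim V0 \<and> V \<subseteq> span (V0 \<union> P)"
proof -
  obtain B0 where B0: "B0 \<subseteq> V0" "independent B0" "V0 \<subseteq> span B0" "card B0 = dim V0" using basis_exists by blast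
  obtain B where B: "B0 \<subseteq> B" "B \<subseteq> V" "independent B" "V \<subseteq> span B"
    using maximal_independent_subset_extend[of B0 V] B0 assms by blast
  have fin: "finite B" using finiteI_independent[OF B(3)] .
  have "card (B - B0) = dim V - dim V0"
    using B B0 fin basis_card_eq_dim[OF B(2,4,3)] by (simp add: card_Diff_subset finite_subset)
  moreover have "V \<subseteq> span (V0 \<union> (B - B0))"
    using B(4) B0(1) span_mono[of B "V0 \<union> (B - B0)"] by auto
  ultimately show ?thesis using B(2) fin by (intro exI[of _ "B - B0"]) auto
qed

end

context field_cell_datum
begin

section \<open>Corner spaces f V g and their dimensions along the cell filtration\<close>

sublocale fd: finite_dimensional_vector_space scale cbasis
proof -
  have "vector_space scale" using module_iff_vector_space module_axioms by blast
  then interpret v: vector_space scale .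
  show "finite_dimensional_vector_space scale cbasis"
    using finite_cbasis cbasis_indep cbasis_span
    by (simp add: finite_dimensional_vector_space_def finite_dimensional_vector_space_axioms_def v.vector_space_axioms)
qed

interpretation fs: vector_space "\<lambda>(c::'k) (f::'t \<Rightarrow> 'k) t. c * f t"
  by (rule pointwise_vector_space)

definition corner :: "'a \<Rightarrow> 'a \<Rightarrow> 'a set \<Rightarrow> 'a set" where
  "corner f g V = (\<lambda>v. f * v * g) ` V"

definition "cdim l g = fs.dim ((\<lambda>x. act l x g) ` \<Delta> l)"

lemma corner_subspace: "subspace V \<Longrightarrow> subspace (corner f g V)"
proof -
  assume V: "subspace V"
  show ?thesis unfolding corner_def subspace_def
  proof safe
    show "0 \<in> (\<lambda>v. f * v * g) ` V" using subspace_0[OF V] by (auto intro!: image_eqI[of _ _ 0])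
  next
    fix x y assume "x \<in> V" "y \<in> V"
    then show "f * x * g + f * y * g \<in> (\<lambda>v. f * v * g) ` V"
      using subspace_add[OF V] by (auto intro!: image_eqI[of _ _ "x + y"] simp: algebra_simps)
  next
    fix c x assume "x \<in> V"
    then show "c *s (f * x * g) \<in> (\<lambda>v. f * v * g) ` V"
      using subspace_scale[OF V] by (auto intro!: image_eqI[of _ _ "c *s x"] simp: scale_mult_left scale_mult_right)
  qed
qed

lemma corner_ideal: "two_sided_ideal V \<Longrightarrow> corner f g V \<subseteq> V"
  by (auto simp: corner_def intro: two_sided_idealD(3,4))

lemma corner_fixed:
  assumes "f * f = f" "g * g = g" "x \<in> corner f g V"
  shows "f * x * g = x"
proof -
  obtain v where v: "x = f * v * g" using assms by (auto simp: corner_def)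
  have "f * (f * v * g) * g = (f * f) * v * (g * g)" by (simp only: mult.assoc)
  then show ?thesis using assms v by simp
qed

lemma cell_finite_basis:
  assumes "l \<in> \<Lambda>" "V \<subseteq> \<Delta> l"
  shows "\<exists>B\<subseteq>V. finite B \<and> fs.independent B \<and> V \<subseteq> fs.span B \<and> card B = fs.dim V"
proof -
  obtain B where B: "B \<subseteq> V" "fs.independent B" "V \<subseteq> fs.span B" "card B = fs.dim V"
    using fs.basis_exists by blast
  have "x \<in> fs.span (unitv ` T l)" if "x \<in> \<Delta> l" for x
  proof -
    have "x = (\<Sum>t\<in>T l. (\<lambda>v. x t * unitv t v))"
          proof
      fix v
      show "x v = (\<Sum>t\<in>T l. (\<lambda>v. x t * unitv t v)) v"
        unfolding sum_fun_apply using fun_cong[OF \<Delta>_expand[OF assms(1) that], of v] by simp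
    qed
    moreover have "(\<Sum>t\<in>T l. (\<lambda>v. x t * unitv t v)) \<in> fs.span (unitv ` T l)"
      by (intro fs.span_sum fs.span_scale fs.span_base) auto
    ultimately show ?thesis by simp
  qed
  then have "B \<subseteq> fs.span (unitv ` T l)" using B(1) assms(2) by blast
  then have "finite B" using fs.independent_span_bound[OF _ B(2)] finite_T[OF assms(1)] by blast
  then show ?thesis using B by blast
qed

lemma cdim_eq_0: "l \<in> \<Lambda> \<Longrightarrow> cdim l g = 0 \<longleftrightarrow> (\<forall>x\<in>\<Delta> l. act l x g = 0)"
proof
  assume l: "l \<in> \<Lambda>"
  let ?V = "(\<lambda>x. act l x g) ` \<Delta> l"
  assume "cdim l g = 0"
  moreover obtain B where "B \<subseteq> ?V" "finite B" "?V \<subseteq> fs.span B" "card B = fs.dim ?V"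
    using cell_finite_basis[OF l, of ?V] act_in[OF l] by blast
  ultimately have "?V \<subseteq> fs.span {}" by (auto simp: cdim_def)
  then show "\<forall>x\<in>\<Delta> l. act l x g = 0" by auto
next
  assume "\<forall>x\<in>\<Delta> l. act l x g = 0"
  then have "(\<lambda>x. act l x g) ` \<Delta> l \<subseteq> fs.span {}" by auto
  then show "cdim l g = 0" unfolding cdim_def using fs.dim_le_card[of _ "{}"] by force
qed

text \<open>Modulo \<open>cspan U\<close> the layer of l is a bimodule: the algebra acts from the
  right on the second factor of a tensor and, as \<open>tens_mult_left\<close> shows, from the left
  on the first factor through the involution.\<close>

lemma tens_mult_right:
  assumes "upset U" "upset (insert l U)" "l \<notin> U" "l \<in> \<Lambda>" "y \<in> \<Delta> l"
  shows "tens l x y * a - tens l x (act l y a) \<in> cspan U"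
proof (rule in_cspan_if_rows)
  have t: "tens l x y \<in> cspan (insert l U)" by (rule tens_in[OF assms(4)]) simp
  have "tens l x (act l y a) \<in> cspan (insert l U)" by (rule tens_in[OF assms(4)]) simp
  then show "tens l x y * a - tens l x (act l y a) \<in> cspan (insert l U)"
    using cspan_mult_right[OF assms(2) t] cspan_subspace subspace_diff by blast
  fix s assume s: "s \<in> T l"
  show "row l s (tens l x y * a - tens l x (act l y a)) = 0"
    unfolding row_linear row_mult[OF assms(1-3) t assms(4) s] row_tens[OF assms(4) s assms(5)]
      row_tens[OF assms(4) s act_in[OF assms(4)]] act_scale_left[OF assms(4)] by simp
qed

lemma tens_mult_left:
  assumes "upset U" "upset (insert l U)" "l \<notin> U" "l \<in> \<Lambda>" "x \<in> \<Delta> l"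
  shows "a * tens l x y - tens l (act l x (cstar a)) y \<in> cspan U"
proof -
  have "cstar (tens l y x * cstar a - tens l y (act l x (cstar a))) \<in> cspan U"
    by (intro cstar_cspan tens_mult_right[OF assms])
  then show ?thesis by (simp add: cstar_diff cstar_mult cstar_tens[OF assms(4)])
qed

lemma tens_linear:
  "tens l (x + x') y = tens l x y + tens l x' y" "tens l x (y + y') = tens l x y + tens l x y'"
  "tens l (\<lambda>t. c * x t) y = c *s tens l x y" "tens l x (\<lambda>t. c * y t) = c *s tens l x y"
  "tens l 0 y = 0" "tens l x 0 = 0"
  unfolding tens_def
  by (simp_all add: algebra_simps scale_left_distrib sum.distrib scale_sum_right)

lemma tens_sandwich_cspan:
  assumes "upset U" "upset (insert l U)" "l \<notin> U" "l \<in> \<Lambda>" "x \<in> \<Delta> l" "q \<in> \<Delta> l"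
  shows "tens l p x * a * tens l y q - cell_form l (act l x a) y *s tens l p q \<in> cspan U"
proof -
  have 1: "(tens l p x * a - tens l p (act l x a)) * tens l y q \<in> cspan U"
    by (intro cspan_mult_right tens_mult_right assms)
  have "tens l p (act l x a) * tens l y q - tens l p (act l (act l x a) (tens l y q)) \<in> cspan U"
    by (intro tens_mult_right assms act_in)
  then have 2: "tens l p (act l x a) * tens l y q - cell_form l (act l x a) y *s tens l p q \<in> cspan U"
    unfolding act_tens[OF assms(4,6)] tens_linear .
  show ?thesis using subspace_add[OF cspan_subspace 1 2] by (simp add: algebra_simps)
qed

lemma corner_tens:
  assumes "upset U" "upset (insert l U)" "l \<notin> U" "l \<in> \<Lambda>" "x \<in> \<Delta> l" "y \<in> \<Delta> l"
  shows "f * tens l x y * g - tens l (act l x (cstar f)) (act l y g) \<in> cspan U"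
proof -
  have 1: "(f * tens l x y - tens l (act l x (cstar f)) y) * g \<in> cspan U"
    by (intro cspan_mult_right tens_mult_left assms)
  have 2: "tens l (act l x (cstar f)) y * g - tens l (act l x (cstar f)) (act l y g) \<in> cspan U"
    by (intro tens_mult_right assms)
  show ?thesis using subspace_add[OF cspan_subspace 1 2] by (simp add: algebra_simps)
qed

text \<open>The layer of l is the tensor square of \<Delta> l, and f and g cut it down to the tensor
  product of \<Delta> l \<open>cstar f\<close> and \<Delta> l g. Bases of these two spaces yield a
  family that together with the corner of \<open>cspan U\<close> spans the new corner and is
  independent modulo \<open>cspan U\<close>.\<close>

lemma dim_corner_step:
  assumes f: "f * f = f" and g: "g * g = g"
    and U: "upset U" "upset (insert l U)" "l \<notin> U" "l \<in> \<Lambda>"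
  shows "fd.dim (corner f g (cspan (insert l U))) = fd.dim (corner f g (cspan U)) + cdim l (cstar f) * cdim l g"
proof -
  note l = U(4)
  define X where "X = (\<lambda>x. act l x (cstar f)) ` \<Delta> l"
  define Y where "Y = (\<lambda>x. act l x g) ` \<Delta> l"
  have ff: "cstar f * cstar f = cstar f" using f by (metis cstar_mult)
  have Xd: "X \<subseteq> \<Delta> l" and Yd: "Y \<subseteq> \<Delta> l" unfolding X_def Y_def using act_in[OF l] by auto
  have Xf: "act l x (cstar f) = x" if "x \<in> X" for x
    using that unfolding X_def by (auto simp: act_mult[OF l, symmetric] ff)
  have Yf: "act l y g = y" if "y \<in> Y" for y
    using that unfolding Y_def by (auto simp: act_mult[OF l, symmetric] g)
  obtain BX where BX: "BX \<subseteq> X" "finite BX" "fs.independent BX" "X \<subseteq> fs.span BX" "card BX = fs.dim X"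
    using cell_finite_basis[OF l Xd] by blast
  obtain BY where BY: "BY \<subseteq> Y" "finite BY" "fs.independent BY" "Y \<subseteq> fs.span BY" "card BY = fs.dim Y"
    using cell_finite_basis[OF l Yd] by blast
  define P where "P = BX \<times> BY"
  have finP: "finite P" unfolding P_def using BX BY by simp
  define w where "w = (\<lambda>(x, y). f * tens l x y * g)"
  \<comment> \<open>x is fixed by \<open>cstar f\<close> and y by g, so cutting their tensor by f
    and g changes nothing modulo \<open>cspan U\<close>.\<close>
  have wt: "w (x, y) - tens l x y \<in> cspan U" if "x \<in> X" "y \<in> Y" for x y
    using corner_tens[OF U, of x y f g] that Xd Yd by (auto simp: w_def Xf Yf)
  define W0 where "W0 = corner f g (cspan U)"
  define W where "W = corner f g (cspan (insert l U))"
  have W0s: "subspace W0" unfolding W0_def by (intro corner_subspace cspan_subspace)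
  have W0c: "W0 \<subseteq> cspan U" unfolding W0_def using corner_ideal cspan_ideal U by blast
  have W0I: "x \<in> W0" if "x \<in> cspan U" "f * x * g = x" for x
    unfolding W0_def corner_def using that by (metis image_eqI)
  define S where "S = {x + y | x y. x \<in> W0 \<and> y \<in> span (w ` P)}"
  have Ss: "subspace S" unfolding S_def by (intro fd.subspace_sums W0s subspace_span)
  have W0S: "W0 \<subseteq> S" unfolding S_def using span_zero by force
  have PS: "span (w ` P) \<subseteq> S" unfolding S_def using subspace_0[OF W0s] by force
  have wS: "f * tens l x y * g \<in> span (w ` P)" if x: "x \<in> fs.span BX" and y: "y \<in> fs.span BY" for x y
  proof -
    have base: "f * tens l x y * g \<in> span (w ` P)" if x: "x \<in> BX" for x
      using y
    proof (rule fs.span_induct)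
      show "fs.subspace {y. f * tens l x y * g \<in> span (w ` P)}"
        unfolding fs.subspace_def
        by (simp add: tens_linear distrib_left distrib_right scale_mult_left scale_mult_right
            span_zero span_add span_scale)
    qed (use x in \<open>auto simp: w_def P_def intro!: span_base\<close>)
    show ?thesis using x
    proof (rule fs.span_induct)
      show "fs.subspace {x. f * tens l x y * g \<in> span (w ` P)}"
        unfolding fs.subspace_def
        by (simp add: tens_linear distrib_left distrib_right scale_mult_left scale_mult_right
            span_zero span_add span_scale)
    qed (rule base)
  qed
  have WS: "W = S"
  proof
    show "W \<subseteq> S"
    proof
      fix z assume "z \<in> W"
      then obtain p where p: "p \<in> cspan (insert l U)" "z = f * p * g" by (auto simp: W_def corner_def)
      have "f * p * g \<in> S"
      proof (rule cspan_induct[OF p(1)])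
        show "subspace {p. f * p * g \<in> S}"
          using Ss by (auto simp: subspace_def algebra_simps scale_mult_left scale_mult_right)
      next
        fix m s t assume m: "m \<in> \<Lambda>" "m \<in> insert l U" "s \<in> T m" "t \<in> T m"
        show "f * C m s t * g \<in> S"
        proof (cases "m = l")
          case False
          then have "C m s t \<in> cspan U" using m by (intro C_in_cspan) auto
          then show ?thesis using W0S unfolding W0_def corner_def by blast
        next
          case True
          define x y where "x = act l (unitv s) (cstar f)" and "y = act l (unitv t) g"
          have x: "x \<in> X" and y: "y \<in> Y" unfolding x_def y_def X_def Y_def using m True unitv_in by auto
          have "f * tens l (unitv s) (unitv t) * g - tens l x y \<in> cspan U"
            unfolding x_def y_def using m True by (intro corner_tens[OF U] unitv_in) auto
          then have d: "f * C l s t * g - tens l x y \<in> cspan U" using m True unitv_tens[of l] by simp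
          have "f * (f * C l s t * g - tens l x y) * g \<in> W0" unfolding W0_def corner_def using d by blast
          moreover have "f * (f * C l s t * g - tens l x y) * g = (f * f) * C l s t * (g * g) - f * tens l x y * g"
            by (simp add: algebra_simps)
          ultimately have "f * C l s t * g - f * tens l x y * g \<in> S" using W0S f g by auto
          moreover have "f * tens l x y * g \<in> S" using wS[of x y] x y BX BY PS by blast
          ultimately show ?thesis using True subspace_add[OF Ss] by fastforce
        qed
      qed
      then show "z \<in> S" using p by simp
    qed
  next
    have Ws: "subspace W" unfolding W_def by (intro corner_subspace cspan_subspace)
    have "w ` P \<subseteq> W" unfolding W_def corner_def w_def P_def using tens_in[OF l, of "insert l U"] by auto
    then have "span (w ` P) \<subseteq> W" using Ws by (rule span_minimal)
    moreover have "W0 \<subseteq> W" unfolding W_def W0_def corner_def using cspan_mono[of U "insert l U"] by auto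
    ultimately show "S \<subseteq> W" unfolding S_def using subspace_add[OF Ws] by blast
  qed
  \<comment> \<open>Independence is proved modulo \<open>cspan U\<close>, where the family consists
    of plain tensors. This gives both the dimension of its span and the trivial intersection with
    W0.\<close>
  have ind: "c p = 0" if c: "(\<Sum>p\<in>P. c p *s w p) \<in> cspan U" and p: "p \<in> P" for c p
  proof -
    have "(\<Sum>p\<in>P. c p *s (w p - tens l (fst p) (snd p))) \<in> cspan U"
      using BX(1) BY(1) by (intro subspace_sum subspace_scale cspan_subspace) (auto simp: P_def intro!: wt)
    then have "(\<Sum>p\<in>P. c p *s w p) - (\<Sum>p\<in>P. c p *s tens l (fst p) (snd p)) \<in> cspan U"
      by (simp add: scale_right_diff_distrib sum_subtractf)
    then have "(\<Sum>p\<in>P. c p *s tens l (fst p) (snd p)) \<in> cspan U"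
      using subspace_diff[OF cspan_subspace c] by force
    then have "cf l s t (\<Sum>p\<in>P. c p *s tens l (fst p) (snd p)) = 0" if "s \<in> T l" "t \<in> T l" for s t
      using that l U(3) unfolding cspan_iff by blast
    then have z: "(\<Sum>p\<in>P. c p * (fst p s * snd p t)) = 0" if "s \<in> T l" "t \<in> T l" for s t
      using that l by (simp add: cf_sum cf_scale cf_tens)
    have z2: "(\<Sum>y\<in>BY. (\<Sum>x\<in>BX. c (x, y) * x s) * y t) = 0" for s t
    proof (cases "s \<in> T l \<and> t \<in> T l")
      case True
      have "(\<Sum>p\<in>P. c p * (fst p s * snd p t)) = (\<Sum>x\<in>BX. \<Sum>y\<in>BY. c (x, y) * (x s * y t))"
        unfolding P_def by (simp add: sum.cartesian_product case_prod_beta)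
      also have "\<dots> = (\<Sum>y\<in>BY. \<Sum>x\<in>BX. c (x, y) * (x s * y t))" by (rule sum.swap)
      finally show ?thesis using z True by (simp add: sum_distrib_right mult.assoc)
    next
      case False
      have "x \<in> \<Delta> l" if "x \<in> BX \<or> x \<in> BY" for x using that BX(1) BY(1) Xd Yd by auto
      then have "(\<Sum>x\<in>BX. c (x, y) * x s) * y t = 0" if "y \<in> BY" for y
        using False that by (auto simp: \<Delta>_def intro!: sum.neutral)
      then show ?thesis by (rule sum.neutral[OF ballI])
    qed
    \<comment> \<open>A vanishing combination of tensors of two independent families: coefficients
      are compared over BY here and over BX next.\<close>
    have z3: "(\<Sum>x\<in>BX. c (x, y) * x s) = 0" if "y \<in> BY" for y s
      using fs.independentD[OF BY(3,2) subset_refl, of "\<lambda>y. \<Sum>x\<in>BX. c (x, y) * x s" y] that z2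
      by (auto simp: fun_eq_iff sum_fun_apply)
    have "c (x, y) = 0" if "x \<in> BX" "y \<in> BY" for x y
      using fs.independentD[OF BX(3,2) subset_refl, of "\<lambda>x. c (x, y)" x] that z3
      by (auto simp: fun_eq_iff sum_fun_apply)
    then show ?thesis using p by (auto simp: P_def)
  qed
  have "W0 \<inter> span (w ` P) = {0}"
  proof -
    have "x = 0" if x: "x \<in> W0" "x \<in> span (w ` P)" for x
    proof -
      obtain c where c: "x = (\<Sum>p\<in>P. c p *s w p)" using span_family[OF finP x(2)] by blast
      then have "c p = 0" if "p \<in> P" for p using ind[of c p] x(1) W0c that by auto
      then show "x = 0" using c by simp
    qed
    then show ?thesis using subspace_0[OF W0s] span_zero by blast
  qed
  moreover have "fd.dim (span (w ` P)) = card P"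
    using ind subspace_0[OF cspan_subspace] by (intro fd.dim_family[OF finP]) auto
  moreover have "fd.dim S + fd.dim (W0 \<inter> span (w ` P)) = fd.dim W0 + fd.dim (span (w ` P))"
    unfolding S_def by (intro fd.dim_sums_Int W0s subspace_span)
  moreover have "card P = cdim l (cstar f) * cdim l g"
    unfolding P_def card_cartesian_product BX(5) BY(5) cdim_def X_def Y_def ..
  ultimately show ?thesis unfolding W_def[symmetric] W0_def[symmetric] WS by simp
qed

lemma dim_corner_cspan:
  assumes f: "f * f = f" and g: "g * g = g" and U: "upset U"
  shows "fd.dim (corner f g (cspan U)) = (\<Sum>l\<in>U. cdim l (cstar f) * cdim l g)"
  using U
proof (induction rule: upset_induct_bottom)
  case empty
  then show ?case by (simp add: cspan_empty corner_def)
next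
  case (step U l)
  have "finite U" using step(1) finite_Lambda finite_subset by (auto simp: upset_def)
  then show ?case using dim_corner_step[OF f g step(1-4)] step(3,5) by simp
qed

lemma upset_Lambda: "upset \<Lambda>" by (simp add: upset_def)

lemma dim_corner_UNIV:
  assumes f: "f * f = f" and g: "g * g = g"
  shows "fd.dim (corner f g UNIV) = (\<Sum>l\<in>\<Lambda>. cdim l (cstar f) * cdim l g)"
  using dim_corner_cspan[OF f g upset_Lambda] by (simp add: cspan_Lambda)

text \<open>Modulo \<open>cspan U\<close>, C_st is the product of C_s \<otimes>
  \<open>prim_vec l\<close>, \<open>prim_idem l\<close> and \<open>prim_covec l\<close> \<otimes>
  C_t, because the scalar produced in the middle is 1. Hence J covers the whole layer of l.\<close>

lemma cspan_in_ideal: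
  assumes U: "upset U" "upset (insert l U)" "l \<notin> U" "l \<in> \<Lambda>"
    and J: "two_sided_ideal J" "l \<in> good_cells" "prim_idem l \<in> J" and x: "x \<in> cspan (insert l U)"
  shows "\<exists>j\<in>J \<inter> cspan (insert l U). x - j \<in> cspan U"
proof -
  have Js: "subspace J" using two_sided_ideal_subspace[OF J(1)] .
  have s: "subspace {y + z | y z. y \<in> J \<inter> cspan (insert l U) \<and> z \<in> cspan U}" (is "subspace ?S")
    by (intro fd.subspace_sums subspace_inter Js cspan_subspace)
  have "x \<in> ?S"
  proof (rule cspan_induct[OF x])
    fix m s t assume m: "m \<in> \<Lambda>" "m \<in> insert l U" "s \<in> T m" "t \<in> T m"
    show "C m s t \<in> ?S"
    proof (cases "m = l")
      case False
      then have "0 + C m s t \<in> ?S" using m C_in_cspan[of m U s t] Js subspace_0[OF Js] subspace_0[OF cspan_subspace] by blast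
      then show ?thesis by simp
    next
      case True
      define j where "j = tens l (unitv s) (prim_vec l) * prim_idem l * tens l (prim_covec l) (unitv t)"
      have "j \<in> J" unfolding j_def using two_sided_idealD[OF J(1)] J(3) by blast
      moreover have jc: "j \<in> cspan (insert l U)" unfolding j_def
        by (intro cspan_mult_right cspan_mult_left U tens_in) auto
      moreover have "j - C l s t \<in> cspan U"
        using tens_sandwich_cspan[OF U prim_vec_in[OF J(2)] unitv_in[of t l], of "unitv s" "prim_idem l" "prim_covec l"] m True
        by (simp add: j_def form_prim_vec_prim_idem[OF J(2)] unitv_tens)
      then have "C l s t - j \<in> cspan U" using subspace_neg[OF cspan_subspace] by fastforce
      ultimately have "j + (C l s t - j) \<in> ?S" by blast
      then show ?thesis using True by simp
    qed
  qed (use s in simp)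
  then show ?thesis by (auto intro!: bexI)
qed

text \<open>Cells are added to U one at a time, and the corner of \<open>cspan U\<close> is compared
  with its intersection with f J g. The layer of a cell whose idempotent lies in J is covered by J,
  and the dimension formula for the sum of P and Q shows that the gap does not grow. Any other cell
  enlarges the gap by at most the dimension of its layer.\<close>

lemma dim_corner_upper:
  assumes f: "f * f = f" and g: "g * g = g" and J: "two_sided_ideal J"
  shows "fd.dim (corner f g UNIV) \<le> fd.dim (corner f g J)
     + (\<Sum>l\<in>\<Lambda> - {m \<in> good_cells. prim_idem m \<in> J}. cdim l (cstar f) * cdim l g)"
proof -
  define X where "X = {m \<in> good_cells. prim_idem m \<in> J}"
  have "fd.dim (corner f g (cspan U)) \<le> fd.dim (corner f g J \<inter> cspan U) + (\<Sum>l\<in>U - X. cdim l (cstar f) * cdim l g)"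
    if "upset U" for U using that
  proof (induction rule: upset_induct_bottom)
    case empty
    then show ?case by (simp add: cspan_empty corner_def)
  next
    case (step U l)
    have finU: "finite U" using step(1) finite_Lambda finite_subset by (auto simp: upset_def)
    have CJ: "subspace (corner f g J)" by (intro corner_subspace two_sided_ideal_subspace J)
    show ?case
    proof (cases "l \<in> X")
      case False
      have "fd.dim (corner f g J \<inter> cspan U) \<le> fd.dim (corner f g J \<inter> cspan (insert l U))"
        using cspan_mono[of U "insert l U"] by (intro fd.dim_subset) auto
      moreover have "insert l U - X = insert l (U - X)" using False by auto
      ultimately show ?thesis
        using dim_corner_step[OF f g step(1-4)] step(3,5) finU by simp
    next
      case True
      define P Q where "P = corner f g J \<inter> cspan (insert l U)" and "Q = corner f g (cspan U)"
      have PQ: "subspace P" "subspace Q" unfolding P_def Q_def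
        by (intro subspace_inter CJ corner_subspace cspan_subspace)+
      have "corner f g (cspan (insert l U)) \<subseteq> {x + y |x y. x \<in> P \<and> y \<in> Q}"
      proof
        fix z assume "z \<in> corner f g (cspan (insert l U))"
        then obtain p where p: "p \<in> cspan (insert l U)" "z = f * p * g" by (auto simp: corner_def)
        obtain j where j: "j \<in> J \<inter> cspan (insert l U)" "p - j \<in> cspan U"
          using cspan_in_ideal[OF step(1-4) J _ _ p(1)] True X_def by auto
        have "f * j * g \<in> P" using j(1) cspan_ideal[OF step(2)] unfolding P_def corner_def
          by (auto dest: two_sided_idealD)
        moreover have "f * (p - j) * g \<in> Q" unfolding Q_def corner_def using j(2) by blast
        moreover have "z = f * j * g + f * (p - j) * g" using p by (simp add: algebra_simps)
        ultimately show "z \<in> {x + y |x y. x \<in> P \<and> y \<in> Q}" by blast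
      qed
      then have "fd.dim (corner f g (cspan (insert l U))) \<le> fd.dim {x + y |x y. x \<in> P \<and> y \<in> Q}"
        by (rule fd.dim_subset)
      moreover have "fd.dim {x + y |x y. x \<in> P \<and> y \<in> Q} + fd.dim (P \<inter> Q) = fd.dim P + fd.dim Q"
        by (rule fd.dim_sums_Int[OF PQ])
      moreover have "corner f g J \<inter> cspan U \<subseteq> P \<inter> Q"
      proof
        fix z assume z: "z \<in> corner f g J \<inter> cspan U"
        then have "f * z * g = z" using corner_fixed[OF f g] by blast
        then show "z \<in> P \<inter> Q" using z cspan_mono[of U "insert l U"] unfolding P_def Q_def
          by (auto simp: corner_def) (metis image_eqI)
      qed
      then have "fd.dim (corner f g J \<inter> cspan U) \<le> fd.dim (P \<inter> Q)" by (rule fd.dim_subset)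
      moreover have "insert l U - X = U - X" using True by auto
      ultimately show ?thesis using step(5) unfolding P_def Q_def by simp
    qed
  qed
  from this[OF upset_Lambda] show ?thesis by (simp add: cspan_Lambda X_def)
qed

text \<open>For e = \<open>prim_idem m\<close> the element f a e b g factors as (f a e) (e b g).
  Modulo f J g only the classes of the two factors modulo J matter, so products of members of
  complementary families suffice, and their number bounds the gain in dimension.\<close>

lemma dim_corner_generated:
  assumes J: "two_sided_ideal J" and J': "J' \<subseteq> span (J \<union> {a * prim_idem m * b | a b m. m \<in> H})"
    and H: "finite H" "H \<subseteq> good_cells"
  shows "fd.dim (corner f g J') \<le> fd.dim (corner f g J)
     + (\<Sum>m\<in>H. (fd.dim (corner f (prim_idem m) UNIV) - fd.dim (corner f (prim_idem m) J))
              * (fd.dim (corner (prim_idem m) g UNIV) - fd.dim (corner (prim_idem m) g J)))"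
proof -
  have "\<forall>m. \<exists>P\<subseteq>corner f (prim_idem m) UNIV. finite P \<and>
     card P = fd.dim (corner f (prim_idem m) UNIV) - fd.dim (corner f (prim_idem m) J) \<and>
     corner f (prim_idem m) UNIV \<subseteq> span (corner f (prim_idem m) J \<union> P)"
    by (intro allI fd.complementary_family) (auto simp: corner_def)
  then obtain P where P: "\<And>m. P m \<subseteq> corner f (prim_idem m) UNIV" "\<And>m. finite (P m)"
     "\<And>m. card (P m) = fd.dim (corner f (prim_idem m) UNIV) - fd.dim (corner f (prim_idem m) J)"
     "\<And>m. corner f (prim_idem m) UNIV \<subseteq> span (corner f (prim_idem m) J \<union> P m)" by metis
  have "\<forall>m. \<exists>Q\<subseteq>corner (prim_idem m) g UNIV. finite Q \<and>
     card Q = fd.dim (corner (prim_idem m) g UNIV) - fd.dim (corner (prim_idem m) g J) \<and>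
     corner (prim_idem m) g UNIV \<subseteq> span (corner (prim_idem m) g J \<union> Q)"
    by (intro allI fd.complementary_family) (auto simp: corner_def)
  then obtain Q where Q: "\<And>m. Q m \<subseteq> corner (prim_idem m) g UNIV" "\<And>m. finite (Q m)"
     "\<And>m. card (Q m) = fd.dim (corner (prim_idem m) g UNIV) - fd.dim (corner (prim_idem m) g J)"
     "\<And>m. corner (prim_idem m) g UNIV \<subseteq> span (corner (prim_idem m) g J \<union> Q m)" by metis
  define F where "F = (\<Union>m\<in>H. (\<lambda>(p, q). p * q) ` (P m \<times> Q m))"
  have finF: "finite F" unfolding F_def using H P Q by auto
  define S where "S = span (corner f g J \<union> F)"
  have Ss: "subspace S" unfolding S_def by (rule subspace_span)
  have JS: "f * j * g \<in> S" if "j \<in> J" for j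
    unfolding S_def using that by (intro span_base) (auto simp: corner_def)
  have main: "f * j * g \<in> S" if "j \<in> J'" for j
  proof -
    have "j \<in> span (J \<union> {a * prim_idem m * b | a b m. m \<in> H})" using that J' by blast
    then show ?thesis
    proof (rule span_induct)
      show "subspace {j. f * j * g \<in> S}"
        using Ss by (auto simp: subspace_def algebra_simps scale_mult_left scale_mult_right)
    next
      fix j assume "j \<in> J \<union> {a * prim_idem m * b | a b m. m \<in> H}"
      then show "f * j * g \<in> S"
      proof
        assume "j \<in> {a * prim_idem m * b | a b m. m \<in> H}"
        then obtain a b m where m: "m \<in> H" "j = a * prim_idem m * b" by blast
        define e where "e = prim_idem m"
        have ee: "e * e = e" using prim_idem_idem m(1) H(2) by (auto simp: e_def)
        have y: "e * b * g \<in> span (corner e g J \<union> Q m)"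
          using Q(4)[of m] unfolding e_def corner_def by blast
        have y': "e * b * g \<in> corner e g UNIV" by (auto simp: corner_def)
        have prodJ: "x * y \<in> S" if xy: "x \<in> corner f e J" "y \<in> corner e g UNIV" for x y
        proof -
          obtain j c where "j \<in> J" "x = f * j * e" "y = e * c * g" using xy by (auto simp: corner_def)
          then have "x * y = f * (j * (e * e * c)) * g" by (simp add: mult.assoc)
          then show ?thesis using JS two_sided_idealD(3)[OF J \<open>j \<in> J\<close>] by simp
        qed
        have prodJ': "x * y \<in> S" if xy: "x \<in> corner f e UNIV" "y \<in> corner e g J" for x y
        proof -
          obtain j c where "j \<in> J" "x = f * c * e" "y = e * j * g" using xy by (auto simp: corner_def)
          then have "x * y = f * (c * e * e * j) * g" by (simp add: mult.assoc)
          then show ?thesis using JS two_sided_idealD(4)[OF J \<open>j \<in> J\<close>] by simp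
        qed
        have "f * a * e \<in> span (corner f e J \<union> P m)" using P(4)[of m] unfolding e_def corner_def by blast
        then have "(f * a * e) * (e * b * g) \<in> S"
        proof (rule span_induct)
          show "subspace {x. x * (e * b * g) \<in> S}" by (rule subspace_algebra_map[OF Ss])
        next
          fix x assume x: "x \<in> corner f e J \<union> P m"
          then show "x * (e * b * g) \<in> S"
          proof
            assume xP: "x \<in> P m"
            show ?thesis using y
            proof (rule span_induct)
              show "subspace {y. x * y \<in> S}" by (rule subspace_algebra_map[OF Ss])
            next
              fix y assume "y \<in> corner e g J \<union> Q m"
              then show "x * y \<in> S"
              proof
                assume "y \<in> Q m"
                then show ?thesis unfolding S_def F_def using xP m(1) by (intro span_base) auto
              qed (use xP P(1)[of m] prodJ' e_def in auto)
            qed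
          qed (use y' prodJ in auto)
        qed
        moreover have "f * j * g = (f * a * e) * (e * b * g)"
        proof -
          have "(f * a * e) * (e * b * g) = f * a * (e * e) * b * g" by (simp only: mult.assoc)
          also have "\<dots> = f * (a * e * b) * g" unfolding ee by (simp only: mult.assoc)
          finally show ?thesis using m(2) by (simp add: e_def)
        qed
        ultimately show ?thesis by simp
      qed (rule JS)
    qed
  qed
  then have "corner f g J' \<subseteq> S" by (auto simp: corner_def)
  then have "fd.dim (corner f g J') \<le> fd.dim (span (corner f g J \<union> F))"
    unfolding S_def by (rule fd.dim_subset)
  also have "\<dots> \<le> fd.dim (corner f g J) + card F" using fd.dim_span_Un_le[OF finF] .
  also have "card F \<le> (\<Sum>m\<in>H. card (P m) * card (Q m))"
  proof -
    have "card F \<le> (\<Sum>m\<in>H. card ((\<lambda>(p, q). p * q) ` (P m \<times> Q m)))"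
      unfolding F_def by (rule card_UN_le[OF H(1)])
    also have "\<dots> \<le> (\<Sum>m\<in>H. card (P m \<times> Q m))" using P Q by (intro sum_mono card_image_le) auto
    finally show ?thesis by (simp add: card_cartesian_product)
  qed
  finally show ?thesis by (simp add: P(3) Q(3))
qed

text \<open>If n were outside a maximal right ideal M, then 1 = m + n a with m in M. As n a is
  nilpotent, m = 1 - n a has a right inverse, so 1 would lie in M.\<close>

lemma heads_ann_radical: "heads_ann \<subseteq> radical_over I"
  unfolding radical_over_def
proof safe
  fix n M assume n: "n \<in> heads_ann" and M: "maximal_right_ideal M" "I \<subseteq> M"
  have r: "right_ideal M" using M by (simp add: maximal_right_ideal_def)
  show "n \<in> M"
  proof (rule ccontr)
    assume nM: "n \<notin> M"
    define K where "K = {m + n * a | m a. m \<in> M}"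
    have "right_ideal K" unfolding right_ideal_def
    proof safe
      show "0 \<in> K" unfolding K_def using r by (auto simp: right_ideal_def intro!: exI[of _ 0])
    next
      fix x y assume "x \<in> K" "y \<in> K"
      then obtain m a m' a' where "m \<in> M" "m' \<in> M" "x = m + n * a" "y = m' + n * a'" by (auto simp: K_def)
      then have "m + m' \<in> M" "x + y = (m + m') + n * (a + a')" using r by (auto simp: right_ideal_def algebra_simps)
      then show "x + y \<in> K" unfolding K_def by blast
    next
      fix x b assume "x \<in> K"
      then obtain m a where "m \<in> M" "x = m + n * a" by (auto simp: K_def)
      then have "m * b \<in> M" "x * b = m * b + n * (a * b)" using r by (auto simp: right_ideal_def algebra_simps)
      then show "x * b \<in> K" unfolding K_def by blast
    qed
    moreover have "M \<subseteq> K" unfolding K_def by (force intro: exI[of _ 0])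
    moreover have "n \<in> K" unfolding K_def using r by (intro CollectI exI[of _ 0] exI[of _ 1]) (auto simp: right_ideal_def)
    ultimately have "K = UNIV" using M nM unfolding maximal_right_ideal_def by blast
    then obtain m a where ma: "m \<in> M" "1 = m + n * a" unfolding K_def by blast
    have "n * a \<in> heads_ann" using two_sided_idealD(3)[OF heads_ann_ideal n] .
    then obtain k where "(n * a) ^ k = 0" using heads_ann_nil by blast
    moreover obtain s where "1 - (n * a) ^ k = (1 - n * a) * s" using one_minus_power_factor by blast
    moreover have "1 - n * a = m" using ma(2) by (simp add: algebra_simps)
    ultimately have "1 = m * s" by simp
    then have "1 \<in> M" using r ma(1) by (metis right_ideal_def)
    then have "x \<in> M" for x using r unfolding right_ideal_def by (metis mult_1_left)
    then show False using M unfolding maximal_right_ideal_def by blast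
  qed
qed

section \<open>Ideals generated by primitive idempotents\<close>

lemma generated_ideal:
  assumes "two_sided_ideal I"
  shows "two_sided_ideal (span (I \<union> {a * prim_idem m * b | a b m. m \<in> H}))" (is "two_sided_ideal ?S")
proof (rule two_sided_idealI)
  fix x c assume x: "x \<in> ?S"
  show "x * c \<in> ?S" using x
  proof (rule span_induct)
    fix x assume "x \<in> I \<union> {a * prim_idem m * b | a b m. m \<in> H}"
    then have "x * c \<in> I \<union> {a * prim_idem m * b | a b m. m \<in> H}"
      using two_sided_idealD(3)[OF assms] by (auto simp: mult.assoc)
    then show "x * c \<in> ?S" by (rule span_base)
  qed (rule subspace_algebra_map, rule subspace_span)
  show "c * x \<in> ?S" using x
  proof (rule span_induct)
    fix x assume x: "x \<in> I \<union> {a * prim_idem m * b | a b m. m \<in> H}"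
    have "c * (a * prim_idem m * b) = (c * a) * prim_idem m * b" for a m b by (simp add: mult.assoc)
    then have "c * x \<in> I \<union> {a * prim_idem m * b | a b m. m \<in> H}"
      using x two_sided_idealD(4)[OF assms] by blast
    then show "c * x \<in> ?S" by (rule span_base)
  qed (rule subspace_algebra_map, rule subspace_span)
qed (auto intro: span_add span_zero)

text \<open>A form of Nakayama's lemma. By the dichotomy each element of J is congruent modulo the
  nilpotent ideal \<open>heads_ann\<close> to an element of the generated ideal. Since J lies in J J
  + I, the congruence improves to all powers of \<open>heads_ann\<close>, hence to
  membership.\<close>

lemma idempotent_ideal_generated:
  assumes I: "two_sided_ideal I" "two_sided_ideal J" "I \<subseteq> J" "J \<subseteq> {x + y | x y. x \<in> ideal_mult J J \<and> y \<in> I}"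
  shows "J \<subseteq> span (I \<union> {a * prim_idem m * b | a b m. m \<in> {m \<in> good_cells. prim_idem m \<in> J}})" (is "J \<subseteq> ?G")
proof -
  have G: "two_sided_ideal ?G" by (rule generated_ideal[OF I(1)])
  have IG: "I \<subseteq> ?G" by (auto intro: span_base)
  define NP where "NP p = span {prod_list ns | ns. set ns \<subseteq> heads_ann \<and> length ns = p}" for p
  have NP1: "heads_ann \<subseteq> NP 1"
  proof
    fix n assume "n \<in> heads_ann"
    then have "n \<in> {prod_list ns | ns. set ns \<subseteq> heads_ann \<and> length ns = 1}" by (intro CollectI exI[of _ "[n]"]) auto
    then show "n \<in> NP 1" unfolding NP_def by (rule span_base)
  qed
  have NPmult: "x * n \<in> NP (Suc p)" if "x \<in> NP p" "n \<in> heads_ann" for x n p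
    using that(1) unfolding NP_def
  proof (rule span_induct)
    fix x assume "x \<in> {prod_list ns | ns. set ns \<subseteq> heads_ann \<and> length ns = p}"
    then obtain ns where "x = prod_list ns" "set ns \<subseteq> heads_ann" "length ns = p" by blast
    then show "x * n \<in> span {prod_list ns | ns. set ns \<subseteq> heads_ann \<and> length ns = Suc p}"
      using that(2) by (intro span_base CollectI exI[of _ "ns @ [n]"]) auto
  qed (rule subspace_algebra_map, rule subspace_span)
  have claim: "\<forall>j\<in>J. \<exists>x\<in>?G. j - x \<in> NP (Suc p)" for p
  proof (induction p)
    case 0
    show ?case
    proof
      fix j assume j: "j \<in> J"
      have "j \<in> head_ann l \<or> (l \<in> good_cells \<and> prim_idem l \<in> ?G)" if l: "l \<in> \<Lambda>" for l
      proof (cases "l \<in> good_cells")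
        case True
        have "prim_idem l \<in> ?G" if "prim_idem l \<in> J"
          using that True by (intro span_base UnI2 CollectI exI[of _ 1] exI[of _ 1] exI[of _ l]) auto
        then show ?thesis using ideal_dichotomy[OF True I(2)] j True by blast
      next
        case False
        then have "1 * j \<in> head_ann l" using head_ann_one[OF l] two_sided_idealD(3)[OF head_ann_ideal[OF l]] by blast
        then show ?thesis by simp
      qed
      then show "\<exists>x\<in>?G. j - x \<in> NP (Suc 0)" using in_ideal_mod_heads_ann[OF G] NP1 by force
    qed
  next
    case (Suc p)
    have add: "\<exists>x\<in>?G. (a + b) - x \<in> NP k" if ab: "\<exists>x\<in>?G. a - x \<in> NP k" "\<exists>x\<in>?G. b - x \<in> NP k" for a b k
    proof -
      obtain x y where "x \<in> ?G" "y \<in> ?G" "a - x \<in> NP k" "b - y \<in> NP k" using ab by blast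
      then have "x + y \<in> ?G" "(a - x) + (b - y) \<in> NP k" using two_sided_idealD(2)[OF G] unfolding NP_def by (auto intro: span_add)
      then show ?thesis by (intro bexI[of _ "x + y"]) (auto simp: algebra_simps)
    qed
    show ?case
    proof
      fix j assume "j \<in> J"
      then obtain u z where uz: "u \<in> ideal_mult J J" "z \<in> I" "j = u + z" using I(4) by blast
      then obtain n x y where xy: "u = (\<Sum>i<(n::nat). x i * y i)" "\<And>i. i < n \<Longrightarrow> x i \<in> J \<and> y i \<in> J"
        unfolding ideal_mult_def by blast
      have "\<exists>g\<in>?G. x i * y i - g \<in> NP (Suc (Suc p))" if i: "i < n" for i
      proof -
        obtain g h where g: "g \<in> ?G" "x i - g \<in> NP (Suc p)" using Suc xy(2)[OF i] by blast
        obtain h where h: "h \<in> ?G" "y i - h \<in> heads_ann"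
        proof -
          have "y i \<in> head_ann l \<or> (l \<in> good_cells \<and> prim_idem l \<in> ?G)" if l: "l \<in> \<Lambda>" for l
          proof (cases "l \<in> good_cells")
            case True
            have "prim_idem l \<in> ?G" if "prim_idem l \<in> J"
              using that True by (intro span_base UnI2 CollectI exI[of _ 1] exI[of _ 1] exI[of _ l]) auto
            then show ?thesis using ideal_dichotomy[OF True I(2)] xy(2)[OF i] True by blast
          next
            case False
            then have "1 * y i \<in> head_ann l" using head_ann_one[OF l] two_sided_idealD(3)[OF head_ann_ideal[OF l]] by blast
            then show ?thesis by simp
          qed
          then show ?thesis using in_ideal_mod_heads_ann[OF G] that by blast
        qed
        \<comment> \<open>If g and h approximate the two factors within the generated ideal, the
          remaining error of the product is the product of the errors, which gains one factor from
          \<open>heads_ann\<close>.\<close>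
        have "g * y i + (x i - g) * h \<in> ?G" using g(1) h(1) two_sided_idealD[OF G] by blast
        moreover have "x i * y i - (g * y i + (x i - g) * h) = (x i - g) * (y i - h)" by (simp add: algebra_simps)
        ultimately show ?thesis using NPmult[OF g(2) h(2)] by (metis (no_types, lifting))
      qed
      note each = this
      have "\<exists>g\<in>?G. (\<Sum>i\<in>A. x i * y i) - g \<in> NP (Suc (Suc p))" if "finite A" "A \<subseteq> {..<n}" for A
        using that
      proof (induction A rule: finite_induct)
        case empty
        then show ?case using two_sided_idealD(1)[OF G] span_zero by (intro bexI[of _ 0]) (auto simp: NP_def)
      next
        case (insert i A)
        then show ?case using add[of "x i * y i" _ "\<Sum>i\<in>A. x i * y i"] each[of i] by simp
      qed
      then have "\<exists>g\<in>?G. u - g \<in> NP (Suc (Suc p))" unfolding xy(1) by blast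
      moreover have "\<exists>g\<in>?G. z - g \<in> NP (Suc (Suc p))"
        using uz(2) IG span_zero by (intro bexI[of _ z]) (auto simp: NP_def)
      ultimately show "\<exists>x\<in>?G. j - x \<in> NP (Suc (Suc p))" unfolding uz(3) by (rule add)
    qed
  qed
  obtain m where m: "\<And>ns. set ns \<subseteq> heads_ann \<Longrightarrow> length ns = m \<Longrightarrow> prod_list ns = 0"
    using heads_ann_nilpotent by blast
  have "m \<noteq> 0" using m[of "[]"] by auto
  then obtain p where p: "m = Suc p" by (cases m) auto
  have "NP m \<subseteq> span {0}" unfolding NP_def by (intro span_mono) (use m in auto)
  then have "NP (Suc p) \<subseteq> {0}" using p by (auto simp: span_insert_0)
  then show ?thesis using claim[of p] by force
qed

section \<open>From heredity chains to nonzero forms\<close>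

definition "cell_ann l = {a. \<forall>x\<in>\<Delta> l. act l x a = 0}"

lemma cell_ann_ideal: "l \<in> \<Lambda> \<Longrightarrow> two_sided_ideal (cell_ann l)"
  by (rule two_sided_idealI) (auto simp: cell_ann_def act_add act_mult act_in)

text \<open>By \<open>head_ann_star\<close> the image of \<open>prim_idem m\<close> under the
  involution is nonzero on the head of m, so by the dichotomy every ideal containing the image
  contains the idempotent itself; transporting ideals by the involution gives the converse. Both are
  applied to the annihilator of \<Delta> l.\<close>

lemma cdim_prim_idem_star:
  assumes m: "m \<in> good_cells" and l: "l \<in> \<Lambda>"
  shows "cdim l (cstar (prim_idem m)) = 0 \<longleftrightarrow> cdim l (prim_idem m) = 0"
proof -
  have nR: "cstar (prim_idem m) \<notin> head_ann m" using head_ann_star[OF good_cells_Lambda[OF m]] prim_idem_notin_head_ann[OF m] by blast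
  have "prim_idem m \<in> J" if "two_sided_ideal J" "cstar (prim_idem m) \<in> J" for J
    using ideal_dichotomy[OF m that(1)] that(2) nR by blast
  note star = this
  have "two_sided_ideal {a. cstar a \<in> cell_ann l}"
    using two_sided_idealD[OF cell_ann_ideal[OF l]] by (intro two_sided_idealI) (auto simp: cstar_add cstar_mult)
  then have "cstar (prim_idem m) \<in> cell_ann l" if "prim_idem m \<in> cell_ann l" using star[of "{a. cstar a \<in> cell_ann l}"] that by simp
  moreover have "prim_idem m \<in> cell_ann l" if "cstar (prim_idem m) \<in> cell_ann l" using star[OF cell_ann_ideal[OF l] that] .
  ultimately show ?thesis unfolding cdim_eq_0[OF l] cell_ann_def by blast
qed

lemma cdim_prim_idem_self: "m \<in> good_cells \<Longrightarrow> cdim m (prim_idem m) \<noteq> 0"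
proof
  assume m: "m \<in> good_cells" and "cdim m (prim_idem m) = 0"
  then have "prim_idem m \<in> head_ann m" using cdim_eq_0[OF good_cells_Lambda[OF m]] by (intro head_ann_0I good_cells_Lambda) auto
  then show False using prim_idem_notin_head_ann[OF m] by simp
qed

text \<open>Along a heredity chain \<open>J\<close> one compares the dimensions of \<open>f A g\<close> and \<open>f (J i) g\<close> for
  idempotents \<open>f\<close> and \<open>g\<close>. An ideal containing the idempotents of the cells in \<open>X\<close> contains the
  corresponding part of the cell filtration, which gives an upper bound for the codimension. Conversely
  \<open>J (i + 1)\<close> is generated by \<open>J i\<close> and the idempotents that enter at this step, which bounds its
  dimension. Hence each step accounts only for cells that own a primitive idempotent, and a cell with
  zero form would be left over when \<open>J n\<close> is the whole algebra.\<close>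

theorem quasi_hereditary_form_nonzero:
  assumes "quasi_hereditary scale"
  shows "good_cells = \<Lambda>"
proof -
  obtain n J where J: "J 0 = {0}" "J n = UNIV" "\<And>i. i < (n::nat) \<Longrightarrow> heredity_ideal_over scale (J i) (J (Suc i))"
    using assms unfolding quasi_hereditary_def by blast
  have fin: "finite good_cells" using finite_Lambda by (auto simp: good_cells_def)
  have Jid: "two_sided_ideal (J i)" if "i \<le> n" for i
  proof (cases i)
    case 0
    have "two_sided_ideal {0::'a}" by (rule two_sided_idealI) auto
    then show ?thesis using 0 J(1) by simp
  next
    case (Suc k)
    then show ?thesis using J(3)[of k] that by (auto simp: heredity_ideal_over_def)
  qed
  define X where "X i = {m \<in> good_cells. prim_idem m \<in> J i}" for i
  \<comment> \<open>By \<open>dim_corner_UNIV\<close> this says that f (J i) g has at most the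
    dimension contributed by the cells in X i. It is proved for all f and g at once, because the
    induction step needs it at the idempotents of the cells that enter.\<close>
  have main: "fd.dim (corner f g (J i)) + (\<Sum>l\<in>\<Lambda> - X i. cdim l (cstar f) * cdim l g) \<le> fd.dim (corner f g UNIV)"
    if "i \<le> n" "f * f = f" "g * g = g" for i f g
    using that
  proof (induction i arbitrary: f g)
    case 0
    have "X 0 = {}"
    proof -
      have "prim_idem m \<noteq> 0" if "m \<in> good_cells" for m
        using prim_idem_notin_head_ann[OF that] two_sided_idealD(1)[OF head_ann_ideal[OF good_cells_Lambda[OF that]]] by metis
      then show ?thesis unfolding X_def J(1) by auto
    qed
    moreover have "fd.dim (corner f g {0}) = 0" by (simp add: corner_def)
    ultimately show ?case using dim_corner_UNIV[OF 0(2,3)] J(1) by simp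
  next
    case (Suc i)
    have i: "i < n" "i \<le> n" using Suc by auto
    have H: "two_sided_ideal (J i)" "two_sided_ideal (J (Suc i))" "J i \<subseteq> J (Suc i)"
      "J (Suc i) \<subseteq> {x + y | x y. x \<in> ideal_mult (J (Suc i)) (J (Suc i)) \<and> y \<in> J i}"
      "ideal_mult (ideal_mult (J (Suc i)) (radical_over (J i))) (J (Suc i)) \<subseteq> J i"
      using J(3)[OF i(1)] unfolding heredity_ideal_over_def by auto
    define H' where "H' = X (Suc i) - X i"
    have H'L: "H' \<subseteq> good_cells" unfolding H'_def X_def by auto
    have finH: "finite H'" using H'L fin finite_subset by auto
    have XS: "X i \<subseteq> X (Suc i)" "X (Suc i) \<subseteq> \<Lambda>" unfolding X_def using H(3) good_cells_Lambda by auto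
    have gen: "J (Suc i) \<subseteq> span (J i \<union> {a * prim_idem m * b | a b m. m \<in> H'})" (is "_ \<subseteq> ?R")
    proof -
      have "a * prim_idem m * b \<in> J i \<union> {a * prim_idem m * b | a b m. m \<in> H'}" if "m \<in> X (Suc i)" for a b m
      proof (cases "m \<in> X i")
        case True
        then show ?thesis using two_sided_idealD(3,4)[OF H(1)] by (auto simp: X_def)
      qed (use that H'_def in blast)
      then have "J i \<union> {a * prim_idem m * b | a b m. m \<in> X (Suc i)} \<subseteq> J i \<union> {a * prim_idem m * b | a b m. m \<in> H'}" by blast
      then have "span (J i \<union> {a * prim_idem m * b | a b m. m \<in> X (Suc i)}) \<subseteq> ?R" by (rule span_mono)
      moreover have "J (Suc i) \<subseteq> span (J i \<union> {a * prim_idem m * b | a b m. m \<in> X (Suc i)})"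
        using idempotent_ideal_generated[OF H(1-4)] unfolding X_def by simp
      ultimately show ?thesis by blast
    qed
    \<comment> \<open>Every element of e A e is a multiple of e plus some d = e d e in
      \<open>heads_ann\<close>. As e lies in J (i + 1) and d in the radical, the condition on J (i +
      1) rad J (i + 1) puts d into J i.\<close>
    have one: "fd.dim (corner (prim_idem m) (prim_idem m) UNIV) \<le> fd.dim (corner (prim_idem m) (prim_idem m) (J i)) + 1" if m: "m \<in> H'" for m
    proof -
      define e where "e = prim_idem m"
      have mL: "m \<in> good_cells" and eJ: "e \<in> J (Suc i)" using m by (auto simp: H'_def X_def e_def)
      have ee: "e * e = e" using prim_idem_idem[OF mL] by (simp add: e_def)
      have "corner e e UNIV \<subseteq> span (corner e e (J i) \<union> {e})"
      proof
        fix z assume "z \<in> corner e e UNIV"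
        then obtain a where z: "z = e * a * e" by (auto simp: corner_def)
        obtain c where c: "e * a * e - c *s e \<in> heads_ann" using prim_idem_local[OF mL, of a] unfolding e_def by blast
        define d where "d = e * a * e - c *s e"
        have "d \<in> radical_over (J i)" using c heads_ann_radical unfolding d_def by blast
        then have "e * d \<in> ideal_mult (J (Suc i)) (radical_over (J i))" unfolding ideal_mult_def
          using eJ by (intro CollectI exI[of _ "1::nat"] exI[of _ "\<lambda>_. e"] exI[of _ "\<lambda>_. d"]) auto
        then have "e * d * e \<in> ideal_mult (ideal_mult (J (Suc i)) (radical_over (J i))) (J (Suc i))"
          unfolding ideal_mult_def[of _ "J (Suc i)"]
          using eJ by (intro CollectI exI[of _ "1::nat"] exI[of _ "\<lambda>_. e * d"] exI[of _ "\<lambda>_. e"]) auto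
        then have dJ: "e * d * e \<in> J i" using H(5) by blast
        have "e * d * e = (e * e) * a * (e * e) - c *s (e * e * e)"
          unfolding d_def by (simp add: algebra_simps scale_mult_left scale_mult_right)
        then have ed: "e * d * e = d" unfolding d_def ee .
        then have "d \<in> corner e e (J i)" using dJ unfolding corner_def by (metis image_eqI)
        then have "d + c *s e \<in> span (corner e e (J i) \<union> {e})"
          by (intro span_add span_scale span_base) auto
        then show "z \<in> span (corner e e (J i) \<union> {e})" unfolding z d_def by simp
      qed
      then have "fd.dim (corner e e UNIV) \<le> fd.dim (span (corner e e (J i) \<union> {e}))" by (rule fd.dim_subset)
      also have "\<dots> \<le> fd.dim (corner e e (J i)) + 1" using fd.dim_span_Un_le[of "{e}" "corner e e (J i)"] by simp
      finally show ?thesis unfolding e_def .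
    qed
    \<comment> \<open>The induction hypothesis at f = g = \<open>prim_idem m\<close> leaves at most
      1 for the cells outside X i, and m alone contributes at least 1. So m contributes exactly 1
      and the others nothing; by \<open>cdim_prim_idem_star\<close> a vanishing product means that
      both factors vanish.\<close>
    have val: "cdim m (prim_idem m) = 1 \<and> cdim m (cstar (prim_idem m)) = 1 \<and>
       (\<forall>l\<in>\<Lambda> - X i - {m}. cdim l (prim_idem m) = 0 \<and> cdim l (cstar (prim_idem m)) = 0)" if m: "m \<in> H'" for m
    proof -
      have mL: "m \<in> good_cells" and mX: "m \<in> \<Lambda> - X i" using m good_cells_Lambda by (auto simp: H'_def X_def)
      have le: "(\<Sum>l\<in>\<Lambda> - X i. cdim l (cstar (prim_idem m)) * cdim l (prim_idem m)) \<le> 1"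
        using Suc.IH[OF i(2) prim_idem_idem[OF mL] prim_idem_idem[OF mL]] one[OF m] by simp
      have split: "(\<Sum>l\<in>\<Lambda> - X i. cdim l (cstar (prim_idem m)) * cdim l (prim_idem m))
        = cdim m (cstar (prim_idem m)) * cdim m (prim_idem m) + (\<Sum>l\<in>\<Lambda> - X i - {m}. cdim l (cstar (prim_idem m)) * cdim l (prim_idem m))"
        using mX finite_Lambda by (intro sum.remove) auto
      have nz: "cdim m (cstar (prim_idem m)) \<noteq> 0" "cdim m (prim_idem m) \<noteq> 0"
        using cdim_prim_idem_self[OF mL] cdim_prim_idem_star[OF mL good_cells_Lambda[OF mL]] by auto
      then have ge: "cdim m (cstar (prim_idem m)) * cdim m (prim_idem m) \<ge> 1" by (simp add: Suc_le_eq)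
      then have prod1: "cdim m (cstar (prim_idem m)) * cdim m (prim_idem m) = 1"
        and sum0: "(\<Sum>l\<in>\<Lambda> - X i - {m}. cdim l (cstar (prim_idem m)) * cdim l (prim_idem m)) = 0"
        using le split by linarith+
      have "cdim l (cstar (prim_idem m)) * cdim l (prim_idem m) = 0" if "l \<in> \<Lambda> - X i - {m}" for l
        using sum0 that finite_Lambda by simp
      then show ?thesis using prod1 cdim_prim_idem_star[OF mL] by auto
    qed
    \<comment> \<open>By \<open>val\<close>, only the term of m survives in the bound for the
      codimension.\<close>
    have c1: "fd.dim (corner f (prim_idem m) UNIV) - fd.dim (corner f (prim_idem m) (J i)) \<le> cdim m (cstar f)" if m: "m \<in> H'" for m
    proof -
      have mL: "m \<in> good_cells" and mX: "m \<in> \<Lambda> - X i" using m good_cells_Lambda by (auto simp: H'_def X_def)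
      have "(\<Sum>l\<in>\<Lambda> - X i. cdim l (cstar f) * cdim l (prim_idem m)) = cdim m (cstar f)"
        using mX finite_Lambda val[OF m] by (subst sum.remove[of _ m]) auto
      then show ?thesis using dim_corner_upper[OF Suc.prems(2) prim_idem_idem[OF mL] H(1)] unfolding X_def by simp
    qed
    have c2: "fd.dim (corner (prim_idem m) g UNIV) - fd.dim (corner (prim_idem m) g (J i)) \<le> cdim m g" if m: "m \<in> H'" for m
    proof -
      have mL: "m \<in> good_cells" and mX: "m \<in> \<Lambda> - X i" using m good_cells_Lambda by (auto simp: H'_def X_def)
      have "(\<Sum>l\<in>\<Lambda> - X i. cdim l (cstar (prim_idem m)) * cdim l g) = cdim m g"
        using mX finite_Lambda val[OF m] by (subst sum.remove[of _ m]) auto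
      then show ?thesis using dim_corner_upper[OF prim_idem_idem[OF mL] Suc.prems(3) H(1)] unfolding X_def by simp
    qed
    have "fd.dim (corner f g (J (Suc i))) \<le> fd.dim (corner f g (J i)) + (\<Sum>m\<in>H'. cdim m (cstar f) * cdim m g)"
    proof -
      have "(\<Sum>m\<in>H'. (fd.dim (corner f (prim_idem m) UNIV) - fd.dim (corner f (prim_idem m) (J i)))
              * (fd.dim (corner (prim_idem m) g UNIV) - fd.dim (corner (prim_idem m) g (J i))))
          \<le> (\<Sum>m\<in>H'. cdim m (cstar f) * cdim m g)"
        using c1 c2 by (intro sum_mono mult_le_mono) auto
      then show ?thesis using dim_corner_generated[OF H(1) gen finH H'L, of f g] by linarith
    qed
    moreover have "fd.dim (corner f g (J i)) + (\<Sum>l\<in>\<Lambda> - X i. cdim l (cstar f) * cdim l g) \<le> fd.dim (corner f g UNIV)"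
      using Suc.IH[OF i(2) Suc.prems(2,3)] .
    moreover have "(\<Sum>l\<in>\<Lambda> - X i. cdim l (cstar f) * cdim l g)
      = (\<Sum>m\<in>H'. cdim m (cstar f) * cdim m g) + (\<Sum>l\<in>\<Lambda> - X (Suc i). cdim l (cstar f) * cdim l g)"
    proof -
      have "\<Lambda> - X i = H' \<union> (\<Lambda> - X (Suc i))" using XS unfolding H'_def by auto
      moreover have "H' \<inter> (\<Lambda> - X (Suc i)) = {}" unfolding H'_def by auto
      ultimately show ?thesis using finH finite_Lambda by (simp add: sum.union_disjoint)
    qed
    ultimately show ?case by linarith
  qed
  \<comment> \<open>At the end of the chain J n is the whole algebra, so for f = g = 1 the cells
    outside X n have total squared dimension 0, whereas cell modules are nonzero.\<close>
  have z: "(\<Sum>l\<in>\<Lambda> - X n. cdim l 1 * cdim l 1) = 0"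
    using main[of n 1 1] by (simp add: J(2))
  have "l \<in> good_cells" if l: "l \<in> \<Lambda>" for l
  proof (rule ccontr)
    assume "l \<notin> good_cells"
    then have "l \<in> \<Lambda> - X n" using l by (auto simp: X_def)
    then have "cdim l 1 = 0" using z finite_Lambda by auto
    moreover obtain t where "t \<in> T l" using T_nonempty[OF l] by auto
    ultimately have "unitv t = 0" using cdim_eq_0[OF l, of 1] unitv_in[of t l] act_one[OF l] by auto
    then show False by (auto simp: unitv_def fun_eq_iff dest: spec[of _ t])
  qed
  then show ?thesis by (auto simp: good_cells_def)
qed

end

section \<open>Vector space dimension of module carriers\<close>

definition coord_space :: "nat \<Rightarrow> (nat \<Rightarrow> 'k::field) set" where
  "coord_space n = {v. \<forall>i\<ge>n. v i = 0}"

text \<open>The carriers of modules carry their vector space structure only on a subset of the ambient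
  type, so the type-based dimension theory of the library applies only through coordinates.\<close>

locale kspace =
  fixes S :: "'m::ab_group_add set" and sm :: "'k::field \<Rightarrow> 'm \<Rightarrow> 'm"
  assumes zero: "0 \<in> S" and add: "x \<in> S \<Longrightarrow> y \<in> S \<Longrightarrow> x + y \<in> S"
    and sm: "x \<in> S \<Longrightarrow> sm c x \<in> S"
    and sm_add: "x \<in> S \<Longrightarrow> y \<in> S \<Longrightarrow> sm c (x + y) = sm c x + sm c y"
    and add_sm: "x \<in> S \<Longrightarrow> sm (c + d) x = sm c x + sm d x"
    and sm_sm: "x \<in> S \<Longrightarrow> sm (c * d) x = sm c (sm d x)"
    and sm_one: "x \<in> S \<Longrightarrow> sm 1 x = x"
begin

definition "lin g \<longleftrightarrow> (\<forall>x\<in>S. \<forall>y\<in>S. g (x + y) = g x + g y) \<and>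
   (\<forall>x\<in>S. \<forall>c. g (sm c x) = (\<lambda>i. c * g x i))"

text \<open>Dimension is a relation to coordinate spaces in one fixed type, so that carriers in
  different ambient types can be compared.\<close>

definition "has_dim n \<longleftrightarrow> (\<exists>g. lin g \<and> bij_betw g S (coord_space n))"

lemma sm_zero_left: "x \<in> S \<Longrightarrow> sm 0 x = 0"
  using add_sm[of x 0 0] by simp

lemma sm_zero_right: "sm c 0 = 0"
  using sm_add[OF zero zero, of c] by simp

lemma neg: "x \<in> S \<Longrightarrow> - x \<in> S" and sm_neg: "x \<in> S \<Longrightarrow> sm (- c) x = - sm c x"
proof -
  assume x: "x \<in> S"
  have *: "sm (- c) x = - sm c x" for c
    using add_sm[OF x, of "- c" c] sm_zero_left[OF x] by (simp add: eq_neg_iff_add_eq_0)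
  then show "sm (- c) x = - sm c x" .
  show "- x \<in> S" using *[of 1] sm[OF x, of "- 1"] sm_one[OF x] by simp
qed

lemma diff: "x \<in> S \<Longrightarrow> y \<in> S \<Longrightarrow> x - y \<in> S"
  using add[of x "- y"] neg[of y] by simp

lemma sum_in: "(\<And>i. i \<in> A \<Longrightarrow> f i \<in> S) \<Longrightarrow> sum f A \<in> S"
  by (induction A rule: infinite_finite_induct) (auto simp: zero add)

lemma sm_sum: "(\<And>i. i \<in> A \<Longrightarrow> f i \<in> S) \<Longrightarrow> sm c (sum f A) = (\<Sum>i\<in>A. sm c (f i))"
  by (induction A rule: infinite_finite_induct) (auto simp: sm_zero_right sm_add sum_in)

lemma lin_zero: "lin g \<Longrightarrow> g 0 = 0"
  unfolding lin_def using zero by (metis add_cancel_left_right)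

lemma lin_neg: "lin g \<Longrightarrow> x \<in> S \<Longrightarrow> g (- x) = - g x"
  using lin_zero neg unfolding lin_def by (metis add.right_inverse eq_neg_iff_add_eq_0 add.commute)

lemma lin_diff: "lin g \<Longrightarrow> x \<in> S \<Longrightarrow> y \<in> S \<Longrightarrow> g (x - y) = g x - g y"
  using lin_neg[of g y] neg[of y] unfolding lin_def by (metis diff_conv_add_uminus)

lemma lin_sum: "lin g \<Longrightarrow> (\<And>i. i \<in> A \<Longrightarrow> f i \<in> S) \<Longrightarrow> g (sum f A) = (\<Sum>i\<in>A. g (f i))"
  by (induction A rule: infinite_finite_induct) (auto simp: lin_zero, auto simp: lin_def sum_in)

lemma lin_sm: "lin g \<Longrightarrow> x \<in> S \<Longrightarrow> g (sm c x) = (\<lambda>i. c * g x i)"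
  by (simp add: lin_def)

text \<open>The coordinates are those with respect to a minimal spanning family modulo \<open>U\<close>.\<close>

lemma coordinates_mod:
  assumes U: "U \<subseteq> S" "0 \<in> U" "\<And>x y. x \<in> U \<Longrightarrow> y \<in> U \<Longrightarrow> x + y \<in> U" "\<And>c x. x \<in> U \<Longrightarrow> sm c x \<in> U"
    and P: "finite P" "\<And>p. p \<in> P \<Longrightarrow> w p \<in> S"
    and span: "\<And>x. x \<in> S \<Longrightarrow> \<exists>c. x - (\<Sum>p\<in>P. sm (c p) (w p)) \<in> U"
  shows "\<exists>g n. lin g \<and> g ` S = coord_space n \<and> (\<forall>x\<in>S. g x = 0 \<longleftrightarrow> x \<in> U)"
proof -
  define ok where "ok Q \<longleftrightarrow> Q \<subseteq> P \<and> (\<forall>x\<in>S. \<exists>c. x - (\<Sum>p\<in>Q. sm (c p) (w p)) \<in> U)" for Q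
  have "ok P" using span by (auto simp: ok_def)
  then obtain Q where Q: "ok Q" "\<And>Q'. ok Q' \<Longrightarrow> card Q \<le> card Q'"
    by (metis arg_min_natI arg_min_nat_le)
  have finQ: "finite Q" and wQ: "\<And>q. q \<in> Q \<Longrightarrow> w q \<in> S"
    using Q P by (auto simp: ok_def dest: finite_subset)
  have Uneg: "- x \<in> U" if "x \<in> U" for x
    using U(4)[OF that, of "- 1"] sm_neg[of x 1] sm_one[of x] that U(1) by auto
  have Udiff: "x - y \<in> U" if "x \<in> U" "y \<in> U" for x y using U(3)[OF that(1) Uneg[OF that(2)]] by simp
  define comb where "comb c = (\<Sum>p\<in>Q. sm (c p) (w p))" for c
  have comb_in: "comb c \<in> S" for c unfolding comb_def using wQ by (intro sum_in sm)
  have comb_add: "comb (\<lambda>p. c p + d p) = comb c + comb d" for c d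
    unfolding comb_def using wQ by (simp add: add_sm sum.distrib)
  have comb_sm: "comb (\<lambda>p. r * c p) = sm r (comb c)" for c r
    unfolding comb_def using wQ by (simp add: sm_sm sm_sum sm)
  have comb_diff: "comb (\<lambda>p. c p - d p) = comb c - comb d" for c d
    using comb_add[of "\<lambda>p. c p - d p" d] by simp
  have ind: "d q = 0" if d: "comb d \<in> U" and q: "q \<in> Q" for d q
  proof (rule ccontr)
    assume nz: "d q \<noteq> 0"
    have "ok (Q - {q})" unfolding ok_def
    proof safe
      fix x assume x: "x \<in> S"
      obtain c where c: "x - comb c \<in> U" using Q(1) x unfolding ok_def comb_def by blast
      \<comment> \<open>Subtracting this multiple of the relation d removes the coefficient at q, so
        q could be dropped, against the minimality of Q.\<close>
      define e where "e p = c p - (c q / d q) * d p" for p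
      have "comb e = comb c - sm (c q / d q) (comb d)"
        unfolding e_def comb_diff comb_sm ..
      then have "x - comb e = (x - comb c) + sm (c q / d q) (comb d)" by (simp only: diff_diff_eq2 diff_add_eq)
      then have "x - comb e \<in> U" using U(3)[OF c U(4)[OF d, of "c q / d q"]] by metis
      moreover have "comb e = (\<Sum>p\<in>Q - {q}. sm (e p) (w p))"
        unfolding comb_def using q finQ nz by (simp add: sum.remove e_def sm_zero_left wQ)
      ultimately show "\<exists>c. x - (\<Sum>p\<in>Q - {q}. sm (c p) (w p)) \<in> U" by auto
    qed (use Q(1) in \<open>auto simp: ok_def\<close>)
    then have "card Q \<le> card (Q - {q})" by (rule Q(2))
    then show False using q finQ by (metis card_Diff1_less leD)
  qed
  define cc where "cc x = (SOME c. x - comb c \<in> U)" for x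
  have cc: "x - comb (cc x) \<in> U" if "x \<in> S" for x
  proof -
    have "\<exists>c. x - comb c \<in> U" using Q(1) that by (simp add: ok_def comb_def)
    then show ?thesis unfolding cc_def by (rule someI_ex)
  qed
  have uniq: "cc x q = c q" if "x \<in> S" "x - comb c \<in> U" "q \<in> Q" for x c q
  proof -
    have "comb (\<lambda>p. cc x p - c p) \<in> U"
      unfolding comb_diff using Udiff[OF that(2) cc[OF that(1)]] by simp
    then show ?thesis using ind[of "\<lambda>p. cc x p - c p" q] that(3) by simp
  qed
  define n where "n = card Q"
  obtain h where h: "bij_betw h {..<n} Q" using ex_bij_betw_nat_finite[OF finQ] by (auto simp: n_def atLeast0LessThan)
  have hQ: "h i \<in> Q" if "i < n" for i using h that by (auto simp: bij_betw_def)
  define g where "g x = (\<lambda>i. if i < n then cc x (h i) else 0)" for x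
  have "lin g" unfolding lin_def
  proof safe
    fix x y assume x: "x \<in> S" and y: "y \<in> S"
    have "(x + y) - comb (\<lambda>p. cc x p + cc y p) \<in> U"
      unfolding comb_add using U(3)[OF cc[OF x] cc[OF y]] by (simp add: algebra_simps)
    from uniq[OF add[OF x y] this] show "g (x + y) = g x + g y"
      by (auto simp: g_def fun_eq_iff hQ)
  next
    fix x c assume x: "x \<in> S"
    have "sm c (x - comb (cc x)) = sm c x - sm c (comb (cc x))"
      using sm_add[OF x neg[OF comb_in]] sm_neg[of "comb (cc x)" c] sm_add[of "comb (cc x)" "- comb (cc x)" c]
        comb_in neg[OF comb_in] sm_zero_right[of c] by (simp add: eq_neg_iff_add_eq_0[symmetric])
    then have "sm c x - comb (\<lambda>p. c * cc x p) \<in> U"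
      unfolding comb_sm using U(4)[OF cc[OF x], of c] by simp
    from uniq[OF sm[OF x] this] show "g (sm c x) = (\<lambda>i. c * g x i)"
      by (auto simp: g_def fun_eq_iff hQ)
  qed
  moreover have "g ` S = coord_space n"
  proof
    show "g ` S \<subseteq> coord_space n" by (auto simp: g_def coord_space_def)
    show "coord_space n \<subseteq> g ` S"
    proof
      fix v :: "nat \<Rightarrow> 'k" assume v: "v \<in> coord_space n"
      define x where "x = comb (\<lambda>q. v (the_inv_into {..<n} h q))"
      have "x - comb (\<lambda>q. v (the_inv_into {..<n} h q)) \<in> U" using U(2) by (simp add: x_def)
      from uniq[OF comb_in this[unfolded x_def]]
      have "g x i = v i" for i
        using v h hQ the_inv_into_f_f[of h "{..<n}" i]
        by (auto simp: g_def x_def coord_space_def bij_betw_def)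
      then show "v \<in> g ` S" using comb_in unfolding x_def by (metis ext image_eqI)
    qed
  qed
  moreover have "g x = 0 \<longleftrightarrow> x \<in> U" if x: "x \<in> S" for x
  proof
    assume "g x = 0"
    then have "cc x q = 0" if "q \<in> Q" for q
      using h that unfolding bij_betw_def g_def fun_eq_iff by (metis imageE lessThan_iff zero_fun_apply)
    then have "comb (cc x) = 0" unfolding comb_def using wQ by (simp add: sm_zero_left)
    then show "x \<in> U" using cc[OF x] by simp
  next
    assume "x \<in> U"
    moreover have "comb (\<lambda>_. 0) = 0" unfolding comb_def using wQ by (simp add: sm_zero_left)
    ultimately have "x - comb (\<lambda>_. 0) \<in> U" by simp
    from uniq[OF x this] show "g x = 0" by (auto simp: g_def fun_eq_iff hQ)
  qed
  ultimately show ?thesis by blast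
qed

lemma inj_if_kernel: "lin g \<Longrightarrow> (\<And>x. x \<in> S \<Longrightarrow> g x = 0 \<Longrightarrow> x = 0) \<Longrightarrow> inj_on g S"
proof (rule inj_onI)
  fix x y assume a: "lin g" "\<And>x. x \<in> S \<Longrightarrow> g x = 0 \<Longrightarrow> x = 0" "x \<in> S" "y \<in> S" "g x = g y"
  have "g (x - y) = 0" using lin_diff[OF a(1,3,4)] a(5) by simp
  then have "x - y = 0" using a(2)[OF diff[OF a(3,4)]] by simp
  then show "x = y" by simp
qed

lemma has_dim_exists:
  assumes "finite P" "\<And>p. p \<in> P \<Longrightarrow> w p \<in> S" "\<And>x. x \<in> S \<Longrightarrow> \<exists>c. x = (\<Sum>p\<in>P. sm (c p) (w p))"
  shows "\<exists>n. has_dim n"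
proof -
  have "\<exists>g n. lin g \<and> g ` S = coord_space n \<and> (\<forall>x\<in>S. g x = 0 \<longleftrightarrow> x \<in> {0})"
    using assms(3) by (intro coordinates_mod[OF _ _ _ _ assms(1,2)]) (auto simp: zero sm_zero_right)
  then show ?thesis using inj_if_kernel unfolding has_dim_def bij_betw_def by (metis singletonD)
qed

end

section \<open>Invariance and additivity of dimension\<close>

lemma coord_kspace: "kspace (coord_space n :: (nat \<Rightarrow> 'k::field) set) (\<lambda>c v i. c * v i)"
  by unfold_locales (auto simp: coord_space_def fun_eq_iff algebra_simps)

lemma coord_expand:
  fixes v :: "nat \<Rightarrow> 'k::field"
  assumes "v \<in> coord_space n"
  shows "v = (\<Sum>i<n. (\<lambda>j. v i * (if j = i then 1 else 0)))"
proof
  fix j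
  have "(\<Sum>i<n. v i * (if j = i then 1 else 0)) = (\<Sum>i<n. if i = j then v j else 0)"
    by (intro sum.cong) auto
  then show "v j = (\<Sum>i<n. (\<lambda>j. v i * (if j = i then 1 else 0))) j"
    using assms by (auto simp: sum_fun_apply coord_space_def)
qed

interpretation nat_fun: vector_space "\<lambda>(c::'k::field) (f::nat \<Rightarrow> 'k) t. c * f t"
  by (rule pointwise_vector_space)

lemma coord_space_span: "(coord_space n :: (nat \<Rightarrow> 'k::field) set) \<subseteq> nat_fun.span ((\<lambda>i j. if j = i then 1 else 0) ` {..<n})"
proof
  fix v :: "nat \<Rightarrow> 'k" assume v: "v \<in> coord_space n"
  have "(\<Sum>i<n. (\<lambda>j. v i * (if j = i then 1 else 0))) \<in> nat_fun.span ((\<lambda>i j. if j = i then 1 else 0) ` {..<n})"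
    by (intro nat_fun.span_sum nat_fun.span_scale nat_fun.span_base imageI)
  then show "v \<in> nat_fun.span ((\<lambda>i j. if j = i then 1 else 0) ` {..<n})"
    unfolding coord_expand[OF v, symmetric] .
qed

text \<open>The images of the n unit vectors are independent and lie in the span of m
  vectors.\<close>

lemma coord_space_le:
  fixes h :: "(nat \<Rightarrow> 'k::field) \<Rightarrow> nat \<Rightarrow> 'k"
  assumes lin: "kspace.lin (coord_space n) (\<lambda>c v i. c * v i) h" and inj: "inj_on h (coord_space n)"
    and im: "h ` coord_space n \<subseteq> coord_space m"
  shows "n \<le> m"
proof -
  interpret kspace "coord_space n :: (nat \<Rightarrow> 'k) set" "\<lambda>c v i. c * v i" by (rule coord_kspace)
  define u where "u i = (\<lambda>j::nat. if j = i then 1 else (0::'k))" for i :: nat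
  have u: "u i \<in> coord_space n" if "i < n" for i using that by (auto simp: u_def coord_space_def)
  define w where "w i = h (u i)" for i
  have ind: "c p = 0" if c: "(\<Sum>p<n. (\<lambda>t. c p * w p t)) = 0" and p: "p \<in> {..<n}" for c p
  proof -
    have in1: "(\<lambda>t. c p * u p t) \<in> coord_space n" if "p < n" for p using u[OF that] by (auto simp: coord_space_def)
    then have in2: "(\<Sum>p<n. (\<lambda>t. c p * u p t)) \<in> coord_space n" by (intro sum_in) auto
    have "h (\<Sum>p<n. (\<lambda>t. c p * u p t)) = (\<Sum>p<n. h (\<lambda>t. c p * u p t))"
      by (rule lin_sum[OF lin]) (use in1 in auto)
    also have "\<dots> = (\<Sum>p<n. (\<lambda>t. c p * w p t))"
      by (intro sum.cong refl) (use lin_sm[OF lin u] in \<open>simp add: w_def\<close>)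
    finally have "h (\<Sum>p<n. (\<lambda>t. c p * u p t)) = (\<Sum>p<n. (\<lambda>t. c p * w p t))" .
    then have "(\<Sum>p<n. (\<lambda>t. c p * u p t)) = 0"
      using inj_onD[OF inj _ in2 zero] lin_zero[OF lin] c by simp
    from fun_cong[OF this, of p] have "(\<Sum>q<n. c q * u q p) = 0" by (simp add: sum_fun_apply)
    moreover have "(\<Sum>q<n. c q * u q p) = (\<Sum>q<n. if q = p then c p else 0)"
      by (intro sum.cong) (auto simp: u_def)
    ultimately show ?thesis using p by simp
  qed
  have i: "inj_on w {..<n}" "nat_fun.independent (w ` {..<n})"
    by (rule nat_fun.independent_family[of "{..<n}" w], simp, erule (1) ind)+
  have "w ` {..<n} \<subseteq> nat_fun.span ((\<lambda>i j. if j = i then 1 else 0) ` {..<m})"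
    using im u coord_space_span[of m] unfolding w_def by blast
  from nat_fun.independent_span_bound[OF _ i(2) this]
  have "n \<le> card ((\<lambda>i j. if j = i then 1 else (0::'k)) ` {..<m})" using card_image[OF i(1)] by simp
  also have "\<dots> \<le> m" using card_image_le[of "{..<m}"] by simp
  finally show ?thesis .
qed

lemma has_dim_le:
  fixes sm :: "'k::field \<Rightarrow> 'm::ab_group_add \<Rightarrow> 'm" and sm' :: "'k \<Rightarrow> 'n::ab_group_add \<Rightarrow> 'n"
  assumes "kspace S sm" "kspace S' sm'" "kspace.has_dim S sm n" "kspace.has_dim S' sm' m"
    and f: "\<And>x. x \<in> S \<Longrightarrow> f x \<in> S'" "\<And>x y. x \<in> S \<Longrightarrow> y \<in> S \<Longrightarrow> f (x + y) = f x + f y"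
      "\<And>x c. x \<in> S \<Longrightarrow> f (sm c x) = sm' c (f x)" "inj_on f S"
  shows "n \<le> m"
proof -
  interpret A: kspace S sm by fact
  interpret B: kspace S' sm' by fact
  interpret N: kspace "coord_space n :: (nat \<Rightarrow> 'k) set" "\<lambda>c v i. c * v i" by (rule coord_kspace)
  obtain g where g: "A.lin g" "bij_betw g S (coord_space n)" using assms(3) A.has_dim_def by blast
  obtain g' where g': "B.lin g'" "bij_betw g' S' (coord_space m)" using assms(4) B.has_dim_def by blast
  define i where "i = inv_into S g"
  have iS: "i v \<in> S" and gi: "g (i v) = v" if "v \<in> coord_space n" for v
    using g(2) that unfolding i_def bij_betw_def by (auto simp: inv_into_into f_inv_into_f)
  have ieq: "i v = x" if "x \<in> S" "g x = v" for v x
    using g(2) that unfolding i_def bij_betw_def by (metis inv_into_f_f)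
  have i_add: "i (v + w) = i v + i w" if "v \<in> coord_space n" "w \<in> coord_space n" for v w
    using g(1) iS[OF that(1)] iS[OF that(2)] gi[OF that(1)] gi[OF that(2)]
    by (intro ieq A.add) (auto simp: A.lin_def)
  have i_sm: "i (\<lambda>j. c * v j) = sm c (i v)" if "v \<in> coord_space n" for v c
    using g(1) iS[OF that] gi[OF that] by (intro ieq A.sm) (auto simp: A.lin_def)
  show ?thesis
  proof (rule coord_space_le)
    show "N.lin (\<lambda>v. g' (f (i v)))"
      unfolding N.lin_def using g'(1) f iS by (auto simp: i_add i_sm B.lin_def)
    show "inj_on (\<lambda>v. g' (f (i v))) (coord_space n)"
      using g'(2) f(1,4) iS gi unfolding bij_betw_def by (auto simp: inj_on_def) metis
    show "(\<lambda>v. g' (f (i v))) ` coord_space n \<subseteq> coord_space m"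
      using g'(2) f(1) iS unfolding bij_betw_def by auto
  qed
qed

lemma has_dim_unique:
  assumes "kspace S sm" "kspace.has_dim S sm n" "kspace.has_dim S sm m"
  shows "n = m"
  using has_dim_le[OF assms(1,1,2,3), of "\<lambda>x. x"] has_dim_le[OF assms(1,1,3,2), of "\<lambda>x. x"]
  by (simp add: inj_on_def)

text \<open>P is p followed by coordinates on Q. Preimages of the unit vectors give a linear section
  \<open>sec\<close> of P, and each x in B is f (t x) + \<open>sec (P x)\<close>. The coordinates of
  t x, followed by those of p x, identify B with a coordinate space of dimension a + q.\<close>

lemma has_dim_exact:
  fixes sa :: "'k::field \<Rightarrow> 'm::ab_group_add \<Rightarrow> 'm" and sb :: "'k \<Rightarrow> 'n::ab_group_add \<Rightarrow> 'n"
    and sq :: "'k \<Rightarrow> 'q::ab_group_add \<Rightarrow> 'q"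
  assumes A: "kspace A sa" and B: "kspace B sb" and Q: "kspace Q sq"
    and dA: "kspace.has_dim A sa a" and dQ: "kspace.has_dim Q sq q"
    and f: "\<And>x. x \<in> A \<Longrightarrow> f x \<in> B" "\<And>x y. x \<in> A \<Longrightarrow> y \<in> A \<Longrightarrow> f (x + y) = f x + f y"
      "\<And>x c. x \<in> A \<Longrightarrow> f (sa c x) = sb c (f x)" "inj_on f A"
    and p: "\<And>x. x \<in> B \<Longrightarrow> p x \<in> Q" "\<And>x y. x \<in> B \<Longrightarrow> y \<in> B \<Longrightarrow> p (x + y) = p x + p y"
      "\<And>x c. x \<in> B \<Longrightarrow> p (sb c x) = sq c (p x)" "p ` B = Q"
    and ex: "f ` A = {x \<in> B. p x = 0}"
  shows "kspace.has_dim B sb (a + q)"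
proof -
  interpret A: kspace A sa by fact
  interpret B: kspace B sb by fact
  interpret Q: kspace Q sq by fact
  obtain ga where ga: "A.lin ga" "bij_betw ga A (coord_space a)" using dA A.has_dim_def by blast
  obtain gq where gq: "Q.lin gq" "bij_betw gq Q (coord_space q)" using dQ Q.has_dim_def by blast
  define P where "P x = gq (p x)" for x
  have Plin: "B.lin P" unfolding B.lin_def P_def using gq(1) p by (auto simp: Q.lin_def)
  have Pim: "P ` B = coord_space q"
    using p(4) gq(2) unfolding P_def bij_betw_def by (simp add: image_image[symmetric])
  have Pker: "P x = 0 \<longleftrightarrow> x \<in> f ` A" if "x \<in> B" for x
  proof -
    have "gq (p x) = 0 \<longleftrightarrow> p x = 0"
      using gq that p(1) Q.lin_zero Q.zero unfolding bij_betw_def inj_on_def by metis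
    then show ?thesis using ex that by (auto simp: P_def)
  qed
  have "\<forall>i. \<exists>x. i < q \<longrightarrow> x \<in> B \<and> P x = (\<lambda>j. if j = i then 1 else 0)"
  proof safe
    fix i
    show "\<exists>x. i < q \<longrightarrow> x \<in> B \<and> P x = (\<lambda>j. if j = i then 1 else 0)"
    proof (cases "i < q")
      case True
      then have "(\<lambda>j. if j = i then 1 else 0) \<in> P ` B" unfolding Pim by (auto simp: coord_space_def)
      then show ?thesis by (auto simp: image_iff)
    qed simp
  qed
  then obtain s where s: "\<And>i. i < q \<Longrightarrow> s i \<in> B" "\<And>i. i < q \<Longrightarrow> P (s i) = (\<lambda>j. if j = i then 1 else 0)" by metis
  define sec where "sec v = (\<Sum>i<q. sb (v i) (s i))" for v
  have secB: "sec v \<in> B" for v unfolding sec_def using s by (intro B.sum_in B.sm) auto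
  have sec_add: "sec (v + w) = sec v + sec w" for v w
    unfolding sec_def using s by (simp add: B.add_sm sum.distrib)
  have sec_sm: "sec (\<lambda>i. c * v i) = sb c (sec v)" for c v
    unfolding sec_def using s by (subst B.sm_sum) (auto simp: B.sm_sm B.sm)
  have Psec: "P (sec v) = v" if v: "v \<in> coord_space q" for v
  proof -
    have "P (sec v) = (\<Sum>i<q. (\<lambda>j. v i * (if j = i then 1 else 0)))"
    proof -
      have "P (sec v) = (\<Sum>i<q. P (sb (v i) (s i)))"
        unfolding sec_def using s by (intro B.lin_sum[OF Plin] B.sm) auto
      also have "\<dots> = (\<Sum>i<q. (\<lambda>j. v i * (if j = i then 1 else 0)))"
      proof (intro sum.cong refl)
        fix i assume "i \<in> {..<q}"
        then show "P (sb (v i) (s i)) = (\<lambda>j. v i * (if j = i then 1 else 0))"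
          using B.lin_sm[OF Plin s(1), of i "v i"] s(2)[of i] by simp
      qed
      finally show ?thesis .
    qed
    then show ?thesis using coord_expand[OF v] by simp
  qed
  define fi where "fi = inv_into A f"
  have fi: "fi y \<in> A" "f (fi y) = y" if "y \<in> f ` A" for y
    using that unfolding fi_def by (auto simp: inv_into_into f_inv_into_f)
  have fi_eq: "fi (f x) = x" if "x \<in> A" for x using that f(4) unfolding fi_def by simp
  define r where "r x = x - sec (P x)" for x
  have r: "r x \<in> f ` A" if "x \<in> B" for x
  proof -
    have "r x \<in> B" unfolding r_def using that secB B.diff by blast
    moreover have "P (r x) = 0"
      unfolding r_def using B.lin_diff[OF Plin that secB] Psec[of "P x"] imageI[OF that, of P] Pim by simp
    ultimately show ?thesis using Pker by blast
  qed
  have r_add: "r (x + y) = r x + r y" if "x \<in> B" "y \<in> B" for x y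
    using that Plin unfolding r_def B.lin_def by (simp add: sec_add)
  have r_sm: "r (sb c x) = sb c (r x)" if "x \<in> B" for c x
  proof -
    have "sb c (r x + sec (P x)) = sb c (r x) + sb c (sec (P x))"
      using B.sm_add r[OF that] ex secB by auto
    then have "sb c x = sb c (r x) + sb c (sec (P x))" by (simp add: r_def)
    moreover have "r (sb c x) = sb c x - sb c (sec (P x))"
      unfolding r_def B.lin_sm[OF Plin that] sec_sm ..
    ultimately show ?thesis by (metis add_diff_cancel_right')
  qed
  have fi_add: "fi (x + y) = fi x + fi y" if "x \<in> f ` A" "y \<in> f ` A" for x y
    using fi[OF that(1)] fi[OF that(2)] f(2) fi_eq A.add by metis
  have fi_sm: "fi (sb c x) = sa c (fi x)" if "x \<in> f ` A" for c x
    using fi[OF that] f(3) fi_eq A.sm by metis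
  define t where "t x = fi (r x)" for x
  have tA: "t x \<in> A" if "x \<in> B" for x unfolding t_def using fi r that by blast
  have decomp: "x = f (t x) + sec (P x)" if "x \<in> B" for x
    unfolding t_def using fi(2)[OF r[OF that]] by (simp add: r_def)
  define G where "G x = (\<lambda>i. if i < a then ga (t x) i else if i < a + q then P x (i - a) else 0)" for x
  have "B.lin G"
    unfolding B.lin_def
  proof safe
    fix x y assume x: "x \<in> B" and y: "y \<in> B"
    have "t (x + y) = t x + t y" unfolding t_def using x y r fi_add by (simp add: r_add)
    then show "G (x + y) = G x + G y"
      using ga(1) tA[OF x] tA[OF y] Plin x y by (auto simp: G_def A.lin_def B.lin_def fun_eq_iff)
  next
    fix x c assume x: "x \<in> B"
    have "t (sb c x) = sa c (t x)" unfolding t_def using x r fi_sm by (simp add: r_sm)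
    then show "G (sb c x) = (\<lambda>i. c * G x i)"
      using ga(1) tA[OF x] Plin x by (auto simp: G_def A.lin_def B.lin_def fun_eq_iff)
  qed
  moreover have "inj_on G B"
  proof (rule B.inj_if_kernel[OF \<open>B.lin G\<close>])
    fix x assume x: "x \<in> B" and G0: "G x = 0"
    have a0: "ga (t x) i = 0" for i
    proof (cases "i < a")
      case True then show ?thesis using fun_cong[OF G0, of i] by (simp add: G_def)
    next
      case False
      have "ga (t x) \<in> coord_space a" using ga(2) tA[OF x] by (auto simp: bij_betw_def)
      then show ?thesis using False by (auto simp: coord_space_def)
    qed
    have p0: "P x i = 0" for i
    proof (cases "i < q")
      case True then show ?thesis using fun_cong[OF G0, of "a + i"] by (simp add: G_def)
    next
      case False
      have "P x \<in> coord_space q" using Pim x by auto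
      then show ?thesis using False by (auto simp: coord_space_def)
    qed
    have "ga (t x) = ga 0" using a0 A.lin_zero[OF ga(1)] by (auto simp: fun_eq_iff)
    then have "t x = 0" using ga(2) tA[OF x] A.zero by (auto simp: bij_betw_def inj_on_def)
    moreover have "f 0 = 0" using f(2)[OF A.zero A.zero] by simp
    moreover have "sec (P x) = 0" unfolding sec_def using p0 s by (simp add: B.sm_zero_left)
    ultimately show "x = 0" using decomp[OF x] by simp
  qed
  moreover have "G ` B = coord_space (a + q)"
  proof
    show "G ` B \<subseteq> coord_space (a + q)" by (auto simp: G_def coord_space_def)
    show "coord_space (a + q) \<subseteq> G ` B"
    proof
      fix v :: "nat \<Rightarrow> 'k" assume v: "v \<in> coord_space (a + q)"
      define v1 v2 where "v1 = (\<lambda>i. if i < a then v i else 0)" and "v2 = (\<lambda>i. v (a + i))"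
      have v1: "v1 \<in> coord_space a" and v2: "v2 \<in> coord_space q"
        using v by (auto simp: v1_def v2_def coord_space_def)
      obtain y where y: "y \<in> A" "ga y = v1" using v1 ga(2) unfolding bij_betw_def by (metis imageE)
      define x where "x = f y + sec v2"
      have fy: "f y \<in> B" "P (f y) = 0" using f(1) y Pker by auto
      have xB: "x \<in> B" unfolding x_def using fy secB B.add by blast
      have Px: "P x = v2" unfolding x_def using Plin fy secB Psec[OF v2] by (simp add: B.lin_def)
      have "r x = f y" unfolding r_def Px by (simp add: x_def)
      then have tx: "t x = y" unfolding t_def using fi_eq y by simp
      have "G x i = v i" for i
        using v unfolding G_def tx Px y(2) by (auto simp: v1_def v2_def coord_space_def)
      then show "v \<in> G ` B" using xB by (metis ext image_eqI)
    qed
  qed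
  ultimately show ?thesis unfolding B.has_dim_def bij_betw_def by blast
qed

section \<open>Modules and the Grothendieck group\<close>

context kspace
begin

lemma sum_sm: "x \<in> S \<Longrightarrow> sm (\<Sum>i\<in>A. c i) x = (\<Sum>i\<in>A. sm (c i) x)"
  by (induction A rule: infinite_finite_induct) (auto simp: sm_zero_left add_sm)

lemma subspace_kspace:
  assumes "U \<subseteq> S" "0 \<in> U" "\<And>x y. x \<in> U \<Longrightarrow> y \<in> U \<Longrightarrow> x + y \<in> U" "\<And>c x. x \<in> U \<Longrightarrow> sm c x \<in> U"
  shows "kspace U sm"
proof -
  have "x \<in> S" if "x \<in> U" for x using that assms(1) by blast
  then show ?thesis using assms(2-4) sm_add add_sm sm_sm sm_one by unfold_locales auto
qed

lemma family_to_set: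
  assumes "finite P" "\<And>p. p \<in> P \<Longrightarrow> w p \<in> S"
  shows "\<exists>d. (\<Sum>p\<in>P. sm (c p) (w p)) = (\<Sum>b\<in>w ` P. sm (d b) b)"
proof -
  have "(\<Sum>p\<in>P. sm (c p) (w p)) = (\<Sum>b\<in>w ` P. \<Sum>p\<in>{p \<in> P. w p = b}. sm (c p) (w p))"
    by (rule sum.image_gen[OF assms(1)])
  also have "\<dots> = (\<Sum>b\<in>w ` P. sm (\<Sum>p\<in>{p \<in> P. w p = b}. c p) b)"
    using assms(2) by (intro sum.cong refl) (auto simp: sum_sm)
  finally show ?thesis by (intro exI[of _ "\<lambda>b. \<Sum>p\<in>{p \<in> P. w p = b}. c p"])
qed

text \<open>A maximal independent subset of the image of U in coordinates is finite, because the
  coordinate space is spanned by n vectors; it is pulled back to U.\<close>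

lemma finite_spanning_subset:
  assumes dim: "has_dim n" and U: "U \<subseteq> S" "0 \<in> U" "\<And>x y. x \<in> U \<Longrightarrow> y \<in> U \<Longrightarrow> x + y \<in> U" "\<And>c x. x \<in> U \<Longrightarrow> sm c x \<in> U"
  shows "\<exists>B. finite B \<and> B \<subseteq> U \<and> (\<forall>x\<in>U. \<exists>c. x = (\<Sum>b\<in>B. sm (c b) b))"
proof -
  obtain g where g: "lin g" "bij_betw g S (coord_space n)" using dim has_dim_def by blast
  have inj: "inj_on g S" using g(2) by (simp add: bij_betw_def)
  obtain B0 where B0: "B0 \<subseteq> g ` U" "nat_fun.independent B0" "g ` U \<subseteq> nat_fun.span B0"
    using nat_fun.maximal_independent_subset by blast
  have gU: "g ` U \<subseteq> coord_space n" using g(2) U(1) by (auto simp: bij_betw_def)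
  have "B0 \<subseteq> nat_fun.span ((\<lambda>i j. if j = i then 1 else 0) ` {..<n})"
    using B0(1) gU coord_space_span[of n] by blast
  then have fin: "finite B0" using nat_fun.independent_span_bound[OF _ B0(2)] by blast
  define h where "h = inv_into U g"
  have h: "h b \<in> U" "g (h b) = b" if "b \<in> B0" for b
    using that B0(1) unfolding h_def by (auto simp: inv_into_into f_inv_into_f)
  have "\<exists>c. x = (\<Sum>b\<in>h ` B0. sm (c b) b)" if x: "x \<in> U" for x
  proof -
    have "g x \<in> nat_fun.span ((\<lambda>b. b) ` B0)" using x B0(3) by auto
    then obtain c where c: "g x = (\<Sum>b\<in>B0. (\<lambda>t. c b * b t))" using nat_fun.span_family[OF fin] by blast
    have hS: "h b \<in> S" if "b \<in> B0" for b using h(1)[OF that] U(1) by blast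
    have "g (\<Sum>b\<in>B0. sm (c b) (h b)) = (\<Sum>b\<in>B0. g (sm (c b) (h b)))"
      using hS sm by (intro lin_sum[OF g(1)]) auto
    also have "\<dots> = g x" unfolding c
    proof (intro sum.cong refl)
      fix b assume b: "b \<in> B0"
      show "g (sm (c b) (h b)) = (\<lambda>t. c b * b t)"
        unfolding lin_sm[OF g(1) hS[OF b]] h(2)[OF b] ..
    qed
    finally have "g (\<Sum>b\<in>B0. sm (c b) (h b)) = g x" .
    then have "(\<Sum>b\<in>B0. sm (c b) (h b)) = x"
      using inj x U(1) hS sm sum_in[of B0 "\<lambda>b. sm (c b) (h b)"] by (auto simp: inj_on_def)
    then show ?thesis using family_to_set[where w = h and P = B0 and c = c, OF fin hS] by simp
  qed
  then show ?thesis using fin h(1) by (intro exI[of _ "h ` B0"]) auto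
qed

lemma has_dim_0: "has_dim 0 \<longleftrightarrow> S = {0}"
proof
  have c0: "coord_space 0 = {0::nat \<Rightarrow> 'k}" by (auto simp: coord_space_def)
  show "S = {0}" if "has_dim 0"
  proof -
    obtain g where g: "bij_betw g S (coord_space 0 :: (nat \<Rightarrow> 'k) set)" using \<open>has_dim 0\<close> has_dim_def by blast
    have g0: "g x = 0" if "x \<in> S" for x using g that unfolding bij_betw_def c0 by blast
    have "x = 0" if "x \<in> S" for x
      using g g0[OF that] g0[OF zero] inj_onD[of g S x 0] that zero unfolding bij_betw_def by simp
    then show ?thesis using zero by auto
  qed
  assume S: "S = {0}"
  have "lin (\<lambda>_. 0)" by (auto simp: lin_def fun_eq_iff)
  moreover have "bij_betw (\<lambda>_. 0) S {0::nat \<Rightarrow> 'k}" by (auto simp: S bij_betw_def)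
  ultimately show "has_dim 0" unfolding has_dim_def c0 by blast
qed

end

section \<open>Right modules, submodules and images\<close>

lemma right_moduleD:
  assumes M: "right_module M"
  shows rm_zero: "0 \<in> mcarrier M" and rm_neg: "\<And>x. x \<in> mcarrier M \<Longrightarrow> - x \<in> mcarrier M"
    and rm_add: "\<And>x y. x \<in> mcarrier M \<Longrightarrow> y \<in> mcarrier M \<Longrightarrow> x + y \<in> mcarrier M"
    and rm_act: "\<And>x a. x \<in> mcarrier M \<Longrightarrow> mact M x a \<in> mcarrier M"
    and rm_act_add: "\<And>x y a. x \<in> mcarrier M \<Longrightarrow> y \<in> mcarrier M \<Longrightarrow> mact M (x + y) a = mact M x a + mact M y a"
    and rm_act_add_right: "\<And>x a b. x \<in> mcarrier M \<Longrightarrow> mact M x (a + b) = mact M x a + mact M x b"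
    and rm_act_mult: "\<And>x a b. x \<in> mcarrier M \<Longrightarrow> mact M x (a * b) = mact M (mact M x a) b"
    and rm_act_one: "\<And>x. x \<in> mcarrier M \<Longrightarrow> mact M x 1 = x"
    and rm_act_zero: "\<And>a. mact M 0 a = 0" and rm_act_zero_right: "\<And>x. x \<in> mcarrier M \<Longrightarrow> mact M x 0 = 0"
    and rm_diff: "\<And>x y. x \<in> mcarrier M \<Longrightarrow> y \<in> mcarrier M \<Longrightarrow> x - y \<in> mcarrier M"
    and rm_act_neg: "\<And>x a. x \<in> mcarrier M \<Longrightarrow> mact M (- x) a = - mact M x a"
proof -
  show z: "0 \<in> mcarrier M" and n: "\<And>x. x \<in> mcarrier M \<Longrightarrow> - x \<in> mcarrier M"
    and a: "\<And>x y. x \<in> mcarrier M \<Longrightarrow> y \<in> mcarrier M \<Longrightarrow> x + y \<in> mcarrier M"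
    and "\<And>x a. x \<in> mcarrier M \<Longrightarrow> mact M x a \<in> mcarrier M"
    and aa: "\<And>x y a. x \<in> mcarrier M \<Longrightarrow> y \<in> mcarrier M \<Longrightarrow> mact M (x + y) a = mact M x a + mact M y a"
    and ar: "\<And>x a b. x \<in> mcarrier M \<Longrightarrow> mact M x (a + b) = mact M x a + mact M x b"
    and "\<And>x a b. x \<in> mcarrier M \<Longrightarrow> mact M x (a * b) = mact M (mact M x a) b"
    and "\<And>x. x \<in> mcarrier M \<Longrightarrow> mact M x 1 = x"
    using M unfolding right_module_def by auto
  show az: "mact M 0 a = 0" for a using aa[OF z z, of a] by simp
  show "mact M x 0 = 0" if "x \<in> mcarrier M" for x using ar[OF that, of 0 0] by simp
  show "x - y \<in> mcarrier M" if "x \<in> mcarrier M" "y \<in> mcarrier M" for x y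
    using a[OF that(1) n[OF that(2)]] by simp
  show "mact M (- x) a = - mact M x a" if "x \<in> mcarrier M" for x a
    using aa[OF that n[OF that], of a] az by (simp add: eq_neg_iff_add_eq_0 add.commute)
qed

lemma rmodule_homD:
  assumes "rmodule_hom M N f"
  shows "\<And>x. x \<in> mcarrier M \<Longrightarrow> f x \<in> mcarrier N"
    "\<And>x y. x \<in> mcarrier M \<Longrightarrow> y \<in> mcarrier M \<Longrightarrow> f (x + y) = f x + f y"
    "\<And>x a. x \<in> mcarrier M \<Longrightarrow> f (mact M x a) = mact N (f x) a"
  using assms unfolding rmodule_hom_def by auto

lemma rmodule_iso_sym:
  assumes "right_module M" "rmodule_iso M N"
  shows "rmodule_iso N M"
proof -
  obtain f where f: "rmodule_hom M N f" "bij_betw f (mcarrier M) (mcarrier N)"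
    using assms(2) by (auto simp: rmodule_iso_def)
  define g where "g = inv_into (mcarrier M) f"
  have g: "g y \<in> mcarrier M" "f (g y) = y" if "y \<in> mcarrier N" for y
    using that f(2) unfolding g_def bij_betw_def by (auto simp: inv_into_into f_inv_into_f)
  have geq: "g y = x" if "x \<in> mcarrier M" "f x = y" for x y
    using that f(2) unfolding g_def bij_betw_def by (metis inv_into_f_f)
  have "rmodule_hom N M g" unfolding rmodule_hom_def
  proof (intro conjI ballI allI)
    fix x y assume "x \<in> mcarrier N" "y \<in> mcarrier N"
    then show "g (x + y) = g x + g y"
      using g rm_add[OF assms(1)] rmodule_homD[OF f(1)] by (intro geq) auto
  next
    fix x a assume "x \<in> mcarrier N"
    then show "g (mact N x a) = mact M (g x) a"
      using g rm_act[OF assms(1)] rmodule_homD[OF f(1)] by (intro geq) auto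
  qed (use g in auto)
  moreover have "bij_betw g (mcarrier N) (mcarrier M)" unfolding g_def by (rule bij_betw_inv_into[OF f(2)])
  ultimately show ?thesis by (auto simp: rmodule_iso_def)
qed

lemma submodule:
  assumes M: "right_module M" and U: "U \<subseteq> mcarrier M" "0 \<in> U" "\<And>x y. x \<in> U \<Longrightarrow> y \<in> U \<Longrightarrow> x + y \<in> U"
    "\<And>x a. x \<in> U \<Longrightarrow> mact M x a \<in> U"
  shows "right_module (M\<lparr>mcarrier := U\<rparr>)"
proof -
  have "- x \<in> U" if x: "x \<in> U" for x
  proof -
    have xM: "x \<in> mcarrier M" using x U(1) by blast
    have "mact M x (1 + (- 1)) = mact M x 1 + mact M x (- 1)" by (rule rm_act_add_right[OF M xM])
    then have "mact M x (- 1) = - x"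
      using rm_act_one[OF M xM] rm_act_zero_right[OF M xM] by (simp add: eq_neg_iff_add_eq_0 add.commute)
    then show ?thesis using U(4)[OF x, of "- 1"] by simp
  qed
  then show ?thesis unfolding right_module_def using U right_moduleD[OF M] by (auto dest!: subsetD[OF U(1)])
qed

text \<open>Stands in for a quotient module: g is to be additive with a submodule as kernel, and its
  image receives the action through arbitrary preimages. In this way quotients are realised in any
  target group.\<close>

definition pushmod :: "('a, 'm) rmodule \<Rightarrow> ('m \<Rightarrow> 'n) \<Rightarrow> ('a, 'n) rmodule" where
  "pushmod M g = \<lparr>mcarrier = g ` mcarrier M, mact = (\<lambda>y a. g (mact M (inv_into (mcarrier M) g y) a))\<rparr>"

lemma pushmod:
  assumes M: "right_module M" and g: "\<And>x y. x \<in> mcarrier M \<Longrightarrow> y \<in> mcarrier M \<Longrightarrow> g (x + y) = g x + g y"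
    and ker: "\<And>x a. x \<in> mcarrier M \<Longrightarrow> g x = 0 \<Longrightarrow> g (mact M x a) = 0"
  shows "right_module (pushmod M g)" "rmodule_hom M (pushmod M g) g"
    "x \<in> mcarrier M \<Longrightarrow> mact (pushmod M g) (g x) a = g (mact M x a)"
proof -
  note m = right_moduleD[OF M]
  have gz: "g 0 = 0" using g[OF m(1) m(1)] by simp
  have gn: "g (- x) = - g x" if "x \<in> mcarrier M" for x
    using g[OF that m(2)[OF that]] gz by (simp add: eq_neg_iff_add_eq_0 add.commute)
  have act: "mact (pushmod M g) (g x) a = g (mact M x a)" if x: "x \<in> mcarrier M" for x a
  proof -
    define y where "y = inv_into (mcarrier M) g (g x)"
    have y: "y \<in> mcarrier M" "g y = g x" unfolding y_def using x by (auto simp: inv_into_into f_inv_into_f)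
    have "g (y + - x) = 0" using g[OF y(1) m(2)[OF x]] gn[OF x] y(2) by simp
    then have "g (mact M (y + - x) a) = 0" using ker m(3)[OF y(1) m(2)[OF x]] by blast
    moreover have "mact M (y + - x) a = mact M y a + - mact M x a"
      by (simp only: m(5)[OF y(1) m(2)[OF x]] m(12)[OF x])
    ultimately have "g (mact M y a) = g (mact M x a)"
      using g[OF m(4)[OF y(1)] m(2)[OF m(4)[OF x]], of a a] gn[OF m(4)[OF x], of a] by simp
    then show ?thesis unfolding pushmod_def y_def by simp
  qed
  then show "x \<in> mcarrier M \<Longrightarrow> mact (pushmod M g) (g x) a = g (mact M x a)" .
  have car: "mcarrier (pushmod M g) = g ` mcarrier M" by (simp add: pushmod_def)
  show "rmodule_hom M (pushmod M g) g" unfolding rmodule_hom_def car using g act by auto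
  show "right_module (pushmod M g)"
    unfolding right_module_def car
  proof (safe)
    show "0 \<in> g ` mcarrier M" using gz m(1) by (metis image_eqI)
  next
    fix x assume "x \<in> mcarrier M" then show "- g x \<in> g ` mcarrier M" using gn m(2) by (metis image_eqI)
  next
    fix x y assume "x \<in> mcarrier M" "y \<in> mcarrier M"
    then show "g x + g y \<in> g ` mcarrier M" using g m(3) by (metis image_eqI)
  next
    fix x y a assume x: "x \<in> mcarrier M" and y: "y \<in> mcarrier M"
    show "mact (pushmod M g) (g x + g y) a = mact (pushmod M g) (g x) a + mact (pushmod M g) (g y) a"
      unfolding g[OF x y, symmetric] act[OF m(3)[OF x y]] act[OF x] act[OF y] m(5)[OF x y]
      by (rule g[OF m(4)[OF x] m(4)[OF y]])
  qed (use act m g in auto)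
qed

section \<open>The dimension of M e for finite-dimensional modules M\<close>

locale field_algebra = assoc_algebra scale
  for scale :: "'k::field \<Rightarrow> 'a::ring_1 \<Rightarrow> 'a" (infixr \<open>*s\<close> 75)
begin

definition smul :: "('a, 'm::ab_group_add) rmodule \<Rightarrow> 'k \<Rightarrow> 'm \<Rightarrow> 'm" where
  "smul M c x = mact M x (c *s 1)"

text \<open>For an idempotent e this is M e, written as a fixed-point set so that it is visibly a
  subspace.\<close>

definition epart :: "('a, 'm::ab_group_add) rmodule \<Rightarrow> 'a \<Rightarrow> 'm set" where
  "epart M e = {x \<in> mcarrier M. mact M x e = x}"

definition edim :: "('a, 'm::ab_group_add) rmodule \<Rightarrow> 'a \<Rightarrow> nat" where
  "edim M e = (THE n. kspace.has_dim (epart M e) (smul M) n)"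

lemma kspace_carrier: "right_module M \<Longrightarrow> kspace (mcarrier M) (smul M)"
proof
  assume M: "right_module M"
  note m = right_moduleD[OF M]
  fix c d :: 'k and x
  assume x: "x \<in> mcarrier M"
  have "(c * d) *s 1 = (d *s 1) * (c *s 1)" by (simp add: scale_mult_left scale_mult_right mult.commute)
  then show "smul M (c * d) x = smul M c (smul M d x)"
    unfolding smul_def using m x by simp
qed (auto simp: smul_def right_moduleD scale_left_distrib)

lemma smul_act: "right_module M \<Longrightarrow> x \<in> mcarrier M \<Longrightarrow> mact M (smul M c x) a = smul M c (mact M x a)"
proof -
  assume M: "right_module M" and x: "x \<in> mcarrier M"
  have "mact M x ((c *s 1) * a) = mact M x (a * (c *s 1))" by (simp add: scale_mult_left scale_mult_right)
  then show ?thesis unfolding smul_def using right_moduleD[OF M] x by simp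
qed

lemma kspace_epart: "right_module M \<Longrightarrow> kspace (epart M e) (smul M)"
proof -
  assume M: "right_module M"
  interpret kspace "mcarrier M" "smul M" by (rule kspace_carrier[OF M])
  show ?thesis
    using right_moduleD[OF M] smul_act[OF M] sm
    by (intro subspace_kspace) (auto simp: epart_def)
qed

lemma fd_moduleD: "fd_module scale M \<Longrightarrow> right_module M"
  by (simp add: fd_module_def)

lemma fd_module_span:
  "fd_module scale M \<Longrightarrow> \<exists>B. finite B \<and> B \<subseteq> mcarrier M \<and> (\<forall>x\<in>mcarrier M. \<exists>c. x = (\<Sum>b\<in>B. smul M (c b) b))"
  by (simp add: fd_module_def smul_def)

lemma fd_moduleI:
  assumes M: "right_module M" and P: "finite P" "\<And>p. p \<in> P \<Longrightarrow> w p \<in> mcarrier M"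
    and "\<And>x. x \<in> mcarrier M \<Longrightarrow> \<exists>c. x = (\<Sum>p\<in>P. smul M (c p) (w p))"
  shows "fd_module scale M"
proof -
  interpret kspace "mcarrier M" "smul M" by (rule kspace_carrier[OF M])
  have "\<exists>c. x = (\<Sum>b\<in>w ` P. smul M (c b) b)" if x: "x \<in> mcarrier M" for x
  proof -
    obtain c where "x = (\<Sum>p\<in>P. smul M (c p) (w p))" using assms(4)[OF x] by blast
    then show ?thesis using family_to_set[where w = w and P = P and c = c, OF P] by simp
  qed
  then show ?thesis unfolding fd_module_def using M P unfolding smul_def
    by (intro conjI exI[of _ "w ` P"]) auto
qed

lemma fd_has_dim:
  assumes "fd_module scale M" "e * e = e"
  shows "kspace.has_dim (epart M e) (smul M) (edim M e)"
proof -
  have M: "right_module M" using fd_moduleD assms by blast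
  interpret E: kspace "epart M e" "smul M" by (rule kspace_epart[OF M])
  interpret K: kspace "mcarrier M" "smul M" by (rule kspace_carrier[OF M])
  obtain B where B: "finite B" "B \<subseteq> mcarrier M" "\<And>x. x \<in> mcarrier M \<Longrightarrow> \<exists>c. x = (\<Sum>b\<in>B. smul M (c b) b)"
    using fd_module_span[OF assms(1)] by blast
  have act_sum: "mact M (sum h A) e = (\<Sum>i\<in>A. mact M (h i) e)" if "\<And>i. i \<in> A \<Longrightarrow> h i \<in> mcarrier M" for h and A :: "'b set"
    using that by (induction A rule: infinite_finite_induct) (auto simp: right_moduleD[OF M] K.sum_in)
  have "\<exists>n. E.has_dim n"
  proof (rule E.has_dim_exists[of B "\<lambda>b. mact M b e"])
    fix b assume "b \<in> B"
    then show "mact M b e \<in> epart M e"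
      using B(2) right_moduleD[OF M] assms(2) unfolding epart_def by (auto simp flip: rm_act_mult[OF M])
  next
    fix x assume x: "x \<in> epart M e"
    then obtain c where c: "x = (\<Sum>b\<in>B. smul M (c b) b)" using B(3) by (auto simp: epart_def)
    have "x = mact M x e" using x by (simp add: epart_def)
    also have "\<dots> = (\<Sum>b\<in>B. mact M (smul M (c b) b) e)"
      unfolding c using B(2) K.sm by (intro act_sum) auto
    also have "\<dots> = (\<Sum>b\<in>B. smul M (c b) (mact M b e))"
      using B(2) smul_act[OF M] by (intro sum.cong) auto
    finally show "\<exists>c. x = (\<Sum>b\<in>B. smul M (c b) (mact M b e))" by blast
  qed (rule B(1))
  then obtain n where n: "E.has_dim n" by blast
  moreover have "edim M e = n"
    unfolding edim_def using n has_dim_unique[OF E.kspace_axioms] by blast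
  ultimately show ?thesis by simp
qed

lemma hom_smul: "rmodule_hom M N f \<Longrightarrow> x \<in> mcarrier M \<Longrightarrow> f (smul M c x) = smul N c (f x)"
  by (simp add: smul_def rmodule_homD)

lemma edim_iso:
  assumes "fd_module scale M" "fd_module scale N" "rmodule_iso M N" "e * e = e"
  shows "edim M e = edim N e"
proof -
  have le: "edim M e \<le> edim N e" if MN: "fd_module scale M" "fd_module scale N" "rmodule_iso M N"
    for M :: "('a, 'm::ab_group_add) rmodule" and N :: "('a, 'n::ab_group_add) rmodule"
  proof -
    obtain f where f: "rmodule_hom M N f" "bij_betw f (mcarrier M) (mcarrier N)"
      using MN by (auto simp: rmodule_iso_def)
    show ?thesis
    proof (rule has_dim_le[OF kspace_epart kspace_epart fd_has_dim fd_has_dim])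
      show "inj_on f (epart M e)" using f(2) by (auto simp: bij_betw_def epart_def inj_on_def)
      fix x assume x: "x \<in> epart M e"
      show "f x \<in> epart N e" using x rmodule_homD[OF f(1)] by (auto simp: epart_def) metis
      show "f (x + y) = f x + f y" if "y \<in> epart M e" for y
        using x that rmodule_homD[OF f(1)] by (auto simp: epart_def)
      show "f (smul M c x) = smul N c (f x)" for c using x hom_smul[OF f(1)] by (auto simp: epart_def)
    qed (use MN assms fd_moduleD in auto)
  qed
  show ?thesis
    using le[OF assms(1-3)] le[OF assms(2,1) rmodule_iso_sym[OF fd_moduleD[OF assms(1)] assms(3)]] by simp
qed

text \<open>M |-> M e is exact: multiplication by e projects M onto M e and commutes with
  homomorphisms, so a preimage x of an element fixed by e may be replaced by x e.\<close>

lemma edim_exact: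
  assumes fd: "fd_module scale M'" "fd_module scale M" "fd_module scale M''" and ex: "short_exact M' M M''" and e: "e * e = e"
  shows "edim M e = edim M' e + edim M'' e"
proof -
  obtain f g where f: "rmodule_hom M' M f" "inj_on f (mcarrier M')" and g: "rmodule_hom M M'' g"
    "g ` mcarrier M = mcarrier M''" and fg: "f ` mcarrier M' = {x \<in> mcarrier M. g x = 0}"
    using ex unfolding short_exact_def by blast
  note m = right_moduleD[OF fd_moduleD[OF fd(2)]]
  have ee: "mact M (mact M x e) e = mact M x e" if "x \<in> mcarrier M" for x
    using that e by (simp flip: m(7))
  have "kspace.has_dim (epart M e) (smul M) (edim M' e + edim M'' e)"
  proof (rule has_dim_exact[OF kspace_epart[OF fd_moduleD[OF fd(1)]]
        kspace_epart[OF fd_moduleD[OF fd(2)]] kspace_epart[OF fd_moduleD[OF fd(3)]]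
        fd_has_dim[OF fd(1) e] fd_has_dim[OF fd(3) e], where f = f and p = g])
    show "inj_on f (epart M' e)" using f(2) by (auto simp: epart_def inj_on_def)
    fix x assume x: "x \<in> epart M' e"
    show "f x \<in> epart M e" using x rmodule_homD[OF f(1)] by (auto simp: epart_def) metis
    show "f (x + y) = f x + f y" if "y \<in> epart M' e" for y
      using x that rmodule_homD[OF f(1)] by (auto simp: epart_def)
    show "f (smul M' c x) = smul M c (f x)" for c using x hom_smul[OF f(1)] by (auto simp: epart_def)
  next
    fix x assume x: "x \<in> epart M e"
    show "g x \<in> epart M'' e" using x rmodule_homD[OF g(1)] by (auto simp: epart_def) metis
    show "g (x + y) = g x + g y" if "y \<in> epart M e" for y
      using x that rmodule_homD[OF g(1)] by (auto simp: epart_def)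
    show "g (smul M c x) = smul M'' c (g x)" for c using x hom_smul[OF g(1)] by (auto simp: epart_def)
  next
    show "g ` epart M e = epart M'' e"
    proof
      show "g ` epart M e \<subseteq> epart M'' e" using rmodule_homD[OF g(1)] by (auto simp: epart_def) metis
      show "epart M'' e \<subseteq> g ` epart M e"
      proof
        fix y assume y: "y \<in> epart M'' e"
        then obtain x where x: "x \<in> mcarrier M" "y = g x" using g(2) by (auto simp: epart_def)
        have "g (mact M x e) = y" using rmodule_homD(3)[OF g(1) x(1)] y x by (simp add: epart_def)
        moreover have "mact M x e \<in> epart M e" using ee m x(1) by (simp add: epart_def)
        ultimately show "y \<in> g ` epart M e" by blast
      qed
    qed
    show "f ` epart M' e = {x \<in> epart M e. g x = 0}"
    proof
      show "f ` epart M' e \<subseteq> {x \<in> epart M e. g x = 0}"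
        using fg rmodule_homD[OF f(1)] by (auto simp: epart_def) metis
      show "{x \<in> epart M e. g x = 0} \<subseteq> f ` epart M' e"
      proof
        fix x assume x: "x \<in> {x \<in> epart M e. g x = 0}"
        then have "x \<in> f ` mcarrier M'" unfolding fg by (auto simp: epart_def)
        then obtain y where y: "y \<in> mcarrier M'" "x = f y" by blast
        have "f (mact M' y e) = f y" using rmodule_homD(3)[OF f(1) y(1)] x y by (auto simp: epart_def)
        then have "mact M' y e = y"
          using f(2) y(1) rm_act[OF fd_moduleD[OF fd(1)] y(1)] by (auto simp: inj_on_def)
        then show "x \<in> f ` epart M' e" using y by (auto simp: epart_def)
      qed
    qed
  qed
  then show ?thesis
    using has_dim_unique[OF kspace_epart[OF fd_moduleD[OF fd(2)]] fd_has_dim[OF fd(2) e]] by blast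
qed

lemma edim_eq_0: "fd_module scale M \<Longrightarrow> e * e = e \<Longrightarrow> edim M e = 0 \<longleftrightarrow> (\<forall>x\<in>mcarrier M. mact M x e = 0)"
proof -
  assume fd: "fd_module scale M" and e: "e * e = e"
  note m = right_moduleD[OF fd_moduleD[OF fd]]
  interpret E: kspace "epart M e" "smul M" by (rule kspace_epart[OF fd_moduleD[OF fd]])
  have "edim M e = 0 \<longleftrightarrow> epart M e = {0}"
    using fd_has_dim[OF fd e] has_dim_unique[OF E.kspace_axioms fd_has_dim[OF fd e]] E.has_dim_0 by metis
  also have "\<dots> \<longleftrightarrow> (\<forall>x\<in>mcarrier M. mact M x e = 0)"
  proof
    assume E: "epart M e = {0}"
    have "mact M x e \<in> epart M e" if "x \<in> mcarrier M" for x
      using that m e by (auto simp: epart_def simp flip: m(7))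
    then show "\<forall>x\<in>mcarrier M. mact M x e = 0" using E by auto
  qed (use E.zero in \<open>auto simp: epart_def\<close>)
  finally show ?thesis .
qed

lemma submodule_fd:
  assumes fd: "fd_module scale M" and U: "U \<subseteq> mcarrier M" "0 \<in> U" "\<And>x y. x \<in> U \<Longrightarrow> y \<in> U \<Longrightarrow> x + y \<in> U"
    "\<And>x a. x \<in> U \<Longrightarrow> mact M x a \<in> U"
  shows "fd_module scale (M\<lparr>mcarrier := U\<rparr>)"
proof -
  have M: "right_module M" using fd_moduleD[OF fd] .
  interpret K: kspace "mcarrier M" "smul M" by (rule kspace_carrier[OF M])
  obtain B where B: "finite B" "B \<subseteq> mcarrier M" "\<And>x. x \<in> mcarrier M \<Longrightarrow> \<exists>c. x = (\<Sum>b\<in>B. smul M (c b) b)"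
    using fd_module_span[OF fd] by blast
  obtain n where n: "K.has_dim n" using K.has_dim_exists[OF B(1), of "\<lambda>b. b"] B by blast
  have "smul M c x \<in> U" if "x \<in> U" for c x using U(4) that by (simp add: smul_def)
  from K.finite_spanning_subset[OF n U(1-3) this]
  show ?thesis unfolding fd_module_def using submodule[OF M U] by (simp add: smul_def)
qed

text \<open>Coordinates modulo U map M onto a coordinate space with kernel U. Transporting the
  action along them gives M / U with elements in the type on which K_0 is based.\<close>

lemma quotient_exists:
  fixes M :: "('a, 'm::ab_group_add) rmodule"
  assumes fd: "fd_module scale M" and U: "U \<subseteq> mcarrier M" "0 \<in> U" "\<And>x y. x \<in> U \<Longrightarrow> y \<in> U \<Longrightarrow> x + y \<in> U"
    "\<And>x a. x \<in> U \<Longrightarrow> mact M x a \<in> U"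
  shows "\<exists>(Q :: ('a, nat \<Rightarrow> 'k) rmodule) p. fd_module scale Q \<and> rmodule_hom M Q p \<and>
    p ` mcarrier M = mcarrier Q \<and> (\<forall>x\<in>mcarrier M. p x = 0 \<longleftrightarrow> x \<in> U)"
proof -
  have M: "right_module M" using fd_moduleD[OF fd] .
  interpret K: kspace "mcarrier M" "smul M" by (rule kspace_carrier[OF M])
  obtain B where B: "finite B" "B \<subseteq> mcarrier M" "\<And>x. x \<in> mcarrier M \<Longrightarrow> \<exists>c. x = (\<Sum>b\<in>B. smul M (c b) b)"
    using fd_module_span[OF fd] by blast
  have Usm: "smul M c x \<in> U" if "x \<in> U" for c x using U(4) that by (simp add: smul_def)
  have "\<exists>c. x - (\<Sum>p\<in>B. smul M (c p) p) \<in> U" if "x \<in> mcarrier M" for x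
    using B(3)[OF that] U(2) by (metis cancel_comm_monoid_add_class.diff_cancel)
  then have "\<exists>g n. K.lin g \<and> g ` mcarrier M = coord_space n \<and> (\<forall>x\<in>mcarrier M. g x = 0 \<longleftrightarrow> x \<in> U)"
    using B(2) by (intro K.coordinates_mod[OF U(1-3) Usm B(1), of "\<lambda>b. b"]) auto
  then obtain g :: "'m \<Rightarrow> nat \<Rightarrow> 'k" where g: "K.lin g" "\<And>x. x \<in> mcarrier M \<Longrightarrow> g x = 0 \<longleftrightarrow> x \<in> U"
    by (elim exE conjE) (rule that, assumption, simp)
  have add: "g (x + y) = g x + g y" if "x \<in> mcarrier M" "y \<in> mcarrier M" for x y using g(1) that by (simp add: K.lin_def)
  have ker: "g (mact M x a) = 0" if "x \<in> mcarrier M" "g x = 0" for x a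
    using that g(2) U(4) rm_act[OF M] by blast
  note p = pushmod[OF M add ker]
  have "fd_module scale (pushmod M g)"
  proof (rule fd_moduleI[OF p(1) B(1), of g])
    show "g b \<in> mcarrier (pushmod M g)" if "b \<in> B" for b using that B(2) by (auto simp: pushmod_def)
    fix y assume "y \<in> mcarrier (pushmod M g)"
    then obtain x where x: "x \<in> mcarrier M" "y = g x" by (auto simp: pushmod_def)
    then obtain c where c: "x = (\<Sum>b\<in>B. smul M (c b) b)" using B(3) by blast
    have "g x = (\<Sum>b\<in>B. g (smul M (c b) b))" unfolding c using B(2) K.sm by (intro K.lin_sum[OF g(1)]) auto
    also have "\<dots> = (\<Sum>b\<in>B. smul (pushmod M g) (c b) (g b))"
      using B(2) by (intro sum.cong refl hom_smul[OF p(2)]) auto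
    finally show "\<exists>c. y = (\<Sum>b\<in>B. smul (pushmod M g) (c b) (g b))" using x by auto
  qed
  then show ?thesis using p(2) g(2) by (intro exI[of _ "pushmod M g"] exI[of _ g]) (auto simp: pushmod_def)
qed

lemma realisation_exists:
  assumes "fd_module scale M"
  shows "\<exists>N :: ('a, nat \<Rightarrow> 'k) rmodule. fd_module scale N \<and> rmodule_iso M N"
proof -
  note m = right_moduleD[OF fd_moduleD[OF assms]]
  obtain N :: "('a, nat \<Rightarrow> 'k) rmodule" and p where N: "fd_module scale N" "rmodule_hom M N p" "p ` mcarrier M = mcarrier N"
    "\<And>x. x \<in> mcarrier M \<Longrightarrow> p x = 0 \<longleftrightarrow> x \<in> {0}"
    using quotient_exists[OF assms, of "{0}"] m(1,9) by auto
  have "inj_on p (mcarrier M)"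
  proof (rule inj_onI)
    fix x y assume xy: "x \<in> mcarrier M" "y \<in> mcarrier M" "p x = p y"
    have "p (x - y) + p y = p x" using rmodule_homD(2)[OF N(2) m(11)[OF xy(1,2)] xy(2)] by simp
    then have "p (x - y) = 0" using xy(3) by simp
    then show "x = y" using N(4)[OF m(11)[OF xy(1,2)]] by simp
  qed
  then show ?thesis using N(1-3) unfolding rmodule_iso_def bij_betw_def by blast
qed

section \<open>Relations in the Grothendieck group\<close>

abbreviation "rel \<equiv> K0_relations scale"

lemma rel_neg: "x \<in> rel \<Longrightarrow> - x \<in> rel"
  using K0_relations.diff[OF K0_relations.zero, of x scale] by simp

lemma rel_add: "x \<in> rel \<Longrightarrow> y \<in> rel \<Longrightarrow> x + y \<in> rel"
  using K0_relations.diff[of x scale "- y"] rel_neg[of y] by simp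

text \<open>An isomorphism is a short exact sequence with zero third term, and the zero module Z has
  class 0 because of the sequence Z, Z, Z. The relations are generated with coefficient 1, so a
  general multiple is obtained by adding up and changing sign.\<close>

lemma rel_iso:
  fixes M N :: "('a, nat \<Rightarrow> 'k) rmodule"
  assumes "fd_module scale M" "fd_module scale N" "rmodule_iso M N"
  shows "Poly_Mapping.single M z - Poly_Mapping.single N z \<in> rel"
proof -
  define Z :: "('a, nat \<Rightarrow> 'k) rmodule" where "Z = \<lparr>mcarrier = {0}, mact = \<lambda>_ _. 0\<rparr>"
  have fdZ: "fd_module scale Z" unfolding fd_module_def right_module_def Z_def
    by (auto intro!: exI[of _ "{}"])
  obtain f where f: "rmodule_hom M N f" "bij_betw f (mcarrier M) (mcarrier N)"
    using assms by (auto simp: rmodule_iso_def)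
  have "short_exact Z Z Z" unfolding short_exact_def Z_def rmodule_hom_def
    by (intro exI[of _ "\<lambda>x. x"] exI[of _ "\<lambda>x. 0"]) auto
  from K0_relations.gen[OF fdZ fdZ fdZ this]
  have Z: "Poly_Mapping.single Z 1 \<in> rel" using rel_neg by force
  have "short_exact M N Z" unfolding short_exact_def
    using f rm_zero[OF fd_moduleD[OF assms(2)]]
    by (intro exI[of _ f] exI[of _ "\<lambda>x. 0"]) (auto simp: Z_def rmodule_hom_def bij_betw_def)
  from K0_relations.gen[OF assms(1,2) fdZ this]
  have "Poly_Mapping.single N 1 - Poly_Mapping.single M 1 - Poly_Mapping.single Z 1 + Poly_Mapping.single Z 1 \<in> rel"
    using rel_add Z by blast
  then have "Poly_Mapping.single N 1 - Poly_Mapping.single M 1 \<in> rel" by simp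
  from rel_neg[OF this] have 1: "Poly_Mapping.single M 1 - Poly_Mapping.single N (1::int) \<in> rel"
    unfolding minus_diff_eq .
  have nat: "Poly_Mapping.single M (int n) - Poly_Mapping.single N (int n) \<in> rel" for n
  proof (induction n)
    case (Suc n)
    have "Poly_Mapping.single M (int (Suc n)) - Poly_Mapping.single N (int (Suc n))
      = (Poly_Mapping.single M 1 - Poly_Mapping.single N 1) + (Poly_Mapping.single M (int n) - Poly_Mapping.single N (int n))"
      by (simp add: single_add algebra_simps)
    then show ?case using rel_add[OF 1 Suc] by simp
  qed (simp add: K0_relations.zero)
  show ?thesis
  proof (cases "z \<ge> 0")
    case True
    then show ?thesis using nat[of "nat z"] by simp
  next
    case False
    have "Poly_Mapping.single N (- z) - Poly_Mapping.single M (- z) \<in> rel"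
      using rel_neg[OF nat[of "nat (- z)"]] False unfolding minus_diff_eq by simp
    then show ?thesis by (simp add: single_uminus)
  qed
qed

definition nat_copy :: "('a, 'm::ab_group_add) rmodule \<Rightarrow> ('a, nat \<Rightarrow> 'k) rmodule" where
  "nat_copy M = (SOME N. fd_module scale N \<and> rmodule_iso M N)"

lemma K0_multiple_nat_copy: "K0_multiple scale n M = Poly_Mapping.single (nat_copy M) n"
  by (simp add: K0_multiple_def nat_copy_def)

lemma nat_copy: "fd_module scale M \<Longrightarrow> fd_module scale (nat_copy M)" "fd_module scale M \<Longrightarrow> rmodule_iso M (nat_copy M)"
  using someI_ex[OF realisation_exists, of M] unfolding nat_copy_def by auto

lemma rel_nat_copy:
  fixes M :: "('a, nat \<Rightarrow> 'k) rmodule"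
  shows "fd_module scale M \<Longrightarrow> Poly_Mapping.single M z - Poly_Mapping.single (nat_copy M) z \<in> rel"
  using rel_iso[OF _ nat_copy] by blast

text \<open>The generating relations concern modules with elements in one fixed type. A sequence of
  modules in arbitrary types is carried to the chosen copies by composing with the
  isomorphisms.\<close>

lemma rel_exact:
  assumes fd: "fd_module scale M'" "fd_module scale M" "fd_module scale M''"
    and f: "rmodule_hom M' M f" "inj_on f (mcarrier M')" and g: "rmodule_hom M M'' g" "g ` mcarrier M = mcarrier M''"
    and fg: "f ` mcarrier M' = {x \<in> mcarrier M. g x = 0}"
  shows "Poly_Mapping.single (nat_copy M) 1 - Poly_Mapping.single (nat_copy M') 1
    - Poly_Mapping.single (nat_copy M'') 1 \<in> rel"
proof -
  note rm = fd_moduleD[OF fd(1)] fd_moduleD[OF fd(2)] fd_moduleD[OF fd(3)]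
  obtain a where a: "rmodule_hom (nat_copy M') M' a" "bij_betw a (mcarrier (nat_copy M')) (mcarrier M')"
    using rmodule_iso_sym[OF rm(1) nat_copy(2)[OF fd(1)]] by (auto simp: rmodule_iso_def)
  obtain b where b: "rmodule_hom M (nat_copy M) b" "bij_betw b (mcarrier M) (mcarrier (nat_copy M))"
    using nat_copy(2)[OF fd(2)] by (auto simp: rmodule_iso_def)
  obtain b' where b': "rmodule_hom (nat_copy M) M b'" "bij_betw b' (mcarrier (nat_copy M)) (mcarrier M)"
    "\<And>x. x \<in> mcarrier M \<Longrightarrow> b' (b x) = x"
  proof
    define b' where "b' = inv_into (mcarrier M) b"
    have g: "b' y \<in> mcarrier M" "b (b' y) = y" if "y \<in> mcarrier (nat_copy M)" for y
      using that b(2) unfolding b'_def bij_betw_def by (auto simp: inv_into_into f_inv_into_f)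
    show geq: "b' (b x) = x" if "x \<in> mcarrier M" for x
      using that b(2) unfolding b'_def bij_betw_def by simp
    show "rmodule_hom (nat_copy M) M b'" unfolding rmodule_hom_def
    proof (intro conjI ballI allI)
      fix x y assume xy: "x \<in> mcarrier (nat_copy M)" "y \<in> mcarrier (nat_copy M)"
      have "b' (b (b' x + b' y)) = b' x + b' y" using g xy rm_add[OF rm(2)] by (intro geq) auto
      then show "b' (x + y) = b' x + b' y" using g xy rmodule_homD(2)[OF b(1)] by simp
    next
      fix x a assume x: "x \<in> mcarrier (nat_copy M)"
      have "b' (b (mact M (b' x) a)) = mact M (b' x) a" using g x rm_act[OF rm(2)] by (intro geq) auto
      then show "b' (mact (nat_copy M) x a) = mact M (b' x) a" using g x rmodule_homD(3)[OF b(1)] by simp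
    qed (use g in auto)
    show "bij_betw b' (mcarrier (nat_copy M)) (mcarrier M)" unfolding b'_def by (rule bij_betw_inv_into[OF b(2)])
  qed
  obtain d where d: "rmodule_hom M'' (nat_copy M'') d" "bij_betw d (mcarrier M'') (mcarrier (nat_copy M''))"
    using nat_copy(2)[OF fd(3)] by (auto simp: rmodule_iso_def)
  have d0: "d y = 0 \<longleftrightarrow> y = 0" if "y \<in> mcarrier M''" for y
  proof -
    have "d 0 = 0" using rmodule_homD(2)[OF d(1) rm_zero[OF rm(3)] rm_zero[OF rm(3)]] by simp
    then show ?thesis using inj_onD[of d "mcarrier M''" y 0] d(2) that rm_zero[OF rm(3)]
      unfolding bij_betw_def by auto
  qed
  have "short_exact (nat_copy M') (nat_copy M) (nat_copy M'')"
    unfolding short_exact_def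
  proof (intro exI conjI)
    show "rmodule_hom (nat_copy M') (nat_copy M) (\<lambda>x. b (f (a x)))"
      unfolding rmodule_hom_def using rmodule_homD[OF a(1)] rmodule_homD[OF f(1)] rmodule_homD[OF b(1)] by simp
    show "inj_on (\<lambda>x. b (f (a x))) (mcarrier (nat_copy M'))"
      using a(2) b(2) f(2) rmodule_homD(1)[OF a(1)] rmodule_homD(1)[OF f(1)]
      unfolding bij_betw_def inj_on_def by metis
    show "rmodule_hom (nat_copy M) (nat_copy M'') (\<lambda>x. d (g (b' x)))"
      unfolding rmodule_hom_def using rmodule_homD[OF d(1)] rmodule_homD[OF g(1)] rmodule_homD[OF b'(1)] by simp
    show "(\<lambda>x. d (g (b' x))) ` mcarrier (nat_copy M) = mcarrier (nat_copy M'')"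
      using d(2) g(2) b'(2) unfolding bij_betw_def by (metis image_image)
    have "(\<lambda>x. b (f (a x))) ` mcarrier (nat_copy M') = b ` f ` a ` mcarrier (nat_copy M')" by (simp add: image_image)
    also have "\<dots> = b ` {x \<in> mcarrier M. g x = 0}" using a(2) fg by (simp add: bij_betw_def)
    also have "\<dots> = {x \<in> mcarrier (nat_copy M). d (g (b' x)) = 0}"
    proof
      show "b ` {x \<in> mcarrier M. g x = 0} \<subseteq> {x \<in> mcarrier (nat_copy M). d (g (b' x)) = 0}"
        using rmodule_homD(1)[OF b(1)] b'(3) d0[of 0] rm_zero[OF rm(3)] by auto
      show "{x \<in> mcarrier (nat_copy M). d (g (b' x)) = 0} \<subseteq> b ` {x \<in> mcarrier M. g x = 0}"
      proof
        fix x assume x: "x \<in> {x \<in> mcarrier (nat_copy M). d (g (b' x)) = 0}"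
        then have "x \<in> b ` mcarrier M" using b(2) by (simp add: bij_betw_def)
        then obtain y where y: "y \<in> mcarrier M" "x = b y" by blast
        then have "d (g y) = 0" using x b'(3) by simp
        then have "g y = 0" using d0 rmodule_homD(1)[OF g(1) y(1)] by blast
        then show "x \<in> b ` {x \<in> mcarrier M. g x = 0}" using y by blast
      qed
    qed
    finally show "(\<lambda>x. b (f (a x))) ` mcarrier (nat_copy M') = {x \<in> mcarrier (nat_copy M). d (g (b' x)) = 0}" .
  qed
  then show ?thesis by (intro K0_relations.gen nat_copy fd)
qed

text \<open>The functional M |-> dim (M e), extended linearly to the free abelian group. By
  \<open>edim_exact\<close> it vanishes on the relations when e is idempotent, so it tests equations
  in K_0.\<close>

definition hdim :: "'a \<Rightarrow> (('a, nat \<Rightarrow> 'k) rmodule \<Rightarrow>\<^sub>0 int) \<Rightarrow> int" where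
  "hdim e p = (\<Sum>M\<in>Poly_Mapping.keys p. Poly_Mapping.lookup p M * int (edim M e))"

lemma hdim_superset:
  "finite A \<Longrightarrow> Poly_Mapping.keys p \<subseteq> A \<Longrightarrow> hdim e p = (\<Sum>M\<in>A. Poly_Mapping.lookup p M * int (edim M e))"
  unfolding hdim_def by (rule sum.mono_neutral_left) (auto simp: in_keys_iff)

lemma hdim_add: "hdim e (p + q) = hdim e p + hdim e q"
proof -
  let ?A = "Poly_Mapping.keys p \<union> Poly_Mapping.keys q"
  have "Poly_Mapping.keys (p + q) \<subseteq> ?A" by (rule Poly_Mapping.keys_add)
  then show ?thesis
    by (simp add: hdim_superset[of ?A] lookup_add algebra_simps sum.distrib)
qed

lemma hdim_single: "hdim e (Poly_Mapping.single M n) = n * int (edim M e)"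
  by (simp add: hdim_superset[of "{M}"] lookup_single)

lemma hdim_zero [simp]: "hdim e 0 = 0" by (simp add: hdim_def)

lemma hdim_neg: "hdim e (- p) = - hdim e p"
  using hdim_add[of e p "- p"] by simp

lemma hdim_diff: "hdim e (p - q) = hdim e p - hdim e q"
  using hdim_add[of e p "- q"] hdim_neg[of e q] by simp

lemma hdim_sum: "hdim e (sum f A) = (\<Sum>i\<in>A. hdim e (f i))"
  by (induction A rule: infinite_finite_induct) (auto simp: hdim_add)

lemma hdim_rel: "e * e = e \<Longrightarrow> x \<in> rel \<Longrightarrow> hdim e x = 0"
proof -
  assume e: "e * e = e" and "x \<in> rel"
  from this(2) show ?thesis
    by (induction rule: K0_relations.induct) (auto simp: hdim_diff hdim_single edim_exact e)
qed

lemma hdim_K0_multiple: "fd_module scale M \<Longrightarrow> e * e = e \<Longrightarrow> hdim e (K0_multiple scale n M) = n * int (edim M e)"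
  unfolding K0_multiple_nat_copy hdim_single using edim_iso[OF _ nat_copy(1) nat_copy(2), of M e] by simp

end

section \<open>Blocks\<close>

context field_cell_datum
begin

sublocale field_algebra scale ..

section \<open>Cell modules as modules, and the independence of their classes\<close>

abbreviation "CM l \<equiv> cell_module l"

lemma CM_simps [simp]: "mcarrier (CM l) = \<Delta> l" "mact (CM l) = act l"
  by (simp_all add: cell_module_eq)

lemma CM_right_module: "l \<in> \<Lambda> \<Longrightarrow> right_module (CM l)"
  unfolding right_module_def by (simp add: \<Delta>_closed act_in act_add_left act_add act_mult)

lemma CM_smul: "l \<in> \<Lambda> \<Longrightarrow> x \<in> \<Delta> l \<Longrightarrow> smul (CM l) c x = (\<lambda>t. c * x t)"
  by (simp add: smul_def act_scale)

lemma CM_fd: "l \<in> \<Lambda> \<Longrightarrow> fd_module scale (CM l)"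
proof (rule fd_moduleI[where P = "T l" and w = unitv])
  assume l: "l \<in> \<Lambda>"
  show "right_module (CM l)" "finite (T l)" using l CM_right_module finite_T by auto
  fix x assume "x \<in> mcarrier (CM l)"
  then have x: "x \<in> \<Delta> l" by simp
  have "x = (\<Sum>t\<in>T l. (\<lambda>v. x t * unitv t v))"
  proof
    fix v show "x v = (\<Sum>t\<in>T l. (\<lambda>v. x t * unitv t v)) v"
      unfolding sum_fun_apply using fun_cong[OF \<Delta>_expand[OF l x], of v] by simp
  qed
  also have "\<dots> = (\<Sum>t\<in>T l. smul (CM l) (x t) (unitv t))"
    using l unitv_in by (intro sum.cong refl) (simp add: CM_smul)
  finally show "\<exists>c. x = (\<Sum>t\<in>T l. smul (CM l) (c t) (unitv t))" by (intro exI[of _ x])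
qed (use unitv_in in simp)

lemma CM_sub_fd:
  assumes "l \<in> \<Lambda>" "U \<subseteq> \<Delta> l" "0 \<in> U" "\<And>x y. x \<in> U \<Longrightarrow> y \<in> U \<Longrightarrow> x + y \<in> U" "\<And>x a. x \<in> U \<Longrightarrow> act l x a \<in> U"
  shows "fd_module scale (CM l\<lparr>mcarrier := U\<rparr>)"
  using assms by (intro submodule_fd CM_fd) auto

lemma edim_CM_0: "l \<in> \<Lambda> \<Longrightarrow> e * e = e \<Longrightarrow> edim (CM l) e = 0 \<longleftrightarrow> e \<in> cell_ann l"
  by (simp add: edim_eq_0 CM_fd cell_ann_def)

text \<open>Otherwise the dichotomy would put the annihilator of \<Delta> l inside that of the head
  of m. But an element of cell m acting as 1 on this head annihilates \<Delta> l unless m \<le>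
  l.\<close>

lemma prim_idem_in_cell_ann: "m \<in> good_cells \<Longrightarrow> l \<in> \<Lambda> \<Longrightarrow> \<not> m \<le> l \<Longrightarrow> prim_idem m \<in> cell_ann l"
proof (rule ccontr)
  assume m: "m \<in> good_cells" and l: "l \<in> \<Lambda>" "\<not> m \<le> l" and "prim_idem m \<notin> cell_ann l"
  then have sub: "cell_ann l \<subseteq> head_ann m" using ideal_dichotomy[OF m cell_ann_ideal[OF l(1)]] by blast
  have m': "m \<in> \<Lambda>" using good_cells_Lambda[OF m] .
  obtain z where z: "z \<in> cspan {m}" "z - 1 \<in> head_ann m" using ex_cell_one[OF m'] by blast
  have "z \<in> cell_ann l" using act_cspan_zero[OF l(1) z(1)] l by (auto simp: cell_ann_def)
  then have "z - (z - 1) \<in> head_ann m" using two_sided_idealD(6)[OF head_ann_ideal[OF m'] _ z(2)] sub by blast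
  then show False using head_ann_one[OF m'] m by simp
qed

lemma prim_idem_notin_cell_ann: "m \<in> good_cells \<Longrightarrow> prim_idem m \<notin> cell_ann m"
  using head_ann_0I[OF good_cells_Lambda, of m "prim_idem m"] prim_idem_notin_head_ann[of m] by (auto simp: cell_ann_def)

text \<open>Take k maximal among the cells with nonzero coefficient. The functional of
  \<open>prim_idem k\<close> vanishes on \<Delta> m unless k \<le> m, so only the term of k remains,
  where it is nonzero. D is arbitrary because the linkage argument restricts to the cells on which a
  central idempotent is nonzero.\<close>

lemma cell_classes_independent:
  assumes D: "finite D" "D \<subseteq> good_cells"
    and z: "\<And>k. k \<in> D \<Longrightarrow> (\<Sum>m\<in>D. c m * int (edim (CM m) (prim_idem k))) = 0" and m: "m \<in> D"
  shows "c m = 0"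
proof (rule ccontr)
  assume "c m \<noteq> 0"
  then have ne: "{m \<in> D. c m \<noteq> 0} \<noteq> {}" "finite {m \<in> D. c m \<noteq> 0}" using D m by auto
  obtain k where k: "k \<in> D" "c k \<noteq> 0" "\<And>m. m \<in> D \<Longrightarrow> c m \<noteq> 0 \<Longrightarrow> k \<le> m \<Longrightarrow> k = m"
    using finite_has_maximal[OF ne(2,1)] by blast
  have kL: "k \<in> good_cells" using k D by auto
  have "c m * int (edim (CM m) (prim_idem k)) = 0" if "m \<in> D - {k}" for m
  proof (cases "c m = 0")
    case False
    then have "\<not> k \<le> m" using k(3)[of m] that by auto
    moreover have "m \<in> \<Lambda>" using that D good_cells_Lambda by auto
    ultimately show ?thesis using prim_idem_in_cell_ann[OF kL] edim_CM_0[OF _ prim_idem_idem[OF kL]] by simp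
  qed simp
  then have "(\<Sum>m\<in>D. c m * int (edim (CM m) (prim_idem k))) = c k * int (edim (CM k) (prim_idem k))"
    using D k(1) by (subst sum.remove[of _ k]) (simp_all only: sum.neutral[OF ballI] add_0_right)
  then have "edim (CM k) (prim_idem k) = 0" using z[OF k(1)] k(2) by simp
  then show False using edim_CM_0[OF good_cells_Lambda[OF kL] prim_idem_idem[OF kL]] prim_idem_notin_cell_ann[OF kL] by simp
qed

text \<open>A vector x outside the radical generates the cell module: if <x, y> is nonzero, a
  multiple of y \<otimes> z maps x to z.\<close>

lemma proper_submodule_in_rad:
  assumes l: "l \<in> \<Lambda>" and K: "K \<subseteq> \<Delta> l" "\<And>x a. x \<in> K \<Longrightarrow> act l x a \<in> K"
    "0 \<in> K" "\<And>x y. x \<in> K \<Longrightarrow> y \<in> K \<Longrightarrow> x + y \<in> K" and ne: "K \<noteq> \<Delta> l"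
  shows "K \<subseteq> rad l"
proof
  fix x assume x: "x \<in> K"
  show "x \<in> rad l"
  proof (rule ccontr)
    assume "x \<notin> rad l"
    then obtain y where y: "y \<in> \<Delta> l" "cell_form l x y \<noteq> 0" using x K(1) by (auto simp: rad_def)
    have "z \<in> K" if z: "z \<in> \<Delta> l" for z
    proof -
      have "act l x (inverse (cell_form l x y) *s tens l y z) = z"
        using y l z by (simp add: act_scale act_tens fun_eq_iff)
      then show ?thesis using K(2)[OF x] by metis
    qed
    then show False using ne K(1) by blast
  qed
qed

section \<open>The classes of cell modules span\<close>

definition "intspan D p \<longleftrightarrow>
  (\<exists>c. p - (\<Sum>m\<in>D. Poly_Mapping.single (nat_copy (CM m)) (c m)) \<in> rel)"

lemma intspan_add: "intspan D p \<Longrightarrow> intspan D q \<Longrightarrow> intspan D (p + q)"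
proof -
  assume "intspan D p" "intspan D q"
  then obtain c d where c: "p - (\<Sum>m\<in>D. Poly_Mapping.single (nat_copy (CM m)) (c m)) \<in> rel"
    and d: "q - (\<Sum>m\<in>D. Poly_Mapping.single (nat_copy (CM m)) (d m)) \<in> rel" by (auto simp: intspan_def)
  have "p + q - (\<Sum>m\<in>D. Poly_Mapping.single (nat_copy (CM m)) (c m + d m)) \<in> rel"
    using rel_add[OF c d] by (simp add: single_add sum.distrib algebra_simps)
  then show ?thesis unfolding intspan_def by (intro exI[of _ "\<lambda>m. c m + d m"])
qed

lemma intspan_neg: "intspan D p \<Longrightarrow> intspan D (- p)"
proof -
  assume "intspan D p"
  then obtain c where c: "p - (\<Sum>m\<in>D. Poly_Mapping.single (nat_copy (CM m)) (c m)) \<in> rel" by (auto simp: intspan_def)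
  have "- p - (\<Sum>m\<in>D. Poly_Mapping.single (nat_copy (CM m)) (- c m)) \<in> rel"
    using rel_neg[OF c] by (simp add: single_uminus sum_negf)
  then show ?thesis unfolding intspan_def by (intro exI[of _ "\<lambda>m. - c m"])
qed

lemma intspan_rel: "p \<in> rel \<Longrightarrow> intspan D p"
  unfolding intspan_def by (intro exI[of _ "\<lambda>_. 0"]) simp

lemma intspan_cong: "p - q \<in> rel \<Longrightarrow> intspan D q \<Longrightarrow> intspan D p"
  using intspan_add[OF intspan_rel, of "p - q" D q] by simp

lemma intspan_sum: "(\<And>i. i \<in> A \<Longrightarrow> intspan D (f i)) \<Longrightarrow> intspan D (sum f A)"
  by (induction A rule: infinite_finite_induct) (auto simp: intspan_add intspan_rel K0_relations.zero)

lemma intspan_CM: "finite D \<Longrightarrow> m \<in> D \<Longrightarrow> intspan D (Poly_Mapping.single (nat_copy (CM m)) 1)"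
proof -
  assume a: "finite D" "m \<in> D"
  have "(\<Sum>k\<in>D. Poly_Mapping.single (nat_copy (CM k)) (if k = m then 1 else 0))
    = (\<Sum>k\<in>D. if k = m then Poly_Mapping.single (nat_copy (CM m)) (1::int) else 0)"
    by (intro sum.cong) auto
  then show ?thesis unfolding intspan_def using a
    by (intro exI[of _ "\<lambda>k. if k = m then 1 else 0"]) (simp add: K0_relations.zero)
qed

lemma intspan_mono: "finite D' \<Longrightarrow> D \<subseteq> D' \<Longrightarrow> intspan D p \<Longrightarrow> intspan D' p"
proof -
  assume a: "finite D'" "D \<subseteq> D'" and "intspan D p"
  then obtain c where c: "p - (\<Sum>m\<in>D. Poly_Mapping.single (nat_copy (CM m)) (c m)) \<in> rel" by (auto simp: intspan_def)
  have "(\<Sum>m\<in>D'. Poly_Mapping.single (nat_copy (CM m)) (if m \<in> D then c m else 0))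
    = (\<Sum>m\<in>D. Poly_Mapping.single (nat_copy (CM m)) (c m))"
    using a by (intro sum.mono_neutral_cong_right) auto
  then show ?thesis unfolding intspan_def using c by (intro exI[of _ "\<lambda>m. if m \<in> D then c m else 0"]) simp
qed

text \<open>Induction on the set of cells that annihilate M and, inside it, on the dimension of M.
  If cell l acts nontrivially, some nonzero x0 C_st gives a nonzero map from \<Delta> l to M. Its
  kernel K lies in the radical, so it is also annihilated by cell l and covered by the outer
  hypothesis; the class of its image V is that of \<Delta> l minus that of K; and M / V has smaller
  dimension.\<close>

lemma cell_classes_span:
  assumes "upset U" "good_cells = \<Lambda>" "fd_module scale (M :: ('a, nat \<Rightarrow> 'k) rmodule)"
    "\<And>x a. x \<in> mcarrier M \<Longrightarrow> a \<in> cspan U \<Longrightarrow> mact M x a = 0"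
  shows "intspan (\<Lambda> - U) (Poly_Mapping.single M 1)"
  using assms(1,3,4)
proof (induction arbitrary: M rule: upset_induct)
  case top
  note m = right_moduleD[OF fd_moduleD[OF top(1)]]
  have "x = 0" if x: "x \<in> mcarrier M" for x
  proof -
    have "mact M x 1 = 0" by (rule top(2)[OF x]) (simp add: cspan_Lambda)
    then show ?thesis using m(8)[OF x] by metis
  qed
  then have car: "mcarrier M = {0}" using m(1) by blast
  have "rmodule_hom M M (\<lambda>x. x)" by (simp add: rmodule_hom_def)
  then have "short_exact M M M" unfolding short_exact_def
    by (intro exI[of _ "\<lambda>x. x"] conjI) (auto simp: car)
  from K0_relations.gen[OF top(1) top(1) top(1) this]
  have "Poly_Mapping.single M 1 \<in> rel" using rel_neg by force
  then show ?case by (rule intspan_rel)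
next
  case (step U l)
  have l: "l \<in> \<Lambda>" by fact
  have finD: "finite (\<Lambda> - U)" using finite_Lambda by simp
  show ?case using step.prems
  proof (induction "edim M 1" arbitrary: M rule: less_induct)
    case less
    have fdM: "fd_module scale M" by fact
    note m = right_moduleD[OF fd_moduleD[OF fdM]]
    have killM: "mact M x a = 0" if "x \<in> mcarrier M" "a \<in> cspan U" for x a using less.prems(2) that by blast
    show ?case
    proof (cases "\<forall>x\<in>mcarrier M. \<forall>s\<in>T l. \<forall>t\<in>T l. mact M x (C l s t) = 0")
      case True
      have "mact M x a = 0" if x: "x \<in> mcarrier M" and a: "a \<in> cspan (insert l U)" for x a
      proof (rule cspan_induct[OF a])
        show "subspace {a. mact M x a = 0}"
          unfolding subspace_def
        proof safe
          fix c a assume "mact M x a = 0"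
          moreover have "mact M x (a * (c *s 1)) = mact M (mact M x a) (c *s 1)" by (rule m(7)[OF x])
          ultimately show "mact M x (c *s a) = 0" using m(9) scale_as_mult(1)[of c a] by simp
        qed (use m x in auto)
      next
        fix k s t assume k: "k \<in> \<Lambda>" "k \<in> insert l U" "s \<in> T k" "t \<in> T k"
        then show "mact M x (C k s t) = 0"
          using True x killM[OF x C_in_cspan[of k U s t]] by (cases "k = l") auto
      qed
      from step.IH[OF fdM this] show ?thesis by (rule intspan_mono[OF finD, rotated]) auto
    next
      case False
      then obtain x0 s t where x0: "x0 \<in> mcarrier M" "s \<in> T l" "t \<in> T l" "mact M x0 (C l s t) \<noteq> 0" by blast
      \<comment> \<open>This is a homomorphism on \<Delta> l, because multiplying a tensor on the
        right agrees with acting on its second factor up to \<open>cspan U\<close>, which kills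
        M.\<close>
      define f where "f z = mact M x0 (tens l (unitv s) z)" for z
      have f_in: "f z \<in> mcarrier M" for z unfolding f_def using m x0 by blast
      have f_add: "f (y + z) = f y + f z" for y z unfolding f_def tens_linear using m x0 by simp
      have f0: "f 0 = 0" using f_add[of 0 0] by simp
      have f_act: "f (act l z a) = mact M (f z) a" if z: "z \<in> \<Delta> l" for z a
      proof -
        have "mact M x0 (tens l (unitv s) z * a - tens l (unitv s) (act l z a)) = 0"
          by (intro killM x0 tens_mult_right step z)
        moreover have "mact M x0 (tens l (unitv s) z * a)
          = mact M x0 (tens l (unitv s) z * a - tens l (unitv s) (act l z a)) + mact M x0 (tens l (unitv s) (act l z a))"
          using m(6)[OF x0(1), of "tens l (unitv s) z * a - tens l (unitv s) (act l z a)" "tens l (unitv s) (act l z a)"] by simp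
        ultimately show ?thesis unfolding f_def using m(7)[OF x0(1)] by simp
      qed
      define K where "K = {z \<in> \<Delta> l. f z = 0}"
      have K: "K \<subseteq> \<Delta> l" "0 \<in> K" "\<And>x y. x \<in> K \<Longrightarrow> y \<in> K \<Longrightarrow> x + y \<in> K" "\<And>x a. x \<in> K \<Longrightarrow> act l x a \<in> K"
        using \<Delta>_closed f0 act_in[OF l] m(9) by (auto simp: K_def f_add f_act)
      have "f (unitv t) \<noteq> 0" unfolding f_def using x0 unitv_tens[OF l x0(2,3)] by simp
      then have "K \<noteq> \<Delta> l" using unitv_in[OF x0(3)] by (auto simp: K_def)
      then have Krad: "K \<subseteq> rad l" using proper_submodule_in_rad[OF l K(1) K(4) K(2,3)] by blast
      define V where "V = f ` \<Delta> l"
      have V: "V \<subseteq> mcarrier M" "0 \<in> V" "\<And>x y. x \<in> V \<Longrightarrow> y \<in> V \<Longrightarrow> x + y \<in> V" "\<And>x a. x \<in> V \<Longrightarrow> mact M x a \<in> V"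
      proof -
        show "V \<subseteq> mcarrier M" using f_in by (auto simp: V_def)
        show "0 \<in> V" using f0 \<Delta>_closed(1) unfolding V_def by (metis image_eqI)
        show "x + y \<in> V" if "x \<in> V" "y \<in> V" for x y
          using that f_add \<Delta>_closed(2) unfolding V_def by (auto simp flip: f_add)
        show "mact M x a \<in> V" if "x \<in> V" for x a
          using that act_in[OF l] unfolding V_def by (auto simp flip: f_act)
      qed
      define KM where "KM = CM l\<lparr>mcarrier := K\<rparr>"
      define VM where "VM = M\<lparr>mcarrier := V\<rparr>"
      have fdK: "fd_module scale KM" unfolding KM_def by (rule CM_sub_fd[OF l K])
      have fdV: "fd_module scale VM" unfolding VM_def by (rule submodule_fd[OF fdM V])
      obtain Q :: "('a, nat \<Rightarrow> 'k) rmodule" and p where Q: "fd_module scale Q" "rmodule_hom M Q p"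
        "p ` mcarrier M = mcarrier Q" "\<And>x. x \<in> mcarrier M \<Longrightarrow> p x = 0 \<longleftrightarrow> x \<in> V"
        using quotient_exists[OF fdM V] by blast
      have ex1: "Poly_Mapping.single (nat_copy (CM l)) 1 - Poly_Mapping.single (nat_copy KM) 1
          - Poly_Mapping.single (nat_copy VM) 1 \<in> rel"
        by (rule rel_exact[OF fdK CM_fd[OF l] fdV, of "\<lambda>x. x" f])
          (use K f_add f_act in \<open>auto simp: rmodule_hom_def KM_def VM_def V_def K_def\<close>)
      have se: "short_exact VM M Q" unfolding short_exact_def
        using Q V(1) by (intro exI[of _ "\<lambda>x. x"] exI[of _ p]) (auto simp: rmodule_hom_def VM_def)
      have KMspan: "intspan (\<Lambda> - U) (Poly_Mapping.single (nat_copy KM) 1)"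
      proof (rule intspan_mono[OF finD _ step.IH[OF nat_copy(1)[OF fdK]]])
        fix x a assume x: "x \<in> mcarrier (nat_copy KM)" and a: "a \<in> cspan (insert l U)"
        obtain h where h: "rmodule_hom KM (nat_copy KM) h" "bij_betw h (mcarrier KM) (mcarrier (nat_copy KM))"
          using nat_copy(2)[OF fdK] by (auto simp: rmodule_iso_def)
        then have "x \<in> h ` mcarrier KM" using x by (simp add: bij_betw_def)
        then obtain y where y: "y \<in> mcarrier KM" "x = h y" by blast
        have "mact KM y a = 0" using y(1) Krad rad_cspan_zero[OF step(1-4) _ a] by (auto simp: KM_def)
        then have "mact (nat_copy KM) x a = h 0" using rmodule_homD(3)[OF h(1) y(1), of a] y(2) by simp
        also have "h 0 = 0" using rmodule_homD(2)[OF h(1), of 0 0] rm_zero[OF fd_moduleD[OF fdK]] by simp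
        finally show "mact (nat_copy KM) x a = 0" .
      qed auto
      have CMspan: "intspan (\<Lambda> - U) (Poly_Mapping.single (nat_copy (CM l)) 1)"
        using l step(3) finD by (intro intspan_CM) auto
      have "intspan (\<Lambda> - U) (Poly_Mapping.single (nat_copy (CM l)) 1 + - Poly_Mapping.single (nat_copy KM) 1)"
        by (intro intspan_add intspan_neg CMspan KMspan)
      moreover have "Poly_Mapping.single VM 1 - (Poly_Mapping.single (nat_copy (CM l)) 1 + - Poly_Mapping.single (nat_copy KM) 1) \<in> rel"
        using rel_add[OF rel_neg[OF ex1] rel_nat_copy[OF fdV, of 1]] by (simp add: algebra_simps)
      ultimately have VMspan: "intspan (\<Lambda> - U) (Poly_Mapping.single VM 1)" by (rule intspan_cong[rotated])
      have "edim VM 1 \<noteq> 0"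
        using \<open>f (unitv t) \<noteq> 0\<close> unitv_in[OF x0(3)] rm_act_one[OF fd_moduleD[OF fdV]]
        by (subst edim_eq_0[OF fdV]) (auto simp: VM_def V_def)
      then have lt: "edim Q 1 < edim M 1" using edim_exact[OF fdV fdM Q(1) se, of 1] by simp
      have "intspan (\<Lambda> - U) (Poly_Mapping.single Q 1)"
      proof (rule less.hyps[OF lt Q(1)])
        fix x a assume x: "x \<in> mcarrier Q" and a: "a \<in> cspan U"
        obtain y where y: "y \<in> mcarrier M" "x = p y" using x Q(3) by blast
        have "mact Q x a = p (mact M y a)" using rmodule_homD(3)[OF Q(2) y(1)] y(2) by simp
        then show "mact Q x a = 0" using killM[OF y(1) a] rmodule_homD(2)[OF Q(2) m(1) m(1)] by simp
      qed
      then have "intspan (\<Lambda> - U) (Poly_Mapping.single VM 1 + Poly_Mapping.single Q 1)"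
        using VMspan intspan_add by blast
      moreover have "Poly_Mapping.single M 1 - (Poly_Mapping.single VM 1 + Poly_Mapping.single Q 1) \<in> rel"
        using K0_relations.gen[OF fdV fdM Q(1) se] by (simp add: algebra_simps)
      ultimately show ?thesis by (rule intspan_cong[rotated])
    qed
  qed
qed

section \<open>Central idempotents and blocks\<close>

definition central_idem :: "'a \<Rightarrow> bool" where
  "central_idem c \<longleftrightarrow> c * c = c \<and> (\<forall>a. c * a = a * c)"

lemma central_idemD: "central_idem c \<Longrightarrow> c * c = c" "central_idem c \<Longrightarrow> c * a = a * c"
  unfolding central_idem_def by blast+

lemma central_idem_compl: "central_idem c \<Longrightarrow> central_idem (1 - c)"
proof -
  assume c: "central_idem c"
  have "(1 - c) * a = a * (1 - c)" for a
    using central_idemD(2)[OF c, of a] by (simp add: left_diff_distrib right_diff_distrib)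
  moreover have "(1 - c) * (1 - c) = 1 - c"
    using central_idemD(1)[OF c] by (simp add: left_diff_distrib right_diff_distrib)
  ultimately show ?thesis unfolding central_idem_def by blast
qed

lemma central_idem_mult: "central_idem b \<Longrightarrow> central_idem d \<Longrightarrow> central_idem (b * d)"
proof -
  assume b: "central_idem b" and d: "central_idem d"
  have "(b * d) * (b * d) = b * (d * b) * d" by (simp only: mult.assoc)
  also have "d * b = b * d" by (rule central_idemD(2)[OF d])
  also have "b * (b * d) * d = (b * b) * (d * d)" by (simp only: mult.assoc)
  finally have 1: "(b * d) * (b * d) = b * d" by (simp only: central_idemD(1)[OF b] central_idemD(1)[OF d])
  have "(b * d) * a = a * (b * d)" for a
  proof -
    have "(b * d) * a = b * (d * a)" by (rule mult.assoc)
    also have "d * a = a * d" by (rule central_idemD(2)[OF d])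
    also have "b * (a * d) = (b * a) * d" by (simp only: mult.assoc)
    also have "b * a = a * b" by (rule central_idemD(2)[OF b])
    finally show ?thesis by (simp only: mult.assoc)
  qed
  with 1 show ?thesis unfolding central_idem_def by blast
qed

lemma one_notin_cell_ann: "l \<in> \<Lambda> \<Longrightarrow> 1 \<notin> cell_ann l"
proof
  assume l: "l \<in> \<Lambda>" and "1 \<in> cell_ann l"
  obtain t where "t \<in> T l" using T_nonempty[OF l] by auto
  then have "unitv t = 0" using \<open>1 \<in> cell_ann l\<close> unitv_in[of t l] act_one[OF l] by (auto simp: cell_ann_def)
  then show False by (auto simp: unitv_def fun_eq_iff dest: spec[of _ t])
qed

lemma compl_notin_cell_ann: "l \<in> \<Lambda> \<Longrightarrow> c \<in> cell_ann l \<Longrightarrow> 1 - c \<notin> cell_ann l"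
  using two_sided_idealD(2)[OF cell_ann_ideal, of l c "1 - c"] one_notin_cell_ann[of l] by auto

lemma act_fixed: "l \<in> \<Lambda> \<Longrightarrow> 1 - c \<in> cell_ann l \<Longrightarrow> x \<in> \<Delta> l \<Longrightarrow> act l x c = x"
  by (auto simp: cell_ann_def act_diff)

text \<open>The kernels of c and 1 - c on \<Delta> l are submodules. If both are proper, both lie in
  the radical, and then so does every x = x c + x (1 - c), contradicting the nonzero form.\<close>

lemma central_idem_cell_ann:
  assumes l: "l \<in> good_cells" and c: "central_idem c"
  shows "c \<in> cell_ann l \<or> 1 - c \<in> cell_ann l"
proof (rule ccontr)
  assume n: "\<not> (c \<in> cell_ann l \<or> 1 - c \<in> cell_ann l)"
  have l': "l \<in> \<Lambda>" using good_cells_Lambda[OF l] .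
  have sub: "{x \<in> \<Delta> l. act l x d = 0} \<subseteq> rad l" if d: "central_idem d" "d \<notin> cell_ann l" for d
  proof (rule proper_submodule_in_rad[OF l'])
    fix x a assume x: "x \<in> {x \<in> \<Delta> l. act l x d = 0}"
    have "act l (act l x a) d = act l (act l x d) a"
      using central_idemD(2)[OF d(1), of a] by (simp flip: act_mult[OF l'])
    then show "act l x a \<in> {x \<in> \<Delta> l. act l x d = 0}" using x act_in[OF l'] l' by simp
  qed (use d(2) l' in \<open>auto simp: cell_ann_def act_add_left \<Delta>_closed\<close>)
  have "x \<in> rad l" if x: "x \<in> \<Delta> l" for x
  proof -
    have cc: "c * (1 - c) = 0" "(1 - c) * c = 0"
      using central_idemD(1)[OF c] by (simp_all add: left_diff_distrib right_diff_distrib)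
    have "act l x c \<in> rad l" using sub[OF central_idem_compl[OF c]] n act_in[OF l'] cc l'
      by (auto simp flip: act_mult[OF l'])
    moreover have "act l x (1 - c) \<in> rad l" using sub[OF c] n act_in[OF l'] cc l'
      by (auto simp flip: act_mult[OF l'])
    ultimately have "act l x c + act l x (1 - c) \<in> rad l" by (rule rad_closed(3))
    then show ?thesis using l' x by (simp flip: act_add[OF l'])
  qed
  then show False using l rad_closed(1)[of l] by (auto simp: good_cells_def)
qed

text \<open>The component b of 1 in B is an identity element of the ideal B; comparing b a b with b
  a and with a b shows that it is central.\<close>

lemma summand_central_idem:
  assumes B: "two_sided_ideal B" "two_sided_ideal B'" "internal_direct_sum UNIV B B'"
  shows "\<exists>b. central_idem b \<and> B = range ((*) b)"
proof -
  obtain b b' where b: "b \<in> B" "b' \<in> B'" "1 = b + b'" using B(3) unfolding internal_direct_sum_def by blast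
  have int: "x = 0" if "x \<in> B" "x \<in> B'" for x using B(3) that unfolding internal_direct_sum_def by blast
  have l: "b * x = x" and r: "x * b = x" if x: "x \<in> B" for x
  proof -
    have "b' * x = 0" using int two_sided_idealD(4)[OF B(1) x] two_sided_idealD(3)[OF B(2) b(2)] by blast
    then show "b * x = x" using b(3) by (metis add.right_neutral distrib_right mult_1_left)
    have "x * b' = 0" using int two_sided_idealD(3)[OF B(1) x] two_sided_idealD(4)[OF B(2) b(2)] by blast
    then show "x * b = x" using b(3) by (metis add.right_neutral distrib_left mult_1_right)
  qed
  have "b * a = a * b" for a
  proof -
    have "b * a = (b * a) * b" by (rule r[OF two_sided_idealD(3)[OF B(1) b(1)], symmetric])
    also have "\<dots> = b * (a * b)" by (rule mult.assoc)
    also have "\<dots> = a * b" by (rule l[OF two_sided_idealD(4)[OF B(1) b(1)]])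
    finally show ?thesis .
  qed
  then have "central_idem b" unfolding central_idem_def using l[OF b(1)] by blast
  moreover have "B = range ((*) b)"
    using l two_sided_idealD(3)[OF B(1) b(1)] by (auto simp: image_iff) metis
  ultimately show ?thesis by blast
qed

lemma central_idem_ideal: "central_idem b \<Longrightarrow> two_sided_ideal (range ((*) b))"
proof -
  assume b: "central_idem b"
  show ?thesis
  proof (rule two_sided_idealI)
    fix x a assume "x \<in> range ((*) b)"
    then obtain y where y: "x = b * y" by blast
    have "a * (b * y) = b * (a * y)" using central_idemD(2)[OF b, of a] by (metis mult.assoc)
    then show "a * x \<in> range ((*) b)" using y by blast
    show "x * a \<in> range ((*) b)" using y by (simp add: mult.assoc)
  next
    fix x y assume "x \<in> range ((*) b)" "y \<in> range ((*) b)"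
    then show "x + y \<in> range ((*) b)" by (auto simp flip: distrib_left)
  qed (auto intro: image_eqI[of _ _ 0])
qed

lemma belongs_iff:
  assumes l: "l \<in> \<Lambda>" and b: "central_idem b"
  shows "mod_ideal_mult (CM l) (range ((*) b)) = mcarrier (CM l) \<longleftrightarrow> 1 - b \<in> cell_ann l"
proof
  assume eq: "mod_ideal_mult (CM l) (range ((*) b)) = mcarrier (CM l)"
  show "1 - b \<in> cell_ann l" unfolding cell_ann_def
  proof safe
    fix x assume "x \<in> \<Delta> l"
    then have "x \<in> mod_ideal_mult (CM l) (range ((*) b))" using eq by simp
    then obtain n y a where x: "x = (\<Sum>i<(n::nat). act l (y i) (a i))" "\<And>i. i < n \<Longrightarrow> a i \<in> range ((*) b)"
      unfolding mod_ideal_mult_def by auto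
    have "act l (act l (y i) (a i)) (1 - b) = 0" if i: "i < n" for i
    proof -
      obtain c where c: "a i = b * c" using x(2)[OF i] by blast
      have cb: "b * c = c * b" by (rule central_idemD(2)[OF b])
      have "a i * (1 - b) = b * c - b * (c * b)" unfolding c by (simp add: right_diff_distrib mult.assoc)
      also have "\<dots> = b * c - (b * b) * c" unfolding cb[symmetric] by (simp add: mult.assoc)
      finally have "a i * (1 - b) = b * c - (b * b) * c" .
      then have "a i * (1 - b) = 0" using central_idemD(1)[OF b] by simp
      then show ?thesis using l by (simp flip: act_mult[OF l])
    qed
    then show "act l x (1 - b) = 0" unfolding x(1) act_sum_left[OF l] by simp
  qed
next
  assume b1: "1 - b \<in> cell_ann l"
  show "mod_ideal_mult (CM l) (range ((*) b)) = mcarrier (CM l)"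
  proof
    show "mod_ideal_mult (CM l) (range ((*) b)) \<subseteq> mcarrier (CM l)"
    proof
      fix x assume "x \<in> mod_ideal_mult (CM l) (range ((*) b))"
      then obtain n y a where x: "x = (\<Sum>i<(n::nat). act l (y i) (a i))" unfolding mod_ideal_mult_def by auto
      have "act l (y i) (a i) t = 0" if "t \<notin> T l" for i t
        using act_in[OF l, of "y i" "a i"] that by (simp add: \<Delta>_def)
      then show "x \<in> mcarrier (CM l)" unfolding x CM_simps by (simp add: \<Delta>_def sum_fun_apply)
    qed
    show "mcarrier (CM l) \<subseteq> mod_ideal_mult (CM l) (range ((*) b))"
    proof
      fix x assume "x \<in> mcarrier (CM l)"
      then have x: "x \<in> \<Delta> l" "act l x b = x" using act_fixed[OF l b1] by auto
      have "b \<in> range ((*) b)" by (metis mult_1_right rangeI)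
      then show "x \<in> mod_ideal_mult (CM l) (range ((*) b))" unfolding mod_ideal_mult_def
        using x by (intro CollectI exI[of _ "1::nat"] exI[of _ "\<lambda>_. x"] exI[of _ "\<lambda>_. b"]) simp
    qed
  qed
qed

text \<open>From left to right: a central idempotent c splits the block b A into b c A and b (1 - c)
  A, one of which is 0. From right to left: the block is b A, where b is a central idempotent acting
  as 1 on \<Delta> l for which b A has least dimension.\<close>

lemma same_block_iff:
  assumes l: "l \<in> good_cells" and m: "m \<in> good_cells"
  shows "(\<exists>B. belongs_to_block (CM l) B \<and> belongs_to_block (CM m) B) \<longleftrightarrow>
    (\<forall>c. central_idem c \<longrightarrow> (c \<in> cell_ann l \<longleftrightarrow> c \<in> cell_ann m))"
proof
  note l' = good_cells_Lambda[OF l] and m' = good_cells_Lambda[OF m]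
  assume "\<exists>B. belongs_to_block (CM l) B \<and> belongs_to_block (CM m) B"
  then obtain B where B: "is_block B" "mod_ideal_mult (CM l) B = mcarrier (CM l)" "mod_ideal_mult (CM m) B = mcarrier (CM m)"
    by (auto simp: belongs_to_block_def)
  obtain B' where B': "two_sided_ideal B" "two_sided_ideal B'" "internal_direct_sum UNIV B B'"
    using B(1) by (auto simp: is_block_def)
  obtain b where b: "central_idem b" "B = range ((*) b)" using summand_central_idem[OF B'] by blast
  have bl: "1 - b \<in> cell_ann l" and bm: "1 - b \<in> cell_ann m"
    using belongs_iff[OF l' b(1)] belongs_iff[OF m' b(1)] B(2,3) b(2) by auto
  show "\<forall>c. central_idem c \<longrightarrow> (c \<in> cell_ann l \<longleftrightarrow> c \<in> cell_ann m)"
  proof (intro allI impI)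
    fix c assume c: "central_idem c"
    have ci: "central_idem (b * d)" if d: "central_idem d" for d by (rule central_idem_mult[OF b(1) d])
    define I J where "I = range ((*) (b * c))" and "J = range ((*) (b * (1 - c)))"
    have IJ: "two_sided_ideal I" "two_sided_ideal J"
      unfolding I_def J_def by (intro central_idem_ideal ci c central_idem_compl)+
    have cc: "(b * c) * (b * (1 - c)) = 0"
    proof -
      have "(b * c) * (b * (1 - c)) = b * (c * b) * (1 - c)" by (simp only: mult.assoc)
      also have "c * b = b * c" by (rule central_idemD(2)[OF c])
      also have "b * (b * c) * (1 - c) = (b * b) * (c * (1 - c))" by (simp only: mult.assoc)
      also have "c * (1 - c) = 0" using central_idemD(1)[OF c] by (simp add: right_diff_distrib)
      finally show ?thesis by simp
    qed
    have "internal_direct_sum B I J" unfolding internal_direct_sum_def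
    proof
      show "B = {x + y |x y. x \<in> I \<and> y \<in> J}"
      proof
        show "B \<subseteq> {x + y |x y. x \<in> I \<and> y \<in> J}"
        proof
          fix x assume "x \<in> B"
          then obtain a where "x = b * a" using b(2) by blast
          then have "x = b * c * a + b * (1 - c) * a" by (simp add: algebra_simps)
          then show "x \<in> {x + y |x y. x \<in> I \<and> y \<in> J}" unfolding I_def J_def by blast
        qed
        have "I \<subseteq> B" "J \<subseteq> B" unfolding I_def J_def b(2) by (auto simp: mult.assoc)
        then show "{x + y |x y. x \<in> I \<and> y \<in> J} \<subseteq> B" using two_sided_idealD(2)[OF B'(1)] by blast
      qed
      show "I \<inter> J = {0}"
      proof -
        have "x = 0" if "x \<in> I" "x \<in> J" for x
        proof -
          obtain a a' where a: "x = b * c * a" "x = b * (1 - c) * a'" using \<open>x \<in> I\<close> \<open>x \<in> J\<close> I_def J_def by blast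
          have "x = (b * c) * (b * c) * a" unfolding central_idemD(1)[OF ci[OF c]] by (rule a(1))
          then have "x = (b * c) * x" using a(1) by (simp add: mult.assoc)
          then have "x = (b * c) * (b * (1 - c)) * a'" using a(2) by (metis mult.assoc)
          then show "x = 0" using cc by simp
        qed
        then show ?thesis using two_sided_idealD(1)[OF IJ(1)] two_sided_idealD(1)[OF IJ(2)] by blast
      qed
    qed
    then have "I = {0} \<or> J = {0}" using B(1) IJ unfolding is_block_def by blast
    then have "b * c = 0 \<or> b * (1 - c) = 0"
      unfolding I_def J_def by (metis mult_1_right rangeI singletonD)
    then show "c \<in> cell_ann l \<longleftrightarrow> c \<in> cell_ann m"
    proof
      assume z: "b * c = 0"
      have "c \<in> cell_ann k" if "k \<in> \<Lambda>" "1 - b \<in> cell_ann k" for k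
      proof -
        have "(1 - b) * c \<in> cell_ann k" using two_sided_idealD(3)[OF cell_ann_ideal[OF that(1)] that(2)] .
        then show ?thesis using z by (simp add: algebra_simps)
      qed
      then show ?thesis using bl bm l' m' by blast
    next
      assume z: "b * (1 - c) = 0"
      have "1 - c \<in> cell_ann k" if "k \<in> \<Lambda>" "1 - b \<in> cell_ann k" for k
      proof -
        have "(1 - b) * (1 - c) \<in> cell_ann k" using two_sided_idealD(3)[OF cell_ann_ideal[OF that(1)] that(2)] .
        moreover have "(1 - b) * (1 - c) = (1 - c) - b * (1 - c)" by (simp add: algebra_simps)
        ultimately show ?thesis using z by simp
      qed
      then show ?thesis using bl bm l' m' compl_notin_cell_ann by blast
    qed
  qed
next
  note l' = good_cells_Lambda[OF l] and m' = good_cells_Lambda[OF m]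
  assume all: "\<forall>c. central_idem c \<longrightarrow> (c \<in> cell_ann l \<longleftrightarrow> c \<in> cell_ann m)"
  define ok where "ok b \<longleftrightarrow> central_idem b \<and> 1 - b \<in> cell_ann l" for b
  have "ok 1" unfolding ok_def central_idem_def using two_sided_idealD(1)[OF cell_ann_ideal[OF l']] by simp
  then obtain b where b: "ok b" "\<And>b'. ok b' \<Longrightarrow> fd.dim (range ((*) b)) \<le> fd.dim (range ((*) b'))"
    using that[of "arg_min (\<lambda>b. fd.dim (range ((*) b))) ok"]
      arg_min_natI[of ok 1 "\<lambda>b. fd.dim (range ((*) b))"] arg_min_nat_le[of ok _ "\<lambda>b. fd.dim (range ((*) b))"]
    by blast
  have bc: "central_idem b" and bl: "1 - b \<in> cell_ann l" using b(1) by (auto simp: ok_def)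
  define B where "B = range ((*) b)"
  have Bid: "two_sided_ideal B" unfolding B_def by (rule central_idem_ideal[OF bc])
  have bx: "b * x = x" "x * b = x" if xB: "x \<in> B" for x
  proof -
    obtain a where a: "x = b * a" using xB unfolding B_def by blast
    show "b * x = x" unfolding a using central_idemD(1)[OF bc] by (simp flip: mult.assoc)
    then show "x * b = x" using central_idemD(2)[OF bc, of x] by simp
  qed
  have b0: "b \<noteq> 0" using bl one_notin_cell_ann[OF l'] by auto
  have bB: "b \<in> B" unfolding B_def by (metis mult_1_right rangeI)
  \<comment> \<open>The component i that acts as 1 on \<Delta> l is itself a central idempotent, so
    minimality forces i A = B and leaves no room for J.\<close>
  have half: "J = {0}" if IJ: "two_sided_ideal I" "two_sided_ideal J" "internal_direct_sum B I J"
      and i: "i \<in> I" "j \<in> J" "b = i + j" "1 - i \<in> cell_ann l" for I J i j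
  proof -
    have sub: "I \<subseteq> B" "J \<subseteq> B"
    proof -
      have "x + 0 \<in> B" if "x \<in> I" for x using IJ(3) that two_sided_idealD(1)[OF IJ(2)] unfolding internal_direct_sum_def by blast
      then show "I \<subseteq> B" by auto
      have "0 + x \<in> B" if "x \<in> J" for x using IJ(3) that two_sided_idealD(1)[OF IJ(1)] unfolding internal_direct_sum_def by blast
      then show "J \<subseteq> B" by auto
    qed
    have int: "x = 0" if "x \<in> I" "x \<in> J" for x using IJ(3) that unfolding internal_direct_sum_def by blast
    have ix: "i * x = x" "x * i = x" if x: "x \<in> I" for x
    proof -
      have "j * x = 0" using int two_sided_idealD(4)[OF IJ(1) x] two_sided_idealD(3)[OF IJ(2) i(2)] by blast
      then show "i * x = x" using bx(1)[of x] x sub i(3) by (metis add.right_neutral distrib_right subsetD)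
      have "x * j = 0" using int two_sided_idealD(3)[OF IJ(1) x] two_sided_idealD(4)[OF IJ(2) i(2)] by blast
      then show "x * i = x" using bx(2)[of x] x sub i(3) by (metis add.right_neutral distrib_left subsetD)
    qed
    have "i * a = a * i" for a
    proof -
      have "i * a = (i * a) * i" by (rule ix(2)[OF two_sided_idealD(3)[OF IJ(1) i(1)], symmetric])
      also have "\<dots> = i * (a * i)" by (rule mult.assoc)
      also have "\<dots> = a * i" by (rule ix(1)[OF two_sided_idealD(4)[OF IJ(1) i(1)]])
      finally show ?thesis .
    qed
    then have "central_idem i" unfolding central_idem_def using ix(1)[OF i(1)] by blast
    then have oki: "ok i" using i(4) by (simp add: ok_def)
    have iI: "range ((*) i) \<subseteq> I" using two_sided_idealD(3)[OF IJ(1) i(1)] by auto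
    have "range ((*) i) = B"
    proof (rule fd.subspace_dim_equal)
      show "subspace (range ((*) i))" "subspace B"
        using two_sided_ideal_subspace central_idem_ideal[OF \<open>central_idem i\<close>] Bid by auto
      show "range ((*) i) \<subseteq> B" using iI sub by blast
      show "fd.dim B \<le> fd.dim (range ((*) i))" unfolding B_def by (rule b(2)[OF oki])
    qed
    then have "J \<subseteq> I" using iI sub by blast
    then show ?thesis using int two_sided_idealD(1)[OF IJ(2)] by blast
  qed
  have "is_block B" unfolding is_block_def
  proof (intro conjI allI impI)
    show "two_sided_ideal B" by fact
    show "B \<noteq> {0}" using b0 bB by auto
    have "internal_direct_sum UNIV B (range ((*) (1 - b)))" unfolding internal_direct_sum_def
    proof
      have "a = b * a + (1 - b) * a" for a by (simp add: algebra_simps)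
      then show "UNIV = {x + y |x y. x \<in> B \<and> y \<in> range ((*) (1 - b))}" unfolding B_def by blast
      have "x = 0" if "x \<in> B" "x \<in> range ((*) (1 - b))" for x
      proof -
        obtain a where a: "x = (1 - b) * a" using \<open>x \<in> range _\<close> by blast
        have "b * x = (b - b * b) * a" unfolding a by (simp add: left_diff_distrib right_diff_distrib mult.assoc)
        then show "x = 0" using bx(1)[OF that(1)] central_idemD(1)[OF bc] by simp
      qed
      then show "B \<inter> range ((*) (1 - b)) = {0}"
        using two_sided_idealD(1)[OF Bid] two_sided_idealD(1)[OF central_idem_ideal[OF central_idem_compl[OF bc]]] by blast
    qed
    then show "\<exists>B'. two_sided_ideal B' \<and> internal_direct_sum UNIV B B'"
      using central_idem_ideal[OF central_idem_compl[OF bc]] by blast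
    fix I J assume "two_sided_ideal I \<and> two_sided_ideal J \<and> internal_direct_sum B I J"
    then have IJ: "two_sided_ideal I" "two_sided_ideal J" "internal_direct_sum B I J" by auto
    have JI: "internal_direct_sum B J I"
      using IJ(3) unfolding internal_direct_sum_def by (auto simp: Int_commute) (metis add.commute)+
    obtain i j where ij: "i \<in> I" "j \<in> J" "b = i + j" using bB IJ(3) unfolding internal_direct_sum_def by blast
    show "I = {0} \<or> J = {0}"
    proof (cases "1 - i \<in> cell_ann l")
      case True
      then show ?thesis using half[OF IJ ij] by blast
    next
      \<comment> \<open>Then i acts as 0 on \<Delta> l, so j acts as 1 there and the roles of I and
        J are exchanged.\<close>
      case False
      have int: "x = 0" if "x \<in> I" "x \<in> J" for x
        using IJ(3) that unfolding internal_direct_sum_def by blast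
      have ibj: "i * x = x \<and> x * i = x" if x: "x \<in> I" for x
      proof -
        have "x + 0 \<in> B" using IJ(3) x two_sided_idealD(1)[OF IJ(2)] unfolding internal_direct_sum_def by blast
        then have xB: "x \<in> B" by simp
        have "j * x = 0"
          by (rule int[OF two_sided_idealD(4)[OF IJ(1) x] two_sided_idealD(3)[OF IJ(2) ij(2)]])
        moreover have "x * j = 0"
          by (rule int[OF two_sided_idealD(3)[OF IJ(1) x] two_sided_idealD(4)[OF IJ(2) ij(2)]])
        ultimately show ?thesis using bx[OF xB] ij(3) by (simp add: distrib_left distrib_right)
      qed
      have ii: "i * i = i" using ibj[OF ij(1)] by simp
      have "i * a = a * i" for a
      proof -
        have "i * a = (i * a) * i" using ibj[OF two_sided_idealD(3)[OF IJ(1) ij(1)]] by simp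
        also have "\<dots> = i * (a * i)" by (rule mult.assoc)
        also have "\<dots> = a * i" using ibj[OF two_sided_idealD(4)[OF IJ(1) ij(1)]] by simp
        finally show ?thesis .
      qed
      then have "central_idem i" unfolding central_idem_def using ii by blast
      then have "i \<in> cell_ann l" using central_idem_cell_ann[OF l] False by blast
      then have "(1 - b) + i \<in> cell_ann l" using two_sided_idealD(2)[OF cell_ann_ideal[OF l'] bl] by blast
      then have "1 - j \<in> cell_ann l" using ij(3) by (simp add: algebra_simps)
      then show ?thesis using half[OF IJ(2,1) JI ij(2,1)] ij(3) by (simp add: add.commute)
    qed
  qed
  moreover have "1 - b \<in> cell_ann m" using all central_idem_compl[OF bc] bl by blast
  ultimately have "belongs_to_block (CM l) B" "belongs_to_block (CM m) B"
    unfolding belongs_to_block_def B_def using belongs_iff[OF l' bc] belongs_iff[OF m' bc] bl by auto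
  then show "\<exists>B. belongs_to_block (CM l) B \<and> belongs_to_block (CM m) B" by blast
qed

text \<open>A union of linkage classes is cut out by a central idempotent: an idempotent that acts as 0 or 1
  on the simple modules acts in the same way on the cell modules, so does its image under the
  involution, and the filtration of the algebra by cells then forces it to be central.\<close>

lemma linkage_class_central_idem:
  assumes good_cells: "good_cells = \<Lambda>"
    and link: "\<And>l m. l \<in> \<Lambda> \<Longrightarrow> m \<in> \<Lambda> \<Longrightarrow> prim_idem m \<notin> cell_ann l \<Longrightarrow> l \<in> X \<longleftrightarrow> m \<in> X"
  shows "\<exists>f. central_idem f \<and> (\<forall>l\<in>\<Lambda>. if l \<in> X then 1 - f \<in> cell_ann l else f \<in> cell_ann l)"
proof -
  obtain a where a: "\<And>l. l \<in> \<Lambda> \<Longrightarrow> a - (if l \<in> X then 1 else 0) \<in> head_ann l"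
    using density[of "\<lambda>l. if l \<in> X then 1 else 0"] by blast
  have "a * a - a \<in> head_ann l" if l: "l \<in> \<Lambda>" for l
  proof -
    note R = two_sided_idealD[OF head_ann_ideal[OF l]]
    have "a * (a - 1) = (a - 1) * a" by (simp add: algebra_simps)
    moreover have "a * (a - 1) = a * a - a" by (simp add: algebra_simps)
    ultimately show ?thesis using a[OF l] R(3,4) by (cases "l \<in> X") (metis, metis diff_zero)
  qed
  then have "a * a - a \<in> heads_ann" by (simp add: heads_ann_def)
  then obtain f where f: "f * f = f" "f - a \<in> heads_ann" using lift_idempotent_heads_ann by blast
  have fRA: "f - (if l \<in> X then 1 else 0) \<in> head_ann l" if l: "l \<in> \<Lambda>" for l
  proof -
    have "(f - a) + (a - (if l \<in> X then 1 else 0)) \<in> head_ann l"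
      using two_sided_idealD(2)[OF head_ann_ideal[OF l] _ a[OF l], of "f - a"] f(2) l unfolding heads_ann_def by blast
    then show ?thesis by (simp add: algebra_simps)
  qed
  \<comment> \<open>By the linkage hypothesis every cell k with \<open>prim_idem k\<close> nonzero
    on \<Delta> l is on the same side of X as l. So \<open>idem_in_ideal\<close> passes from the
    action of g on the heads to its action on \<Delta> l.\<close>
  have lift: "(if l \<in> X then 1 - g \<in> cell_ann l else g \<in> cell_ann l)"
    if g: "g * g = g" "\<And>l. l \<in> \<Lambda> \<Longrightarrow> g - (if l \<in> X then 1 else 0) \<in> head_ann l" and l: "l \<in> \<Lambda>" for g l
  proof -
    have g1: "1 - g \<in> head_ann k" if "k \<in> \<Lambda>" "k \<in> X" for k
      using two_sided_idealD(5)[OF head_ann_ideal[OF that(1)] g(2)[OF that(1)]] that by simp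
    have g0: "g \<in> head_ann k" if "k \<in> \<Lambda>" "k \<notin> X" for k using g(2)[OF that(1)] that by simp
    have idem: "(1 - g) * (1 - g) = 1 - g" using g(1) by (simp add: algebra_simps)
    show ?thesis
    proof (cases "l \<in> X")
      case True
      have "1 - g \<in> cell_ann l"
      proof (rule idem_in_ideal[OF cell_ann_ideal[OF l] idem])
        fix k assume k: "k \<in> \<Lambda>"
        show "1 - g \<in> head_ann k \<or> (k \<in> good_cells \<and> prim_idem k \<in> cell_ann l)"
          using g1[OF k] link[OF l k] True k good_cells by blast
      qed
      then show ?thesis using True by simp
    next
      case False
      have "g \<in> cell_ann l"
      proof (rule idem_in_ideal[OF cell_ann_ideal[OF l] g(1)])
        fix k assume k: "k \<in> \<Lambda>"
        show "g \<in> head_ann k \<or> (k \<in> good_cells \<and> prim_idem k \<in> cell_ann l)"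
          using g0[OF k] link[OF l k] False k good_cells by blast
      qed
      then show ?thesis using False by simp
    qed
  qed
  have fs: "cstar f * cstar f = cstar f" using f(1) by (metis cstar_mult)
  have fsRA: "cstar f - (if l \<in> X then 1 else 0) \<in> head_ann l" if l: "l \<in> \<Lambda>" for l
    using fRA[OF l] head_ann_star[OF l, of "f - (if l \<in> X then 1 else 0)"] by (auto simp: cstar_diff split: if_splits)
  note fA = lift[OF f(1) fRA] and fsA = lift[OF fs fsRA]
  \<comment> \<open>The product is fixed by u on the left and by v on the right. In the layer of l
    either v kills its rows or u kills its columns, so it descends through all cells to 0.\<close>
  have kill: "u * w * v = 0"
    if uv: "u * u = u" "v * v = v"
      "\<And>l. l \<in> \<Lambda> \<Longrightarrow> v \<in> cell_ann l \<or> cstar u \<in> cell_ann l" for u v w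
  proof -
    define z where "z = u * w * v"
    have zv: "z * v = z" unfolding z_def using uv(2) by (simp add: mult.assoc)
    have uz: "u * z = z" unfolding z_def using uv(1) by (simp flip: mult.assoc)
    have "z \<in> cspan U" if "upset U" for U
      using that
    proof (induction rule: upset_induct)
      case top
      then show ?case by (simp add: cspan_Lambda)
    next
      case (step U l)
      from uv(3)[OF step(4)] show ?case
      proof
        assume vA: "v \<in> cell_ann l"
        show ?thesis
        proof (rule in_cspan_if_rows[OF step(5)])
          fix s assume s: "s \<in> T l"
          have "row l s (z * v) = act l (row l s z) v" by (rule row_mult[OF step(1-3) step(5) step(4) s])
          then show "row l s z = 0" using vA row_in unfolding zv cell_ann_def by auto
        qed
      next
        assume uA: "cstar u \<in> cell_ann l"
        have "cstar z \<in> cspan U"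
        proof (rule in_cspan_if_rows[OF cstar_cspan[OF step(5)]])
          fix s assume s: "s \<in> T l"
          have "row l s (cstar z * cstar u) = act l (row l s (cstar z)) (cstar u)"
            by (rule row_mult[OF step(1-3) cstar_cspan[OF step(5)] step(4) s])
          moreover have "cstar z * cstar u = cstar z" using uz by (metis cstar_mult)
          ultimately show "row l s (cstar z) = 0" using uA row_in unfolding cell_ann_def by auto
        qed
        then show ?thesis using cstar_cspan[of "cstar z"] by simp
      qed
    qed
    from this[of "{}"] show ?thesis by (simp add: upset_def cspan_empty z_def)
  qed
  have idem: "(1 - f) * (1 - f) = 1 - f" using f(1) by (simp add: algebra_simps)
  \<comment> \<open>On each \<Delta> l the idempotents f and \<open>cstar f\<close> both act as 1 or
    both as 0, so one of 1 - f and \<open>cstar f\<close> acts as 0 there; the same holds with f and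
    1 - f exchanged.\<close>
  have "f * w * (1 - f) = 0" for w
    using fA fsA by (intro kill[OF f(1) idem]) metis
  moreover have "(1 - f) * w * f = 0" for w
    using fA fsA by (intro kill[OF idem f(1)]) (metis cstar_diff cstar_one)
  ultimately have "f * w = w * f" for w by (simp add: left_diff_distrib right_diff_distrib)
  then have "central_idem f" unfolding central_idem_def using f(1) by blast
  then show ?thesis using fA by blast
qed

end

section \<open>Jantzen coefficients\<close>

text \<open>The properties of the Jantzen filtration on which the argument rests, stated over the
  residue field alone, with F l i as its i-th term. Finiteness makes the sum of the terms
  meaningful, since a sum over an infinite index set is 0 by convention.\<close>

locale jantzen_data = field_cell_datum scale \<Lambda> T C
  for scale :: "'k::field \<Rightarrow> 'a::ring_1 \<Rightarrow> 'a" (infixr \<open>*s\<close> 75)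
    and \<Lambda> :: "'l::order set" and T :: "'l \<Rightarrow> 't set" and C :: "'l \<Rightarrow> 't \<Rightarrow> 't \<Rightarrow> 'a" +
  fixes F :: "'l \<Rightarrow> nat \<Rightarrow> ('t \<Rightarrow> 'k) set"
  assumes good_cells: "good_cells = \<Lambda>"
    and F_rad: "l \<in> \<Lambda> \<Longrightarrow> 0 < i \<Longrightarrow> F l i \<subseteq> rad l"
    and F_zero: "l \<in> \<Lambda> \<Longrightarrow> 0 \<in> F l i"
    and F_add: "l \<in> \<Lambda> \<Longrightarrow> x \<in> F l i \<Longrightarrow> y \<in> F l i \<Longrightarrow> x + y \<in> F l i"
    and F_act: "l \<in> \<Lambda> \<Longrightarrow> x \<in> F l i \<Longrightarrow> act l x a \<in> F l i"
    and F_one: "l \<in> \<Lambda> \<Longrightarrow> F l 1 = rad l"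
    and F_finite: "l \<in> \<Lambda> \<Longrightarrow> finite {i. 0 < i \<and> F l i \<noteq> {0}}"
begin

section \<open>Existence and uniqueness of the Jantzen coefficients\<close>

definition "Fil l i = CM l\<lparr>mcarrier := F l i\<rparr>"

lemma Fil_simps [simp]: "mcarrier (Fil l i) = F l i" "mact (Fil l i) = act l"
  by (simp_all add: Fil_def)

definition is_coeff :: "('l \<Rightarrow> 'l \<Rightarrow> int) \<Rightarrow> bool" where
  "is_coeff J \<longleftrightarrow> (\<forall>l \<mu>. \<not> (l \<in> \<Lambda> \<and> \<mu> \<in> \<Lambda> \<and> \<mu> < l) \<longrightarrow> J l \<mu> = 0) \<and>
     (\<forall>l\<in>\<Lambda>. K0_eq scale (\<Sum>i | 0 < i \<and> mcarrier (Fil l i) \<noteq> {0}. K0_multiple scale 1 (Fil l i))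
        (\<Sum>\<mu> | \<mu> \<in> \<Lambda> \<and> \<mu> < l. K0_multiple scale (J l \<mu>) (CM \<mu>)))"

definition "jcoeff = (THE J. is_coeff J)"

lemma Fil_fd: "l \<in> \<Lambda> \<Longrightarrow> 0 < i \<Longrightarrow> fd_module scale (Fil l i)"
proof -
  assume l: "l \<in> \<Lambda>" and i: "0 < i"
  have "F l i \<subseteq> \<Delta> l" using F_rad[OF l i] rad_closed(1)[of l] by blast
  then show ?thesis unfolding Fil_def by (rule CM_sub_fd[OF l _ F_zero[OF l] F_add[OF l] F_act[OF l]])
qed

lemma rad_killed:
  assumes l: "l \<in> \<Lambda>" and x: "x \<in> rad l" and a: "a \<in> cspan {m \<in> \<Lambda>. \<not> m < l}"
  shows "act l x a = 0"
proof (rule cspan_induct[OF a])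
  show "subspace {a. act l x a = 0}"
    using l by (auto simp: subspace_def act_add act_scale fun_eq_iff)
next
  fix m s t assume m: "m \<in> \<Lambda>" "m \<in> {m \<in> \<Lambda>. \<not> m < l}" "s \<in> T m" "t \<in> T m"
  show "act l x (C m s t) = 0"
  proof (cases "m = l")
    case True
    then show ?thesis using m l x unitv_in[of s l] by (auto simp: act_C_same rad_def fun_eq_iff)
  next
    case False
    then have "\<not> m \<le> l" using m by (auto simp: le_less)
    then show ?thesis using act_cspan_zero[OF l C_in_cspan[of m "{m}" s t]] m by auto
  qed
qed

text \<open>The terms with i > 0 lie in the radical, which by \<open>rad_killed\<close> is
  annihilated by all cells not strictly below l; so \<open>cell_classes_span\<close> needs only the
  cells strictly below l.\<close>

lemma coeff_exists: "\<exists>J. is_coeff J"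
proof -
  have "\<exists>c. (\<Sum>i | 0 < i \<and> mcarrier (Fil l i) \<noteq> {0}. K0_multiple scale 1 (Fil l i))
      - (\<Sum>m\<in>{\<mu> \<in> \<Lambda>. \<mu> < l}. Poly_Mapping.single (nat_copy (CM m)) (c m)) \<in> rel" if l: "l \<in> \<Lambda>" for l
  proof -
    define U where "U = {m \<in> \<Lambda>. \<not> m < l}"
    have U: "upset U" unfolding U_def upset_def by (auto dest: less_trans)
    have LU: "\<Lambda> - U = {\<mu> \<in> \<Lambda>. \<mu> < l}" by (auto simp: U_def)
    have "intspan (\<Lambda> - U) (\<Sum>i | 0 < i \<and> mcarrier (Fil l i) \<noteq> {0}. K0_multiple scale 1 (Fil l i))"
    proof (rule intspan_sum)
      fix i assume "i \<in> {i. 0 < i \<and> mcarrier (Fil l i) \<noteq> {0}}"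
      then have i: "0 < i" by simp
      have fd: "fd_module scale (Fil l i)" by (rule Fil_fd[OF l i])
      show "intspan (\<Lambda> - U) (K0_multiple scale 1 (Fil l i))"
        unfolding K0_multiple_nat_copy
      proof (rule cell_classes_span[OF U good_cells nat_copy(1)[OF fd]])
        fix x a assume x: "x \<in> mcarrier (nat_copy (Fil l i))" and a: "a \<in> cspan U"
        obtain h where h: "rmodule_hom (Fil l i) (nat_copy (Fil l i)) h"
          "bij_betw h (mcarrier (Fil l i)) (mcarrier (nat_copy (Fil l i)))"
          using nat_copy(2)[OF fd] unfolding rmodule_iso_def by blast
        have "x \<in> h ` mcarrier (Fil l i)" using x h(2) unfolding bij_betw_def by blast
        then obtain y where y: "y \<in> mcarrier (Fil l i)" "x = h y" by blast
        have "act l y a = 0" using y(1) F_rad[OF l i] rad_killed[OF l _ a[unfolded U_def]] by auto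
        then have "mact (nat_copy (Fil l i)) x a = h 0" using rmodule_homD(3)[OF h(1) y(1), of a] y(2) by simp
        also have "h 0 = 0"
          using rmodule_homD(2)[OF h(1) rm_zero[OF fd_moduleD[OF fd]] rm_zero[OF fd_moduleD[OF fd]]] by simp
        finally show "mact (nat_copy (Fil l i)) x a = 0" .
      qed
    qed
    then show ?thesis unfolding intspan_def LU .
  qed
  then have ex: "\<forall>l\<in>\<Lambda>. \<exists>c. (\<Sum>i | 0 < i \<and> mcarrier (Fil l i) \<noteq> {0}. K0_multiple scale 1 (Fil l i))
      - (\<Sum>m\<in>{\<mu> \<in> \<Lambda>. \<mu> < l}. Poly_Mapping.single (nat_copy (CM m)) (c m)) \<in> rel" ..
  obtain c where c: "\<forall>l\<in>\<Lambda>. (\<Sum>i | 0 < i \<and> mcarrier (Fil l i) \<noteq> {0}. K0_multiple scale 1 (Fil l i))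
      - (\<Sum>m\<in>{\<mu> \<in> \<Lambda>. \<mu> < l}. Poly_Mapping.single (nat_copy (CM m)) (c l m)) \<in> rel"
    by (rule exE[OF bchoice[OF ex]])
  define J where "J l m = (if l \<in> \<Lambda> \<and> m \<in> \<Lambda> \<and> m < l then c l m else 0)" for l m
  have "(\<Sum>\<mu> | \<mu> \<in> \<Lambda> \<and> \<mu> < l. K0_multiple scale (J l \<mu>) (CM \<mu>))
    = (\<Sum>m\<in>{\<mu> \<in> \<Lambda>. \<mu> < l}. Poly_Mapping.single (nat_copy (CM m)) (c l m))" if "l \<in> \<Lambda>" for l
    using that by (intro sum.cong) (auto simp: K0_multiple_nat_copy J_def)
  then have "is_coeff J" unfolding is_coeff_def K0_eq_def using c by (auto simp: J_def)
  then show ?thesis by blast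
qed

lemma coeff_edim:
  assumes J: "is_coeff J" and l: "l \<in> \<Lambda>" and e: "e * e = e"
  shows "(\<Sum>i | 0 < i \<and> F l i \<noteq> {0}. int (edim (Fil l i) e)) = (\<Sum>\<mu> | \<mu> \<in> \<Lambda> \<and> \<mu> < l. J l \<mu> * int (edim (CM \<mu>) e))"
proof -
  let ?X = "\<Sum>i | 0 < i \<and> mcarrier (Fil l i) \<noteq> {0}. K0_multiple scale 1 (Fil l i)"
  let ?Y = "\<Sum>\<mu> | \<mu> \<in> \<Lambda> \<and> \<mu> < l. K0_multiple scale (J l \<mu>) (CM \<mu>)"
  have "hdim e (?X - ?Y) = 0"
    using J l hdim_rel[OF e] unfolding is_coeff_def K0_eq_def by blast
  moreover have "hdim e ?X = (\<Sum>i | 0 < i \<and> F l i \<noteq> {0}. int (edim (Fil l i) e))"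
    unfolding hdim_sum using l e by (intro sum.cong) (auto simp: hdim_K0_multiple Fil_fd)
  moreover have "hdim e ?Y = (\<Sum>\<mu> | \<mu> \<in> \<Lambda> \<and> \<mu> < l. J l \<mu> * int (edim (CM \<mu>) e))"
    unfolding hdim_sum using e by (intro sum.cong) (auto simp: hdim_K0_multiple CM_fd)
  ultimately show ?thesis by (simp add: hdim_diff)
qed

lemma coeff_unique: "is_coeff J \<Longrightarrow> is_coeff J' \<Longrightarrow> J = J'"
proof (intro ext)
  fix l m assume J: "is_coeff J" and J': "is_coeff J'"
  show "J l m = J' l m"
  proof (cases "l \<in> \<Lambda> \<and> m \<in> \<Lambda> \<and> m < l")
    case True
    have fin: "finite {\<mu>. \<mu> \<in> \<Lambda> \<and> \<mu> < l}" using finite_Lambda by simp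
    have "J l m - J' l m = 0"
    proof (rule cell_classes_independent[OF fin])
      show "{\<mu>. \<mu> \<in> \<Lambda> \<and> \<mu> < l} \<subseteq> good_cells" using good_cells by auto
      fix k assume "k \<in> {\<mu>. \<mu> \<in> \<Lambda> \<and> \<mu> < l}"
      then have k: "k \<in> good_cells" using good_cells by auto
      show "(\<Sum>m | m \<in> \<Lambda> \<and> m < l. (J l m - J' l m) * int (edim (CM m) (prim_idem k))) = 0"
        using coeff_edim[OF J, of l "prim_idem k"] coeff_edim[OF J', of l "prim_idem k"] True prim_idem_idem[OF k]
        by (simp add: left_diff_distrib sum_subtractf)
    qed (use True in simp)
    then show ?thesis by simp
  next
    case False
    then show ?thesis using J J' unfolding is_coeff_def by metis
  qed
qed

lemma is_coeff_jcoeff: "is_coeff jcoeff"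
  unfolding jcoeff_def using coeff_exists coeff_unique by (metis theI')

lemma jcoeff_range: "jcoeff l m \<noteq> 0 \<Longrightarrow> l \<in> \<Lambda> \<and> m \<in> \<Lambda> \<and> m < l"
  using is_coeff_jcoeff unfolding is_coeff_def by blast

text \<open>If c kills \<Delta> l, it kills the whole filtration, so the functionals of the
  idempotents c \<open>prim_idem k\<close> give homogeneous relations among the coefficients in row
  l. Only the cells in D, where c acts as 1, contribute, and there c \<open>prim_idem k\<close> acts
  like \<open>prim_idem k\<close>. Independence on D makes all coefficients on D vanish.\<close>

lemma jcoeff_cell_ann_step:
  assumes J: "jcoeff l m \<noteq> 0" and c: "central_idem c" and cl: "c \<in> cell_ann l"
  shows "c \<in> cell_ann m"
proof (rule ccontr)
  assume cm: "c \<notin> cell_ann m"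
  have lm: "l \<in> \<Lambda>" "m \<in> \<Lambda>" "m < l" using jcoeff_range[OF J] by auto
  define D where "D = {\<mu> \<in> \<Lambda>. \<mu> < l \<and> c \<notin> cell_ann \<mu>}"
  have finD: "finite D" "D \<subseteq> good_cells" using finite_Lambda good_cells by (auto simp: D_def)
  have "jcoeff l m = 0"
  proof (rule cell_classes_independent[OF finD])
    show "m \<in> D" using lm cm by (simp add: D_def)
    fix k assume "k \<in> D"
    then have k: "k \<in> good_cells" using finD by auto
    define e where "e = c * prim_idem k"
    have e: "e * e = e"
    proof -
      have "e * e = c * (prim_idem k * c) * prim_idem k" unfolding e_def by (simp only: mult.assoc)
      also have "prim_idem k * c = c * prim_idem k" by (rule central_idemD(2)[OF c, symmetric])
      also have "c * (c * prim_idem k) * prim_idem k = (c * c) * (prim_idem k * prim_idem k)" by (simp only: mult.assoc)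
      finally show ?thesis unfolding central_idemD(1)[OF c] prim_idem_idem[OF k] e_def .
    qed
    have "edim (Fil l i) e = 0" if i: "0 < i" for i
    proof -
      have "act l x e = 0" if "x \<in> F l i" for x
        using that F_rad[OF lm(1) i] rad_closed(1)[of l] cl lm(1) unfolding e_def act_mult[OF lm(1)] cell_ann_def by auto
      then show ?thesis using edim_eq_0[OF Fil_fd[OF lm(1) i] e] by simp
    qed
    then have z: "(\<Sum>\<mu> | \<mu> \<in> \<Lambda> \<and> \<mu> < l. jcoeff l \<mu> * int (edim (CM \<mu>) e)) = 0"
      using coeff_edim[OF is_coeff_jcoeff lm(1) e] by simp
    have "(\<Sum>\<mu>\<in>D. jcoeff l \<mu> * int (edim (CM \<mu>) (prim_idem k))) = (\<Sum>\<mu> | \<mu> \<in> \<Lambda> \<and> \<mu> < l. jcoeff l \<mu> * int (edim (CM \<mu>) e))"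
    proof (rule sum.mono_neutral_cong_left)
      show "finite {\<mu>. \<mu> \<in> \<Lambda> \<and> \<mu> < l}" using finite_Lambda by simp
      show "D \<subseteq> {\<mu>. \<mu> \<in> \<Lambda> \<and> \<mu> < l}" by (auto simp: D_def)
      show "\<forall>\<mu>\<in>{\<mu>. \<mu> \<in> \<Lambda> \<and> \<mu> < l} - D. jcoeff l \<mu> * int (edim (CM \<mu>) e) = 0"
      proof
        fix \<mu> assume "\<mu> \<in> {\<mu>. \<mu> \<in> \<Lambda> \<and> \<mu> < l} - D"
        then have \<mu>: "\<mu> \<in> \<Lambda>" "c \<in> cell_ann \<mu>" by (auto simp: D_def)
        have "e \<in> cell_ann \<mu>" unfolding e_def by (rule two_sided_idealD(3)[OF cell_ann_ideal[OF \<mu>(1)] \<mu>(2)])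
        then show "jcoeff l \<mu> * int (edim (CM \<mu>) e) = 0" using edim_CM_0[OF \<mu>(1) e] by simp
      qed
      fix \<mu> assume "\<mu> \<in> D"
      then have \<mu>: "\<mu> \<in> \<Lambda>" "1 - c \<in> cell_ann \<mu>" using central_idem_cell_ann[OF _ c, of \<mu>] good_cells by (auto simp: D_def)
      have "act \<mu> x e = act \<mu> x (prim_idem k)" if "x \<in> \<Delta> \<mu>" for x
        unfolding e_def act_mult[OF \<mu>(1)] act_fixed[OF \<mu> that] ..
      then have "epart (CM \<mu>) e = epart (CM \<mu>) (prim_idem k)" by (auto simp: epart_def)
      then show "jcoeff l \<mu> * int (edim (CM \<mu>) (prim_idem k)) = jcoeff l \<mu> * int (edim (CM \<mu>) e)"
        by (simp add: edim_def)
    qed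
    then show "(\<Sum>\<mu>\<in>D. jcoeff l \<mu> * int (edim (CM \<mu>) (prim_idem k))) = 0" using z by simp
  qed
  then show False using J by simp
qed

text \<open>c acts on each cell module as 0 or as 1, so the converse is the preceding lemma for 1 -
  c.\<close>

lemma jcoeff_cell_ann:
  assumes J: "jcoeff l m \<noteq> 0" and c: "central_idem c"
  shows "c \<in> cell_ann l \<longleftrightarrow> c \<in> cell_ann m"
proof
  assume cm: "c \<in> cell_ann m"
  have lm: "l \<in> good_cells" "m \<in> \<Lambda>" using jcoeff_range[OF J] good_cells by auto
  show "c \<in> cell_ann l"
    using central_idem_cell_ann[OF lm(1) c] jcoeff_cell_ann_step[OF J central_idem_compl[OF c]] compl_notin_cell_ann[OF lm(2) cm] by blast
qed (rule jcoeff_cell_ann_step[OF J c])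

section \<open>Jantzen linkage and blocks\<close>

abbreviation "jstep \<equiv> (\<lambda>l \<mu>. l \<in> \<Lambda> \<and> \<mu> \<in> \<Lambda> \<and> (jcoeff l \<mu> \<noteq> 0 \<or> jcoeff \<mu> l \<noteq> 0))"

lemma jstep_sym: "jstep\<^sup>*\<^sup>* l m \<Longrightarrow> jstep\<^sup>*\<^sup>* m l"
proof (induction rule: rtranclp_induct)
  case (step y z)
  then have "jstep z y" by auto
  then show ?case using step(3) by (rule converse_rtranclp_into_rtranclp)
qed simp

text \<open>For l \<noteq> m, \<open>prim_idem m\<close> kills the head of l, so its image on
  \<Delta> l lies in the radical, the first term of the filtration. The left side of the Jantzen
  relation is thus positive at \<open>prim_idem m\<close>; some cell below l has a nonzero
  coefficient and a nonzero action of \<open>prim_idem m\<close>, and the induction applies to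
  it.\<close>

lemma composition_factor_linked:
  assumes "l \<in> \<Lambda>" "m \<in> \<Lambda>" "prim_idem m \<notin> cell_ann l"
  shows "jstep\<^sup>*\<^sup>* l m"
  using assms(1,3)
proof (induction "card {k \<in> \<Lambda>. k < l}" arbitrary: l rule: less_induct)
  case less
  have mL: "m \<in> good_cells" using assms(2) good_cells by simp
  note l = less.prems(1)
  show ?case
  proof (cases "l = m")
    case False
    obtain x where x: "x \<in> \<Delta> l" "act l x (prim_idem m) \<noteq> 0" using less.prems(2) by (auto simp: cell_ann_def)
    define y where "y = act l x (prim_idem m)"
    have y: "y \<in> rad l" "act l y (prim_idem m) = y" "y \<noteq> 0"
      using prim_idem_other[OF mL l False] x l prim_idem_idem[OF mL] unfolding y_def head_ann_def
      by (auto simp flip: act_mult[OF l])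
    have y1: "y \<in> F l 1" using y(1) F_one[OF l] by simp
    then have "edim (Fil l 1) (prim_idem m) \<noteq> 0"
      using edim_eq_0[OF Fil_fd[OF l, of 1] prim_idem_idem[OF mL]] y by auto
    then have "0 < int (edim (Fil l 1) (prim_idem m))" by simp
    also have "\<dots> \<le> (\<Sum>i | 0 < i \<and> F l i \<noteq> {0}. int (edim (Fil l i) (prim_idem m)))"
      using y1 y(3) F_finite[OF l] by (intro member_le_sum) auto
    finally have "(\<Sum>\<mu> | \<mu> \<in> \<Lambda> \<and> \<mu> < l. jcoeff l \<mu> * int (edim (CM \<mu>) (prim_idem m))) \<noteq> 0"
      using coeff_edim[OF is_coeff_jcoeff l prim_idem_idem[OF mL]] by simp
    then obtain \<mu> where \<mu>: "\<mu> \<in> \<Lambda>" "\<mu> < l" "jcoeff l \<mu> * int (edim (CM \<mu>) (prim_idem m)) \<noteq> 0"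
      by (metis (mono_tags, lifting) mem_Collect_eq sum.neutral)
    then have J: "jcoeff l \<mu> \<noteq> 0" and "prim_idem m \<notin> cell_ann \<mu>" using edim_CM_0[OF \<mu>(1) prim_idem_idem[OF mL]] by auto
    have "{k \<in> \<Lambda>. k < \<mu>} \<subset> {k \<in> \<Lambda>. k < l}" using \<mu> by (auto dest: less_trans)
    then have "card {k \<in> \<Lambda>. k < \<mu>} < card {k \<in> \<Lambda>. k < l}" using finite_Lambda by (intro psubset_card_mono) auto
    then have "jstep\<^sup>*\<^sup>* \<mu> m" using less.hyps \<mu>(1) \<open>prim_idem m \<notin> cell_ann \<mu>\<close> by blast
    moreover have "jstep l \<mu>" using J l \<mu> by simp
    ultimately show ?thesis by (rule converse_rtranclp_into_rtranclp[rotated])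
  qed simp
qed

theorem same_block_iff_jantzen:
  assumes l: "l \<in> \<Lambda>" and m: "m \<in> \<Lambda>"
  shows "(\<exists>B. belongs_to_block (CM l) B \<and> belongs_to_block (CM m) B) \<longleftrightarrow> jstep\<^sup>*\<^sup>* l m"
proof -
  have "(\<forall>c. central_idem c \<longrightarrow> (c \<in> cell_ann l \<longleftrightarrow> c \<in> cell_ann m)) \<longleftrightarrow> jstep\<^sup>*\<^sup>* l m"
  proof
    assume "jstep\<^sup>*\<^sup>* l m"
    then show "\<forall>c. central_idem c \<longrightarrow> (c \<in> cell_ann l \<longleftrightarrow> c \<in> cell_ann m)"
    proof (induction rule: rtranclp_induct)
      case (step y z)
      have "c \<in> cell_ann y \<longleftrightarrow> c \<in> cell_ann z" if "central_idem c" for c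
        using step(2) jcoeff_cell_ann[OF _ that, of y z] jcoeff_cell_ann[OF _ that, of z y] by blast
      then show ?case using step(3) by blast
    qed simp
  next
    assume all: "\<forall>c. central_idem c \<longrightarrow> (c \<in> cell_ann l \<longleftrightarrow> c \<in> cell_ann m)"
    \<comment> \<open>The linkage class of l. The central idempotent cutting it out acts as 1 on
      \<Delta> l, hence on \<Delta> m, which places m in the class.\<close>
    define X where "X = {k. jstep\<^sup>*\<^sup>* l k}"
    have "k \<in> X \<longleftrightarrow> k' \<in> X" if "k \<in> \<Lambda>" "k' \<in> \<Lambda>" "prim_idem k' \<notin> cell_ann k" for k k'
    proof -
      have kk: "jstep\<^sup>*\<^sup>* k k'" by (rule composition_factor_linked[OF that])
      show ?thesis unfolding X_def mem_Collect_eq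
      proof
        assume "jstep\<^sup>*\<^sup>* l k" then show "jstep\<^sup>*\<^sup>* l k'" using kk by (rule rtranclp_trans)
      next
        assume "jstep\<^sup>*\<^sup>* l k'" then show "jstep\<^sup>*\<^sup>* l k" using jstep_sym[OF kk] by (rule rtranclp_trans)
      qed
    qed
    from linkage_class_central_idem[OF good_cells this]
    obtain f where f: "central_idem f" "\<And>k. k \<in> \<Lambda> \<Longrightarrow> if k \<in> X then 1 - f \<in> cell_ann k else f \<in> cell_ann k" by blast
    have "l \<in> X" by (simp add: X_def)
    then have "1 - f \<in> cell_ann l" using f(2)[OF l] by simp
    then have "1 - f \<in> cell_ann m" using all central_idem_compl[OF f(1)] by blast
    then have "f \<notin> cell_ann m" using compl_notin_cell_ann[OF m] by blast
    then have "m \<in> X" using f(2)[OF m] by (metis (full_types))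
    then show "jstep\<^sup>*\<^sup>* l m" by (simp add: X_def)
  qed
  then show ?thesis using same_block_iff[of l m] l m good_cells by simp
qed

end

section \<open>Base change and discrete valuation rings\<close>

text \<open>For x in the radical, z = C_s \<otimes> x satisfies z a z = 0 modulo the cells above l,
  since x a is again in the radical. Semisimplicity splits off I = z A + \<open>cspan U\<close>, and
  the component i of 1 in I satisfies z = i z. So z lies in \<open>cspan U\<close>, and x =
  0.\<close>

lemma (in field_cell_datum) semisimple_rad:
  assumes ss: "semisimple_ring TYPE('a)" and l: "l \<in> \<Lambda>"
  shows "rad l = {0}"
proof -
  have "x = 0" if x: "x \<in> rad l" for x
  proof -
    define U where "U = {m \<in> \<Lambda>. l < m}"
    have U: "upset U" "upset (insert l U)" "l \<notin> U" using l by (auto simp: U_def upset_def)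
    obtain s where s: "s \<in> T l" using T_nonempty[OF l] by auto
    have xD: "x \<in> \<Delta> l" using x rad_closed(1) by blast
    define z where "z = tens l (unitv s) x"
    define I where "I = {z * a + u | a u. u \<in> cspan U}"
    note cU = two_sided_idealD[OF cspan_ideal[OF U(1)]]
    have I: "right_ideal I" unfolding right_ideal_def
    proof safe
      have "z * 0 + 0 \<in> I" unfolding I_def using cU(1) by blast
      then show "0 \<in> I" by simp
    next
      fix y w assume "y \<in> I" "w \<in> I"
      then obtain a u b v where "y = z * a + u" "w = z * b + v" "u \<in> cspan U" "v \<in> cspan U" by (auto simp: I_def)
      then have "y + w = z * (a + b) + (u + v)" "u + v \<in> cspan U" using cU(2) by (auto simp: algebra_simps)
      then show "y + w \<in> I" unfolding I_def by blast
    next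
      fix y b assume "y \<in> I"
      then obtain a u where "y = z * a + u" "u \<in> cspan U" by (auto simp: I_def)
      then have "y * b = z * (a * b) + u * b" "u * b \<in> cspan U" using cU(3) by (auto simp: algebra_simps)
      then show "y * b \<in> I" unfolding I_def by blast
    qed
    obtain J where J: "right_ideal J" "internal_direct_sum UNIV I J"
      using ss I unfolding semisimple_ring_def by blast
    obtain i j where ij: "i \<in> I" "j \<in> J" "1 = i + j" using J(2) unfolding internal_direct_sum_def by blast
    have zI: "z \<in> I"
    proof -
      have "z * 1 + 0 \<in> I" unfolding I_def using cU(1) by blast
      then show ?thesis by simp
    qed
    have "i * z \<in> I" "j * z \<in> J" "i * z * (- 1) \<in> I" using I J(1) ij unfolding right_ideal_def by blast+
    \<comment> \<open>j z = z - i z lies in both summands and therefore vanishes.\<close>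
    moreover have jz: "j * z = z + i * z * (- 1)" using ij(3) by (metis add_diff_cancel_left' distrib_right
        mult_1_left mult_minus_right mult.right_neutral diff_conv_add_uminus)
    ultimately have "j * z \<in> I" using I zI unfolding right_ideal_def by metis
    then have "j * z = 0" using \<open>j * z \<in> J\<close> J(2) unfolding internal_direct_sum_def by blast
    then have zi: "z = i * z" using ij(3) by (metis add.right_neutral distrib_right mult_1_left)
    obtain a u where au: "i = z * a + u" "u \<in> cspan U" using ij(1) by (auto simp: I_def)
    have "cell_form l (act l x a) (unitv s) = 0"
      using rad_act[OF l x, of a] unitv_in[OF s] by (auto simp: rad_def)
    then have "z * a * z \<in> cspan U"
      using tens_sandwich_cspan[OF U l xD xD, of "unitv s" a "unitv s"] unfolding z_def by simp
    then have "z * a * z + u * z \<in> cspan U" using cU(2) cU(3)[OF au(2)] by blast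
    then have "z \<in> cspan U" using zi au(1) by (simp add: distrib_right)
    then have "cf l s t z = 0" if "t \<in> T l" for t using that s l U(3) unfolding cspan_iff by blast
    then have "x t = 0" if "t \<in> T l" for t using that cf_tens[OF l s that, of "unitv s" x] by (simp add: z_def unitv_def)
    then show "x = 0" using xD by (auto simp: \<Delta>_def fun_eq_iff)
  qed
  then show ?thesis using rad_closed(2) by blast
qed

text \<open>Covers the residue field and the fraction field alike: every element of the target is a
  quotient of two values of \<phi>, in the first case with denominator 1.\<close>

locale base_changed = cell_datum scale \<Lambda> T C
  for scale :: "'o::idom \<Rightarrow> 's::ring_1 \<Rightarrow> 's" (infixr \<open>*s\<close> 75)
    and \<Lambda> :: "'l::order set" and T :: "'l \<Rightarrow> 't set" and C :: "'l \<Rightarrow> 't \<Rightarrow> 't \<Rightarrow> 's" +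
  fixes \<phi> :: "'o \<Rightarrow> 'r::field" and scale' :: "'r \<Rightarrow> 'a::ring_1 \<Rightarrow> 'a" (infixr \<open>*t\<close> 75) and \<iota> :: "'s \<Rightarrow> 'a"
  assumes phi_one: "\<phi> 1 = 1" and phi_add: "\<phi> (a + b) = \<phi> a + \<phi> b" and phi_mult: "\<phi> (a * b) = \<phi> a * \<phi> b"
    and phi_frac: "\<exists>a d. \<phi> d \<noteq> 0 \<and> r * \<phi> d = \<phi> a"
    and bc: "base_change \<phi> scale scale' \<iota>"
begin

section \<open>The cell datum after base change\<close>

lemma phi_zero [simp]: "\<phi> 0 = 0"
  using phi_add[of 0 0] by (simp only: add_0_right add_cancel_right_right)

lemma phi_minus: "\<phi> (a - b) = \<phi> a - \<phi> b"
  using phi_add[of "a - b" b] by simp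

lemma phi_sum: "\<phi> (sum f A) = (\<Sum>i\<in>A. \<phi> (f i))"
  by (induction A rule: infinite_finite_induct) (auto simp: phi_add)

lemma iota:
  shows iota_one: "\<iota> 1 = 1" and iota_add: "\<iota> (x + y) = \<iota> x + \<iota> y"
    and iota_mult: "\<iota> (x * y) = \<iota> x * \<iota> y" and iota_scale: "\<iota> (c *s x) = \<phi> c *t \<iota> x"
  using bc by (simp_all add: base_change_def)

lemma iota_zero [simp]: "\<iota> 0 = 0" using iota_add[of 0 0] by simp

lemma iota_minus: "\<iota> (x - y) = \<iota> x - \<iota> y"
  using iota_add[of "x - y" y] by simp

lemma iota_sum: "\<iota> (sum f A) = (\<Sum>i\<in>A. \<iota> (f i))"
  by (induction A rule: infinite_finite_induct) (auto simp: iota_add)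

sublocale B: assoc_algebra scale'
  using bc by (simp add: base_change_def)

sublocale BV: vector_space scale'
  using module_iff_vector_space B.module_axioms by blast

text \<open>\<open>base_change\<close> provides some basis, not the cellular one. The coefficients
  of x in that basis are killed by \<phi>, and each cellular coordinate of x is a linear combination
  of them.\<close>

lemma iota_kernel: "\<iota> x = 0 \<Longrightarrow> \<phi> (cf l s t x) = 0"
proof -
  assume x0: "\<iota> x = 0"
  obtain B where B: "module_basis scale B" "inj_on \<iota> B" "module_basis scale' (\<iota> ` B)"
    using bc by (auto simp: base_change_def)
  have "x \<in> span B" using B(1) by (simp add: module_basis_def)
  then obtain F r where F: "finite F" "F \<subseteq> B" "x = (\<Sum>b\<in>F. r b *s b)" unfolding span_explicit by blast
  have ind: "B.independent (\<iota> ` B)" using B(3) by (simp add: module_basis_def)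
  have inj: "inj_on \<iota> F" using B(2) F(2) by (rule inj_on_subset)
  have "(\<Sum>y\<in>\<iota> ` F. \<phi> (r (the_inv_into F \<iota> y)) *t y) = (\<Sum>b\<in>F. \<phi> (r b) *t \<iota> b)"
    unfolding sum.reindex[OF inj] by (intro sum.cong) (auto simp: the_inv_into_f_f[OF inj])
  also have "\<dots> = 0" using x0 unfolding F(3) by (simp add: iota_sum iota_scale)
  finally have z: "(\<Sum>y\<in>\<iota> ` F. \<phi> (r (the_inv_into F \<iota> y)) *t y) = 0" .
  have "\<phi> (r b) = 0" if b: "b \<in> F" for b
  proof -
    have "\<phi> (r (the_inv_into F \<iota> (\<iota> b))) = 0"
      using B.independentD[OF ind _ _ z, of "\<iota> b"] F(1,2) b by auto
    then show ?thesis using the_inv_into_f_f[OF inj b] by simp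
  qed
  then show ?thesis unfolding F(3) by (simp add: cf_sum cf_scale phi_sum phi_mult)
qed

lemma iota_frac: "\<exists>x d. \<phi> d \<noteq> 0 \<and> \<phi> d *t y = \<iota> x"
proof -
  obtain B where B: "module_basis scale' (\<iota> ` B)"
    using bc by (auto simp: base_change_def)
  have "y \<in> B.span (\<iota> ` B)" using B by (simp add: module_basis_def)
  then show ?thesis
  proof (rule B.span_induct)
    show "B.subspace {y. \<exists>x d. \<phi> d \<noteq> 0 \<and> \<phi> d *t y = \<iota> x}"
      unfolding B.subspace_def
    proof safe
      show "\<exists>x d. \<phi> d \<noteq> 0 \<and> \<phi> d *t 0 = \<iota> x" by (intro exI[of _ 0] exI[of _ 1]) (simp add: phi_one)
    next
      fix y x d y' x' d' assume a: "\<phi> d \<noteq> 0" "\<phi> d *t y = \<iota> x" "\<phi> d' \<noteq> 0" "\<phi> d' *t y' = \<iota> x'"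
      have "\<phi> (d * d') *t (y + y') = \<phi> d' *t (\<phi> d *t y) + \<phi> d *t (\<phi> d' *t y')"
        by (simp add: phi_mult B.scale_right_distrib mult.commute)
      also have "\<dots> = \<iota> (d' *s x + d *s x')" unfolding a by (simp add: iota_add iota_scale)
      finally show "\<exists>x d. \<phi> d \<noteq> 0 \<and> \<phi> d *t (y + y') = \<iota> x"
        using a by (intro exI[of _ "d' *s x + d *s x'"] exI[of _ "d * d'"]) (simp add: phi_mult)
    next
      fix c y x d assume a: "\<phi> d \<noteq> 0" "\<phi> d *t y = \<iota> x"
      obtain e d' where e: "\<phi> d' \<noteq> 0" "c * \<phi> d' = \<phi> e" using phi_frac by blast
      have "\<phi> (d * d') *t (c *t y) = (c * \<phi> d') *t (\<phi> d *t y)"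
        by (simp add: phi_mult mult_ac)
      also have "\<dots> = \<iota> (e *s x)" unfolding a e by (simp add: iota_scale)
      finally show "\<exists>x d. \<phi> d \<noteq> 0 \<and> \<phi> d *t (c *t y) = \<iota> x"
        using a e by (intro exI[of _ "e *s x"] exI[of _ "d * d'"]) (simp add: phi_mult)
    qed
  next
    fix y assume "y \<in> \<iota> ` B"
    then obtain b where "y = \<iota> b" by blast
    then show "\<exists>x d. \<phi> d \<noteq> 0 \<and> \<phi> d *t y = \<iota> x" by (intro exI[of _ b] exI[of _ 1]) (simp add: phi_one)
  qed
qed

definition "num y = (SOME x. \<exists>d. \<phi> d \<noteq> 0 \<and> \<phi> d *t y = \<iota> x)"
definition "den y = (SOME d. \<phi> d \<noteq> 0 \<and> \<phi> d *t y = \<iota> (num y))"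

lemma num_den: "\<phi> (den y) \<noteq> 0" "\<phi> (den y) *t y = \<iota> (num y)"
proof -
  have "\<exists>d. \<phi> d \<noteq> 0 \<and> \<phi> d *t y = \<iota> (num y)" unfolding num_def by (rule someI_ex[OF iota_frac])
  from someI_ex[OF this] show "\<phi> (den y) \<noteq> 0" "\<phi> (den y) *t y = \<iota> (num y)" unfolding den_def by auto
qed

definition "bcf l s t y = \<phi> (cf l s t (num y)) / \<phi> (den y)"

text \<open>Two fractions representing y differ, after cross-multiplication, by an element of the
  kernel of \<iota>, whose coordinates vanish under \<phi>. So \<open>bcf\<close> may be computed
  from any convenient numerator and denominator.\<close>

lemma bcf_eq:
  assumes "\<phi> d \<noteq> 0" "\<phi> d *t y = \<iota> x"
  shows "bcf l s t y = \<phi> (cf l s t x) / \<phi> d"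
proof -
  have "\<iota> (d *s num y - den y *s x) = \<phi> d *t (\<phi> (den y) *t y) - \<phi> (den y) *t (\<phi> d *t y)"
    by (simp add: iota_minus iota_scale num_den assms)
  also have "\<dots> = 0" by (simp add: mult.commute)
  finally have "\<phi> (cf l s t (d *s num y - den y *s x)) = 0" by (rule iota_kernel)
  then have "\<phi> d * \<phi> (cf l s t (num y)) = \<phi> (den y) * \<phi> (cf l s t x)"
    by (simp add: cf_diff cf_scale phi_minus phi_mult)
  then show ?thesis unfolding bcf_def using num_den(1)[of y] assms(1) by (simp add: field_simps)
qed

lemma bcf_iota: "bcf l s t (\<iota> x) = \<phi> (cf l s t x)"
  using bcf_eq[of 1 "\<iota> x" x] by (simp add: phi_one)

lemma bcf_add: "bcf l s t (y + z) = bcf l s t y + bcf l s t z"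
proof -
  have "\<phi> (den y * den z) *t (y + z) = \<phi> (den z) *t (\<phi> (den y) *t y) + \<phi> (den y) *t (\<phi> (den z) *t z)"
    by (simp add: phi_mult B.scale_right_distrib mult.commute)
  also have "\<dots> = \<iota> (den z *s num y + den y *s num z)" unfolding num_den by (simp add: iota_add iota_scale)
  finally have "bcf l s t (y + z) = \<phi> (cf l s t (den z *s num y + den y *s num z)) / \<phi> (den y * den z)"
    using num_den(1) by (intro bcf_eq) (auto simp: phi_mult)
  then show ?thesis unfolding bcf_def using num_den(1)[of y] num_den(1)[of z]
    by (simp add: cf_add cf_scale phi_add phi_mult field_simps)
qed

lemma bcf_scale: "bcf l s t (c *t y) = c * bcf l s t y"
proof -
  obtain e d where e: "\<phi> d \<noteq> 0" "c * \<phi> d = \<phi> e" using phi_frac by blast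
  have "\<phi> (den y * d) *t (c *t y) = (c * \<phi> d) *t (\<phi> (den y) *t y)" by (simp add: phi_mult mult_ac)
  also have "\<dots> = \<iota> (e *s num y)" unfolding e num_den by (simp add: iota_scale)
  finally have "bcf l s t (c *t y) = \<phi> (cf l s t (e *s num y)) / \<phi> (den y * d)"
    using num_den(1) e by (intro bcf_eq) (auto simp: phi_mult)
  also have "\<dots> = (c * \<phi> d) * \<phi> (cf l s t (num y)) / (\<phi> (den y) * \<phi> d)"
    unfolding e(2) by (simp add: cf_scale phi_mult)
  finally show ?thesis unfolding bcf_def using e(1) by simp
qed

lemma bcf_zero [simp]: "bcf l s t 0 = 0" using bcf_scale[of l s t 0 0] by simp

lemma bcf_sum: "bcf l s t (sum f A) = (\<Sum>i\<in>A. bcf l s t (f i))"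
  by (induction A rule: infinite_finite_induct) (auto simp: bcf_add)

abbreviation "CC l s t \<equiv> \<iota> (C l s t)"

lemma bcf_C:
  "l \<in> \<Lambda> \<Longrightarrow> s \<in> T l \<Longrightarrow> t \<in> T l \<Longrightarrow> l' \<in> \<Lambda> \<Longrightarrow> s' \<in> T l' \<Longrightarrow> t' \<in> T l' \<Longrightarrow>
   bcf l s t (CC l' s' t') = (if l = l' \<and> s = s' \<and> t = t' then 1 else 0)"
  by (simp add: bcf_iota cf_C phi_one)

lemma iota_expand: "\<iota> x = (\<Sum>l\<in>\<Lambda>. \<Sum>s\<in>T l. \<Sum>t\<in>T l. \<phi> (cf l s t x) *t CC l s t)"
  by (subst cf_expand[of x]) (simp add: iota_sum iota_scale)

lemma bcf_expand: "y = (\<Sum>l\<in>\<Lambda>. \<Sum>s\<in>T l. \<Sum>t\<in>T l. bcf l s t y *t CC l s t)"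
proof -
  have "\<phi> (den y) *t y = \<phi> (den y) *t (\<Sum>l\<in>\<Lambda>. \<Sum>s\<in>T l. \<Sum>t\<in>T l. bcf l s t y *t CC l s t)"
    unfolding num_den(2) iota_expand[of "num y"] B.scale_sum_right bcf_def
    using num_den(1)[of y] by (intro sum.cong) auto
  then show ?thesis using num_den(1)[of y] by (simp add: BV.scale_cancel_left)
qed

lemma scaled_eqI: "\<phi> d \<noteq> 0 \<Longrightarrow> \<phi> d *t y = \<phi> d *t z \<Longrightarrow> y = z"
  by (simp add: BV.scale_cancel_left)

definition "bstar y = (\<Sum>l\<in>\<Lambda>. \<Sum>s\<in>T l. \<Sum>t\<in>T l. bcf l s t y *t CC l t s)"

lemma bstar_eq:
  assumes "\<phi> d \<noteq> 0" "\<phi> d *t y = \<iota> x"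
  shows "\<phi> d *t bstar y = \<iota> (cstar x)"
  unfolding bstar_def cstar_def iota_sum iota_scale B.scale_sum_right
  using assms(1) by (intro sum.cong refl) (simp add: bcf_eq[OF assms])

lemma bstar_C: "l \<in> \<Lambda> \<Longrightarrow> s \<in> T l \<Longrightarrow> t \<in> T l \<Longrightarrow> bstar (CC l s t) = CC l t s"
  using bstar_eq[of 1 "CC l s t" "C l s t"] by (simp add: phi_one cstar_C)

text \<open>The axioms that involve an element y of the new algebra are multiplied by a denominator
  of y; they then become images of the same axioms for the numerator.\<close>

lemma cell_datum_base_change: "cell_datum scale' \<Lambda> T CC"
proof unfold_locales
  show "finite \<Lambda>" by (rule finite_Lambda)
  show "finite (T l)" "T l \<noteq> {}" if "l \<in> \<Lambda>" for l using that finite_T T_nonempty by auto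
  have eq: "l = l' \<and> s = s' \<and> t = t'" if "CC l s t = CC l' s' t'" "l \<in> \<Lambda>" "s \<in> T l" "t \<in> T l" "l' \<in> \<Lambda>" "s' \<in> T l'" "t' \<in> T l'"
    for l s t l' s' t'
  proof -
    have "bcf l s t (CC l s t) = bcf l s t (CC l' s' t')" by (simp only: that(1))
    then show ?thesis
      unfolding bcf_C[OF that(2-4) that(2-4)] bcf_C[OF that(2-4) that(5-7)] by (cases "l = l' \<and> s = s' \<and> t = t'") auto
  qed
  then show "inj_on (\<lambda>(l, s, t). CC l s t) (SIGMA l:\<Lambda>. T l \<times> T l)" unfolding inj_on_def by clarsimp
  define S where "S = {CC l s t |l s t. l \<in> \<Lambda> \<and> s \<in> T l \<and> t \<in> T l}"
  have "S = \<iota> ` cbasis" unfolding S_def cbasis_def by blast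
  then have finS: "finite S" using finite_cbasis by simp
  have "\<not> B.dependent S"
  proof (rule BV.independent_if_scalars_zero[OF finS])
    fix f y assume z: "(\<Sum>y\<in>S. f y *t y) = 0" and "y \<in> S"
    then obtain l s t where y: "y = CC l s t" "l \<in> \<Lambda>" "s \<in> T l" "t \<in> T l" by (auto simp: S_def)
    have "bcf l s t x = (if x = y then 1 else 0)" if "x \<in> S" for x
      using that eq unfolding S_def y(1) using y(2-4) by (auto simp: bcf_C)
    then have "(\<Sum>x\<in>S. f x * bcf l s t x) = (\<Sum>x\<in>S. if x = y then f y else 0)" by (intro sum.cong) auto
    moreover have "(\<Sum>x\<in>S. f x * bcf l s t x) = 0" using arg_cong[OF z, of "bcf l s t"] by (simp add: bcf_sum bcf_scale)
    ultimately show "f y = 0" using finS \<open>y \<in> S\<close> by simp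
  qed
  moreover have "y \<in> B.span S" for y
  proof -
    have "(\<Sum>l\<in>\<Lambda>. \<Sum>s\<in>T l. \<Sum>t\<in>T l. bcf l s t y *t CC l s t) \<in> B.span S"
      by (intro B.span_sum B.span_scale B.span_base) (auto simp: S_def)
    then show ?thesis using bcf_expand[of y] by simp
  qed
  ultimately show "module_basis scale' {CC l s t |l s t. l \<in> \<Lambda> \<and> s \<in> T l \<and> t \<in> T l}"
    unfolding module_basis_def S_def by blast
next
  fix l t y assume l: "l \<in> \<Lambda>" "t \<in> T l"
  define H where "H = {CC \<mu> y z |\<mu> y z. \<mu> \<in> \<Lambda> \<and> l < \<mu> \<and> y \<in> T \<mu> \<and> z \<in> T \<mu>}"
  have hi: "\<iota> x \<in> B.span H" if "x \<in> higher l" for x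
    using that unfolding higher_def
  proof (rule span_induct)
    show "subspace {x. \<iota> x \<in> B.span H}"
      unfolding subspace_def by (auto simp: iota_add iota_scale intro: B.span_add B.span_scale B.span_zero)
  qed (auto simp: H_def intro!: B.span_base)
  define r where "r v = \<phi> (cell_coeff l t (num y) v) / \<phi> (den y)" for v
  have "CC l s t * y - (\<Sum>v\<in>T l. r v *t CC l s v) \<in> B.span H" if s: "s \<in> T l" for s
  proof -
    have "\<phi> (den y) *t (CC l s t * y - (\<Sum>v\<in>T l. r v *t CC l s v))
      = CC l s t * (\<phi> (den y) *t y) - (\<Sum>v\<in>T l. (\<phi> (den y) * r v) *t CC l s v)"
      by (simp add: B.scale_right_diff_distrib B.scale_sum_right B.scale_mult_right)
    also have "\<dots> = \<iota> (C l s t * num y - (\<Sum>v\<in>T l. cell_coeff l t (num y) v *s C l s v))"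
      unfolding num_den(2) using num_den(1)[of y] by (simp add: iota_minus iota_mult iota_sum iota_scale r_def)
    also have "\<dots> \<in> B.span H" by (intro hi cf_mult(2)[OF l(1) s l(2) s])
    finally have "inverse (\<phi> (den y)) *t (\<phi> (den y) *t (CC l s t * y - (\<Sum>v\<in>T l. r v *t CC l s v))) \<in> B.span H"
      by (rule B.span_scale)
    then show ?thesis using num_den(1)[of y] by simp
  qed
  then show "\<exists>r. \<forall>s\<in>T l. CC l s t * y - (\<Sum>v\<in>T l. r v *t CC l s v)
      \<in> B.span {CC \<mu> y z |\<mu> y z. \<mu> \<in> \<Lambda> \<and> l < \<mu> \<and> y \<in> T \<mu> \<and> z \<in> T \<mu>}"
    unfolding H_def by blast
next
  have add: "bstar (y + z) = bstar y + bstar z" for y z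
    unfolding bstar_def by (simp add: bcf_add B.scale_left_distrib sum.distrib)
  have sc: "bstar (c *t y) = c *t bstar y" for c y
    unfolding bstar_def by (simp add: bcf_scale B.scale_sum_right)
  have mult: "bstar (y * z) = bstar z * bstar y" for y z
  proof (rule scaled_eqI[of "den y * den z"])
    show dd: "\<phi> (den y * den z) \<noteq> 0" using num_den(1) by (simp add: phi_mult)
    have "\<phi> (den y * den z) *t (y * z) = (\<phi> (den y) *t y) * (\<phi> (den z) *t z)"
      by (simp add: phi_mult B.scale_mult_left B.scale_mult_right mult.commute)
    then have "\<phi> (den y * den z) *t (y * z) = \<iota> (num y * num z)" unfolding num_den iota_mult .
    then have "\<phi> (den y * den z) *t bstar (y * z) = \<iota> (cstar (num y * num z))" by (rule bstar_eq[OF dd])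
    also have "\<dots> = (\<phi> (den z) *t bstar z) * (\<phi> (den y) *t bstar y)"
      by (simp add: cstar_mult iota_mult bstar_eq num_den)
    also have "\<dots> = \<phi> (den y * den z) *t (bstar z * bstar y)"
      by (simp add: phi_mult B.scale_mult_left B.scale_mult_right mult.commute)
    finally show "\<phi> (den y * den z) *t bstar (y * z) = \<phi> (den y * den z) *t (bstar z * bstar y)" .
  qed
  have inv: "bstar (bstar y) = y" for y
  proof (rule scaled_eqI[OF num_den(1)[of y]])
    have "\<phi> (den y) *t bstar (bstar y) = \<iota> (cstar (cstar (num y)))"
      by (intro bstar_eq num_den)
    then show "\<phi> (den y) *t bstar (bstar y) = \<phi> (den y) *t y" by (simp add: num_den)
  qed
  have "module_hom scale' scale' bstar"
    by unfold_locales (auto simp: add sc)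
  moreover have "bij bstar" by (rule o_bij[of bstar]) (auto simp: inv)
  ultimately show "\<exists>star. module_hom scale' scale' star \<and> bij star \<and> (\<forall>x y. star (x * y) = star y * star x) \<and>
      (\<forall>l\<in>\<Lambda>. \<forall>s\<in>T l. \<forall>t\<in>T l. star (CC l s t) = CC l t s)"
    using mult bstar_C by blast
qed

sublocale A: field_cell_datum scale' \<Lambda> T CC
  by (intro field_cell_datum.intro cell_datum_base_change)

lemma A_cf: "l \<in> \<Lambda> \<Longrightarrow> s \<in> T l \<Longrightarrow> t \<in> T l \<Longrightarrow> A.cf l s t (\<iota> x) = \<phi> (cf l s t x)"
proof (induction x rule: basis_induct)
  case 1
  then show ?case by (auto simp: subspace_def cf_add cf_scale A.cf_add A.cf_scale iota_add iota_scale phi_add phi_mult)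
next
  case (2 l' s' t')
  then show ?case by (simp add: cf_C A.cf_C phi_one)
qed

lemma A_cell_coeff: "l \<in> \<Lambda> \<Longrightarrow> t \<in> T l \<Longrightarrow> A.cell_coeff l t (\<iota> x) v = \<phi> (cell_coeff l t x v)"
  by (cases "v \<in> T l")
    (simp_all add: A.cf_mult(1)[of l t] cf_mult(1)[of l t] A_cf cell_coeff_outside A.cell_coeff_outside flip: iota_mult)

lemma A_gram: "l \<in> \<Lambda> \<Longrightarrow> t \<in> T l \<Longrightarrow> u \<in> T l \<Longrightarrow> A.gram l t u = \<phi> (gram l t u)"
  using A.gram_coeff[of l t u t t] gram_coeff[of l t u t t] A_cell_coeff[of l t "C l u t" t] by simp

lemma A_form: "l \<in> \<Lambda> \<Longrightarrow> A.cell_form l (\<phi> \<circ> x) (\<phi> \<circ> y) = \<phi> (cell_form l x y)"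
  unfolding A.cell_form_def cell_form_def by (simp add: phi_sum phi_mult A_gram)

lemma A_act: "l \<in> \<Lambda> \<Longrightarrow> A.act l (\<phi> \<circ> x) (\<iota> a) = \<phi> \<circ> act l x a"
  unfolding A.act_def act_def by (auto simp: fun_eq_iff phi_sum phi_mult A_cell_coeff)

lemma A_\<Delta>: "x \<in> \<Delta> l \<Longrightarrow> \<phi> \<circ> x \<in> A.\<Delta> l"
  by (auto simp: \<Delta>_def A.\<Delta>_def)

end

section \<open>Denominators and powers of the uniformizer\<close>

lemma common_denominator:
  fixes Z :: "'p \<Rightarrow> 'o::idom fract"
  assumes "finite P"
  shows "\<exists>d h. d \<noteq> 0 \<and> (\<forall>p\<in>P. Z p * Fraction_Field.Fract d 1 = Fraction_Field.Fract (h p) 1)"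
  using assms
proof (induction P rule: finite_induct)
  case empty
  then show ?case by (intro exI[of _ 1]) auto
next
  case (insert q P)
  then obtain d h where d: "d \<noteq> 0" "\<And>p. p \<in> P \<Longrightarrow> Z p * Fraction_Field.Fract d 1 = Fraction_Field.Fract (h p) 1" by blast
  obtain a b where ab: "Z q = Fraction_Field.Fract a b" "b \<noteq> 0" by (cases "Z q") auto
  have "Z p * Fraction_Field.Fract (d * b) 1 = Fraction_Field.Fract (if p = q then a * d else h p * b) 1" if "p \<in> insert q P" for p
  proof (cases "p = q")
    case True
    then show ?thesis using ab by (simp add: eq_fract)
  next
    case False
    have "Fraction_Field.Fract (d * b) 1 = Fraction_Field.Fract d 1 * Fraction_Field.Fract b 1" by simp
    then have "Z p * Fraction_Field.Fract (d * b) 1 = (Z p * Fraction_Field.Fract d 1) * Fraction_Field.Fract b 1"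
      by (simp only: mult.assoc)
    also have "Z p * Fraction_Field.Fract d 1 = Fraction_Field.Fract (h p) 1" using d(2)[of p] that False by blast
    finally show ?thesis using False by simp
  qed
  then show ?case using d ab by (intro exI[of _ "d * b"] exI[of _ "\<lambda>p. if p = q then a * d else h p * b"]) auto
qed

context
  assumes dvr: "discrete_valuation_ring TYPE('o::idom)"
begin

lemma ex_uniformizer: "\<exists>p::'o. p \<noteq> 0 \<and> \<not> p dvd 1 \<and> (\<forall>i. ideal_power nonunits i = {p ^ i * x | x. True})"
proof -
  obtain p :: 'o where p: "nonunits = {p * x | x. True}"
    using dvr unfolding discrete_valuation_ring_def by metis
  have "p * 1 \<in> nonunits" unfolding p by blast
  then have pn: "\<not> p dvd 1" by (simp add: nonunits_def)
  have p0: "p \<noteq> 0" using dvr p unfolding discrete_valuation_ring_def by auto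
  have "ideal_power nonunits i = {p ^ i * x | x. True}" for i
  proof (induction i)
    case (Suc i)
    show ?case
    proof
      show "{p ^ Suc i * x | x. True} \<subseteq> ideal_power nonunits (Suc i)"
      proof
        fix y assume "y \<in> {p ^ Suc i * x | x. True}"
        then obtain x where y: "y = p * (p ^ i * x)" by (auto simp: mult.assoc)
        have "p * 1 \<in> nonunits" unfolding p by blast
        then show "y \<in> ideal_power nonunits (Suc i)"
          unfolding ideal_power.simps ideal_mult_def Suc y
          by (intro CollectI exI[of _ "1::nat"] exI[of _ "\<lambda>_. p"] exI[of _ "\<lambda>_. p ^ i * x"]) auto
      qed
      show "ideal_power nonunits (Suc i) \<subseteq> {p ^ Suc i * x | x. True}"
      proof
        fix y :: 'o assume "y \<in> ideal_power nonunits (Suc i)"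
        then obtain n x z where y: "y = (\<Sum>j<(n::nat). x j * z j)" "\<And>j. j < n \<Longrightarrow> x j \<in> nonunits \<and> z j \<in> ideal_power nonunits i"
          unfolding ideal_power.simps ideal_mult_def by blast
        have "p ^ Suc i dvd x j * z j" if "j < n" for j
        proof -
          have "p dvd x j" using y(2)[OF that] unfolding p by auto
          moreover have "p ^ i dvd z j" using y(2)[OF that] unfolding Suc by auto
          ultimately show ?thesis using mult_dvd_mono by fastforce
        qed
        then have "p ^ Suc i dvd y" unfolding y(1) by (intro dvd_sum) auto
        then show "y \<in> {p ^ Suc i * x | x. True}" by (auto elim: dvdE)
      qed
    qed
  qed simp
  then show ?thesis using p0 pn by blast
qed

text \<open>If all powers of p divided d, the quotients x i = d / p^i would generate an ascending
  chain of ideals. Its union is principal with a generator in the ideal of some x i; then x i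
  divides x (i + 1), and p is a unit.\<close>

lemma uniformizer_powers_bounded:
  fixes d p :: 'o
  assumes d: "d \<noteq> 0" and p: "p \<noteq> 0" "\<not> p dvd 1"
  shows "\<exists>i. \<not> p ^ i dvd d"
proof (rule ccontr)
  assume "\<nexists>i. \<not> p ^ i dvd d"
  then have "\<forall>i. \<exists>x. d = p ^ i * x" by (auto simp: dvd_def)
  then obtain x where x: "\<And>i. d = p ^ i * x i" by metis
  have step: "x i = p * x (Suc i)" for i
  proof -
    have "p ^ i * x i = p ^ Suc i * x (Suc i)" using x by metis
    also have "\<dots> = p ^ i * (p * x (Suc i))" by (simp only: power_Suc2 mult.assoc)
    finally show ?thesis using p by (simp add: mult_left_cancel)
  qed
  have chain: "x (i + k) dvd x i" for i k
  proof (induction k)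
    case (Suc k)
    have "x (i + Suc k) dvd x (i + k)" using step[of "i + k"] by simp
    then show ?case using Suc dvd_trans by blast
  qed simp
  define I where "I = {y. \<exists>i. x i dvd y}"
  have "two_sided_ideal I"
  proof (rule two_sided_idealI)
    fix y z assume "y \<in> I" "z \<in> I"
    then obtain i j where "x i dvd y" "x j dvd z" by (auto simp: I_def)
    then have "x (i + j) dvd y" "x (i + j) dvd z" using chain[of i j] chain[of j i] dvd_trans by (auto simp: add.commute)
    then show "y + z \<in> I" unfolding I_def by (blast intro: dvd_add)
  qed (auto simp: I_def intro: dvd_mult dvd_mult2)
  then obtain a where a: "I = {a * x | x. True}" using dvr unfolding discrete_valuation_ring_def by blast
  have "a * 1 \<in> I" unfolding a by blast
  then obtain i where i: "x i dvd a" by (auto simp: I_def)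
  have "x (Suc i) \<in> I" unfolding I_def by (intro CollectI exI[of _ "Suc i"]) simp
  then have "a dvd x (Suc i)" unfolding a by auto
  then have "x i dvd x (Suc i)" using i dvd_trans by blast
  then obtain c where "x (Suc i) = x i * c" by (auto simp: dvd_def)
  then have "x (Suc i) * 1 = x (Suc i) * (p * c)" using step[of i] by (simp add: mult_ac)
  moreover have "x (Suc i) \<noteq> 0" using x[of "Suc i"] d by auto
  ultimately have "1 = p * c" by (metis mult_left_cancel)
  then show False using p(2) by (metis dvd_triv_left)
qed

end


context base_changed
begin

section \<open>Reduction modulo the maximal ideal and the conclusion\<close>

lemma iota_surj: "surj \<phi> \<Longrightarrow> surj \<iota>"
proof -
  assume "surj \<phi>"
  have "\<exists>x. y = \<iota> x" for y
  proof -
    obtain e where e: "\<phi> e = inverse (\<phi> (den y))" using \<open>surj \<phi>\<close> by (metis surjD)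
    have "\<phi> e *t (\<phi> (den y) *t y) = \<iota> (e *s num y)" by (simp add: num_den iota_scale)
    then show ?thesis using e num_den(1)[of y] by auto
  qed
  then show ?thesis by (simp add: surj_def)
qed

lemma cell_module_red_eq:
  assumes "surj \<phi>" "l \<in> \<Lambda>"
  shows "cell_module_red \<phi> \<iota> l = A.cell_module l"
proof -
  have "\<iota> (inv \<iota> a) = a" for a using iota_surj[OF assms(1)] by (rule surj_f_inv_f)
  then have "\<phi> (cell_coeff l t (inv \<iota> a) v) = A.cell_coeff l t a v" if "t \<in> T l" for t a v
    using A_cell_coeff[OF assms(2) that, of "inv \<iota> a" v] by simp
  then show ?thesis unfolding cell_module_red_def A.cell_module_def by (simp add: fun_eq_iff)
qed

end

text \<open>Over the fraction field the radical is zero, so Z is a true inverse of the Gram matrix,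
  and d clears its denominators. A common divisor of all form values of x then divides d x v for
  every v, which bounds the length of the Jantzen filtration.\<close>

lemma gram_adjoint:
  fixes scale :: "'o::idom \<Rightarrow> 's::ring_1 \<Rightarrow> 's" and scale_K :: "'o fract \<Rightarrow> 'sK::ring_1 \<Rightarrow> 'sK"
  assumes bcK: "base_changed scale \<Lambda> T C (\<lambda>a. Fraction_Field.Fract a 1) scale_K \<iota>_K"
    and ss: "semisimple_ring TYPE('sK)" and l: "l \<in> \<Lambda>"
  shows "\<exists>d h. d \<noteq> 0 \<and> (\<forall>x\<in>cell_datum.\<Delta> T l. \<forall>v\<in>T l.
    (\<Sum>u\<in>T l. cell_datum.cell_form scale \<Lambda> T C l x (cell_datum.unitv u) * h u v) = d * x v)"
proof -
  interpret K: base_changed scale \<Lambda> T C "\<lambda>a. Fraction_Field.Fract a 1" scale_K \<iota>_K by (rule bcK)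
  let ?\<phi> = "\<lambda>a::'o. Fraction_Field.Fract a 1"
  obtain Z where Z: "\<And>x. x \<in> K.A.\<Delta> l \<Longrightarrow>
      (\<lambda>v. \<Sum>u\<in>T l. \<Sum>w\<in>T l. K.A.cell_form l x (K.A.unitv u) * Z u w * K.A.unitv w v) - x \<in> K.A.rad l"
    using K.A.ex_gram_inverse[OF l] by blast
  have fin: "finite (T l \<times> T l)" using K.finite_T[OF l] by simp
  obtain d h where d: "d \<noteq> 0"
    "\<And>p. p \<in> T l \<times> T l \<Longrightarrow> Z (fst p) (snd p) * ?\<phi> d = ?\<phi> (h p)"
    using common_denominator[OF fin, of "\<lambda>p. Z (fst p) (snd p)"] by blast
  have "(\<Sum>u\<in>T l. K.cell_form l x (K.unitv u) * h (u, v)) = d * x v" if x: "x \<in> K.\<Delta> l" and v: "v \<in> T l" for x v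
  proof -
    have un: "K.A.unitv u = ?\<phi> \<circ> K.unitv u" for u
      by (auto simp: K.A.unitv_def K.unitv_def fun_eq_iff K.phi_one)
    have e: "(\<Sum>u\<in>T l. \<Sum>w\<in>T l. K.A.cell_form l (?\<phi> \<circ> x) (K.A.unitv u) * Z u w * K.A.unitv w v) = ?\<phi> (x v)"
      using Z[OF K.A_\<Delta>[OF x]] unfolding K.A.semisimple_rad[OF ss l] by (auto simp: fun_eq_iff)
    have "(\<Sum>w\<in>T l. a * Z u w * K.A.unitv w v) = a * Z u v" for a u
    proof -
      have "(\<Sum>w\<in>T l. a * Z u w * K.A.unitv w v) = (\<Sum>w\<in>T l. if w = v then a * Z u v else 0)"
        by (intro sum.cong) (auto simp: K.A.unitv_def)
      then show ?thesis using v K.finite_T[OF l] by simp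
    qed
    then have "(\<Sum>u\<in>T l. ?\<phi> (K.cell_form l x (K.unitv u)) * Z u v) = ?\<phi> (x v)"
      using e unfolding un K.A_form[OF l] by simp
    moreover have "(\<Sum>u\<in>T l. ?\<phi> (K.cell_form l x (K.unitv u)) * (Z u v * ?\<phi> d))
      = (\<Sum>u\<in>T l. ?\<phi> (K.cell_form l x (K.unitv u)) * Z u v) * ?\<phi> d"
      by (simp only: sum_distrib_right mult.assoc)
    ultimately have "(\<Sum>u\<in>T l. ?\<phi> (K.cell_form l x (K.unitv u)) * (Z u v * ?\<phi> d)) = ?\<phi> (x v) * ?\<phi> d"
      by (simp only:)
    moreover have "Z u v * ?\<phi> d = ?\<phi> (h (u, v))" if "u \<in> T l" for u using d(2)[of "(u, v)"] that v by simp
    ultimately have "(\<Sum>u\<in>T l. ?\<phi> (K.cell_form l x (K.unitv u)) * ?\<phi> (h (u, v))) = ?\<phi> (x v) * ?\<phi> d" by simp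
    then have "?\<phi> (\<Sum>u\<in>T l. K.cell_form l x (K.unitv u) * h (u, v)) = ?\<phi> (d * x v)"
      by (simp only: K.phi_sum K.phi_mult mult.commute)
    then show ?thesis by (simp add: eq_fract)
  qed
  then show ?thesis using d(1) by (intro exI[of _ d] exI[of _ "\<lambda>u v. h (u, v)"]) simp
qed

theorem proposition2p9:
  fixes scale :: "'o::idom \<Rightarrow> 's::ring_1 \<Rightarrow> 's"
    and \<Lambda> :: "'l::order set"
    and T :: "'l \<Rightarrow> 't set"
    and C :: "'l \<Rightarrow> 't \<Rightarrow> 't \<Rightarrow> 's"
    and scale_K :: "'o fract \<Rightarrow> 'sK::ring_1 \<Rightarrow> 'sK"
    and \<iota>_K :: "'s \<Rightarrow> 'sK"
    and \<phi> :: "'o \<Rightarrow> 'k::field"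
    and scale_k :: "'k \<Rightarrow> 'sk::ring_1 \<Rightarrow> 'sk"
    and \<iota>_k :: "'s \<Rightarrow> 'sk"
    and l \<mu> :: 'l
  assumes "discrete_valuation_ring TYPE('o)"
    and "residue_map \<phi>"
    and "cell_datum scale \<Lambda> T C"
    and "base_change (\<lambda>a. Fraction_Field.Fract a 1) scale scale_K \<iota>_K"
    and "semisimple_ring TYPE('sK)"
    and "base_change \<phi> scale scale_k \<iota>_k"
    and "quasi_hereditary scale_k"
    and "l \<in> \<Lambda>" and "\<mu> \<in> \<Lambda>"
  shows "(\<exists>B. belongs_to_block (cell_datum.cell_module_red scale \<Lambda> T C \<phi> \<iota>_k l) B \<and>
              belongs_to_block (cell_datum.cell_module_red scale \<Lambda> T C \<phi> \<iota>_k \<mu>) B) \<longleftrightarrow>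
         cell_datum.jantzen_equivalent scale \<Lambda> T C \<phi> scale_k \<iota>_k l \<mu>"
proof -
  have res: "\<phi> 1 = 1" "\<And>a b. \<phi> (a + b) = \<phi> a + \<phi> b" "\<And>a b. \<phi> (a * b) = \<phi> a * \<phi> b" "surj \<phi>"
    "{a. \<phi> a = 0} = nonunits"
    using assms(2) by (auto simp: residue_map_def)
  have nonunit: "a \<in> nonunits \<longleftrightarrow> \<phi> a = 0" for a using res(5) by blast
  interpret cell_datum scale \<Lambda> T C by fact
  interpret R: base_changed scale \<Lambda> T C \<phi> scale_k \<iota>_k
  proof
    show "\<exists>a d. \<phi> d \<noteq> 0 \<and> r * \<phi> d = \<phi> a" for r
      using surjD[OF res(4), of r] res(1) by (metis mult.right_neutral zero_neq_one)
  qed (use res assms(6) in auto)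
  have bcK: "base_changed scale \<Lambda> T C (\<lambda>a. Fraction_Field.Fract a 1) scale_K \<iota>_K"
  proof
    show "\<exists>a d. Fraction_Field.Fract d 1 \<noteq> 0 \<and> r * Fraction_Field.Fract d 1 = Fraction_Field.Fract a 1"
      for r :: "'o fract"
    proof -
      obtain a b where "r = Fraction_Field.Fract a b" "b \<noteq> 0" by (cases r) auto
      then show ?thesis by (intro exI[of _ a] exI[of _ b]) (simp add: eq_fract Zero_fract_def)
    qed
  qed (use assms(4) in \<open>auto simp: One_fract_def\<close>)
  have red: "cell_module_red \<phi> \<iota>_k k = R.A.cell_module k" if "k \<in> \<Lambda>" for k
    by (rule R.cell_module_red_eq[OF res(4) that])
  have surj_k: "surj \<iota>_k" by (rule R.iota_surj[OF res(4)])
  obtain p :: 'o where p: "p \<noteq> 0" "\<not> p dvd 1" "\<And>i. ideal_power nonunits i = {p ^ i * x | x. True}"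
    using ex_uniformizer[OF assms(1)] by blast
  have pow: "a \<in> ideal_power nonunits i \<longleftrightarrow> p ^ i dvd a" for a i unfolding p(3) by (auto simp: dvd_def)
  have pow1: "ideal_power nonunits 1 = (nonunits :: 'o set)"
  proof -
    obtain q :: 'o where q: "nonunits = {q * x | x. True}"
      using assms(1) unfolding discrete_valuation_ring_def by metis
    have "ideal_power nonunits 1 = (nonunits :: 'o set)"
    proof
      show "ideal_power nonunits 1 \<subseteq> (nonunits :: 'o set)"
      proof
        fix y :: 'o assume "y \<in> ideal_power nonunits 1"
        then obtain n x z where y: "y = (\<Sum>j<(n::nat). x j * z j)" "\<And>j. j < n \<Longrightarrow> x j \<in> nonunits"
          unfolding One_nat_def ideal_power.simps ideal_mult_def by blast
        then show "y \<in> nonunits" unfolding nonunit by (simp add: R.phi_sum res(3))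
      qed
      show "(nonunits :: 'o set) \<subseteq> ideal_power nonunits 1"
      proof
        fix y :: 'o assume "y \<in> nonunits"
        then show "y \<in> ideal_power nonunits 1" unfolding One_nat_def ideal_power.simps ideal_mult_def
          by (intro CollectI exI[of _ "1::nat"] exI[of _ "\<lambda>_. y"] exI[of _ "\<lambda>_. 1"]) auto
      qed
    qed
    then show ?thesis .
  qed
  have anti: "ideal_power nonunits i \<subseteq> (nonunits :: 'o set)" if "0 < i" for i
    using that pow pow1 by (metis One_nat_def Suc_leI dvd_trans le_imp_power_dvd subsetI)
  define F where "F k i = (\<lambda>x. \<phi> \<circ> x) ` jantzen_submodule k i" for k i
  have js: "jantzen_submodule k i = {x \<in> \<Delta> k. \<forall>y\<in>\<Delta> k. p ^ i dvd cell_form k x y}" for k i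
    unfolding jantzen_submodule_def cell_module_eq pow by simp
  \<comment> \<open>Coordinates outside \<open>T k\<close> are lifted to 0, so that the lift is
    again a vector of the cell module.\<close>
  have lift: "\<exists>x\<in>\<Delta> k. y = \<phi> \<circ> x" if y: "y \<in> R.A.\<Delta> k" for k y
  proof -
    have "\<exists>a. \<phi> a = y t \<and> (t \<notin> T k \<longrightarrow> a = 0)" for t
      using surjD[OF res(4), of "y t"] y by (cases "t \<in> T k") (auto simp: R.A.\<Delta>_def)
    then obtain x where "\<And>t. \<phi> (x t) = y t \<and> (t \<notin> T k \<longrightarrow> x t = 0)" by metis
    then show ?thesis by (intro bexI[of _ x]) (auto simp: \<Delta>_def)
  qed
  have radD: "\<phi> \<circ> x \<in> R.A.rad k"
    if k: "k \<in> \<Lambda>" and x: "x \<in> \<Delta> k" "\<And>y. y \<in> \<Delta> k \<Longrightarrow> \<phi> (cell_form k x y) = 0" for k x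
    unfolding R.A.rad_def using R.A_\<Delta>[OF x(1)] lift x(2) R.A_form[OF k, of x] by fastforce
  interpret J: jantzen_data scale_k \<Lambda> T R.CC F
  proof
    show "R.A.good_cells = \<Lambda>" by (rule R.A.quasi_hereditary_form_nonzero[OF assms(7)])
  next
    fix k i assume k: "k \<in> \<Lambda>" and i: "0 < (i::nat)"
    show "F k i \<subseteq> R.A.rad k"
    proof
      fix y assume "y \<in> F k i"
      then obtain x where x: "x \<in> \<Delta> k" "y = \<phi> \<circ> x" "\<And>z. z \<in> \<Delta> k \<Longrightarrow> cell_form k x z \<in> ideal_power nonunits i"
        unfolding F_def js pow by blast
      have "\<phi> (cell_form k x z) = 0" if "z \<in> \<Delta> k" for z using x(3)[OF that] anti[OF i] nonunit by blast
      then show "y \<in> R.A.rad k" unfolding x(2) by (rule radD[OF k x(1)])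
    qed
  next
    fix k i assume k: "k \<in> \<Lambda>"
    have "\<phi> \<circ> 0 = 0" by (auto simp: fun_eq_iff)
    moreover have "0 \<in> jantzen_submodule k i" unfolding js by (simp add: \<Delta>_closed)
    ultimately show "0 \<in> F k i" unfolding F_def by (metis image_eqI)
  next
    fix k y z i assume k: "k \<in> \<Lambda>" and "y \<in> F k i" "z \<in> F k i"
    then obtain u v where uv: "u \<in> jantzen_submodule k i" "v \<in> jantzen_submodule k i" "y = \<phi> \<circ> u" "z = \<phi> \<circ> v"
      unfolding F_def by blast
    have "u + v \<in> jantzen_submodule k i" using uv(1,2) unfolding js by (simp add: \<Delta>_closed form_add_left)
    moreover have "y + z = \<phi> \<circ> (u + v)" unfolding uv by (auto simp: fun_eq_iff res(2))
    ultimately show "y + z \<in> F k i" unfolding F_def by blast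
  next
    fix k y i a assume k: "k \<in> \<Lambda>" and "y \<in> F k i"
    then obtain u where u: "u \<in> jantzen_submodule k i" "y = \<phi> \<circ> u" unfolding F_def by blast
    obtain b where b: "a = \<iota>_k b" using surj_k by (metis surjD)
    have "act k u b \<in> jantzen_submodule k i" using u(1) unfolding js by (simp add: act_in[OF k] form_assoc[OF k])
    moreover have "R.A.act k y a = \<phi> \<circ> act k u b" unfolding u(2) b by (rule R.A_act[OF k])
    ultimately show "R.A.act k y a \<in> F k i" unfolding F_def by blast
  next
    fix k assume k: "k \<in> \<Lambda>"
    show "F k 1 = R.A.rad k"
    proof
      show "F k 1 \<subseteq> R.A.rad k"
      proof
        fix y assume "y \<in> F k 1"
        then obtain x where x: "x \<in> \<Delta> k" "y = \<phi> \<circ> x" "\<And>z. z \<in> \<Delta> k \<Longrightarrow> cell_form k x z \<in> ideal_power nonunits 1"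
          unfolding F_def js pow by blast
        have "\<phi> (cell_form k x z) = 0" if "z \<in> \<Delta> k" for z using x(3)[OF that] pow1 nonunit by blast
        then show "y \<in> R.A.rad k" unfolding x(2) by (rule radD[OF k x(1)])
      qed
      show "R.A.rad k \<subseteq> F k 1"
      proof
        fix y assume y: "y \<in> R.A.rad k"
        obtain x where x: "x \<in> \<Delta> k" "y = \<phi> \<circ> x" using lift[of y k] y R.A.rad_closed(1)[of k] by blast
        have "cell_form k x z \<in> ideal_power nonunits 1" if z: "z \<in> \<Delta> k" for z
        proof -
          have "R.A.cell_form k y (\<phi> \<circ> z) = 0" using y R.A_\<Delta>[OF z] by (auto simp: R.A.rad_def)
          then show ?thesis unfolding pow1 nonunit x(2) R.A_form[OF k] .
        qed
        then have "x \<in> jantzen_submodule k 1" unfolding js using x(1) pow[of _ 1] by blast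
        then show "y \<in> F k 1" unfolding F_def x(2) by blast
      qed
    qed
    obtain d h where d: "d \<noteq> 0" "\<And>x v. x \<in> \<Delta> k \<Longrightarrow> v \<in> T k \<Longrightarrow>
        (\<Sum>u\<in>T k. cell_form k x (unitv u) * h u v) = d * x v"
      using gram_adjoint[OF bcK assms(5) k] by blast
    \<comment> \<open>From this exponent on the filtration is zero: if p^i with i \<ge> n divides
      all form values of x, it divides d x v, and a unit x v would make p^n divide d.\<close>
    obtain n where n: "\<not> p ^ n dvd d" using uniformizer_powers_bounded[OF assms(1) d(1) p(1,2)] by blast
    have "F k i = {0}" if i: "n \<le> i" for i
    proof -
      have "y = 0" if "y \<in> F k i" for y
      proof -
        obtain x where x: "x \<in> \<Delta> k" "y = \<phi> \<circ> x" "\<And>z. z \<in> \<Delta> k \<Longrightarrow> p ^ i dvd cell_form k x z"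
          using \<open>y \<in> F k i\<close> unfolding F_def js by blast
        have "\<phi> (x v) = 0" for v
        proof (cases "v \<in> T k")
          case True
          have "p ^ i dvd d * x v"
            unfolding d(2)[OF x(1) True, symmetric] using x(3) unitv_in by (intro dvd_sum dvd_mult2) auto
          then have pd: "p ^ n dvd d * x v" using le_imp_power_dvd[OF i] dvd_trans by blast
          show ?thesis
          proof (rule ccontr)
            assume "\<phi> (x v) \<noteq> 0"
            then have "x v dvd 1" using nonunit[of "x v"] by (simp add: nonunits_def)
            then obtain c where "1 = x v * c" by (auto simp: dvd_def)
            then have "d = d * x v * c" by (simp add: mult.assoc flip: mult.assoc[of d])
            then show False using pd n by (metis dvd_mult2)
          qed
        qed (use x(1) in \<open>simp add: \<Delta>_def\<close>)
        then show "y = 0" unfolding x(2) by (auto simp: fun_eq_iff)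
      qed
      moreover have "0 \<in> F k i"
      proof -
        have "\<phi> \<circ> 0 = 0" by (auto simp: fun_eq_iff)
        moreover have "0 \<in> jantzen_submodule k i" unfolding js by (simp add: \<Delta>_closed)
        ultimately show ?thesis unfolding F_def by (metis image_eqI)
      qed
      ultimately show ?thesis by blast
    qed
    then have "{i. 0 < i \<and> F k i \<noteq> {0}} \<subseteq> {..<n}" by (auto simp: not_less[symmetric])
    then show "finite {i. 0 < i \<and> F k i \<noteq> {0}}" by (rule finite_subset) simp
  qed
  have fil: "jantzen_filtration \<phi> \<iota>_k k i = J.Fil k i" if "k \<in> \<Lambda>" for k i
    unfolding jantzen_filtration_def J.Fil_def F_def red[OF that] ..
  have "(\<Sum>i | 0 < i \<and> mcarrier (jantzen_filtration \<phi> \<iota>_k k i) \<noteq> {0}. K0_multiple scale_k 1 (jantzen_filtration \<phi> \<iota>_k k i))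
      = (\<Sum>i | 0 < i \<and> mcarrier (J.Fil k i) \<noteq> {0}. K0_multiple scale_k 1 (J.Fil k i))" if "k \<in> \<Lambda>" for k
    by (simp only: fil[OF that])
  moreover have "(\<Sum>m | m \<in> \<Lambda> \<and> m < k. K0_multiple scale_k (Q k m) (cell_module_red \<phi> \<iota>_k m))
      = (\<Sum>m | m \<in> \<Lambda> \<and> m < k. K0_multiple scale_k (Q k m) (R.A.cell_module m))" for Q k
    by (intro sum.cong) (auto simp: red)
  \<comment> \<open>Both functions are definite descriptions of the same predicate, because the
    modules coincide for all cells in \<Lambda>.\<close>
  ultimately have "jantzen_coeff \<phi> scale_k \<iota>_k = J.jcoeff"
    unfolding jantzen_coeff_def J.jcoeff_def J.is_coeff_def
    by (intro arg_cong[where f = The] ext) (simp cong: ball_cong)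
  then have "jantzen_equivalent \<phi> scale_k \<iota>_k = (\<lambda>l \<mu>. l \<in> \<Lambda> \<and> \<mu> \<in> \<Lambda> \<and> (J.jcoeff l \<mu> \<noteq> 0 \<or> J.jcoeff \<mu> l \<noteq> 0))\<^sup>*\<^sup>*"
    unfolding jantzen_equivalent_def by simp
  then show ?thesis
    using J.same_block_iff_jantzen[OF assms(8,9)] unfolding red[OF assms(8)] red[OF assms(9)] by simp
qed

end
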